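(* Consider the Sturm–Liouville problem $$-y''(x)+q(x)y(x)=\lambda y(x),\quad x\in(-1,1),\qquad \alpha_L y(-1)+\beta_L y'(-1)=0,\qquad \alpha_R y(1)+\beta_R y'(1)=0,$$ with $\alpha_L^2+\beta_L^2\ne 0$, $\alpha_R^2+\beta_R^2\neq 0$ and potential $$q(x)=\sum_{i=1}^S\frac{g_i(x)}{(1-x)^{\beta_i}(1+x)^{\gamma_i}},\qquad \beta_i,\gamma_i<1,\quad i=1,\dots,S,$$ where each $g_i$ is analytic inside and on a Bernstein ellipse containing $[-1,1]$. Assume that $q$ is unbounded at least at one of the endpoints $\pm1$. For each $i$ let $r_i$ and $\ell_i$ be the multiplicities of $x=1$ and $x=-1$, respectively, as zeros of $g_i$, i.e. $g_i(x)=(1-x)^{r_i}(1+x)^{\ell_i}\hat g_i(x)$ with $\hat g_i(\pm1)\ne0$. Let $$\mathcal I_L=\{i\in\{1,\dots,S\}: -\gamma_i\notin\mathbb N_0\},\qquad \mathcal I_R=\{i\in\{1,\dots,S\}: -\beta_i\notin\mathbb N_0\},$$ where $\mathbb N_0=\{0,1,2,\dots\}$. Let $\lambda$ be an exact eigenvalue of the problem of fixed index, and let $\lambda^{(N)}$ be its approximation of the same index given by the Legendre–Galerkin spectral matrix method of size $N$ described in the context. If $N$ is sufficiently larger than the index of the eigenvalue, then $$\lambda-\lambda^{(N)}=O\left((N+1)^{-p}\right),\qquad p=\inf(p_L,p_R),$$ where $$p_L=\inf_{i\in\mathcal I_L}\left(6-4\hat\gamma_i\right),\quad \hat\gamma_i=\gamma_i-\ell_i-\kappa_-,\qquad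 p_R=\inf_{i\in\mathcal I_R}\left(6-4\hat\beta_i\right),\quad \hat\beta_i=\beta_i-r_i-\kappa_+,$$ with the convention $\inf\emptyset=+\infty$, and where $\kappa_\pm\in\{0,1\}$ are the constants defined in the context.
   Context: The spectrum of the problem consists of real simple eigenvalues, numbered increasingly from index $1$: $\lambda_1<\lambda_2<\lambda_3<\cdots$, tending to infinity. Legendre–Galerkin method. Let $\Pi_{N+1}$ be the space of polynomials of degree at most $N+1$ and $$\mathcal S_N=\{r\in\Pi_{N+1}:\ \alpha_L r(-1)+\beta_L r'(-1)=\alpha_R r(1)+\beta_R r'(1)=0\}=\mathrm{span}(\mathcal R_0,\dots,\mathcal R_{N-1}),$$ where $\mathcal R_n=\xi_n\mathcal P_n+\eta_n\mathcal P_{n+1}+\theta_n\mathcal P_{n+2}$, $\mathcal P_j$ is the Legendre polynomial of degree $j$ (normalized by $\mathcal P_j(1)=1$), and the coefficients are chosen so that $\mathcal R_n$ satisfies both boundary conditions, with $\max(|\xi_n|,|\eta_n|,|\theta_n|)=1$ and $\xi_n\ge 0$ (and $\eta_n=0$ if $\alpha_L\beta_R+\alpha_R\beta_L=0$). With $\langle u,v\rangle=\int_{-1}^1u(x)v(x)\,dx$, the numerical eigenvalues are the eigenvalues $\lambda^{(N)}$ of the $N\times N$ symmetric generalized eigenvalue problem $$(A_N+Q_N)\zeta_N=\lambda^{(N)}B_N\zeta_N,$$ with entries, for $m,n=0,\dots,N-1$, $$(A_N)_{mn}=-\langle\mathcal R_m,\mathcal R_n''\rangle,\quad (B_N)_{mn}=\langle\mathcal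 R_m,\mathcal R_n\rangle,\quad (Q_N)_{mn}=\langle\mathcal R_m,q\,\mathcal R_n\rangle .$$ The numerical eigenvalues are ordered increasingly, so that the one with index $k$ approximates $\lambda_k$. The $O(\cdot)$ statement concerns a fixed index as $N$ increases. Constants $\kappa_\pm$: $\kappa_+=1$ if $\mathcal R_n(1)=0$ (i.e. the boundary condition at $x=1$ is the Dirichlet condition $y(1)=0$) and $\kappa_+=0$ otherwise; $\kappa_-=1$ if $\mathcal R_n(-1)=0$ (i.e. the boundary condition at $x=-1$ is $y(-1)=0$) and $\kappa_-=0$ otherwise. *)

theory Defs
  imports
    "HOL-Complex_Analysis.Complex_Analysis"
    "HOL-Library.Landau_Symbols"
    "HOL-Computational_Algebra.Polynomial"
    "Jordan_Normal_Form.Matrix_Kernel"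
begin

section \<open>The Sturm--Liouville problem\<close>

text \<open>
  The closed region bounded by the Bernstein ellipse with foci \<open>-1, 1\<close>, i.e. the image of the circle
  of radius \<open>\<rho> > 1\<close> under \<open>w \<mapsto> (w + 1/w)/2\<close>; the sum of the focal distances is
  \<open>\<rho> + 1/\<rho>\<close> on the ellipse.
\<close>
definition bernstein_region :: "real \<Rightarrow> complex set" where
  "bernstein_region \<rho> = {z. cmod (z - 1) + cmod (z + 1) \<le> \<rho> + 1 / \<rho>}"

text \<open>
  Only the values at \<open>-1 < x < 1\<close> are meaningful. The functions \<open>g i\<close> live on the complex plane;
  they will be assumed real on \<open>[-1, 1]\<close>.
\<close>
definition potential ::
    "nat \<Rightarrow> (nat \<Rightarrow> complex \<Rightarrow> complex) \<Rightarrow> (nat \<Rightarrow> real) \<Rightarrow> (nat \<Rightarrow> real) \<Rightarrow> real \<Rightarrow> real" where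
  "potential S g \<beta> \<gamma> x =
     (\<Sum>i=1..S. Re (g i (of_real x)) / ((1 - x) powr \<beta> i * (1 + x) powr \<gamma> i))"

text \<open>
  The functions \<open>y'\<close>, \<open>y''\<close> are derivatives of \<open>y\<close>; at the endpoints \<open>y'\<close> is the one-sided
  derivative, and the second derivative is only required in the open interval, as \<open>q\<close> may be
  unbounded at \<open>\<plusminus>1\<close>.
\<close>
definition sl_eigenvalue ::
    "(real \<Rightarrow> real) \<Rightarrow> real \<Rightarrow> real \<Rightarrow> real \<Rightarrow> real \<Rightarrow> real \<Rightarrow> bool" where
  "sl_eigenvalue q \<alpha>L \<beta>L \<alpha>R \<beta>R lam \<longleftrightarrow>
     (\<exists>y y' y''.
        (\<exists>x\<in>{-1..1}. y x \<noteq> 0) \<and>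
        (\<forall>x\<in>{-1..1}. (y has_real_derivative y' x) (at x within {-1..1})) \<and>
        continuous_on {-1..1} y' \<and>
        (\<forall>x\<in>{-1<..<1}. (y' has_real_derivative y'' x) (at x)) \<and>
        (\<forall>x\<in>{-1<..<1}. - y'' x + q x * y x = lam * y x) \<and>
        \<alpha>L * y (-1) + \<beta>L * y' (-1) = 0 \<and>
        \<alpha>R * y 1 + \<beta>R * y' 1 = 0)"

text \<open>All eigenvalues are simple, so the numbering (from 1) counts them without multiplicity.\<close>
definition sl_eigenvalue_of_index ::
    "(real \<Rightarrow> real) \<Rightarrow> real \<Rightarrow> real \<Rightarrow> real \<Rightarrow> real \<Rightarrow> nat \<Rightarrow> real \<Rightarrow> bool" where
  "sl_eigenvalue_of_index q \<alpha>L \<beta>L \<alpha>R \<beta>R k lam \<longleftrightarrow>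
     sl_eigenvalue q \<alpha>L \<beta>L \<alpha>R \<beta>R lam \<and>
     finite {\<mu>. sl_eigenvalue q \<alpha>L \<beta>L \<alpha>R \<beta>R \<mu> \<and> \<mu> < lam} \<and>
     card {\<mu>. sl_eigenvalue q \<alpha>L \<beta>L \<alpha>R \<beta>R \<mu> \<and> \<mu> < lam} + 1 = k"

section \<open>The Legendre--Galerkin method\<close>

text \<open>Rodrigues' formula; this is the normalization with value 1 at \<open>x = 1\<close>.\<close>
definition legendre_poly :: "nat \<Rightarrow> real poly" where
  "legendre_poly n = Polynomial.smult (1 / (2 ^ n * fact n)) ((pderiv ^^ n) ([:-1, 0, 1:] ^ n))"

definition boundary_conditions ::
    "real \<Rightarrow> real \<Rightarrow> real \<Rightarrow> real \<Rightarrow> real poly \<Rightarrow> bool" where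
  "boundary_conditions \<alpha>L \<beta>L \<alpha>R \<beta>R r \<longleftrightarrow>
     \<alpha>L * poly r (-1) + \<beta>L * poly (pderiv r) (-1) = 0 \<and>
     \<alpha>R * poly r 1 + \<beta>R * poly (pderiv r) 1 = 0"

definition galerkin_space ::
    "real \<Rightarrow> real \<Rightarrow> real \<Rightarrow> real \<Rightarrow> nat \<Rightarrow> real poly set" where
  "galerkin_space \<alpha>L \<beta>L \<alpha>R \<beta>R N =
     {r. Polynomial.degree r \<le> N + 1 \<and> boundary_conditions \<alpha>L \<beta>L \<alpha>R \<beta>R r}"

definition galerkin_basis ::
    "(nat \<Rightarrow> real) \<Rightarrow> (nat \<Rightarrow> real) \<Rightarrow> (nat \<Rightarrow> real) \<Rightarrow> nat \<Rightarrow> real poly" where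
  "galerkin_basis \<xi> \<eta> \<theta> n =
     Polynomial.smult (\<xi> n) (legendre_poly n) + Polynomial.smult (\<eta> n) (legendre_poly (n + 1))
       + Polynomial.smult (\<theta> n) (legendre_poly (n + 2))"

text \<open>
  These conditions determine the coefficients, except for a common sign if \<open>\<xi> n = 0\<close>. For
  exceptional boundary conditions the functions \<open>galerkin_basis \<xi> \<eta> \<theta> n\<close> are linearly dependent
  (e.g. if \<open>\<alpha>L = 3\<close>, \<open>\<beta>L = 1\<close>, \<open>\<alpha>R = -3\<close>, \<open>\<beta>R = 1\<close>, those with \<open>n = 0\<close> and \<open>n = 2\<close> are both the
  Legendre polynomial of degree 2 up to sign), so that they span the Galerkin space is a separate
  hypothesis.
\<close>
definition galerkin_coefficients ::
    "real \<Rightarrow> real \<Rightarrow> real \<Rightarrow> real \<Rightarrow> (nat \<Rightarrow> real) \<Rightarrow> (nat \<Rightarrow> real) \<Rightarrow> (nat \<Rightarrow> real) \<Rightarrow> bool" where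
  "galerkin_coefficients \<alpha>L \<beta>L \<alpha>R \<beta>R \<xi> \<eta> \<theta> \<longleftrightarrow>
     (\<forall>n. boundary_conditions \<alpha>L \<beta>L \<alpha>R \<beta>R (galerkin_basis \<xi> \<eta> \<theta> n) \<and>
          Max {\<bar>\<xi> n\<bar>, \<bar>\<eta> n\<bar>, \<bar>\<theta> n\<bar>} = 1 \<and> \<xi> n \<ge> 0 \<and>
          (\<alpha>L * \<beta>R + \<alpha>R * \<beta>L = 0 \<longrightarrow> \<eta> n = 0))"

definition poly_span :: "(nat \<Rightarrow> real poly) \<Rightarrow> nat \<Rightarrow> real poly set" where
  "poly_span R N = {\<Sum>n<N. Polynomial.smult (c n) (R n) | c. True}"

definition L2_inner :: "(real \<Rightarrow> real) \<Rightarrow> (real \<Rightarrow> real) \<Rightarrow> real" where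
  "L2_inner u v = (LBINT x:{-1<..<1}. u x * v x)"

definition matrix_A :: "(nat \<Rightarrow> real poly) \<Rightarrow> nat \<Rightarrow> real Matrix.mat" where
  "matrix_A R N =
     Matrix.mat N N (\<lambda>(m, n). - L2_inner (poly (R m)) (poly (pderiv (pderiv (R n)))))"

definition matrix_B :: "(nat \<Rightarrow> real poly) \<Rightarrow> nat \<Rightarrow> real Matrix.mat" where
  "matrix_B R N = Matrix.mat N N (\<lambda>(m, n). L2_inner (poly (R m)) (poly (R n)))"

definition matrix_Q :: "(real \<Rightarrow> real) \<Rightarrow> (nat \<Rightarrow> real poly) \<Rightarrow> nat \<Rightarrow> real Matrix.mat" where
  "matrix_Q q R N =
     Matrix.mat N N (\<lambda>(m, n). L2_inner (poly (R m)) (\<lambda>x. q x * poly (R n) x))"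

definition generalized_eigenvalue :: "real Matrix.mat \<Rightarrow> real Matrix.mat \<Rightarrow> real \<Rightarrow> bool" where
  "generalized_eigenvalue M B \<mu> \<longleftrightarrow>
     (\<exists>v\<in>carrier_vec (dim_col M).
        v \<noteq> 0\<^sub>v (dim_col M) \<and> M *\<^sub>v v = \<mu> \<cdot>\<^sub>v (B *\<^sub>v v))"

text \<open>
  The eigenvalue with index \<open>k\<close> (from 1) in the increasing enumeration with multiplicity; the
  multiplicity is the dimension of the eigenspace, which is the right notion for a symmetric
  pencil with positive definite \<open>B\<close>. The value is meaningful for \<open>1 \<le> k \<le> dim_row M\<close>.
\<close>
definition generalized_eigenvalue_of_index ::
    "real Matrix.mat \<Rightarrow> real Matrix.mat \<Rightarrow> nat \<Rightarrow> real" where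
  "generalized_eigenvalue_of_index M B k =
     Min {\<mu>. generalized_eigenvalue M B \<mu> \<and>
             k \<le> (\<Sum>\<nu> | generalized_eigenvalue M B \<nu> \<and> \<nu> \<le> \<mu>. kernel_dim (M - \<nu> \<cdot>\<^sub>m B))}"

definition numerical_eigenvalue ::
    "(real \<Rightarrow> real) \<Rightarrow> (nat \<Rightarrow> real poly) \<Rightarrow> nat \<Rightarrow> nat \<Rightarrow> real" where
  "numerical_eigenvalue q R N k =
     generalized_eigenvalue_of_index (matrix_A R N + matrix_Q q R N) (matrix_B R N) k"

text \<open>
  The constants \<open>\<kappa>\<^sub>-\<close>, \<open>\<kappa>\<^sub>+\<close>, as a function of the coefficient of the derivative in the condition
  at the endpoint: as the two coefficients do not both vanish, the condition is the Dirichlet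
  condition iff this one is zero.
\<close>
definition dirichlet_indicator :: "real \<Rightarrow> real" where
  "dirichlet_indicator b = (if b = 0 then 1 else 0)"

end

theory Submission
  imports Defs
begin

text \<open>
  The Galerkin eigenvalues are the Ritz values of the energy form on the spaces of polynomials of degree
  at most \<open>N + 1\<close> that satisfy the boundary conditions. If such polynomials approximate the eigenfunctions
  up to index \<open>k\<close> with squared \<open>L\<^sup>2\<close> error \<open>E\<close> in the first derivative, the \<open>k\<close>-th Ritz value exceeds \<open>\<lambda>\<^sub>k\<close>
  by at most \<open>O(E)\<close>; it is not smaller than \<open>\<lambda>\<^sub>k\<close>, because limits of Ritz functions as \<open>N\<close> grows
  are eigenfunctions.

  It remains to bound \<open>E\<close>. Integrating \<open>y'' = (q - \<lambda>) y\<close> repeatedly from an endpoint shows that there \<open>y'\<close> is a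
  polynomial plus a function that behaves like a power \<open>s\<close> of the distance, with \<open>p = 4 s + 2\<close> for the worse
  endpoint; a Dirichlet condition gains one power since then \<open>q y\<close> vanishes to one order more. The Legendre
  coefficients of such a function are \<open>O(n powr (- 2 s - 1))\<close>, so its series has squared error \<open>O(N powr (- p))\<close>.
\<close>

section \<open>Symmetric pencils\<close>

text \<open>Trial functions must satisfy all boundary conditions, Robin conditions included, so the
  approximation of an eigenfunction has to match value and slope at both endpoints. Repairing a
  truncated series there costs no order: its endpoint values are off by O(N powr (-2 s)), and the
  correction has an L2 norm smaller by a factor of order N, which is the size of the truncation
  error.

  The exponent s counts twice in the coefficients because the Legendre operator resolves distances
  of order 1 / n^2 at the endpoints. A term of \<open>q\<close> whose exponent at an endpoint is an
  integer is analytic there, hence a polynomial up to any order, and puts no bound on s. Any other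
  term gives s = l i - \<gamma> i + \<kappa> + 1 at the left end, whence 4 s + 2 = 6 - 4 (\<gamma> i
  - l i - \<kappa>).

  Ritz functions are only known to converge uniformly, so the discrete equation passes to the limit
  with both derivatives on a polynomial test function. That k Ritz functions lead to k different
  eigenvalues rests on simplicity.\<close>

lemma homogeneous_system_nontrivial:
  fixes A :: "nat \<Rightarrow> 'a \<Rightarrow> real"
  assumes "finite J" "m < card J"
  shows "\<exists>c. (\<exists>j\<in>J. c j \<noteq> 0) \<and> (\<forall>i<m. (\<Sum>j\<in>J. A i j * c j) = 0)"
  using assms
proof (induction m arbitrary: A J)
  case 0
  then obtain j where "j \<in> J" by (metis all_not_in_conv card.empty less_numeral_extra(3))
  then show ?case by (intro exI[of _ "\<lambda>_. 1"]) auto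
next
  case (Suc m)
  show ?case
  proof (cases "\<forall>j\<in>J. A m j = 0")
    case True
    obtain c where c: "\<exists>j\<in>J. c j \<noteq> 0" "\<forall>i<m. (\<Sum>j\<in>J. A i j * c j) = 0"
      using Suc.IH[of J A] Suc.prems by auto
    have "(\<Sum>j\<in>J. A i j * c j) = 0" if "i < Suc m" for i
      using that c(2) True by (cases "i = m") auto
    with c(1) show ?thesis by blast
  next
    case False
    then obtain k where k: "k \<in> J" "A m k \<noteq> 0" by blast
    \<comment> \<open>The pivot \<open>A m k\<close> clears column \<open>k\<close> from the other
      equations. The index set is arbitrary, not an initial segment, so that the induction may drop
      the unknown of the pivot; equation \<open>m\<close> then fixes its value in
      \<open>d\<close>.\<close>
    define A' where "A' = (\<lambda>i j. A i j - A i k * A m j / A m k)"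
    have "m < card (J - {k})" using Suc.prems k by simp
    then obtain c where c: "\<exists>j\<in>J - {k}. c j \<noteq> 0"
        "\<forall>i<m. (\<Sum>j\<in>J - {k}. A' i j * c j) = 0"
      using Suc.IH[of "J - {k}" A'] Suc.prems by auto
    define s where "s = (\<Sum>j\<in>J - {k}. A m j * c j)"
    define d where "d = c(k := - s / A m k)"
    have sum_d: "(\<Sum>j\<in>J. A i j * d j) = (\<Sum>j\<in>J - {k}. A i j * c j) - A i k * s / A m k" for i
    proof -
      have "(\<Sum>j\<in>J. A i j * d j) = A i k * d k + (\<Sum>j\<in>J - {k}. A i j * d j)"
        using Suc.prems k by (simp add: sum.remove)
      also have "(\<Sum>j\<in>J - {k}. A i j * d j) = (\<Sum>j\<in>J - {k}. A i j * c j)"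
        by (rule sum.cong) (auto simp: d_def)
      finally show ?thesis by (simp add: d_def)
    qed
    have "(\<Sum>j\<in>J. A i j * d j) = 0" if "i < Suc m" for i
    proof (cases "i = m")
      case True
      then show ?thesis using sum_d[of m] k by (simp add: s_def)
    next
      case False
      with that have "i < m" by simp
      then have "0 = (\<Sum>j\<in>J - {k}. A' i j * c j)" using c(2) by simp
      also have "\<dots> = (\<Sum>j\<in>J - {k}. A i j * c j - (A i k / A m k) * (A m j * c j))"
        by (rule sum.cong) (auto simp: A'_def algebra_simps)
      also have "\<dots> = (\<Sum>j\<in>J - {k}. A i j * c j) - (A i k / A m k) * s"
        by (simp add: sum_subtractf s_def sum_distrib_left)
      finally show ?thesis using sum_d[of i] by simp
    qed
    moreover have "\<exists>j\<in>J. d j \<noteq> 0" using c(1) by (auto simp: d_def)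
    ultimately show ?thesis by blast
  qed
qed

text \<open>Coordinate vectors are total functions on the natural numbers of which only the first
  \<open>N\<close> entries count, so vectors of all lengths share one type and are compared only
  below \<open>N\<close>.\<close>

definition bilin :: "nat \<Rightarrow> (nat \<Rightarrow> nat \<Rightarrow> real) \<Rightarrow> (nat \<Rightarrow> real) \<Rightarrow> (nat \<Rightarrow> real) \<Rightarrow> real" where
  "bilin N M c d = (\<Sum>i<N. \<Sum>j<N. M i j * c i * d j)"

lemma bilin_add_left: "bilin N M (\<lambda>i. c i + c' i) d = bilin N M c d + bilin N M c' d"
  by (simp add: bilin_def algebra_simps sum.distrib)

lemma bilin_add_right: "bilin N M d (\<lambda>i. c i + c' i) = bilin N M d c + bilin N M d c'"
  by (simp add: bilin_def algebra_simps sum.distrib)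

lemma bilin_scale_left: "bilin N M (\<lambda>i. t * c i) d = t * bilin N M c d"
  by (simp add: bilin_def algebra_simps sum_distrib_left)

lemma bilin_scale_right: "bilin N M d (\<lambda>i. t * c i) = t * bilin N M d c"
  by (simp add: bilin_def algebra_simps sum_distrib_left)

lemma bilin_diff_left: "bilin N M (\<lambda>i. c i - c' i) d = bilin N M c d - bilin N M c' d"
  by (simp add: bilin_def algebra_simps sum_subtractf)

lemma bilin_diff_right: "bilin N M d (\<lambda>i. c i - c' i) = bilin N M d c - bilin N M d c'"
  by (simp add: bilin_def algebra_simps sum_subtractf)

lemma bilin_cong: "(\<And>j. j < N \<Longrightarrow> c j = c' j) \<Longrightarrow> (\<And>j. j < N \<Longrightarrow> d j = d' j) \<Longrightarrow> bilin N M c d = bilin N M c' d'"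
  by (simp add: bilin_def)

lemma bilin_sum_left:
  "finite I \<Longrightarrow> bilin N M (\<lambda>i. \<Sum>k\<in>I. f k i) d = (\<Sum>k\<in>I. bilin N M (f k) d)"
proof (induction I rule: finite_induct)
  case empty
  show ?case by (simp add: bilin_def)
next
  case (insert x F)
  then show ?case by (simp add: bilin_add_left)
qed

lemma bilin_commute:
  assumes "\<And>i j. i < N \<Longrightarrow> j < N \<Longrightarrow> M i j = M j i"
  shows "bilin N M c d = bilin N M d c"
proof -
  have "bilin N M c d = (\<Sum>j<N. \<Sum>i<N. M i j * c i * d j)"
    unfolding bilin_def by (rule sum.swap)
  also have "\<dots> = bilin N M d c"
    unfolding bilin_def using assms by (intro sum.cong) (auto simp: algebra_simps)
  finally show ?thesis .
qed

lemma continuous_on_bilin: "continuous_on UNIV (\<lambda>c. bilin N M c c)"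
  unfolding bilin_def by (intro continuous_intros continuous_on_product_coordinates)

lemma continuous_on_bilin_left: "continuous_on UNIV (\<lambda>c. bilin N M c d)"
  unfolding bilin_def by (intro continuous_intros continuous_on_product_coordinates)

text \<open>Tychonoff's theorem. As total functions, coordinate vectors live in an infinite product,
  where closed and bounded does not mean compact; unit spheres are therefore cut out of a product of
  compact factors.\<close>

lemma compact_PiE_UNIV:
  fixes S :: "nat \<Rightarrow> real set"
  assumes "\<And>i. compact (S i)"
  shows "compact (PiE UNIV S)"
proof -
  have "compactin (product_topology (\<lambda>i::nat. euclidean :: real topology) UNIV) (PiE UNIV S)"
    using assms by (simp add: compactin_PiE)
  then show ?thesis by (simp add: euclidean_product_topology)
qed

text \<open>For \<open>t\<close> a small multiple of \<open>- b\<close> the linear term outweighs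
  the quadratic one. This is the stationarity condition at a minimum of the Rayleigh
  quotient.\<close>

lemma quadratic_nonneg_linear_coeff_zero:
  fixes b g :: real
  assumes "\<And>t. 0 \<le> 2 * t * b + t\<^sup>2 * g"
  shows "b = 0"
proof (rule ccontr)
  assume "b \<noteq> 0"
  define e where "e = 1 / (\<bar>g\<bar> + 1)"
  have e: "e > 0" "e * \<bar>g\<bar> < 1" by (auto simp: e_def field_simps)
  have "0 \<le> 2 * (- e * b) * b + (- e * b)\<^sup>2 * g" by (rule assms)
  also have "\<dots> = e * b\<^sup>2 * (e * g - 2)" by (simp add: power2_eq_square algebra_simps)
  finally have "0 \<le> e * b\<^sup>2 * (e * g - 2)" .
  moreover have "e * b\<^sup>2 > 0" using e(1) \<open>b \<noteq> 0\<close> by simp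
  ultimately have "0 \<le> e * g - 2"
    using mult_le_cancel_left_pos[of "e * b\<^sup>2" 0 "e * g - 2"] by (simp only: mult_zero_right)
  moreover have "e * g \<le> e * \<bar>g\<bar>" using e by (intro mult_left_mono) auto
  ultimately show False using e(2) by simp
qed

text \<open>The next eigenvector minimises the Rayleigh quotient on the complement of the previous ones.\<close>

lemma pencil_next_eigenvector:
  fixes M B :: "nat \<Rightarrow> nat \<Rightarrow> real"
  assumes symM: "\<And>i j. i < N \<Longrightarrow> j < N \<Longrightarrow> M i j = M j i"
    and symB: "\<And>i j. i < N \<Longrightarrow> j < N \<Longrightarrow> B i j = B j i"
    and pos: "\<And>c. (\<exists>j<N. c j \<noteq> 0) \<Longrightarrow> bilin N B c c > 0"
    and mN: "m < N"
    and orth: "\<And>i j. i < m \<Longrightarrow> j < m \<Longrightarrow> bilin N B (u i) (u j) = (if i = j then 1 else 0)"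
    and eig: "\<And>i z. i < m \<Longrightarrow> bilin N M (u i) z = \<nu> i * bilin N B (u i) z"
  shows "\<exists>x \<mu>. bilin N B x x = 1 \<and> (\<forall>i<m. bilin N B x (u i) = 0) \<and>
           (\<forall>z. bilin N M x z = \<mu> * bilin N B x z) \<and>
           (\<forall>z. (\<forall>i<m. bilin N B z (u i) = 0) \<longrightarrow> \<mu> * bilin N B z z \<le> bilin N M z z)"
proof -
  \<comment> \<open>The Euclidean sphere rather than the \<open>B\<close>-sphere: its coordinates
    are bounded outright, and the Rayleigh quotient is homogeneous. Entries from \<open>N\<close> on
    are pinned to 0 to keep the set compact.\<close>
  define K where "K = {c::nat \<Rightarrow> real. (\<forall>j\<ge>N. c j = 0) \<and> (\<Sum>j<N. (c j)\<^sup>2) = 1 \<and> (\<forall>i<m. bilin N B c (u i) = 0)}"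
  have comp: "compact K"
  proof -
    have "K = PiE UNIV (\<lambda>j. if j < N then {-1..1} else {0}) \<inter> {c. (\<Sum>j<N. (c j)\<^sup>2) = 1}
              \<inter> (\<Inter>i\<in>{..<m}. {c. bilin N B c (u i) = 0})"
    proof -
      have bnd: "\<bar>c j\<bar> \<le> 1" if "(\<Sum>j<N. (c j)\<^sup>2) = 1" "j < N" for c :: "nat \<Rightarrow> real" and j
      proof -
        have "(c j)\<^sup>2 \<le> (\<Sum>j<N. (c j)\<^sup>2)" using that(2) by (intro member_le_sum) auto
        then show ?thesis using that by (simp add: abs_square_le_1)
      qed
      have P: "c \<in> PiE UNIV F \<longleftrightarrow> (\<forall>j. c j \<in> F j)" for c :: "nat \<Rightarrow> real" and F
        by (simp add: PiE_def Pi_def)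
      show ?thesis
      proof (intro Set.set_eqI iffI)
        fix c assume c: "c \<in> K"
        have "c j \<in> (if j < N then {-1..1} else {0})" for j
          using c bnd[of c j] by (auto simp: K_def abs_le_iff)
        then show "c \<in> PiE UNIV (\<lambda>j. if j < N then {-1..1} else {0}) \<inter> {c. (\<Sum>j<N. (c j)\<^sup>2) = 1}
              \<inter> (\<Inter>i\<in>{..<m}. {c. bilin N B c (u i) = 0})"
          using c unfolding Int_iff P by (simp add: K_def)
      next
        fix c assume c: "c \<in> PiE UNIV (\<lambda>j. if j < N then {-1..1} else {0}) \<inter> {c. (\<Sum>j<N. (c j)\<^sup>2) = 1}
              \<inter> (\<Inter>i\<in>{..<m}. {c. bilin N B c (u i) = 0})"
        then have "\<forall>j. c j \<in> (if j < N then {-1..1} else {0})" unfolding Int_iff P by blast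
        then have "\<forall>j\<ge>N. c j = 0" by (metis not_le singletonD)
        then show "c \<in> K" using c by (simp add: K_def)
      qed
    qed
    moreover have "closed {c::nat \<Rightarrow> real. (\<Sum>j<N. (c j)\<^sup>2) = 1}"
      by (intro closed_Collect_eq continuous_intros continuous_on_product_coordinates)
    moreover have "closed (\<Inter>i\<in>{..<m}. {c. bilin N B c (u i) = 0})"
      by (intro closed_INT ballI closed_Collect_eq continuous_on_bilin_left continuous_intros)
    moreover have "compact (PiE UNIV (\<lambda>j::nat. if j < N then {-1..1::real} else {0}))"
      by (rule compact_PiE_UNIV) auto
    ultimately show ?thesis by (simp add: compact_Int_closed)
  qed
  have resc: "\<exists>t y. y \<in> K \<and> t \<noteq> 0 \<and> (\<forall>j<N. c j = t * y j)"
    if c: "\<exists>j<N. c j \<noteq> 0" "\<forall>i<m. bilin N B c (u i) = 0" for c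
  proof -
    obtain j where j: "j < N" "c j \<noteq> 0" using c by blast
    have "(c j)\<^sup>2 \<le> (\<Sum>j<N. (c j)\<^sup>2)" using j(1) by (intro member_le_sum) auto
    with j have p: "(\<Sum>j<N. (c j)\<^sup>2) > 0" by (smt (verit) zero_less_power2)
    define t where "t = sqrt (\<Sum>j<N. (c j)\<^sup>2)"
    have t: "t > 0" "t\<^sup>2 = (\<Sum>j<N. (c j)\<^sup>2)" using p by (auto simp: t_def)
    define y where "y = (\<lambda>j. if j < N then c j / t else 0)"
    have "(\<Sum>j<N. (y j)\<^sup>2) = (\<Sum>j<N. (c j)\<^sup>2) / t\<^sup>2"
      by (simp add: y_def power_divide sum_divide_distrib)
    also have "\<dots> = 1" using t p by simp
    finally have y1: "(\<Sum>j<N. (y j)\<^sup>2) = 1" .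
    have "bilin N B y (u i) = bilin N B (\<lambda>j. inverse t * c j) (u i)" for i
      by (rule bilin_cong) (auto simp: y_def field_simps)
    then have "\<forall>i<m. bilin N B y (u i) = 0" unfolding bilin_scale_left using c(2) by simp
    then have "y \<in> K" using y1 by (auto simp: K_def y_def)
    moreover have "\<forall>j<N. c j = t * y j" using t by (auto simp: y_def)
    ultimately show ?thesis using t by (intro exI[of _ t] exI[of _ y]) auto
  qed
  have KN: "\<exists>j<N. c j \<noteq> 0" if "c \<in> K" for c
  proof (rule ccontr)
    assume "\<not> ?thesis"
    then have "(\<Sum>j<N. (c j)\<^sup>2) = 0" by simp
    with that show False by (simp add: K_def)
  qed
  have "K \<noteq> {}"
  proof -
    obtain c where c: "\<exists>j\<in>{..<N}. c j \<noteq> 0"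
        "\<forall>i<m. (\<Sum>j\<in>{..<N}. (\<Sum>k<N. B j k * u i k) * c j) = 0"
      using homogeneous_system_nontrivial[of "{..<N}" m "\<lambda>i j. \<Sum>k<N. B j k * u i k"] mN by auto
    have "bilin N B c (u i) = (\<Sum>j\<in>{..<N}. (\<Sum>k<N. B j k * u i k) * c j)" for i
      unfolding bilin_def by (simp add: sum_distrib_right sum_distrib_left algebra_simps)
    then have "\<forall>i<m. bilin N B c (u i) = 0" using c by simp
    with resc[of c] c show ?thesis by auto
  qed
  have cont: "continuous_on K (\<lambda>c. bilin N M c c / bilin N B c c)"
  proof -
    have "bilin N B c c \<noteq> 0" if "c \<in> K" for c using pos[OF KN[OF that]] by simp
    then show ?thesis
      by (intro continuous_on_divide continuous_on_subset[OF continuous_on_bilin]) auto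
  qed
  obtain x where x: "x \<in> K" and min: "\<And>y. y \<in> K \<Longrightarrow>
      bilin N M x x / bilin N B x x \<le> bilin N M y y / bilin N B y y"
    using continuous_attains_inf[OF comp \<open>K \<noteq> {}\<close> cont] by auto
  define \<mu> where "\<mu> = bilin N M x x / bilin N B x x"
  have xpos: "bilin N B x x > 0" by (rule pos[OF KN[OF x]])
  have min': "\<mu> * bilin N B z z \<le> bilin N M z z" if z: "\<forall>i<m. bilin N B z (u i) = 0" for z
  proof (cases "\<exists>j<N. z j \<noteq> 0")
    case False
    then show ?thesis by (simp add: bilin_def)
  next
    case True
    then obtain t y where ty: "y \<in> K" "t \<noteq> 0" "\<forall>j<N. z j = t * y j" using resc z by blast
    have e: "bilin N M z z = t * (t * bilin N M y y)" for M
    proof -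
      have "bilin N M z z = bilin N M (\<lambda>j. t * y j) (\<lambda>j. t * y j)"
        using ty by (intro bilin_cong) auto
      then show ?thesis by (simp add: bilin_scale_left bilin_scale_right)
    qed
    have "bilin N B y y > 0" by (rule pos[OF KN[OF ty(1)]])
    then have "\<mu> * bilin N B y y \<le> bilin N M y y"
      using min[OF ty(1)] by (simp add: \<mu>_def pos_le_divide_eq)
    then have "t\<^sup>2 * (\<mu> * bilin N B y y) \<le> t\<^sup>2 * bilin N M y y" by (intro mult_left_mono) auto
    then show ?thesis by (simp add: e power2_eq_square algebra_simps)
  qed
  have xo: "\<forall>i<m. bilin N B x (u i) = 0" using x by (simp add: K_def)
  \<comment> \<open>Varying \<open>x + t * z\<close> within the constraint gives the eigenvalue
    equation against admissible \<open>z\<close> only.\<close>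
  have eq1: "bilin N M x z = \<mu> * bilin N B x z" if z: "\<forall>i<m. bilin N B z (u i) = 0" for z
  proof -
    have "bilin N M x z - \<mu> * bilin N B x z = 0"
    proof (rule quadratic_nonneg_linear_coeff_zero)
      fix t :: real
      define w where "w = (\<lambda>i. x i + t * z i)"
      have "\<forall>i<m. bilin N B w (u i) = 0"
        unfolding w_def bilin_add_left bilin_scale_left using xo z by simp
      from min'[OF this] have "0 \<le> bilin N M w w - \<mu> * bilin N B w w" by simp
      moreover have "bilin N M w w = bilin N M x x + 2 * t * bilin N M x z + t\<^sup>2 * bilin N M z z"
        by (simp add: w_def bilin_add_left bilin_scale_left bilin_add_right bilin_scale_right
              bilin_commute[OF symM, where c=z and d=x] power2_eq_square algebra_simps)
      moreover have "bilin N B w w = bilin N B x x + 2 * t * bilin N B x z + t\<^sup>2 * bilin N B z z"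
        by (simp add: w_def bilin_add_left bilin_scale_left bilin_add_right bilin_scale_right
              bilin_commute[OF symB, where c=z and d=x] power2_eq_square algebra_simps)
      moreover have "bilin N M x x = \<mu> * bilin N B x x" using xpos by (simp add: \<mu>_def)
      ultimately show "0 \<le> 2 * t * (bilin N M x z - \<mu> * bilin N B x z)
          + t\<^sup>2 * (bilin N M z z - \<mu> * bilin N B z z)"
        by (simp add: algebra_simps)
    qed
    then show ?thesis by simp
  qed
  \<comment> \<open>For arbitrary \<open>z\<close> the \<open>B\<close>-projection \<open>s\<close>
    onto the earlier eigenvectors is split off. Both forms vanish on the pair \<open>x\<close>,
    \<open>s\<close>: \<open>B\<close> by the constraint, \<open>M\<close> because each
    \<open>u i\<close> is itself an eigenvector.\<close>
  have eq2: "bilin N M x z = \<mu> * bilin N B x z" for z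
  proof -
    define s where "s = (\<lambda>j. \<Sum>i<m. bilin N B z (u i) * u i j)"
    define w where "w = (\<lambda>j. z j - s j)"
    have "bilin N B s (u k) = bilin N B z (u k)" if "k < m" for k
    proof -
      have "bilin N B s (u k) = (\<Sum>i<m. bilin N B z (u i) * bilin N B (u i) (u k))"
        unfolding s_def by (subst bilin_sum_left) (auto simp: bilin_scale_left)
      also have "\<dots> = (\<Sum>i<m. if i = k then bilin N B z (u i) else 0)"
        using that by (intro sum.cong) (auto simp: orth)
      also have "\<dots> = bilin N B z (u k)" using that by simp
      finally show ?thesis .
    qed
    then have "\<forall>i<m. bilin N B w (u i) = 0"
      by (simp add: w_def bilin_diff_left)
    note eq1[OF this]
    moreover have "bilin N B x s = 0" "bilin N M x s = 0"
    proof -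
      have "bilin N B x s = bilin N B s x" using symB by (rule bilin_commute)
      also have "\<dots> = (\<Sum>i<m. bilin N B z (u i) * bilin N B (u i) x)"
        unfolding s_def by (subst bilin_sum_left) (auto simp: bilin_scale_left)
      also have "\<dots> = 0" using xo by (intro sum.neutral) (simp add: bilin_commute[OF symB, where d=x])
      finally show "bilin N B x s = 0" .
      have "bilin N M x s = bilin N M s x" using symM by (rule bilin_commute)
      also have "\<dots> = (\<Sum>i<m. bilin N B z (u i) * bilin N M (u i) x)"
        unfolding s_def by (subst bilin_sum_left) (auto simp: bilin_scale_left)
      also have "\<dots> = 0" using xo by (intro sum.neutral) (simp add: eig bilin_commute[OF symB, where d=x])
      finally show "bilin N M x s = 0" .
    qed
    ultimately show ?thesis by (simp add: w_def bilin_diff_right)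
  qed
  define y where "y = (\<lambda>j. (1 / sqrt (bilin N B x x)) * x j)"
  have "bilin N B y y = 1"
    unfolding y_def bilin_scale_left bilin_scale_right using xpos by (simp add: field_simps)
  moreover have "\<forall>i<m. bilin N B y (u i) = 0" unfolding y_def bilin_scale_left using xo by simp
  moreover have "\<forall>z. bilin N M y z = \<mu> * bilin N B y z"
    unfolding y_def bilin_scale_left eq2 by simp
  ultimately show ?thesis using min' by blast
qed

text \<open>The induction also carries that \<open>\<nu> i\<close> is the minimum over the
  complement of the first \<open>i\<close> vectors. Monotonicity follows, since every later vector
  competes in that minimum.\<close>

lemma pencil_eigenvectors:
  fixes M B :: "nat \<Rightarrow> nat \<Rightarrow> real"
  assumes symM: "\<And>i j. i < N \<Longrightarrow> j < N \<Longrightarrow> M i j = M j i"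
    and symB: "\<And>i j. i < N \<Longrightarrow> j < N \<Longrightarrow> B i j = B j i"
    and pos: "\<And>c. (\<exists>j<N. c j \<noteq> 0) \<Longrightarrow> bilin N B c c > 0"
  shows "\<exists>u \<nu>. (\<forall>i<N. \<forall>j<N. bilin N B (u i) (u j) = (if i = j then 1 else 0)) \<and>
           (\<forall>i<N. \<forall>z. bilin N M (u i) z = \<nu> i * bilin N B (u i) z) \<and>
           (\<forall>i j. i \<le> j \<longrightarrow> j < N \<longrightarrow> \<nu> i \<le> \<nu> j)"
proof -
  have ex: "\<exists>u \<nu>. (\<forall>i<m. \<forall>j<m. bilin N B (u i) (u j) = (if i = j then 1 else 0)) \<and>
           (\<forall>i<m. \<forall>z. bilin N M (u i) z = \<nu> i * bilin N B (u i) z) \<and>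
           (\<forall>i<m. \<forall>z. (\<forall>j<i. bilin N B z (u j) = 0) \<longrightarrow> \<nu> i * bilin N B z z \<le> bilin N M z z)"
    if "m \<le> N" for m
    using that
  proof (induction m)
    case 0
    show ?case by auto
  next
    case (Suc m)
    then have "m \<le> N" by simp
    from Suc.IH[OF this] obtain u \<nu> where
        u0: "\<forall>i<m. \<forall>j<m. bilin N B (u i) (u j) = (if i = j then 1 else 0)"
        "\<forall>i<m. \<forall>z. bilin N M (u i) z = \<nu> i * bilin N B (u i) z"
        "\<forall>i<m. \<forall>z. (\<forall>j<i. bilin N B z (u j) = 0) \<longrightarrow> \<nu> i * bilin N B z z \<le> bilin N M z z"
      by blast
    have u: "\<And>i j. i < m \<Longrightarrow> j < m \<Longrightarrow> bilin N B (u i) (u j) = (if i = j then 1 else 0)"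
        "\<And>i z. i < m \<Longrightarrow> bilin N M (u i) z = \<nu> i * bilin N B (u i) z"
        "\<And>i z. i < m \<Longrightarrow> (\<forall>j<i. bilin N B z (u j) = 0) \<Longrightarrow> \<nu> i * bilin N B z z \<le> bilin N M z z"
      using u0 by blast+
    obtain x \<mu> where x: "bilin N B x x = 1" "\<forall>i<m. bilin N B x (u i) = 0"
           "\<forall>z. bilin N M x z = \<mu> * bilin N B x z"
           "\<forall>z. (\<forall>i<m. bilin N B z (u i) = 0) \<longrightarrow> \<mu> * bilin N B z z \<le> bilin N M z z"
      using pencil_next_eigenvector[of N M B m u \<nu>, OF symM symB pos _ u(1,2)] Suc.prems by auto
    have x': "\<forall>i<m. bilin N B (u i) x = 0" using x(2) by (simp add: bilin_commute[OF symB, where d=x])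
    show ?case
    proof (intro exI[of _ "u(m := x)"] exI[of _ "\<nu>(m := \<mu>)"] conjI allI impI)
      fix i j assume "i < Suc m" "j < Suc m"
      then show "bilin N B ((u(m := x)) i) ((u(m := x)) j) = (if i = j then 1 else 0)"
        using u(1) x x' by (auto simp: less_Suc_eq)
    next
      fix i z assume "i < Suc m"
      then show "bilin N M ((u(m := x)) i) z = (\<nu>(m := \<mu>)) i * bilin N B ((u(m := x)) i) z"
        using u(2) x by (auto simp: less_Suc_eq)
    next
      fix i z assume i: "i < Suc m" and z: "\<forall>j<i. bilin N B z ((u(m := x)) j) = 0"
      have "\<forall>j<i. bilin N B z (u j) = 0"
      proof (intro allI impI)
        fix j assume "j < i"
        then have "j \<noteq> m" using i by simp
        then show "bilin N B z (u j) = 0" using z \<open>j < i\<close> by (metis fun_upd_other)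
      qed
      then show "(\<nu>(m := \<mu>)) i * bilin N B z z \<le> bilin N M z z"
        using u(3)[of i z] x(4) i by (cases "i = m") auto
    qed
  qed
  from ex[OF order_refl] obtain u \<nu> where
        u0: "\<forall>i<N. \<forall>j<N. bilin N B (u i) (u j) = (if i = j then 1 else 0)"
        "\<forall>i<N. \<forall>z. bilin N M (u i) z = \<nu> i * bilin N B (u i) z"
        "\<forall>i<N. \<forall>z. (\<forall>j<i. bilin N B z (u j) = 0) \<longrightarrow> \<nu> i * bilin N B z z \<le> bilin N M z z"
    by blast
  have u: "\<And>i j. i < N \<Longrightarrow> j < N \<Longrightarrow> bilin N B (u i) (u j) = (if i = j then 1 else 0)"
        "\<And>i z. i < N \<Longrightarrow> bilin N M (u i) z = \<nu> i * bilin N B (u i) z"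
        "\<And>i z. i < N \<Longrightarrow> (\<forall>j<i. bilin N B z (u j) = 0) \<Longrightarrow> \<nu> i * bilin N B z z \<le> bilin N M z z"
    using u0 by blast+
  have "\<nu> i \<le> \<nu> j" if "i \<le> j" "j < N" for i j
  proof -
    have "\<forall>k<i. bilin N B (u j) (u k) = 0" using u(1)[of j] that by auto
    then have "\<nu> i * bilin N B (u j) (u j) \<le> bilin N M (u j) (u j)" using u(3)[of i] that by simp
    then show ?thesis using u(1)[of j j] u(2)[of j "u j"] that by simp
  qed
  with u0(1,2) show ?thesis by blast
qed

text \<open>The remainder \<open>w\<close> is orthogonal to all \<open>u i\<close>. With them it
  makes \<open>N + 1\<close> vectors of \<open>N\<close> coordinates, hence a linear relation;
  pairing it with each \<open>u k\<close> leaves only the coefficient of \<open>w\<close>, so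
  \<open>w\<close> has \<open>B\<close>-norm 0.\<close>

lemma pencil_expansion:
  fixes B :: "nat \<Rightarrow> nat \<Rightarrow> real"
  assumes pos: "\<And>c. (\<exists>j<N. c j \<noteq> 0) \<Longrightarrow> bilin N B c c > 0"
    and orth: "\<And>i j. i < N \<Longrightarrow> j < N \<Longrightarrow> bilin N B (u i) (u j) = (if i = j then 1 else 0)"
    and "j < N"
  shows "z j = (\<Sum>i<N. bilin N B z (u i) * u i j)"
proof -
  define w where "w = (\<lambda>j. z j - (\<Sum>i<N. bilin N B z (u i) * u i j))"
  have wo: "bilin N B w (u k) = 0" if "k < N" for k
  proof -
    have "bilin N B (\<lambda>j. \<Sum>i<N. bilin N B z (u i) * u i j) (u k) = (\<Sum>i<N. bilin N B z (u i) * bilin N B (u i) (u k))"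
      by (subst bilin_sum_left) (auto simp: bilin_scale_left)
    also have "\<dots> = (\<Sum>i<N. if i = k then bilin N B z (u i) else 0)"
      using that by (intro sum.cong) (auto simp: orth)
    also have "\<dots> = bilin N B z (u k)" using that by simp
    finally show ?thesis by (simp add: w_def bilin_diff_left)
  qed
  define U where "U = (\<lambda>i. if i < N then u i else w)"
  obtain c where c: "\<exists>i\<in>{..<Suc N}. c i \<noteq> 0" "\<forall>j<N. (\<Sum>i\<in>{..<Suc N}. U i j * c i) = 0"
    using homogeneous_system_nontrivial[of "{..<Suc N}" N "\<lambda>j i. U i j"] by auto
  have cz: "0 = (\<Sum>i<Suc N. c i * bilin N B (U i) d)" for d
  proof -
    have "0 = bilin N B (\<lambda>j. \<Sum>i<Suc N. c i * U i j) d"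
      unfolding bilin_def using c(2) by (simp add: mult.commute)
    then show ?thesis by (simp only: bilin_sum_left[OF finite_lessThan] bilin_scale_left)
  qed
  have ck: "c k = 0" if "k < N" for k
  proof -
    have "0 = (\<Sum>i<N. c i * bilin N B (u i) (u k)) + c N * bilin N B w (u k)"
      using cz[of "u k"] by (simp add: U_def)
    also have "(\<Sum>i<N. c i * bilin N B (u i) (u k)) = (\<Sum>i<N. if i = k then c i else 0)"
      using that by (intro sum.cong) (auto simp: orth)
    finally show ?thesis using that wo by simp
  qed
  then have "c N \<noteq> 0" using c(1) by (auto simp: less_Suc_eq)
  moreover have "c N * bilin N B w w = 0" using cz[of w] ck by (simp add: U_def)
  ultimately have "bilin N B w w = 0" by simp
  then have "w j = 0" using pos[of w] \<open>j < N\<close> by (metis less_irrefl)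
  then show ?thesis by (simp add: w_def)
qed

section \<open>Legendre polynomials\<close>

text \<open>Leibniz' rule stops after two terms. Orders are written as successors so that no
  truncated subtraction occurs.\<close>

lemma higher_pderiv_X_mult:
  fixes f :: "real poly"
  shows
  "(pderiv ^^ Suc m) ([:0, 1:] * f) = [:0, 1:] * (pderiv ^^ Suc m) f + Polynomial.smult (real (Suc m)) ((pderiv ^^ m) f)"
proof (induction m)
  case 0
  show ?case by (simp add: pderiv_mult pderiv_pCons)
next
  case (Suc m)
  have "(pderiv ^^ Suc (Suc m)) ([:0, 1:] * f) = pderiv ((pderiv ^^ Suc m) ([:0, 1:] * f))" by simp
  also have "\<dots> = pderiv ([:0, 1:] * (pderiv ^^ Suc m) f + Polynomial.smult (real (Suc m)) ((pderiv ^^ m) f))"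
    by (simp only: Suc.IH)
  also have "\<dots> = [:0, 1:] * (pderiv ^^ Suc (Suc m)) f + (pderiv ^^ Suc m) f
      + Polynomial.smult (real (Suc m)) ((pderiv ^^ Suc m) f)"
    by (simp add: pderiv_add pderiv_mult pderiv_smult pderiv_pCons algebra_simps)
  also have "\<dots> = [:0, 1:] * (pderiv ^^ Suc (Suc m)) f
      + Polynomial.smult (real (Suc (Suc m))) ((pderiv ^^ Suc m) f)"
    by (simp only: of_nat_Suc smult_add_left smult_1_left ac_simps)
  finally show ?case .
qed

lemma higher_pderiv_quadratic_mult:
  fixes f :: "real poly"
  shows
  "(pderiv ^^ Suc (Suc m)) ([:-1, 0, 1:] * f) = [:-1, 0, 1:] * (pderiv ^^ Suc (Suc m)) f
     + Polynomial.smult (2 * real (Suc (Suc m))) ([:0, 1:] * (pderiv ^^ Suc m) f)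
     + Polynomial.smult (real (Suc m) * real (Suc (Suc m))) ((pderiv ^^ m) f)"
proof -
  have e: "[:-1, 0, 1:] * g = [:0, 1:] * ([:0, 1:] * g) - g" for g :: "real poly" by simp
  have "(pderiv ^^ Suc (Suc m)) ([:-1, 0, 1:] * f)
      = (pderiv ^^ Suc (Suc m)) ([:0, 1:] * ([:0, 1:] * f)) - (pderiv ^^ Suc (Suc m)) f"
  proof -
    have "(pderiv ^^ n) (p - q) = (pderiv ^^ n) p - (pderiv ^^ n) q" for n and p q :: "real poly"
      by (induction n) (simp_all add: pderiv_diff)
    then show ?thesis by (simp only: e)
  qed
  also have "(pderiv ^^ Suc (Suc m)) ([:0, 1:] * ([:0, 1:] * f)) = [:0, 1:] * (pderiv ^^ Suc (Suc m)) ([:0, 1:] * f)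
      + Polynomial.smult (real (Suc (Suc m))) ((pderiv ^^ Suc m) ([:0, 1:] * f))"
    by (rule higher_pderiv_X_mult)
  also have "(pderiv ^^ Suc (Suc m)) ([:0, 1:] * f) = [:0, 1:] * (pderiv ^^ Suc (Suc m)) f
      + Polynomial.smult (real (Suc (Suc m))) ((pderiv ^^ Suc m) f)"
    by (rule higher_pderiv_X_mult)
  also have "(pderiv ^^ Suc m) ([:0, 1:] * f) = [:0, 1:] * (pderiv ^^ Suc m) f
      + Polynomial.smult (real (Suc m)) ((pderiv ^^ m) f)"
    by (rule higher_pderiv_X_mult)
  finally have eq: "(pderiv ^^ Suc (Suc m)) ([:-1, 0, 1:] * f) =
      [:0, 1:] * ([:0, 1:] * (pderiv ^^ Suc (Suc m)) f + Polynomial.smult (real (Suc (Suc m))) ((pderiv ^^ Suc m) f))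
      + Polynomial.smult (real (Suc (Suc m))) ([:0, 1:] * (pderiv ^^ Suc m) f + Polynomial.smult (real (Suc m)) ((pderiv ^^ m) f))
      - (pderiv ^^ Suc (Suc m)) f" .
  have alg: "[:0, 1:] * ([:0, 1:] * a + Polynomial.smult s b) + Polynomial.smult s ([:0, 1:] * b + Polynomial.smult t c) - a
      = [:-1, 0, 1:] * a + Polynomial.smult (2 * s) ([:0, 1:] * b) + Polynomial.smult (t * s) c"
    for a b c :: "real poly" and s t :: real
    by (intro poly_eqI) (simp add: algebra_simps coeff_pCons split: nat.split)
  show ?thesis by (simp only: eq alg)
qed

text \<open>For W = (x^2 - 1)^n one has (x^2 - 1) W' = 2 n x W. Differentiating this n + 1 times
  gives the equation for the n-th derivative of W, which is the Legendre polynomial up to Rodrigues'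
  constant.\<close>

lemma legendre_ode_poly:
  "[:-1, 0, 1:] * pderiv (pderiv (legendre_poly n)) + Polynomial.smult 2 ([:0, 1:] * pderiv (legendre_poly n))
     = Polynomial.smult (real n * (real n + 1)) (legendre_poly n)"
proof (cases n)
  case 0
  then show ?thesis by (simp add: legendre_poly_def)
next
  case (Suc m)
  define W :: "real poly" where "W = [:-1, 0, 1:] ^ n"
  have W': "[:-1, 0, 1:] * pderiv W = Polynomial.smult (2 * real n) ([:0, 1:] * W)"
  proof -
    have "pderiv W = Polynomial.smult (real n) ([:-1, 0, 1:] ^ m) * pderiv [:-1, 0, 1:]"
      unfolding W_def Suc by (rule pderiv_power_Suc)
    also have "pderiv [:-1, 0, 1:] = Polynomial.smult 2 [:0, 1::real:]" by (simp add: pderiv_pCons)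
    finally have "pderiv W = Polynomial.smult (real n) ([:-1, 0, 1:] ^ m) * Polynomial.smult 2 [:0, 1:]" .
    moreover have "Q * (Polynomial.smult a (Q ^ m) * Polynomial.smult 2 X) = Polynomial.smult (2 * a) (X * Q ^ Suc m)"
      for Q X :: "real poly" and a by (simp add: ac_simps)
    ultimately show ?thesis unfolding W_def Suc by (simp only:)
  qed
  have "(pderiv ^^ Suc (Suc m)) ([:-1, 0, 1:] * pderiv W)
      = Polynomial.smult (2 * real n) ((pderiv ^^ Suc (Suc m)) ([:0, 1:] * W))"
    by (simp only: W' higher_pderiv_smult)
  then have "[:-1, 0, 1:] * (pderiv ^^ Suc (Suc m)) (pderiv W)
     + Polynomial.smult (2 * real (Suc (Suc m))) ([:0, 1:] * (pderiv ^^ Suc m) (pderiv W))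
     + Polynomial.smult (real (Suc m) * real (Suc (Suc m))) ((pderiv ^^ m) (pderiv W))
     = Polynomial.smult (2 * real n) ([:0, 1:] * (pderiv ^^ Suc (Suc m)) W
         + Polynomial.smult (real (Suc (Suc m))) ((pderiv ^^ Suc m) W))"
    unfolding higher_pderiv_quadratic_mult higher_pderiv_X_mult .
  moreover define V where "V = (pderiv ^^ n) W"
  moreover have "(pderiv ^^ m) (pderiv W) = V" "(pderiv ^^ Suc m) (pderiv W) = pderiv V"
      "(pderiv ^^ Suc (Suc m)) (pderiv W) = pderiv (pderiv V)" "(pderiv ^^ Suc m) W = V"
      "(pderiv ^^ Suc (Suc m)) W = pderiv V"
    unfolding V_def Suc by (simp_all only: funpow_swap1 funpow.simps o_apply)
  ultimately have eq: "[:-1, 0, 1:] * pderiv (pderiv V) + Polynomial.smult (2 * real (Suc (Suc m))) ([:0, 1:] * pderiv V)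
     + Polynomial.smult (real (Suc m) * real (Suc (Suc m))) V
     = Polynomial.smult (2 * real n) ([:0, 1:] * pderiv V + Polynomial.smult (real (Suc (Suc m))) V)"
    by simp
  have eqV: "[:-1, 0, 1:] * pderiv (pderiv V) + Polynomial.smult 2 ([:0, 1:] * pderiv V)
     = Polynomial.smult (real n * (real n + 1)) V"
  proof -
    have "Z + Polynomial.smult 2 Y = Polynomial.smult (real n * (real n + 1)) U"
      if "Z + Polynomial.smult (2 * real (Suc (Suc m))) Y + Polynomial.smult (real (Suc m) * real (Suc (Suc m))) U
         = Polynomial.smult (2 * real n) (Y + Polynomial.smult (real (Suc (Suc m))) U)" for Z Y U :: "real poly"
    proof (rule poly_eqI)
      fix i
      show "Polynomial.coeff (Z + Polynomial.smult 2 Y) i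
        = Polynomial.coeff (Polynomial.smult (real n * (real n + 1)) U) i"
        using arg_cong[OF that, of "\<lambda>p. Polynomial.coeff p i"] unfolding Suc by (simp add: algebra_simps)
    qed
    from this[OF eq] show ?thesis .
  qed
  have L: "legendre_poly n = Polynomial.smult (1 / (2 ^ n * fact n)) V"
    by (simp add: legendre_poly_def V_def W_def)
  have "[:-1, 0, 1:] * pderiv (pderiv (legendre_poly n)) + Polynomial.smult 2 ([:0, 1:] * pderiv (legendre_poly n))
      = Polynomial.smult (1 / (2 ^ n * fact n)) ([:-1, 0, 1:] * pderiv (pderiv V) + Polynomial.smult 2 ([:0, 1:] * pderiv V))"
    unfolding L by (simp only: pderiv_smult mult_smult_right smult_add_right smult_smult mult.commute)
  also have "\<dots> = Polynomial.smult (real n * (real n + 1)) (legendre_poly n)"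
    unfolding eqV L by (simp only: smult_smult mult.commute)
  finally show ?thesis .
qed

lemma legendre_ode:
  "(1 - x\<^sup>2) * poly (pderiv (pderiv (legendre_poly n))) x
     = 2 * x * poly (pderiv (legendre_poly n)) x - real n * (real n + 1) * poly (legendre_poly n) x"
  using arg_cong[OF legendre_ode_poly[of n], of "\<lambda>p. poly p x"]
  by (simp add: algebra_simps power2_eq_square)

text \<open>Only the lowest power of x - 1 matters; everything divisible by one more is hidden in
  \<open>h\<close>. For \<open>k = n\<close> and f = (x + 1)^n the value at 1 is n! 2^n, the
  constant in Rodrigues' formula.\<close>

lemma higher_pderiv_linear_power_mult:
  fixes f :: "real poly"
  shows "k \<le> n \<Longrightarrow> \<exists>h. (pderiv ^^ k) ([:-1, 1:] ^ n * f) =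
     [:-1, 1:] ^ (n - k) * (Polynomial.smult (fact n / fact (n - k)) f + [:-1, 1:] * h)"
proof (induction k)
  case 0
  show ?case by (intro exI[of _ 0]) simp
next
  case (Suc k)
  then obtain h where h: "(pderiv ^^ k) ([:-1, 1:] ^ n * f) =
     [:-1, 1:] ^ (n - k) * (Polynomial.smult (fact n / fact (n - k)) f + [:-1, 1:] * h)" by auto
  define j where "j = n - Suc k"
  have nk: "n - k = Suc j" using Suc.prems by (simp add: j_def)
  define c :: real where "c = fact n / fact (n - k)"
  define g where "g = Polynomial.smult c f + [:-1, 1:] * h"
  have c: "real (Suc j) * c = fact n / fact j"
  proof -
    have "fact (Suc j) = real (Suc j) * fact j" by simp
    then show ?thesis unfolding c_def nk by (simp del: of_nat_Suc fact_Suc)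
  qed
  have "(pderiv ^^ Suc k) ([:-1, 1:] ^ n * f) = pderiv ([:-1, 1:] ^ Suc j * g)"
    by (simp only: funpow.simps o_apply h nk g_def c_def)
  also have "\<dots> = [:-1, 1:] ^ j * (Polynomial.smult (real (Suc j)) g + [:-1, 1:] * pderiv g)"
  proof -
    have "pderiv (Q ^ Suc j * g) = Q ^ j * (Polynomial.smult (real (Suc j)) g + Q * pderiv g)"
      if "pderiv Q = 1" for Q :: "real poly"
      by (simp only: pderiv_mult pderiv_power_Suc that) (simp add: distrib_left ac_simps del: of_nat_Suc)
    moreover have "pderiv [:-1, 1:] = (1 :: real poly)" by (simp add: pderiv_pCons)
    ultimately show ?thesis by blast
  qed
  also have "Polynomial.smult (real (Suc j)) g + [:-1, 1:] * pderiv g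
      = Polynomial.smult (real (Suc j) * c) f + [:-1, 1:] * (Polynomial.smult (real (Suc j)) h + pderiv g)"
    by (simp only: g_def smult_add_right smult_smult mult_smult_right distrib_left add.assoc)
  finally show ?case unfolding c j_def[symmetric] by blast
qed

lemma poly_legendre_1: "poly (legendre_poly n) 1 = 1"
proof -
  have sq: "[:-1, 0, 1:] = [:-1, 1:] * [:1, 1::real:]" by simp
  show ?thesis unfolding legendre_poly_def sq power_mult_distrib
    using higher_pderiv_linear_power_mult[of n n "[:1, 1:] ^ n"] by (auto simp: poly_power)
qed

lemma higher_pderiv_reflect:
  fixes p :: "real poly"
  assumes "pcompose p [:0, -1:] = p"
  shows "pcompose ((pderiv ^^ k) p) [:0, -1:] = Polynomial.smult ((-1) ^ k) ((pderiv ^^ k) p)"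
proof (induction k)
  case 0
  show ?case using assms by simp
next
  case (Suc k)
  have "pderiv (pcompose ((pderiv ^^ k) p) [:0, -1:]) = - pcompose (pderiv ((pderiv ^^ k) p)) [:0, -1:]"
    by (simp add: pderiv_pcompose pderiv_pCons)
  then have "pcompose (pderiv ((pderiv ^^ k) p)) [:0, -1:] = - pderiv (pcompose ((pderiv ^^ k) p) [:0, -1:])"
    by simp
  then show ?case by (simp add: Suc.IH pderiv_smult)
qed

lemma legendre_reflect: "poly (legendre_poly n) (-x) = (-1) ^ n * poly (legendre_poly n) x"
proof -
  have "pcompose ([:-1, 0, 1:] ^ n) [:0, -1:] = ([:-1, 0, 1:] ^ n :: real poly)"
  proof (induction n)
    case (Suc n)
    have "pcompose [:-1, 0, 1:] [:0, -1:] = ([:-1, 0, 1:] :: real poly)" by (simp add: pcompose_pCons)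
    then show ?case by (simp only: power_Suc pcompose_mult Suc.IH)
  qed (simp add: pcompose_1)
  from arg_cong[OF higher_pderiv_reflect[OF this, of n], of "\<lambda>p. poly p x"]
  have "poly ((pderiv ^^ n) ([:-1, 0, 1:] ^ n)) (- x) = (-1) ^ n * poly ((pderiv ^^ n) ([:-1, 0, 1:] ^ n)) x"
    by (simp add: poly_pcompose del: mult_pCons_left mult_pCons_right power_Suc)
  then show ?thesis by (simp add: legendre_poly_def)
qed

lemma poly_legendre_minus_1: "poly (legendre_poly n) (-1) = (-1) ^ n"
  using legendre_reflect[of n 1] by (simp add: poly_legendre_1)

lemma degree_legendre: "Polynomial.degree (legendre_poly n) = n"
proof -
  have "Polynomial.degree ([:-1, 0, 1:] ^ n :: real poly) = 2 * n"
    by (subst degree_power_eq) auto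
  then show ?thesis by (simp add: legendre_poly_def degree_higher_pderiv)
qed

text \<open>Sonin's argument: by the Legendre equation the left-hand side has derivative 2 x P'^2 /
  (n (n + 1)), so it decreases up to 0 and increases afterwards, with value 1 at both endpoints. It
  yields the bound on P and the weighted bound on P' at once.\<close>

lemma legendre_energy_le:
  assumes "n \<ge> 1" "x \<in> {-1..1}"
  shows "(poly (legendre_poly n) x)\<^sup>2 + (1 - x\<^sup>2) * (poly (pderiv (legendre_poly n)) x)\<^sup>2 / (real n * (real n + 1)) \<le> 1"
proof -
  define \<nu> where "\<nu> = real n * (real n + 1)"
  have \<nu>: "\<nu> > 0" using assms by (simp add: \<nu>_def)
  let ?P = "poly (legendre_poly n)" and ?P' = "poly (pderiv (legendre_poly n))"
    and ?P'' = "poly (pderiv (pderiv (legendre_poly n)))"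
  define c where "c = 1 / \<nu>"
  have c: "c > 0" "c * \<nu> = 1" using \<nu> by (auto simp: c_def)
  define E where "E = (\<lambda>x. (?P x)\<^sup>2 + c * ((1 - x\<^sup>2) * (?P' x)\<^sup>2))"
  have E': "(E has_real_derivative 2 * x * (c * (?P' x)\<^sup>2)) (at x)" for x
  proof -
    have "(E has_real_derivative 2 * ?P x * ?P' x + c * (- 2 * x * (?P' x)\<^sup>2 + (1 - x\<^sup>2) * (2 * ?P' x * ?P'' x))) (at x)"
      unfolding E_def by (auto intro!: derivative_eq_intros poly_DERIV simp: power2_eq_square algebra_simps)
    moreover have e: "(1 - x\<^sup>2) * (2 * ?P' x * ?P'' x) = 2 * ?P' x * (2 * x * ?P' x - \<nu> * ?P x)"
    proof -
      have "(1 - x\<^sup>2) * (2 * ?P' x * ?P'' x) = 2 * ?P' x * ((1 - x\<^sup>2) * ?P'' x)" by simp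
      then show ?thesis unfolding legendre_ode \<nu>_def .
    qed
    have "2 * ?P x * ?P' x + c * (- 2 * x * (?P' x)\<^sup>2 + (1 - x\<^sup>2) * (2 * ?P' x * ?P'' x))
        = 2 * x * (c * (?P' x)\<^sup>2) + 2 * ?P x * ?P' x * (1 - c * \<nu>)"
      unfolding e by (simp add: power2_eq_square algebra_simps)
    ultimately show ?thesis using c by simp
  qed
  have "E 1 = 1" "E (-1) = 1" by (simp_all add: E_def poly_legendre_1 poly_legendre_minus_1 flip: power_mult)
  show ?thesis
  proof (cases "x \<ge> 0")
    case True
    have "E x \<le> E 1"
    proof (rule DERIV_nonneg_imp_nondecreasing[of x 1 E])
      show "x \<le> 1" using assms by simp
      fix t assume "x \<le> t"
      then show "\<exists>y. DERIV E t :> y \<and> 0 \<le> y" using True c E'[of t] \<open>x \<le> t\<close> by (intro exI[of _ "2 * t * (c * (?P' t)\<^sup>2)"]) simp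
    qed
    then show ?thesis using \<open>E 1 = 1\<close> by (simp add: E_def c_def \<nu>_def)
  next
    case False
    have "E x \<le> E (-1)"
    proof (rule DERIV_nonpos_imp_nonincreasing[of "-1" x E])
      show "-1 \<le> x" using assms by simp
      fix t assume "t \<le> x"
      then show "\<exists>y. DERIV E t :> y \<and> y \<le> 0" 
      proof (intro exI conjI)
        show "DERIV E t :> 2 * t * (c * (?P' t)\<^sup>2)" by (rule E')
        show "2 * t * (c * (?P' t)\<^sup>2) \<le> 0"
          using False c \<open>t \<le> x\<close> by (rule_tac mult_nonpos_nonneg) auto
      qed
    qed
    then show ?thesis using \<open>E (-1) = 1\<close> by (simp add: E_def c_def \<nu>_def)
  qed
qed

lemma abs_legendre_le_1:
  assumes "x \<in> {-1..1}"
  shows "\<bar>poly (legendre_poly n) x\<bar> \<le> 1"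
proof (cases "n \<ge> 1")
  case True
  have "x\<^sup>2 \<le> 1" using assms by (simp add: abs_square_le_1 abs_le_iff)
  then have "0 \<le> (1 - x\<^sup>2) * (poly (pderiv (legendre_poly n)) x)\<^sup>2 / (real n * (real n + 1))"
    by simp
  with legendre_energy_le[OF True assms] have "(poly (legendre_poly n) x)\<^sup>2 \<le> 1" by linarith
  then show ?thesis by (simp add: abs_square_le_1)
next
  case False
  then have "n = 0" by simp
  then show ?thesis by (simp add: legendre_poly_def)
qed

lemma legendre_deriv_bound:
  assumes "n \<ge> 1" "x \<in> {-1..1}"
  shows "(1 - x\<^sup>2) * (poly (pderiv (legendre_poly n)) x)\<^sup>2 \<le> real n * (real n + 1)"
proof -
  have p: "real n * (real n + 1) > 0" using assms by simp
  have "0 \<le> (poly (legendre_poly n) x)\<^sup>2" by simp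
  with legendre_energy_le[OF assms]
  have "(1 - x\<^sup>2) * (poly (pderiv (legendre_poly n)) x)\<^sup>2 / (real n * (real n + 1)) \<le> 1" by linarith
  then show ?thesis using p by (simp only: pos_divide_le_eq mult_1)
qed

lemma integrable_poly: "poly p integrable_on {a..b::real}"
  by (intro integrable_continuous_real continuous_intros)

text \<open>Lagrange's identity: the weighted Wronskian \<open>F\<close> has derivative (\<nu> m -
  \<nu> n) P_m P_n and vanishes at both endpoints together with the weight 1 - x^2.\<close>

lemma legendre_orthogonal:
  assumes "m \<noteq> n"
  shows "integral {-1..1} (\<lambda>x. poly (legendre_poly m) x * poly (legendre_poly n) x) = 0"
proof -
  let ?P = "\<lambda>n. poly (legendre_poly n)" and ?P' = "\<lambda>n. poly (pderiv (legendre_poly n))"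
    and ?P'' = "\<lambda>n. poly (pderiv (pderiv (legendre_poly n)))"
  define \<nu> where "\<nu> = (\<lambda>n. real n * (real n + 1))"
  define F where "F = (\<lambda>x. (1 - x\<^sup>2) * (?P m x * ?P' n x - ?P' m x * ?P n x))"
  have F': "(F has_real_derivative (\<nu> m - \<nu> n) * (?P m x * ?P n x)) (at x within {-1..1})" for x
  proof -
    have "(F has_real_derivative - 2 * x * (?P m x * ?P' n x - ?P' m x * ?P n x)
        + (?P m x * ((1 - x\<^sup>2) * ?P'' n x) - ((1 - x\<^sup>2) * ?P'' m x) * ?P n x)) (at x within {-1..1})"
      unfolding F_def
      by (auto intro!: derivative_eq_intros DERIV_subset[OF poly_DERIV] simp: algebra_simps)
    then show ?thesis unfolding legendre_ode \<nu>_def by (simp add: algebra_simps)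
  qed
  have "((\<lambda>x. (\<nu> m - \<nu> n) * (?P m x * ?P n x)) has_integral (F 1 - F (-1))) {-1..1}"
    by (rule fundamental_theorem_of_calculus)
       (auto intro: F' simp: has_real_derivative_iff_has_vector_derivative[symmetric])
  from integral_unique[OF this]
  have "integral {-1..1} (\<lambda>x. (\<nu> m - \<nu> n) * (?P m x * ?P n x)) = 0"
    by (simp only:) (simp add: F_def)
  then have "(\<nu> m - \<nu> n) * integral {-1..1} (\<lambda>x. ?P m x * ?P n x) = 0"
    by (simp only: integral_mult_right)
  moreover have "\<nu> m \<noteq> \<nu> n"
  proof -
    have "\<nu> m < \<nu> n" if "m < n" for m n
      using that unfolding \<nu>_def by (intro mult_strict_mono') auto
    from this[of m n] this[of n m] show ?thesis using assms by (cases m n rule: linorder_cases) auto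
  qed
  ultimately show ?thesis by simp
qed

lemma legendre_expansion:
  assumes "Polynomial.degree p < n"
  shows "\<exists>c. p = (\<Sum>j<n. Polynomial.smult (c j) (legendre_poly j))"
  using assms
proof (induction n arbitrary: p)
  case 0
  then show ?case by simp
next
  case (Suc n)
  define a where "a = Polynomial.coeff p n / Polynomial.coeff (legendre_poly n) n"
  have lc: "Polynomial.coeff (legendre_poly n) n \<noteq> 0"
    using poly_legendre_1[of n] degree_legendre[of n] by (metis leading_coeff_0_iff poly_0 zero_neq_one)
  define r where "r = p - Polynomial.smult a (legendre_poly n)"
  have d: "Polynomial.degree r \<le> n" unfolding r_def
    using Suc.prems degree_legendre[of n] by (intro degree_diff_le) (auto intro: order_trans[OF degree_smult_le])
  have c0: "Polynomial.coeff r n = 0" using lc by (simp add: r_def a_def)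
  obtain c where c: "r = (\<Sum>j<n. Polynomial.smult (c j) (legendre_poly j))"
  proof (cases "n = 0")
    case True
    then have "r = 0" using d c0 by (metis leading_coeff_0_iff le_zero_eq)
    then show ?thesis using that True by simp
  next
    case False
    then have "Polynomial.degree r < n" using d c0
      by (metis Polynomial.degree_0 leading_coeff_0_iff le_neq_implies_less neq0_conv)
    then show ?thesis using Suc.IH that by blast
  qed
  have "p = r + Polynomial.smult a (legendre_poly n)" by (simp add: r_def)
  also have "\<dots> = (\<Sum>j<Suc n. Polynomial.smult ((c(n := a)) j) (legendre_poly j))"
    unfolding c by simp
  finally show ?case by blast
qed

lemma legendre_orthogonal_lower_degree:
  assumes "Polynomial.degree p < n"
  shows "integral {-1..1} (\<lambda>x. poly p x * poly (legendre_poly n) x) = 0"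
proof -
  obtain c where c: "p = (\<Sum>j<n. Polynomial.smult (c j) (legendre_poly j))"
    using legendre_expansion[OF assms] by blast
  have "integral {-1..1} (\<lambda>x. poly p x * poly (legendre_poly n) x)
      = integral {-1..1} (\<lambda>x. \<Sum>j<n. c j * (poly (legendre_poly j) x * poly (legendre_poly n) x))"
    unfolding c by (simp add: poly_sum sum_distrib_right mult.assoc)
  also have "\<dots> = (\<Sum>j<n. integral {-1..1} (\<lambda>x. c j * (poly (legendre_poly j) x * poly (legendre_poly n) x)))"
    by (rule integral_sum) (auto intro!: integrable_continuous_real continuous_intros)
  also have "\<dots> = 0" by (simp add: legendre_orthogonal)
  finally show ?thesis .
qed

text \<open>In r = x P' - n P the leading terms cancel, so r is orthogonal to P. Hence the integral
  of (x P^2)' = P^2 + 2 x P P', which is 2 by the endpoint values, equals 2 n + 1 times the integral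
  of P^2.\<close>

lemma legendre_norm: "integral {-1..1} (\<lambda>x. (poly (legendre_poly n) x)\<^sup>2) = 2 / (2 * real n + 1)"
proof -
  let ?P = "poly (legendre_poly n)" and ?P' = "poly (pderiv (legendre_poly n))"
  define r where "r = [:0, 1:] * pderiv (legendre_poly n) - Polynomial.smult (real n) (legendre_poly n)"
  have cr: "Polynomial.coeff r i = (real i - real n) * Polynomial.coeff (legendre_poly n) i" for i
    by (cases i) (simp_all add: r_def coeff_pderiv algebra_simps)
  have "integral {-1..1} (\<lambda>x. poly r x * ?P x) = 0"
  proof (cases "n = 0")
    case True
    then have "r = 0" by (simp add: r_def legendre_poly_def)
    then show ?thesis by simp
  next
    case False
    have "Polynomial.degree r < n"
    proof -
      have "Polynomial.coeff r i = 0" if "i > n - 1" for i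
      proof (cases "i = n")
        case True then show ?thesis by (simp add: cr)
      next
        case False
        then have "i > n" using that by simp
        then show ?thesis using degree_legendre[of n] by (simp add: cr coeff_eq_0)
      qed
      then have "Polynomial.degree r \<le> n - 1" by (intro degree_le) auto
      then show ?thesis using False by simp
    qed
    then show ?thesis by (rule legendre_orthogonal_lower_degree)
  qed
  moreover have "poly r x = x * ?P' x - real n * ?P x" for x by (simp add: r_def)
  ultimately have r0: "integral {-1..1} (\<lambda>x. (x * ?P' x - real n * ?P x) * ?P x) = 0" by simp
  have F: "((\<lambda>x. (?P x)\<^sup>2 + 2 * (x * ?P' x * ?P x)) has_integral (1 * (?P 1)\<^sup>2 - (-1) * (?P (-1))\<^sup>2)) {-1..1}"
    by (rule fundamental_theorem_of_calculus)
       (auto intro!: derivative_eq_intros DERIV_subset[OF poly_DERIV]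
         simp: power2_eq_square algebra_simps has_real_derivative_iff_has_vector_derivative[symmetric])
  have "2 = integral {-1..1} (\<lambda>x. (?P x)\<^sup>2 + 2 * (x * ?P' x * ?P x))"
    using F by (simp add: integral_unique poly_legendre_1 poly_legendre_minus_1 flip: power_mult)
  also have "\<dots> = integral {-1..1} (\<lambda>x. (2 * real n + 1) * (?P x)\<^sup>2 + 2 * ((x * ?P' x - real n * ?P x) * ?P x))"
    by (simp add: algebra_simps power2_eq_square)
  also have "\<dots> = integral {-1..1} (\<lambda>x. (2 * real n + 1) * (?P x)\<^sup>2) + integral {-1..1} (\<lambda>x. 2 * ((x * ?P' x - real n * ?P x) * ?P x))"
    by (rule integral_add) (auto intro!: integrable_continuous_real continuous_intros)
  also have "\<dots> = (2 * real n + 1) * integral {-1..1} (\<lambda>x. (?P x)\<^sup>2)" using r0 by simp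
  finally show ?thesis by (simp add: field_simps)
qed

section \<open>Functions with algebraic weights at the endpoints\<close>

text \<open>
  \<open>D = (1 - x\<^sup>2) d/dx\<close> is a derivation that preserves the order of vanishing at the endpoints, so
  a function of order \<open>s\<close> is described by one and the same bound for all \<open>D\<^sup>j f\<close>.
\<close>

fun wreg :: "real set \<Rightarrow> real \<Rightarrow> nat \<Rightarrow> (real \<Rightarrow> real) \<Rightarrow> bool" where
  "wreg I s 0 f \<longleftrightarrow> (\<exists>C. \<forall>x\<in>I. \<bar>f x\<bar> \<le> C * (1 - x\<^sup>2) powr s)"
| "wreg I s (Suc m) f \<longleftrightarrow> (\<exists>C. \<forall>x\<in>I. \<bar>f x\<bar> \<le> C * (1 - x\<^sup>2) powr s) \<and>
     (\<exists>f'. (\<forall>x\<in>I. (f has_real_derivative f' x) (at x)) \<and> wreg I s m (\<lambda>x. (1 - x\<^sup>2) * f' x))"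

declare wreg.simps(2) [simp del]

lemma wreg_bounded: "wreg I s m f \<Longrightarrow> \<exists>C. \<forall>x\<in>I. \<bar>f x\<bar> \<le> C * (1 - x\<^sup>2) powr s"
  by (cases m) (auto simp: wreg.simps(2))

lemma wreg_SucE:
  assumes "wreg I s (Suc m) f"
  obtains f' where "\<forall>x\<in>I. (f has_real_derivative f' x) (at x)" "wreg I s m (\<lambda>x. (1 - x\<^sup>2) * f' x)"
  using assms unfolding wreg.simps(2) by blast

lemma wreg_SucI:
  assumes "\<exists>C. \<forall>x\<in>I. \<bar>f x\<bar> \<le> C * (1 - x\<^sup>2) powr s"
    "\<forall>x\<in>I. (f has_real_derivative f' x) (at x)" "wreg I s m (\<lambda>x. (1 - x\<^sup>2) * f' x)"
  shows "wreg I s (Suc m) f"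
  using assms unfolding wreg.simps(2) by blast

lemma square_less_1:
  fixes x :: real
  shows "x \<in> {-1<..<1} \<Longrightarrow> x\<^sup>2 < 1"
  by (simp add: abs_square_less_1 abs_less_iff)

lemma wreg_bounded_pos:
  assumes "wreg I s m f"
  obtains C where "C > 0" "\<And>x. x \<in> I \<Longrightarrow> \<bar>f x\<bar> \<le> C * (1 - x\<^sup>2) powr s"
proof -
  obtain C where C: "\<forall>x\<in>I. \<bar>f x\<bar> \<le> C * (1 - x\<^sup>2) powr s" using wreg_bounded[OF assms] by blast
  have "\<bar>f x\<bar> \<le> max C 1 * (1 - x\<^sup>2) powr s" if "x \<in> I" for x
    using C that by (intro order_trans[OF bspec[OF C that]] mult_right_mono) auto
  then show ?thesis by (intro that[of "max C 1"]) auto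
qed

lemma wreg_SucD: "wreg I s (Suc m) f \<Longrightarrow> wreg I s m f"
proof (induction m arbitrary: f)
  case 0
  then show ?case using wreg_bounded by simp
next
  case (Suc m)
  obtain f' where f': "\<forall>x\<in>I. (f has_real_derivative f' x) (at x)" "wreg I s (Suc m) (\<lambda>x. (1 - x\<^sup>2) * f' x)"
    by (rule wreg_SucE[OF Suc.prems])
  show ?case by (rule wreg_SucI[OF wreg_bounded[OF Suc.prems] f'(1) Suc.IH[OF f'(2)]])
qed

lemma wreg_le: "wreg I s m f \<Longrightarrow> n \<le> m \<Longrightarrow> wreg I s n f"
  by (induction m) (auto simp: le_Suc_eq dest: wreg_SucD)

lemma wreg_cong:
  assumes "open I"
  shows "wreg I s m f \<Longrightarrow> (\<And>x. x \<in> I \<Longrightarrow> f x = g x) \<Longrightarrow> wreg I s m g"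
proof (induction m arbitrary: f g)
  case 0
  then show ?case by simp
next
  case (Suc m)
  obtain f' where f': "\<forall>x\<in>I. (f has_real_derivative f' x) (at x)" "wreg I s m (\<lambda>x. (1 - x\<^sup>2) * f' x)"
    by (rule wreg_SucE[OF Suc.prems(1)])
  have "\<forall>x\<in>I. (g has_real_derivative f' x) (at x)"
    using f'(1) has_field_derivative_transform_within_open[OF _ assms] Suc.prems(2) by blast
  moreover have "\<exists>C. \<forall>x\<in>I. \<bar>g x\<bar> \<le> C * (1 - x\<^sup>2) powr s"
    using wreg_bounded[OF Suc.prems(1)] Suc.prems(2) by simp
  ultimately show ?case using wreg_SucI[OF _ _ f'(2)] by blast
qed

lemma wreg_add: "wreg I s m f \<Longrightarrow> wreg I s m g \<Longrightarrow> wreg I s m (\<lambda>x. f x + g x)"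
proof (induction m arbitrary: f g)
  case 0
  obtain C where C: "\<And>x. x \<in> I \<Longrightarrow> \<bar>f x\<bar> \<le> C * (1 - x\<^sup>2) powr s" using 0(1) by auto
  obtain C' where C': "\<And>x. x \<in> I \<Longrightarrow> \<bar>g x\<bar> \<le> C' * (1 - x\<^sup>2) powr s" using 0(2) by auto
  have "\<bar>f x + g x\<bar> \<le> (C + C') * (1 - x\<^sup>2) powr s" if "x \<in> I" for x
    using C[OF that] C'[OF that] abs_triangle_ineq[of "f x" "g x"] by (simp add: algebra_simps)
  then show ?case by auto
next
  case (Suc m)
  obtain f' where f': "\<forall>x\<in>I. (f has_real_derivative f' x) (at x)" "wreg I s m (\<lambda>x. (1 - x\<^sup>2) * f' x)"
    by (rule wreg_SucE[OF Suc.prems(1)])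
  obtain g' where g': "\<forall>x\<in>I. (g has_real_derivative g' x) (at x)" "wreg I s m (\<lambda>x. (1 - x\<^sup>2) * g' x)"
    by (rule wreg_SucE[OF Suc.prems(2)])
  have "wreg I s m (\<lambda>x. (1 - x\<^sup>2) * (f' x + g' x))"
    using Suc.IH[OF f'(2) g'(2)] by (simp add: algebra_simps)
  moreover have "\<exists>C. \<forall>x\<in>I. \<bar>f x + g x\<bar> \<le> C * (1 - x\<^sup>2) powr s"
    by (rule wreg_bounded[OF Suc.IH[OF wreg_SucD[OF Suc.prems(1)] wreg_SucD[OF Suc.prems(2)]]])
  moreover have "\<forall>x\<in>I. ((\<lambda>x. f x + g x) has_real_derivative f' x + g' x) (at x)"
    using f'(1) g'(1) by (auto intro!: DERIV_add)
  ultimately show ?case by (intro wreg_SucI)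
qed

lemma wreg_mult: "wreg I s m f \<Longrightarrow> wreg I t m g \<Longrightarrow> wreg I (s + t) m (\<lambda>x. f x * g x)"
proof (induction m arbitrary: f g)
  case 0
  obtain C where C: "C > 0" "\<And>x. x \<in> I \<Longrightarrow> \<bar>f x\<bar> \<le> C * (1 - x\<^sup>2) powr s"
    using wreg_bounded_pos[OF 0(1)] by blast
  obtain C' where C': "\<And>x. x \<in> I \<Longrightarrow> \<bar>g x\<bar> \<le> C' * (1 - x\<^sup>2) powr t" using 0(2) by auto
  have "\<bar>f x * g x\<bar> \<le> (C * C') * (1 - x\<^sup>2) powr (s + t)" if "x \<in> I" for x
  proof -
    have "\<bar>f x * g x\<bar> \<le> (C * (1 - x\<^sup>2) powr s) * (C' * (1 - x\<^sup>2) powr t)"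
      unfolding abs_mult using C C' that by (intro mult_mono) auto
    then show ?thesis by (simp add: powr_add ac_simps)
  qed
  then show ?case by auto
next
  case (Suc m)
  obtain f' where f': "\<forall>x\<in>I. (f has_real_derivative f' x) (at x)" "wreg I s m (\<lambda>x. (1 - x\<^sup>2) * f' x)"
    by (rule wreg_SucE[OF Suc.prems(1)])
  obtain g' where g': "\<forall>x\<in>I. (g has_real_derivative g' x) (at x)" "wreg I t m (\<lambda>x. (1 - x\<^sup>2) * g' x)"
    by (rule wreg_SucE[OF Suc.prems(2)])
  have "wreg I (s + t) m (\<lambda>x. (1 - x\<^sup>2) * (f' x * g x + g' x * f x))"
    using wreg_add[OF Suc.IH[OF f'(2) wreg_SucD[OF Suc.prems(2)]] Suc.IH[OF wreg_SucD[OF Suc.prems(1)] g'(2)]]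
    by (simp add: algebra_simps)
  moreover have "\<exists>C. \<forall>x\<in>I. \<bar>f x * g x\<bar> \<le> C * (1 - x\<^sup>2) powr (s + t)"
    by (rule wreg_bounded[OF Suc.IH[OF wreg_SucD[OF Suc.prems(1)] wreg_SucD[OF Suc.prems(2)]]])
  moreover have "\<forall>x\<in>I. ((\<lambda>x. f x * g x) has_real_derivative (f' x * g x + g' x * f x)) (at x)"
    using f'(1) g'(1) by (auto intro!: DERIV_mult)
  ultimately show ?case by (intro wreg_SucI)
qed

lemma wreg_weaken:
  assumes "I \<subseteq> {-1<..<1}" "t \<le> s"
  shows "wreg I s m f \<Longrightarrow> wreg I t m f"
proof (induction m arbitrary: f)
  case 0
  obtain C where C: "C > 0" "\<And>x. x \<in> I \<Longrightarrow> \<bar>f x\<bar> \<le> C * (1 - x\<^sup>2) powr s"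
    using wreg_bounded_pos[OF 0] by blast
  have "\<bar>f x\<bar> \<le> C * (1 - x\<^sup>2) powr t" if "x \<in> I" for x
  proof -
    have "x\<^sup>2 < 1" using assms(1) that square_less_1 by blast
    then have "(1 - x\<^sup>2) powr s \<le> (1 - x\<^sup>2) powr t" using assms(2) by (intro powr_mono') auto
    then show ?thesis using C that by (meson order_trans mult_left_mono less_imp_le)
  qed
  then show ?case by auto
next
  case (Suc m)
  obtain f' where f': "\<forall>x\<in>I. (f has_real_derivative f' x) (at x)" "wreg I s m (\<lambda>x. (1 - x\<^sup>2) * f' x)"
    by (rule wreg_SucE[OF Suc.prems(1)])
  have "\<exists>C. \<forall>x\<in>I. \<bar>f x\<bar> \<le> C * (1 - x\<^sup>2) powr t"
    using wreg_bounded[OF Suc.IH[OF wreg_SucD[OF Suc.prems]]] .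
  then show ?case using f'(1) Suc.IH[OF f'(2)] by (rule wreg_SucI)
qed

lemma wreg_poly:
  assumes "I \<subseteq> {-1<..<1}"
  shows "wreg I 0 m (poly p)"
proof (induction m arbitrary: p)
  have "\<exists>C. \<forall>x\<in>I. \<bar>poly p x\<bar> \<le> C * (1 - x\<^sup>2) powr 0" for p
  proof -
    have "compact (poly p ` {-1..1::real})" by (intro compact_continuous_image continuous_intros compact_Icc)
    then obtain C where C: "\<And>x. x \<in> {-1..1} \<Longrightarrow> \<bar>poly p x\<bar> \<le> C"
      by (metis bounded_real compact_imp_bounded imageI)
    have "\<bar>poly p x\<bar> \<le> C * (1 - x\<^sup>2) powr 0" if "x \<in> I" for x
    proof -
      have "x\<^sup>2 < 1" using assms(1) that square_less_1 by blast
      then show ?thesis using C[of x] assms that by auto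
    qed
    then show ?thesis by blast
  qed
  note b = this
  {
    case 0
    show ?case using b by simp
  next
    case (Suc m)
    have "wreg I 0 m (\<lambda>x. (1 - x\<^sup>2) * poly (pderiv p) x)"
      using Suc.IH[of "[:1, 0, -1:] * pderiv p"] by (simp add: power2_eq_square algebra_simps)
    then show ?case using b poly_DERIV by (intro wreg_SucI[where f' = "poly (pderiv p)"]) blast+
  }
qed

lemma wreg_const: "I \<subseteq> {-1<..<1} \<Longrightarrow> wreg I 0 m (\<lambda>x. c)"
proof -
  assume "I \<subseteq> {-1<..<1}"
  then have "wreg I 0 m (poly [:c:])" by (rule wreg_poly)
  moreover have "poly [:c:] = (\<lambda>x. c)" by auto
  ultimately show ?thesis by simp
qed

lemma wreg_cmult: "I \<subseteq> {-1<..<1} \<Longrightarrow> wreg I s m f \<Longrightarrow> wreg I s m (\<lambda>x. c * f x)"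
  using wreg_mult[OF wreg_const[of I m c], of s f] by simp

lemma wreg_minus: "I \<subseteq> {-1<..<1} \<Longrightarrow> wreg I s m f \<Longrightarrow> wreg I s m (\<lambda>x. - f x)"
  using wreg_cmult[of I s m f "-1"] by simp

lemma wreg_sum:
  assumes "finite A" "I \<subseteq> {-1<..<1}" "\<And>i. i \<in> A \<Longrightarrow> wreg I s m (f i)"
  shows "wreg I s m (\<lambda>x. \<Sum>i\<in>A. f i x)"
  using assms
proof (induction A rule: finite_induct)
  case empty
  have "wreg I s m (\<lambda>x. 0)"
  proof (induction m)
    case 0
    show ?case by (auto intro!: exI[of _ 0])
  next
    case (Suc m)
    then show ?case by (intro wreg_SucI[where f' = "\<lambda>_. 0"]) (auto intro!: exI[of _ 0])
  qed
  then show ?case by simp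
next
  case (insert x F)
  then show ?case by (simp add: wreg_add)
qed

lemma wreg_phi_powr:
  assumes "I \<subseteq> {-1<..<1}"
  shows "wreg I a m (\<lambda>x. (1 - x\<^sup>2) powr a)"
proof (induction m)
  case 0
  show ?case by (auto intro!: exI[of _ 1])
next
  case (Suc m)
  have d: "((\<lambda>x. (1 - x\<^sup>2) powr a) has_real_derivative (-2 * a * x * (1 - x\<^sup>2) powr a / (1 - x\<^sup>2))) (at x)"
    if "x \<in> I" for x
  proof -
    have "x\<^sup>2 < 1" using assms(1) that square_less_1 by blast
    then show ?thesis by (auto intro!: derivative_eq_intros simp: powr_diff field_simps)
  qed
  \<comment> \<open>D applied to the power of the weight is - 2 a x times that power, a polynomial
    multiple of the function itself, so the induction closes.\<close>
  have "wreg I (0 + a) m (\<lambda>x. poly [:0, -2 * a:] x * (1 - x\<^sup>2) powr a)"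
    by (rule wreg_mult[OF wreg_poly[OF assms] Suc])
  moreover have "(\<lambda>x. poly [:0, -2 * a:] x * (1 - x\<^sup>2) powr a)
      = (\<lambda>x. (1 - x\<^sup>2) * (-2 * a * x * (1 - x\<^sup>2) powr a / (1 - x\<^sup>2)))"
    by (rule ext, case_tac "1 - x\<^sup>2 = 0") simp_all
  ultimately have "wreg I a m (\<lambda>x. (1 - x\<^sup>2) * (-2 * a * x * (1 - x\<^sup>2) powr a / (1 - x\<^sup>2)))"
    by (simp only: add_0)
  moreover have "\<exists>C. \<forall>x\<in>I. \<bar>(1 - x\<^sup>2) powr a\<bar> \<le> C * (1 - x\<^sup>2) powr a"
    by (auto intro!: exI[of _ 1])
  moreover have "\<forall>x\<in>I. ((\<lambda>x. (1 - x\<^sup>2) powr a) has_real_derivative (-2 * a * x * (1 - x\<^sup>2) powr a / (1 - x\<^sup>2))) (at x)"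
    using d by blast
  ultimately show ?case by (intro wreg_SucI[where f' = "\<lambda>x. -2 * a * x * (1 - x\<^sup>2) powr a / (1 - x\<^sup>2)"])
qed

lemma wreg_union:
  assumes "open I" "open J"
  shows "wreg I s m f \<Longrightarrow> wreg J s m f \<Longrightarrow> wreg (I \<union> J) s m f"
proof (induction m arbitrary: f)
  case 0
  obtain C where C: "C > 0" "\<And>x. x \<in> I \<Longrightarrow> \<bar>f x\<bar> \<le> C * (1 - x\<^sup>2) powr s"
    using wreg_bounded_pos[OF 0(1)] by blast
  obtain C' where C': "C' > 0" "\<And>x. x \<in> J \<Longrightarrow> \<bar>f x\<bar> \<le> C' * (1 - x\<^sup>2) powr s"
    using wreg_bounded_pos[OF 0(2)] by blast
  have "\<bar>f x\<bar> \<le> (C + C') * (1 - x\<^sup>2) powr s" if "x \<in> I \<union> J" for x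
  proof -
    have "C * (1 - x\<^sup>2) powr s \<le> (C + C') * (1 - x\<^sup>2) powr s" "C' * (1 - x\<^sup>2) powr s \<le> (C + C') * (1 - x\<^sup>2) powr s"
      using C(1) C'(1) by (auto intro!: mult_right_mono)
    then show ?thesis using that C(2)[of x] C'(2)[of x] by (meson UnE order_trans)
  qed
  then show ?case by auto
next
  case (Suc m)
  obtain f' where f': "\<forall>x\<in>I. (f has_real_derivative f' x) (at x)" "wreg I s m (\<lambda>x. (1 - x\<^sup>2) * f' x)"
    by (rule wreg_SucE[OF Suc.prems(1)])
  obtain g' where g': "\<forall>x\<in>J. (f has_real_derivative g' x) (at x)" "wreg J s m (\<lambda>x. (1 - x\<^sup>2) * g' x)"
    by (rule wreg_SucE[OF Suc.prems(2)])
  \<comment> \<open>On the overlap the two derivatives agree by uniqueness, so \<open>h\<close>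
    extends both.\<close>
  define h where "h = (\<lambda>x. if x \<in> I then f' x else g' x)"
  have hI: "h x = f' x" if "x \<in> I" for x using that by (simp add: h_def)
  have hJ: "h x = g' x" if "x \<in> J" for x using that f'(1) g'(1) by (auto simp: h_def intro: DERIV_unique)
  have "wreg I s m (\<lambda>x. (1 - x\<^sup>2) * h x)" by (rule wreg_cong[OF assms(1) f'(2)]) (simp add: hI)
  moreover have "wreg J s m (\<lambda>x. (1 - x\<^sup>2) * h x)" by (rule wreg_cong[OF assms(2) g'(2)]) (simp add: hJ)
  moreover have "\<forall>x\<in>I \<union> J. (f has_real_derivative h x) (at x)" using f'(1) g'(1) hI hJ by auto
  moreover have "\<exists>C. \<forall>x\<in>I \<union> J. \<bar>f x\<bar> \<le> C * (1 - x\<^sup>2) powr s"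
    by (rule wreg_bounded[OF Suc.IH[OF wreg_SucD[OF Suc.prems(1)] wreg_SucD[OF Suc.prems(2)]]])
  ultimately show ?case using Suc.IH[of "\<lambda>x. (1 - x\<^sup>2) * h x"] wreg_SucI[where f' = h] by blast
qed

text \<open>The weight is even, so orders survive reflection; endpoint arguments can therefore be
  carried out at -1 only.\<close>

lemma wreg_reflect:
  assumes "I \<subseteq> {-1<..<1}"
  shows "wreg I s m f \<Longrightarrow> wreg (uminus ` I) s m (\<lambda>x. f (- x))"
proof (induction m arbitrary: f)
  case 0
  then show ?case by auto
next
  case (Suc m)
  obtain f' where f': "\<forall>x\<in>I. (f has_real_derivative f' x) (at x)" "wreg I s m (\<lambda>x. (1 - x\<^sup>2) * f' x)"
    by (rule wreg_SucE[OF Suc.prems(1)])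
  have d: "((\<lambda>x. f (- x)) has_real_derivative - f' (- x)) (at x)" if "x \<in> uminus ` I" for x
  proof -
    have "(f has_real_derivative f' (- x)) (at (- x))" using f'(1) that by auto
    then show ?thesis by (simp add: DERIV_mirror)
  qed
  have "wreg (uminus ` I) s m (\<lambda>x. (1 - x\<^sup>2) * - f' (- x))"
  proof -
    have "uminus ` I \<subseteq> {-1<..<1}" using assms by auto
    from wreg_minus[OF this Suc.IH[OF f'(2)]] show ?thesis by simp
  qed
  moreover have "\<exists>C. \<forall>x\<in>uminus ` I. \<bar>f (- x)\<bar> \<le> C * (1 - x\<^sup>2) powr s"
    using wreg_bounded[OF Suc.prems] by auto
  moreover have "\<forall>x\<in>uminus ` I. ((\<lambda>x. f (- x)) has_real_derivative - f' (- x)) (at x)"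
    using d by blast
  ultimately show ?case by (intro wreg_SucI[where f' = "\<lambda>x. - f' (- x)"])
qed

text \<open>On this interval 1 - x lies between 1/2 and 2, so its powers of either sign are at most
  \<open>2 powr \<bar>a\<bar>\<close>, and 1 + x may replace 1 - x^2 as the weight. The interval
  reaches beyond 0 so that it and its reflection cover (-1, 1) with an overlap.\<close>

lemma one_plus_powr_le:
  fixes x :: real
  assumes "x \<in> {-1<..<1/2}"
  shows "(1 + x) powr a \<le> 2 powr \<bar>a\<bar> * (1 - x\<^sup>2) powr a"
    and "(1 - x\<^sup>2) powr a \<le> 2 powr \<bar>a\<bar> * (1 + x) powr a"
proof -
  have key: "t powr b \<le> 2 powr \<bar>b\<bar>" if "1/2 \<le> t" "t \<le> 2" for t b :: real
  proof (cases "b \<ge> 0")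
    case True
    then show ?thesis using that by (simp add: powr_mono2)
  next
    case False
    have "t powr b \<le> (1/2) powr b" using False that by (intro powr_mono2') auto
    also have "\<dots> = 2 powr \<bar>b\<bar>" using False by (simp add: powr_divide powr_minus_divide)
    finally show ?thesis .
  qed
  have e: "(1 - x\<^sup>2) powr a = (1 - x) powr a * (1 + x) powr a"
    using assms by (simp flip: powr_mult add: power2_eq_square algebra_simps)
  have "(1 + x) powr a = (1 - x) powr (- a) * (1 - x\<^sup>2) powr a"
    using assms by (simp add: e powr_minus field_simps)
  also have "\<dots> \<le> 2 powr \<bar>a\<bar> * (1 - x\<^sup>2) powr a"
    using key[of "1 - x" "- a"] assms by (intro mult_right_mono) auto
  finally show "(1 + x) powr a \<le> 2 powr \<bar>a\<bar> * (1 - x\<^sup>2) powr a" .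
  show "(1 - x\<^sup>2) powr a \<le> 2 powr \<bar>a\<bar> * (1 + x) powr a"
    unfolding e using key[of "1 - x" a] assms by (intro mult_right_mono) auto
qed

lemma one_plus_powr_bounded:
  fixes a :: real
  shows "\<exists>C. \<forall>x\<in>{-1<..<1/2}. \<bar>(1 + x) powr a\<bar> \<le> C * (1 - x\<^sup>2) powr a"
  by (intro exI[of _ "2 powr \<bar>a\<bar>"] ballI) (simp only: abs_of_nonneg[OF powr_ge_zero] one_plus_powr_le(1))

lemma wreg_one_plus_powr:
  "wreg {-1<..<1/2} a m (\<lambda>x. (1 + x) powr a)"
proof (induction m)
  case 0
  show ?case using one_plus_powr_bounded by simp
next
  case (Suc m)
  have d: "((\<lambda>x. (1 + x) powr a) has_real_derivative (a * (1 + x) powr a / (1 + x))) (at x)"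
    if "x \<in> {-1<..<1/2}" for x
    using that by (auto intro!: derivative_eq_intros simp: powr_diff field_simps)
  have "wreg {-1<..<1/2} (0 + a) m (\<lambda>x. poly [:a, -a:] x * (1 + x) powr a)"
    by (rule wreg_mult[OF wreg_poly Suc]) auto
  moreover have "(\<lambda>x. poly [:a, -a:] x * (1 + x) powr a) = (\<lambda>x. (1 - x\<^sup>2) * (a * (1 + x) powr a / (1 + x)))"
  proof
    fix x :: real
    show "poly [:a, -a:] x * (1 + x) powr a = (1 - x\<^sup>2) * (a * (1 + x) powr a / (1 + x))"
    proof (cases "1 + x = 0")
      case False
      have "1 - x\<^sup>2 = (1 + x) * (1 - x)" by (simp add: power2_eq_square algebra_simps)
      moreover have "(1 + x) * (1 - x) * (b / (1 + x)) = (1 - x) * b" for b using False by simp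
      ultimately have "(1 - x\<^sup>2) * (a * (1 + x) powr a / (1 + x)) = (1 - x) * (a * (1 + x) powr a)" by simp
      then show ?thesis by (simp add: algebra_simps)
    qed simp
  qed
  ultimately have "wreg {-1<..<1/2} a m (\<lambda>x. (1 - x\<^sup>2) * (a * (1 + x) powr a / (1 + x)))"
    by (simp only: add_0)
  moreover have "\<forall>x\<in>{-1<..<1/2}. ((\<lambda>x. (1 + x) powr a) has_real_derivative (a * (1 + x) powr a / (1 + x))) (at x)"
    using d by blast
  ultimately show ?case
    by (intro wreg_SucI[OF one_plus_powr_bounded, where f' = "\<lambda>x. a * (1 + x) powr a / (1 + x)"])
qed

lemma wreg_one_plus_power: "wreg {-1<..<1/2} (real n) m (\<lambda>x. (1 + x) ^ n)"
  by (rule wreg_cong[OF _ wreg_one_plus_powr]) (auto simp: powr_realpow)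

text \<open>D maps holomorphic functions on \<open>U\<close> to holomorphic functions on
  \<open>U\<close>, so the induction runs over all of them at once; each level only asks for
  boundedness on a compact segment.\<close>

lemma wreg_holomorphic:
  assumes "open U" "G holomorphic_on U" "complex_of_real ` {a..b} \<subseteq> U" "I \<subseteq> {a..b}" "I \<subseteq> {-1<..<1}"
  shows "wreg I 0 m (\<lambda>x. Re (G (of_real x)))"
  using assms(2)
proof (induction m arbitrary: G)
  have b: "\<exists>C. \<forall>x\<in>I. \<bar>Re (G (of_real x))\<bar> \<le> C * (1 - x\<^sup>2) powr 0" if G: "G holomorphic_on U" for G
  proof -
    have "continuous_on {a..b} (\<lambda>x. G (complex_of_real x))"
      by (rule continuous_on_compose2[OF holomorphic_on_imp_continuous_on[OF G] _ assms(3)])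
         (intro continuous_intros)
    then have "compact ((\<lambda>x. G (complex_of_real x)) ` {a..b})" by (intro compact_continuous_image compact_Icc)
    then obtain C where C: "\<And>x. x \<in> {a..b} \<Longrightarrow> cmod (G (complex_of_real x)) \<le> C"
      by (metis bounded_iff compact_imp_bounded imageI)
    have "\<bar>Re (G (of_real x))\<bar> \<le> C * (1 - x\<^sup>2) powr 0" if "x \<in> I" for x
    proof -
      have "x\<^sup>2 < 1" using assms(5) that square_less_1 by blast
      then show ?thesis using C[of x] assms(4) that abs_Re_le_cmod[of "G (of_real x)"] by fastforce
    qed
    then show ?thesis by blast
  qed
  {
    case 0
    show ?case using b[OF 0] by simp
  next
    case (Suc m)
    have d: "((\<lambda>x. Re (G (of_real x))) has_real_derivative Re (deriv G (of_real x))) (at x)" if "x \<in> I" for x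
    proof -
      have "(G has_field_derivative deriv G (of_real x)) (at (of_real x))"
        using holomorphic_derivI[OF Suc.prems assms(1)] assms(3,4) that by blast
      then have "((\<lambda>x. G (complex_of_real x)) has_vector_derivative deriv G (of_real x)) (at x)"
        by (rule has_vector_derivative_real_field)
      from bounded_linear.has_vector_derivative[OF bounded_linear_Re this]
      show ?thesis by (simp add: has_real_derivative_iff_has_vector_derivative)
    qed
    have "(\<lambda>z. (1 - z\<^sup>2) * deriv G z) holomorphic_on U"
      by (intro holomorphic_intros holomorphic_deriv Suc.prems assms(1))
    from Suc.IH[OF this] have "wreg I 0 m (\<lambda>x. (1 - x\<^sup>2) * Re (deriv G (of_real x)))"
      by (simp add: power2_eq_square)
    moreover have "\<forall>x\<in>I. ((\<lambda>x. Re (G (of_real x))) has_real_derivative Re (deriv G (of_real x))) (at x)"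
      using d by blast
    ultimately show ?case
      by (intro wreg_SucI[OF b[OF Suc.prems], where f' = "\<lambda>x. Re (deriv G (of_real x))"])
  }
qed

section \<open>Integrals on the interval\<close>

lemma abs_integrable_mult_continuous:
  fixes f u :: "real \<Rightarrow> real"
  assumes "f absolutely_integrable_on {a..b}" "continuous_on {a..b} u"
  shows "(\<lambda>x. f x * u x) absolutely_integrable_on {a..b}"
proof -
  have "u \<in> borel_measurable (lebesgue_on {a..b})"
    using assms(2) by (intro continuous_imp_measurable_on_sets_lebesgue) auto
  moreover have "bounded (u ` {a..b})"
    using assms(2) by (intro compact_imp_bounded compact_continuous_image) auto
  ultimately have "(\<lambda>x. u x * f x) absolutely_integrable_on {a..b}"
    using absolutely_integrable_bounded_measurable_product_real[of u "{a..b}" f] assms(1) by simp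
  then show ?thesis by (simp add: mult.commute)
qed

lemma integrable_mult_continuous:
  fixes f u :: "real \<Rightarrow> real"
  assumes "f absolutely_integrable_on {a..b}" "continuous_on {a..b} u"
  shows "(\<lambda>x. f x * u x) integrable_on {a..b}"
  using abs_integrable_mult_continuous[OF assms] set_lebesgue_integral_eq_integral(1) by blast

lemma integral_mult_bound:
  fixes f u :: "real \<Rightarrow> real"
  assumes "f absolutely_integrable_on {a..b}" "continuous_on {a..b} u" "\<And>x. x \<in> {a..b} \<Longrightarrow> \<bar>u x\<bar> \<le> M"
  shows "\<bar>integral {a..b} (\<lambda>x. f x * u x)\<bar> \<le> M * integral {a..b} (\<lambda>x. \<bar>f x\<bar>)"
proof -
  have ai: "(\<lambda>x. \<bar>f x\<bar>) integrable_on {a..b}"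
    using assms(1) unfolding absolutely_integrable_on_def by simp
  have "norm (integral {a..b} (\<lambda>x. f x * u x)) \<le> integral {a..b} (\<lambda>x. M * \<bar>f x\<bar>)"
  proof (rule integral_norm_bound_integral)
    show "(\<lambda>x. f x * u x) integrable_on {a..b}" by (rule integrable_mult_continuous[OF assms(1,2)])
    show "(\<lambda>x. M * \<bar>f x\<bar>) integrable_on {a..b}" using ai by (rule integrable_on_mult_right)
    fix x assume "x \<in> {a..b}"
    then have "\<bar>u x\<bar> * \<bar>f x\<bar> \<le> M * \<bar>f x\<bar>" by (intro mult_right_mono assms(3)) auto
    then show "norm (f x * u x) \<le> M * \<bar>f x\<bar>" by (simp add: abs_mult mult.commute)
  qed
  then show ?thesis by simp
qed

lemma integral_square_eq_0:
  fixes f :: "real \<Rightarrow> real"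
  assumes "continuous_on {-1..1} f" "integral {-1..1} (\<lambda>x. (f x)\<^sup>2) = 0" "x \<in> {-1..1}"
  shows "f x = 0"
proof -
  have "((\<lambda>x. (f x)\<^sup>2) has_integral 0) (cbox (-1) 1)"
    using assms(1,2) integrable_integral[of "\<lambda>x. (f x)\<^sup>2" "{-1..1}"]
    by (simp add: integrable_continuous_real continuous_on_power)
  then have "(f x)\<^sup>2 = 0"
    using assms(1,3) by (intro has_integral_0_cbox_imp_0[of "-1" 1 "\<lambda>x. (f x)\<^sup>2"]) (auto intro: continuous_on_power)
  then show ?thesis by simp
qed

lemma polynomial_function_poly:
  fixes g :: "real \<Rightarrow> real"
  assumes "real_polynomial_function g"
  shows "\<exists>p. g = poly p"
proof -
  obtain a n where g: "g = (\<lambda>x. \<Sum>i\<le>n. a i * x ^ i)"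
    using assms real_polynomial_function_iff_sum[of g] by blast
  have "g = poly (\<Sum>i\<le>n. Polynomial.monom (a i) i)" unfolding g by (simp add: poly_sum poly_monom fun_eq_iff)
  then show ?thesis by blast
qed

lemma weierstrass_poly:
  fixes f :: "real \<Rightarrow> real"
  assumes "continuous_on {-1..1} f" "e > 0"
  obtains p where "\<And>x. x \<in> {-1..1} \<Longrightarrow> \<bar>f x - poly p x\<bar> < e"
proof -
  obtain g where g: "real_polynomial_function g" "\<And>x. x \<in> {-1..1} \<Longrightarrow> \<bar>f x - g x\<bar> < e"
    using Stone_Weierstrass_real_polynomial_function[OF _ assms] by auto
  obtain p where "g = poly p" using polynomial_function_poly[OF g(1)] by blast
  with g(2) that show thesis by blast
qed

text \<open>By Weierstrass the integral of f^2 equals that of f (f - p) with a polynomial p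
  uniformly close to f, and so is arbitrarily small.\<close>

lemma orthogonal_to_polynomials_eq_0:
  fixes f :: "real \<Rightarrow> real"
  assumes cont: "continuous_on {-1..1} f" and orth: "\<And>p. integral {-1..1} (\<lambda>x. f x * poly p x) = 0"
    and x: "x \<in> {-1..1}"
  shows "f x = 0"
proof -
  have af: "f absolutely_integrable_on {-1..1}" by (rule absolutely_integrable_continuous_real[OF cont])
  define A where "A = integral {-1..1} (\<lambda>x. \<bar>f x\<bar>)"
  have A0: "A \<ge> 0" unfolding A_def
    by (intro integral_nonneg integrable_continuous_real continuous_intros cont) auto
  define I where "I = integral {-1..1} (\<lambda>x. (f x)\<^sup>2)"
  have "I \<le> e * A" if e: "e > 0" for e
  proof -
    obtain p where p: "\<And>x. x \<in> {-1..1} \<Longrightarrow> \<bar>f x - poly p x\<bar> < e"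
      using weierstrass_poly[OF cont e] by blast
    have "I = integral {-1..1} (\<lambda>x. f x * (f x - poly p x) + f x * poly p x)"
      by (simp add: I_def power2_eq_square algebra_simps)
    also have "\<dots> = integral {-1..1} (\<lambda>x. f x * (f x - poly p x)) + integral {-1..1} (\<lambda>x. f x * poly p x)"
      by (rule integral_add) (intro integrable_continuous_real continuous_intros cont)+
    also have "\<dots> = integral {-1..1} (\<lambda>x. f x * (f x - poly p x))" by (simp add: orth)
    also have "\<dots> \<le> e * A"
    proof -
      have "\<bar>integral {-1..1} (\<lambda>x. f x * (f x - poly p x))\<bar> \<le> e * A" unfolding A_def
      proof (rule integral_mult_bound[OF af])
        show "continuous_on {-1..1} (\<lambda>x. f x - poly p x)" by (intro continuous_intros cont)
        show "\<bar>f x - poly p x\<bar> \<le> e" if "x \<in> {-1..1}" for x using p[OF that] by simp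
      qed
      then show ?thesis by simp
    qed
    finally show ?thesis .
  qed
  note b = this
  have "I \<le> 0"
  proof (rule field_le_epsilon)
    fix e :: real assume e: "e > 0"
    have "I \<le> e / (A + 1) * A" using b[of "e / (A + 1)"] e A0 by simp
    also have "\<dots> \<le> e" using e A0 by (simp add: field_simps)
    finally show "I \<le> 0 + e" by simp
  qed
  moreover have "I \<ge> 0" unfolding I_def
    by (intro integral_nonneg integrable_continuous_real continuous_intros cont) auto
  ultimately show ?thesis using integral_square_eq_0[OF cont _ x] by (simp add: I_def)
qed

text \<open>The derivative is demanded only inside, because y'' = (q - \<lambda>) y may be unbounded
  at the endpoints.\<close>

lemma ftc_interior:
  fixes F f :: "real \<Rightarrow> real"
  assumes "a \<le> b" "continuous_on {a..b} F" "\<And>x. x \<in> {a<..<b} \<Longrightarrow> (F has_real_derivative f x) (at x)"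
  shows "(f has_integral (F b - F a)) {a..b}"
  using assms by (intro fundamental_theorem_of_calculus_interior)
    (auto simp: has_real_derivative_iff_has_vector_derivative)

lemma integral_has_derivative_interior:
  fixes f :: "real \<Rightarrow> real"
  assumes "f integrable_on {a..b}" "continuous_on {a<..<b} f" "x \<in> {a<..<b}"
  shows "((\<lambda>u. integral {a..u} f) has_real_derivative f x) (at x)"
proof -
  have "((\<lambda>u. integral {a..u} f) has_vector_derivative f x) (at x within {a..b} - {})"
  proof (rule integral_has_vector_derivative_continuous_at)
    show "f integrable_on {a..b}" by fact
    show "x \<in> {a..b} - {}" using assms(3) by auto
    have "isCont f x" using assms(2,3) by (simp add: continuous_on_eq_continuous_at)
    then show "continuous (at x within {a..b} - {}) f" by (simp add: continuous_at_imp_continuous_at_within)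
  qed auto
  then show ?thesis
    using assms(3) at_within_interior[of x "{a..b}"]
    by (simp add: has_real_derivative_iff_has_vector_derivative)
qed

section \<open>Uniqueness for the initial value problem\<close>

text \<open>A contraction argument with an integrable coefficient: as \<open>f\<close> may be
  unbounded near the endpoints, its integral takes the place of a pointwise bound.\<close>

lemma ivp_unique:
  fixes f z z' :: "real \<Rightarrow> real"
  assumes f: "f absolutely_integrable_on {-1..1}"
    and dz: "\<And>x. x \<in> {-1..1} \<Longrightarrow> (z has_real_derivative z' x) (at x within {-1..1})"
    and cz': "continuous_on {-1..1} z'"
    and dz': "\<And>x. x \<in> {-1<..<1} \<Longrightarrow> (z' has_real_derivative f x * z x) (at x)"
    and init: "z (-1) = 0" "z' (-1) = 0" and x: "x \<in> {-1..1}"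
  shows "z x = 0"
proof -
  have cz: "continuous_on {-1..1} z" using dz DERIV_continuous continuous_on_eq_continuous_within by blast
  define A where "A = integral {-1..1} (\<lambda>x. \<bar>f x\<bar>)"
  have ai: "(\<lambda>x. \<bar>f x\<bar>) integrable_on {-1..1}"
    using f unfolding absolutely_integrable_on_def by simp
  have A0: "A \<ge> 0" unfolding A_def by (intro integral_nonneg ai) auto
  text \<open>On a step of length \<open>d\<close> with \<open>d A < 1\<close> the maximum \<open>M\<close> of \<open>\<bar>z\<bar>\<close> satisfies \<open>M \<le> d A M\<close>.\<close>
  have step: "z t = 0 \<and> z' t = 0"
    if c: "-1 \<le> c" "c \<le> e" "e \<le> 1" "(e - c) * A < 1" "z c = 0" "z' c = 0" and t: "t \<in> {c..e}" for c e t
  proof -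
    have sub: "{c..e} \<subseteq> {-1..1}" using c by auto
    have cze: "continuous_on {c..e} z" using cz sub continuous_on_subset by blast
    have "\<exists>m\<in>{c..e}. \<forall>u\<in>{c..e}. \<bar>z u\<bar> \<le> \<bar>z m\<bar>"
      by (rule continuous_attains_sup) (use cze c(2) in \<open>auto intro: continuous_on_rabs\<close>)
    then obtain m where m: "m \<in> {c..e}" "\<And>u. u \<in> {c..e} \<Longrightarrow> \<bar>z u\<bar> \<le> \<bar>z m\<bar>" by blast
    define M where "M = \<bar>z m\<bar>"
    have z'b: "\<bar>z' u\<bar> \<le> M * A" if u: "u \<in> {c..e}" for u
    proof -
      have su: "{c..u} \<subseteq> {-1..1}" using u c by auto
      have "((\<lambda>x. f x * z x) has_integral (z' u - z' c)) {c..u}"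
      proof (rule ftc_interior)
        show "c \<le> u" using u by simp
        show "continuous_on {c..u} z'" using cz' su continuous_on_subset by blast
        fix x assume "x \<in> {c<..<u}"
        then show "(z' has_real_derivative f x * z x) (at x)" using dz' u c by auto
      qed
      then have "z' u = integral {c..u} (\<lambda>x. f x * z x)" using c(6) by (simp add: integral_unique)
      moreover have fu: "f absolutely_integrable_on {c..u}"
        by (rule set_integrable_subset[OF f _ su]) simp
      have "\<bar>integral {c..u} (\<lambda>x. f x * z x)\<bar> \<le> M * integral {c..u} (\<lambda>x. \<bar>f x\<bar>)"
        using m(2) u by (intro integral_mult_bound[OF fu] continuous_on_subset[OF cz su]) (auto simp: M_def)
      moreover have "integral {c..u} (\<lambda>x. \<bar>f x\<bar>) \<le> A" unfolding A_def
        by (intro integral_subset_le su ai integrable_on_subinterval[OF ai su]) auto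
      ultimately show ?thesis using mult_left_mono[of "integral {c..u} (\<lambda>x. \<bar>f x\<bar>)" A M]
        by (simp add: M_def)
    qed
    have zb: "\<bar>z u\<bar> \<le> (e - c) * (M * A)" if u: "u \<in> {c..e}" for u
    proof -
      have su: "{c..u} \<subseteq> {-1..1}" using u c by auto
      have "(z' has_integral (z u - z c)) {c..u}"
        using u su by (intro fundamental_theorem_of_calculus)
          (auto simp: has_real_derivative_iff_has_vector_derivative[symmetric] intro!: DERIV_subset[OF dz su])
      then have "z u = integral {c..u} z'" using c(5) by (simp add: integral_unique)
      moreover have "norm (integral {c..u} z') \<le> (M * A) * (u - c)"
        using u z'b by (intro integral_bound continuous_on_subset[OF cz' su]) auto
      moreover have "(M * A) * (u - c) \<le> (M * A) * (e - c)"
        using u A0 by (intro mult_left_mono) (auto simp: M_def)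
      ultimately show ?thesis by (simp add: mult.commute)
    qed
    have "M \<le> ((e - c) * A) * M" using zb[OF m(1)] by (simp add: M_def mult_ac)
    then have "M = 0"
      using c(4) M_def by (smt (verit) abs_ge_zero mult_le_cancel_right1)
    then have "z t = 0" using m(2)[OF t] by (simp add: M_def)
    moreover have "z' t = 0" using z'b[OF t] \<open>M = 0\<close> by simp
    ultimately show ?thesis by simp
  qed
  \<comment> \<open>The \<open>n\<close> steps of length 2 / n cover the interval, and n > 2 A makes
    each of them short enough for \<open>step\<close>.\<close>
  obtain n :: nat where n: "2 * A < real n" "n > 0" by (metis reals_Archimedean2 gr0I of_nat_0 le_less_trans mult_nonneg_nonneg A0 zero_le_numeral not_less)
  have "\<forall>t\<in>{-1..-1 + 2 * real i / real n}. z t = 0 \<and> z' t = 0" if "i \<le> n" for i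
    using that
  proof (induction i)
    case 0
    then show ?case using init by auto
  next
    case (Suc i)
    let ?c = "-1 + 2 * real i / real n" and ?e = "-1 + 2 * real (Suc i) / real n"
    have ce: "-1 \<le> ?c" "?c \<le> ?e" using n by (auto simp: field_simps)
    have e1: "?e \<le> 1" using n Suc.prems by (simp add: field_simps)
    have d: "(?e - ?c) * A < 1" using n by (simp add: field_simps)
    have IH: "\<forall>t\<in>{-1..?c}. z t = 0 \<and> z' t = 0" using Suc by simp
    then have "z ?c = 0" "z' ?c = 0" using ce by auto
    from step[OF ce e1 d this] IH show ?case by (metis atLeastAtMost_iff linear)
  qed
  from this[of n] show ?thesis using n x by simp
qed

section \<open>From symmetric bilinear forms to matrices and eigenvalues of given index\<close>

notation Matrix.vec_index (infixl "$v" 100)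

abbreviation mat_of :: "nat \<Rightarrow> (nat \<Rightarrow> nat \<Rightarrow> real) \<Rightarrow> real Matrix.mat" where
  "mat_of N M \<equiv> Matrix.mat N N (\<lambda>(i, j). M i j)"

lemma bilin_pencil_vector:
  assumes sym: "\<And>i j. i < N \<Longrightarrow> j < N \<Longrightarrow> M i j = M j i"
  shows "bilin N M c d = (\<Sum>i<N. (\<Sum>j<N. M i j * c j) * d i)"
proof -
  have "bilin N M c d = bilin N M d c" by (rule bilin_commute[OF sym])
  then show ?thesis by (simp add: bilin_def sum_distrib_left sum_distrib_right mult_ac)
qed

lemma mat_of_mult_vec:
  assumes "v \<in> carrier_vec N" "i < N"
  shows "(mat_of N M *\<^sub>v v) $v i = (\<Sum>j<N. M i j * (v $v j))"
  using assms by (simp add: scalar_prod_def lessThan_atLeast0)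

lemma pencil_zero_iff:
  assumes symM: "\<And>i j. i < N \<Longrightarrow> j < N \<Longrightarrow> M i j = M j i"
    and symB: "\<And>i j. i < N \<Longrightarrow> j < N \<Longrightarrow> B i j = B j i"
  shows "(\<forall>i<N. (\<Sum>j<N. M i j * c j) = \<mu> * (\<Sum>j<N. B i j * c j)) \<longleftrightarrow>
         (\<forall>d. bilin N M c d = \<mu> * bilin N B c d)"
proof
  assume h: "\<forall>i<N. (\<Sum>j<N. M i j * c j) = \<mu> * (\<Sum>j<N. B i j * c j)"
  show "\<forall>d. bilin N M c d = \<mu> * bilin N B c d"
  proof
    fix d
    have "bilin N M c d = (\<Sum>i<N. (\<Sum>j<N. M i j * c j) * d i)"
      by (rule bilin_pencil_vector) (rule symM)
    also have "\<dots> = (\<Sum>i<N. (\<mu> * (\<Sum>j<N. B i j * c j)) * d i)"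
      by (intro sum.cong refl) (use h in auto)
    also have "\<dots> = \<mu> * (\<Sum>i<N. (\<Sum>j<N. B i j * c j) * d i)"
      unfolding mult.assoc by (rule sum_distrib_left[symmetric])
    also have "(\<Sum>i<N. (\<Sum>j<N. B i j * c j) * d i) = bilin N B c d"
      by (rule bilin_pencil_vector[symmetric]) (rule symB)
    finally show "bilin N M c d = \<mu> * bilin N B c d" .
  qed
next
  assume h: "\<forall>d. bilin N M c d = \<mu> * bilin N B c d"
  show "\<forall>i<N. (\<Sum>j<N. M i j * c j) = \<mu> * (\<Sum>j<N. B i j * c j)"
  proof (intro allI impI)
    fix i assume "i < N"
    have e: "bilin N K c (\<lambda>j. if j = i then 1 else 0) = (\<Sum>j<N. K i j * c j)"
      if "\<And>i j. i < N \<Longrightarrow> j < N \<Longrightarrow> K i j = K j i" for K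
    proof -
      have "bilin N K c (\<lambda>j. if j = i then 1 else 0) = (\<Sum>k<N. if k = i then (\<Sum>j<N. K i j * c j) else 0)"
      proof -
        have "bilin N K c (\<lambda>j. if j = i then 1 else 0) = (\<Sum>k<N. (\<Sum>j<N. K k j * c j) * (if k = i then 1 else 0))"
          by (rule bilin_pencil_vector) (rule that)
        also have "\<dots> = (\<Sum>k<N. if k = i then (\<Sum>j<N. K i j * c j) else 0)" by (intro sum.cong) auto
        finally show ?thesis .
      qed
      then show ?thesis using \<open>i < N\<close> by simp
    qed
    have "bilin N M c (\<lambda>j. if j = i then 1 else 0) = (\<Sum>j<N. M i j * c j)"
      by (rule e) (rule symM)
    moreover have "bilin N B c (\<lambda>j. if j = i then 1 else 0) = (\<Sum>j<N. B i j * c j)"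
      by (rule e) (rule symB)
    ultimately show "(\<Sum>j<N. M i j * c j) = \<mu> * (\<Sum>j<N. B i j * c j)"
      using h by metis
  qed
qed

text \<open>Functionals \<open>e i\<close> dual to the vectors \<open>w i\<close> give injectivity
  and independence, explicit coefficients give spanning. \<open>I\<close> is any finite set because
  the eigenvectors for one eigenvalue are picked out of a longer list.\<close>

lemma kernel_dim_eqI:
  fixes A :: "real Matrix.mat"
  assumes A: "A \<in> carrier_mat N N" and "finite I"
    and ker: "\<And>i. i \<in> I \<Longrightarrow> w i \<in> mat_kernel A"
    and coord: "\<And>i j. i \<in> I \<Longrightarrow> j \<in> I \<Longrightarrow> (\<Sum>m<N. (w j $v m) * e i m) = (if i = j then 1 else 0)"
    and span: "\<And>v m. v \<in> mat_kernel A \<Longrightarrow> m < N \<Longrightarrow> v $v m = (\<Sum>i\<in>I. a v i * (w i $v m))"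
  shows "kernel_dim A = card I"
proof -
  interpret K: kernel N N A by unfold_locales (rule A)
  have inj: "inj_on w I"
  proof
    fix i j assume "i \<in> I" "j \<in> I" "w i = w j"
    then show "i = j" using coord[of i i] coord[of i j] by (metis zero_neq_one)
  qed
  have carr: "w i \<in> carrier_vec N" if "i \<in> I" for i
    using mat_kernelD(1)[OF A ker[OF that]] .
  have sub: "w ` I \<subseteq> mat_kernel A" using ker by auto
  have lc: "K.lincomb b (w ` I) $v m = (\<Sum>i\<in>I. b (w i) * (w i $v m))" if "m < N" for b m
    by (subst K.lincomb_index[OF that sub]) (simp add: sum.reindex[OF inj])
  have fin: "finite (w ` I)" using assms(2) by simp
  have gen: "K.span (w ` I) = mat_kernel A"
    proof (rule equalityI)
      show "K.span (w ` I) \<subseteq> mat_kernel A" using K.Ker.span_is_subset2[OF sub] by simp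
      show "mat_kernel A \<subseteq> K.span (w ` I)"
      proof
        fix v assume v: "v \<in> mat_kernel A"
        define b where "b = (\<lambda>x. a v (inv_into I w x))"
        have lcc: "K.lincomb b (w ` I) \<in> mat_kernel A"
          using K.Ker.lincomb_closed[OF sub, of b] by (simp add: class_ring_simps)
        have "v = K.lincomb b (w ` I)"
        proof (rule eq_vecI)
          show "dim_vec v = dim_vec (K.lincomb b (w ` I))"
            using mat_kernelD(1)[OF A v] mat_kernelD(1)[OF A lcc] by simp
          fix m assume "m < dim_vec (K.lincomb b (w ` I))"
          then have m: "m < N" using mat_kernelD(1)[OF A lcc] by simp
          show "v $v m = K.lincomb b (w ` I) $v m"
            unfolding lc[OF m] span[OF v m] by (intro sum.cong) (auto simp: b_def inv_into_f_f[OF inj])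
        qed
        then show "v \<in> K.span (w ` I)" unfolding K.Ker.span_def using fin by blast
      qed
    qed
  have indpt: "\<not> K.lin_dep (w ` I)"
  proof -
    {
      fix b :: "real vec \<Rightarrow> real" and v
      assume z: "K.lincomb b (w ` I) = 0\<^sub>v N" and "v \<in> w ` I"
      then obtain i where i: "i \<in> I" "v = w i" by auto
      have "0 = (\<Sum>m<N. (K.lincomb b (w ` I) $v m) * e i m)" unfolding z by simp
      also have "\<dots> = (\<Sum>m<N. \<Sum>j\<in>I. b (w j) * ((w j $v m) * e i m))"
        by (intro sum.cong refl) (simp add: lc sum_distrib_right mult.assoc)
      also have "\<dots> = (\<Sum>j\<in>I. b (w j) * (\<Sum>m<N. (w j $v m) * e i m))"
        by (subst sum.swap) (simp add: sum_distrib_left)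
      also have "\<dots> = (\<Sum>j\<in>I. if j = i then b (w j) else 0)"
        by (intro sum.cong) (auto simp: coord i)
      also have "\<dots> = b v" using i assms(2) by simp
      finally have "b v = 0" by simp
    }
    then show ?thesis
      by (intro K.Ker.finite_lin_indpt2[OF fin sub], auto simp: class_field_def)
  qed
  have "K.basis (w ` I)" unfolding K.Ker.basis_def using gen indpt sub by simp
  from K.Ker.dim_basis[OF fin this] show ?thesis by (simp add: card_image[OF inj])
qed

text \<open>The kernel dimension counts the \<open>i\<close> with \<open>\<nu> i = \<mu>\<close>, so
  the cumulated sum counts those with \<open>\<nu> i \<le> \<mu>\<close>; by monotonicity this count
  first reaches \<open>k\<close> at \<open>\<nu> (k - 1)\<close>. Eigenvalue indices start at 1, the
  arguments of \<open>\<nu>\<close> at 0.\<close>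

lemma generalized_eigenvalue_of_index_eq:
  fixes M B :: "nat \<Rightarrow> nat \<Rightarrow> real"
  assumes symM: "\<And>i j. i < N \<Longrightarrow> j < N \<Longrightarrow> M i j = M j i"
    and symB: "\<And>i j. i < N \<Longrightarrow> j < N \<Longrightarrow> B i j = B j i"
    and pos: "\<And>c. (\<exists>j<N. c j \<noteq> 0) \<Longrightarrow> bilin N B c c > 0"
    and orth: "\<And>i j. i < N \<Longrightarrow> j < N \<Longrightarrow> bilin N B (u i) (u j) = (if i = j then 1 else 0)"
    and eig: "\<And>i z. i < N \<Longrightarrow> bilin N M (u i) z = \<nu> i * bilin N B (u i) z"
    and mono: "\<And>i j. i \<le> j \<Longrightarrow> j < N \<Longrightarrow> \<nu> i \<le> \<nu> j"
    and k: "1 \<le> k" "k \<le> N"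
  shows "generalized_eigenvalue_of_index (mat_of N M) (mat_of N B) k = \<nu> (k - 1)"
proof -
  have expand: "z m = (\<Sum>i<N. bilin N B z (u i) * u i m)" if "m < N" for z m
    by (rule pencil_expansion[OF pos orth that])
  have eq_iff: "mat_of N M *\<^sub>v v = \<mu> \<cdot>\<^sub>v (mat_of N B *\<^sub>v v) \<longleftrightarrow>
      (\<forall>d. bilin N M (\<lambda>j. v $v j) d = \<mu> * bilin N B (\<lambda>j. v $v j) d)" if v: "v \<in> carrier_vec N" for v \<mu>
  proof -
    have "mat_of N M *\<^sub>v v = \<mu> \<cdot>\<^sub>v (mat_of N B *\<^sub>v v) \<longleftrightarrow>
        (\<forall>i<N. (\<Sum>j<N. M i j * (v $v j)) = \<mu> * (\<Sum>j<N. B i j * (v $v j)))"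
    proof -
      have "mat_of N M *\<^sub>v v = \<mu> \<cdot>\<^sub>v (mat_of N B *\<^sub>v v) \<longleftrightarrow>
        (\<forall>i<N. (mat_of N M *\<^sub>v v) $v i = (\<mu> \<cdot>\<^sub>v (mat_of N B *\<^sub>v v)) $v i)"
      proof
        assume h: "\<forall>i<N. (mat_of N M *\<^sub>v v) $v i = (\<mu> \<cdot>\<^sub>v (mat_of N B *\<^sub>v v)) $v i"
        show "mat_of N M *\<^sub>v v = \<mu> \<cdot>\<^sub>v (mat_of N B *\<^sub>v v)"
        proof (rule eq_vecI)
          show "dim_vec (mat_of N M *\<^sub>v v) = dim_vec (\<mu> \<cdot>\<^sub>v (mat_of N B *\<^sub>v v))" by simp
          fix i assume "i < dim_vec (\<mu> \<cdot>\<^sub>v (mat_of N B *\<^sub>v v))"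
          then have "i < N" by simp
          with h show "(mat_of N M *\<^sub>v v) $v i = (\<mu> \<cdot>\<^sub>v (mat_of N B *\<^sub>v v)) $v i" by blast
        qed
      qed simp
      then show ?thesis using mat_of_mult_vec[OF v] by simp
    qed
    also have "\<dots> \<longleftrightarrow> (\<forall>d. bilin N M (\<lambda>j. v $v j) d = \<mu> * bilin N B (\<lambda>j. v $v j) d)"
      by (rule pencil_zero_iff[OF symM symB])
    finally show ?thesis .
  qed
  have coeff0: "bilin N B z (u i) = 0"
    if z: "\<forall>d. bilin N M z d = \<mu> * bilin N B z d" and i: "i < N" "\<nu> i \<noteq> \<mu>" for z \<mu> i
  proof -
    have "\<mu> * bilin N B z (u i) = \<nu> i * bilin N B z (u i)"
      using z eig[OF i(1), of z] by (simp add: bilin_commute[OF symM, where c="u i" and d=z] bilin_commute[OF symB, where c="u i" and d=z])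
    then show ?thesis using i(2) by simp
  qed
  have vec_u: "Matrix.vec N (u i) \<in> carrier_vec N" for i by simp
  have bvec: "bilin N K (\<lambda>j. Matrix.vec N c $v j) d = bilin N K c d" for K c d
    by (rule bilin_cong) auto
  have ge: "generalized_eigenvalue (mat_of N M) (mat_of N B) \<mu> \<longleftrightarrow> (\<exists>i<N. \<nu> i = \<mu>)" for \<mu>
  proof
    assume "generalized_eigenvalue (mat_of N M) (mat_of N B) \<mu>"
    then obtain v where v: "v \<in> carrier_vec N" "v \<noteq> 0\<^sub>v N" "mat_of N M *\<^sub>v v = \<mu> \<cdot>\<^sub>v (mat_of N B *\<^sub>v v)"
      unfolding generalized_eigenvalue_def by auto
    show "\<exists>i<N. \<nu> i = \<mu>"
    proof (rule ccontr)
      assume "\<not> ?thesis"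
      then have "bilin N B (\<lambda>j. v $v j) (u i) = 0" if "i < N" for i
        using coeff0[OF _ that] eq_iff[OF v(1)] v(3) that by blast
      then have "v $v m = 0" if "m < N" for m using expand[OF that, of "\<lambda>j. v $v j"] by simp
      then have "v = 0\<^sub>v N" using v(1) by (intro eq_vecI) auto
      with v(2) show False by simp
    qed
  next
    assume "\<exists>i<N. \<nu> i = \<mu>"
    then obtain i where i: "i < N" "\<nu> i = \<mu>" by blast
    have "Matrix.vec N (u i) \<noteq> 0\<^sub>v N"
    proof
      assume "Matrix.vec N (u i) = 0\<^sub>v N"
      then have "bilin N B (\<lambda>j. Matrix.vec N (u i) $v j) (u i) = 0" by (simp add: bilin_def)
      then show False using orth[OF i(1) i(1)] by (simp add: bvec)
    qed
    moreover have "mat_of N M *\<^sub>v Matrix.vec N (u i) = \<mu> \<cdot>\<^sub>v (mat_of N B *\<^sub>v Matrix.vec N (u i))"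
      unfolding eq_iff[OF vec_u] bvec using eig[OF i(1)] i(2) by simp
    ultimately show "generalized_eigenvalue (mat_of N M) (mat_of N B) \<mu>"
      unfolding generalized_eigenvalue_def by auto
  qed
  have kd: "kernel_dim (mat_of N M - \<mu> \<cdot>\<^sub>m mat_of N B) = card {i. i < N \<and> \<nu> i = \<mu>}" for \<mu>
  proof (rule kernel_dim_eqI)
    let ?A = "mat_of N M - \<mu> \<cdot>\<^sub>m mat_of N B"
    let ?I = "{i. i < N \<and> \<nu> i = \<mu>}"
    show A: "?A \<in> carrier_mat N N" by (simp add: minus_mat_def)
    show "finite ?I" by simp
    have ker_iff: "v \<in> mat_kernel ?A \<longleftrightarrow> v \<in> carrier_vec N \<and>
       (\<forall>d. bilin N M (\<lambda>j. v $v j) d = \<mu> * bilin N B (\<lambda>j. v $v j) d)" for v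
    proof -
      have "?A *\<^sub>v v = 0\<^sub>v N \<longleftrightarrow> (\<forall>i<N. (\<Sum>j<N. M i j * (v $v j)) = \<mu> * (\<Sum>j<N. B i j * (v $v j)))"
        if v: "v \<in> carrier_vec N"
      proof -
        have "(?A *\<^sub>v v) $v i = (\<Sum>j<N. M i j * (v $v j)) - \<mu> * (\<Sum>j<N. B i j * (v $v j))" if "i < N" for i
          using v that by (simp add: scalar_prod_def lessThan_atLeast0 algebra_simps sum_subtractf sum_distrib_left)
        moreover have "dim_vec (?A *\<^sub>v v) = N" by simp
        ultimately show ?thesis by (auto simp: vec_eq_iff)
      qed
      then show ?thesis
        unfolding mat_kernel[OF A] using pencil_zero_iff[OF symM symB] by auto
    qed
    fix i assume i: "i \<in> ?I"
    show "Matrix.vec N (u i) \<in> mat_kernel ?A"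
      unfolding ker_iff bvec using eig i by auto
    fix j assume j: "j \<in> ?I"
    \<comment> \<open>The dual functionals are \<open>B\<close> applied to the eigenvectors; duality
      is their \<open>B\<close>-orthonormality.\<close>
    show "(\<Sum>m<N. (Matrix.vec N (u j) $v m) * (\<Sum>n<N. B m n * u i n)) = (if i = j then 1 else 0)"
    proof -
      have "(\<Sum>m<N. (Matrix.vec N (u j) $v m) * (\<Sum>n<N. B m n * u i n)) = bilin N B (u j) (u i)"
        unfolding bilin_def by (intro sum.cong) (auto simp: sum_distrib_left mult_ac)
      then show ?thesis using orth i j by auto
    qed
  next
    fix v m assume v: "v \<in> mat_kernel (mat_of N M - \<mu> \<cdot>\<^sub>m mat_of N B)" and m: "m < N"
    have A: "mat_of N M - \<mu> \<cdot>\<^sub>m mat_of N B \<in> carrier_mat N N" by (simp add: minus_mat_def)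
    have "mat_of N M *\<^sub>v v = \<mu> \<cdot>\<^sub>v (mat_of N B *\<^sub>v v)"
    proof -
      have vc: "v \<in> carrier_vec N" and z: "(mat_of N M - \<mu> \<cdot>\<^sub>m mat_of N B) *\<^sub>v v = 0\<^sub>v N"
        using mat_kernelD[OF A v] by auto
      have "(mat_of N M *\<^sub>v v) $v i = (\<mu> \<cdot>\<^sub>v (mat_of N B *\<^sub>v v)) $v i" if "i < N" for i
      proof -
        have "((mat_of N M - \<mu> \<cdot>\<^sub>m mat_of N B) *\<^sub>v v) $v i = (\<Sum>j<N. M i j * (v $v j)) - \<mu> * (\<Sum>j<N. B i j * (v $v j))"
          using vc that by (simp add: scalar_prod_def lessThan_atLeast0 algebra_simps sum_subtractf sum_distrib_left)
        then show ?thesis using z that mat_of_mult_vec[OF vc that, of M] mat_of_mult_vec[OF vc that, of B] by simp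
      qed
      then show ?thesis by (intro eq_vecI) auto
    qed
    then have z: "\<forall>d. bilin N M (\<lambda>j. v $v j) d = \<mu> * bilin N B (\<lambda>j. v $v j) d"
      using eq_iff mat_kernelD(1)[OF A v] by blast
    have "v $v m = (\<Sum>i<N. bilin N B (\<lambda>j. v $v j) (u i) * u i m)" by (rule expand[OF m])
    also have "\<dots> = (\<Sum>i\<in>{i. i < N \<and> \<nu> i = \<mu>}. bilin N B (\<lambda>j. v $v j) (u i) * u i m)"
      using coeff0[OF z] by (intro sum.mono_neutral_right) auto
    also have "\<dots> = (\<Sum>i\<in>{i. i < N \<and> \<nu> i = \<mu>}. bilin N B (\<lambda>j. v $v j) (u i) * (Matrix.vec N (u i) $v m))"
      using m by simp
    finally show "v $v m = (\<Sum>i\<in>{i. i < N \<and> \<nu> i = \<mu>}. bilin N B (\<lambda>j. v $v j) (u i) * (Matrix.vec N (u i) $v m))" .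
  qed
  have sumk: "(\<Sum>\<kappa> | generalized_eigenvalue (mat_of N M) (mat_of N B) \<kappa> \<and> \<kappa> \<le> \<mu>.
      kernel_dim (mat_of N M - \<kappa> \<cdot>\<^sub>m mat_of N B)) = card {i. i < N \<and> \<nu> i \<le> \<mu>}" for \<mu>
  proof -
    have set: "{\<kappa>. generalized_eigenvalue (mat_of N M) (mat_of N B) \<kappa> \<and> \<kappa> \<le> \<mu>} = \<nu> ` {i. i < N \<and> \<nu> i \<le> \<mu>}"
      unfolding ge by auto
    have "card {i. i < N \<and> \<nu> i \<le> \<mu>} = (\<Sum>i\<in>{i. i < N \<and> \<nu> i \<le> \<mu>}. 1)" by simp
    also have "\<dots> = (\<Sum>\<kappa>\<in>\<nu> ` {i. i < N \<and> \<nu> i \<le> \<mu>}. \<Sum>i\<in>{i \<in> {i. i < N \<and> \<nu> i \<le> \<mu>}. \<nu> i = \<kappa>}. 1)"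
      by (rule sum.group[symmetric]) auto
    also have "\<dots> = (\<Sum>\<kappa>\<in>\<nu> ` {i. i < N \<and> \<nu> i \<le> \<mu>}. card {i. i < N \<and> \<nu> i = \<kappa>})"
    proof (rule sum.cong[OF refl])
      fix \<kappa> assume "\<kappa> \<in> \<nu> ` {i. i < N \<and> \<nu> i \<le> \<mu>}"
      then have "{i \<in> {i. i < N \<and> \<nu> i \<le> \<mu>}. \<nu> i = \<kappa>} = {i. i < N \<and> \<nu> i = \<kappa>}" by auto
      then show "(\<Sum>i\<in>{i \<in> {i. i < N \<and> \<nu> i \<le> \<mu>}. \<nu> i = \<kappa>}. 1) = card {i. i < N \<and> \<nu> i = \<kappa>}" by simp
    qed
    finally show ?thesis unfolding set kd by simp
  qed
  have fin: "finite {\<mu>. generalized_eigenvalue (mat_of N M) (mat_of N B) \<mu> \<and> P \<mu>}" for P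
  proof (rule finite_subset)
    show "{\<mu>. generalized_eigenvalue (mat_of N M) (mat_of N B) \<mu> \<and> P \<mu>} \<subseteq> \<nu> ` {..<N}"
      unfolding ge by auto
  qed simp
  show ?thesis unfolding generalized_eigenvalue_of_index_def sumk
  proof (rule Min_eqI)
    show "finite {\<mu>. generalized_eigenvalue (mat_of N M) (mat_of N B) \<mu> \<and> k \<le> card {i. i < N \<and> \<nu> i \<le> \<mu>}}"
      by (rule fin)
    have "{..<k} \<subseteq> {i. i < N \<and> \<nu> i \<le> \<nu> (k - 1)}" using mono[of _ "k - 1"] k by auto
    then have "card {..<k} \<le> card {i. i < N \<and> \<nu> i \<le> \<nu> (k - 1)}" by (intro card_mono) auto
    then show "\<nu> (k - 1) \<in> {\<mu>. generalized_eigenvalue (mat_of N M) (mat_of N B) \<mu> \<and> k \<le> card {i. i < N \<and> \<nu> i \<le> \<mu>}}"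
      using k unfolding ge by (auto intro!: exI[of _ "k - 1"])
    fix \<mu> assume "\<mu> \<in> {\<mu>. generalized_eigenvalue (mat_of N M) (mat_of N B) \<mu> \<and> k \<le> card {i. i < N \<and> \<nu> i \<le> \<mu>}}"
    then have c: "k \<le> card {i. i < N \<and> \<nu> i \<le> \<mu>}" by simp
    show "\<nu> (k - 1) \<le> \<mu>"
    proof (rule ccontr)
      assume "\<not> ?thesis"
      then have "{i. i < N \<and> \<nu> i \<le> \<mu>} \<subseteq> {..<k - 1}"
        using mono[of "k - 1"] by (auto simp: not_le) (meson leI le_less_trans not_le order_trans)
      then have "card {i. i < N \<and> \<nu> i \<le> \<mu>} \<le> card {..<k - 1}" by (intro card_mono) auto
      with c k show False by simp
    qed
  qed
qed

section \<open>Decay of Legendre coefficients\<close>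

lemma wreg_continuous_on: "wreg I s (Suc m) f \<Longrightarrow> continuous_on I f"
  by (metis wreg_SucE DERIV_isCont continuous_at_imp_continuous_on)

text \<open>At every point one of 1 - x and 1 + x is at least 1, so its power with negative
  \<open>s\<close> is at most 1 and the other power can be integrated explicitly. For s < -1 the
  cutoff \<open>h\<close> decides the size.\<close>

lemma integral_weight_le:
  fixes s h :: real
  assumes s: "s < -1" and h: "0 < h" "h < 1"
  shows "integral {-1+h..1-h} (\<lambda>x. (1 - x\<^sup>2) powr s) \<le> 2 / (- s - 1) * h powr (s + 1)"
proof -
  define c where "c = 1 / (s + 1)"
  have c: "c * (s + 1) = 1" "2 / (- s - 1) = - 2 * c" using s by (auto simp: c_def field_simps)
  define F where "F = (\<lambda>x::real. c * ((1 + x) powr (s + 1) - (1 - x) powr (s + 1)))"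
  have ab: "-1 + h \<le> 1 - h" using h by simp
  have F': "(F has_real_derivative ((1 + x) powr s + (1 - x) powr s)) (at x within {-1+h..1-h})"
    if "x \<in> {-1+h..1-h}" for x
  proof -
    have "(F has_real_derivative (c * ((s + 1) * (1 + x) powr s + (s + 1) * (1 - x) powr s))) (at x within {-1+h..1-h})"
      unfolding F_def using that h by (auto intro!: derivative_eq_intros)
    moreover have "c * ((s + 1) * A + (s + 1) * B) = c * (s + 1) * (A + B)" for A B by (simp add: algebra_simps)
    ultimately show ?thesis unfolding c(1) by simp
  qed
  have I: "((\<lambda>x. (1 + x) powr s + (1 - x) powr s) has_integral (F (1 - h) - F (-1 + h))) {-1+h..1-h}"
    by (rule fundamental_theorem_of_calculus[OF ab])
       (use F' in \<open>auto simp: has_real_derivative_iff_has_vector_derivative[symmetric]\<close>)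
  have cont: "continuous_on {-1+h..1-h} (\<lambda>x. (1 - x\<^sup>2) powr s)"
  proof -
    have "1 - x\<^sup>2 \<noteq> 0" if "x \<in> {-1+h..1-h}" for x
    proof -
      have "x \<in> {-1<..<1}" using that h by auto
      from square_less_1[OF this] show ?thesis by simp
    qed
    then show ?thesis by (intro continuous_intros) auto
  qed
  have "integral {-1+h..1-h} (\<lambda>x. (1 - x\<^sup>2) powr s) \<le> integral {-1+h..1-h} (\<lambda>x. (1 + x) powr s + (1 - x) powr s)"
  proof (rule integral_le)
    show "(\<lambda>x. (1 - x\<^sup>2) powr s) integrable_on {-1+h..1-h}"
      by (rule integrable_continuous_real[OF cont])
    show "(\<lambda>x. (1 + x) powr s + (1 - x) powr s) integrable_on {-1+h..1-h}" using I by blast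
    fix x assume x: "x \<in> {-1+h..1-h}"
    have "(1 - x\<^sup>2) powr s = (1 + x) powr s * (1 - x) powr s"
      using x h by (simp flip: powr_mult add: power2_eq_square algebra_simps)
    moreover have "(1 + x) powr s * (1 - x) powr s \<le> (1 + x) powr s + (1 - x) powr s"
    proof (cases "x \<le> 0")
      case True
      have "(1 - x) powr s \<le> 1" using True s powr_mono2'[of s 1 "1 - x"] by simp
      then have "(1 + x) powr s * (1 - x) powr s \<le> (1 + x) powr s" by (intro mult_left_le) auto
      then show ?thesis by (simp add: add_increasing2)
    next
      case False
      have "(1 + x) powr s \<le> 1" using False s powr_mono2'[of s 1 "1 + x"] by simp
      then have "(1 + x) powr s * (1 - x) powr s \<le> (1 - x) powr s" by (intro mult_left_le_one_le) auto
      then show ?thesis by (simp add: add_increasing)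
    qed
    ultimately show "(1 - x\<^sup>2) powr s \<le> (1 + x) powr s + (1 - x) powr s" by simp
  qed
  also have "\<dots> = F (1 - h) - F (-1 + h)" using I by (rule integral_unique)
  also have "\<dots> = 2 / (- s - 1) * (h powr (s + 1) - (2 - h) powr (s + 1))"
    unfolding c(2) by (simp add: F_def algebra_simps)
  also have "\<dots> \<le> 2 / (- s - 1) * h powr (s + 1)"
    using s by (intro mult_left_mono) auto
  finally show ?thesis .
qed

definition legendre_step :: "nat \<Rightarrow> real" where
  "legendre_step n = 1 / (real n * (real n + 1))"

lemma legendre_step_bounds:
  assumes "n \<ge> 2"
  shows "0 < legendre_step n" "legendre_step n \<le> 1/6" "legendre_step n * (real n * (real n + 1)) = 1"
proof -
  have n: "real n \<ge> 2" using assms by simp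
  have "2 * 3 \<le> real n * (real n + 1)" using n by (intro mult_mono) auto
  then show "0 < legendre_step n" "legendre_step n \<le> 1/6" "legendre_step n * (real n * (real n + 1)) = 1"
    by (auto simp: legendre_step_def field_simps)
qed

text \<open>
  The cutoff distance from the endpoints is \<open>h = 1/(n(n+1))\<close>, the reciprocal of the eigenvalue of
  the Legendre operator. Each integration by parts against that operator gains a factor \<open>h\<close> and
  loses one power of the weight; the boundary terms are of the right size \<open>h\<^sup>s\<^sup>+\<^sup>1\<close> every time.
\<close>

lemma legendre_coefficient_cut:
  "wreg {-1<..<1} s (Suc (2 * k)) f \<Longrightarrow> s + 1 < real k \<Longrightarrow>
   \<exists>C. \<forall>n\<ge>2. \<bar>integral {-1 + legendre_step n..1 - legendre_step n} (\<lambda>x. f x * poly (legendre_poly n) x)\<bar>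
      \<le> C * legendre_step n powr (s + 1)"
proof (induction k arbitrary: s f)
  case 0
  \<comment> \<open>Here the weight is no longer integrable up to the endpoints, and the crude bound
    of |f P| over the cut interval already has the right order in \<open>h\<close>.\<close>
  then have s: "s < -1" by simp
  obtain C where C: "C > 0" "\<And>x. x \<in> {-1<..<1} \<Longrightarrow> \<bar>f x\<bar> \<le> C * (1 - x\<^sup>2) powr s"
    using wreg_bounded_pos[OF "0.prems"(1)] by blast
  have cf: "continuous_on {-1<..<1} f" using wreg_continuous_on 0 by blast
  have "\<bar>integral {-1 + legendre_step n..1 - legendre_step n} (\<lambda>x. f x * poly (legendre_poly n) x)\<bar>
      \<le> (C * (2 / (- s - 1))) * legendre_step n powr (s + 1)" if n: "n \<ge> 2" for n
  proof -
    define h where "h = legendre_step n"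
    have h: "0 < h" "h < 1" using legendre_step_bounds[OF n] by (auto simp: h_def)
    have sub: "{-1 + h..1 - h} \<subseteq> {-1<..<1}" using h by auto
    have nz: "1 - x\<^sup>2 \<noteq> 0" if "x \<in> {-1 + h..1 - h}" for x
      using square_less_1[of x] sub that by auto
    have "norm (integral {-1 + h..1 - h} (\<lambda>x. f x * poly (legendre_poly n) x))
        \<le> integral {-1 + h..1 - h} (\<lambda>x. C * (1 - x\<^sup>2) powr s)"
    proof (rule integral_norm_bound_integral)
      show "(\<lambda>x. f x * poly (legendre_poly n) x) integrable_on {-1 + h..1 - h}"
        by (intro integrable_continuous_real continuous_intros continuous_on_subset[OF cf sub])
      show "(\<lambda>x. C * (1 - x\<^sup>2) powr s) integrable_on {-1 + h..1 - h}"
        using nz by (intro integrable_continuous_real continuous_intros) auto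
      fix x assume x: "x \<in> {-1 + h..1 - h}"
      have "\<bar>f x * poly (legendre_poly n) x\<bar> \<le> (C * (1 - x\<^sup>2) powr s) * 1"
        unfolding abs_mult using C sub x abs_legendre_le_1[of x n] h by (intro mult_mono) auto
      then show "norm (f x * poly (legendre_poly n) x) \<le> C * (1 - x\<^sup>2) powr s" by simp
    qed
    also have "\<dots> = C * integral {-1 + h..1 - h} (\<lambda>x. (1 - x\<^sup>2) powr s)" by (rule integral_mult_right)
    also have "\<dots> \<le> C * (2 / (- s - 1) * h powr (s + 1))"
      using C(1) integral_weight_le[OF s h] by (intro mult_left_mono) auto
    finally show ?thesis by (simp add: h_def mult.assoc)
  qed
  then show ?case by blast
next
  case (Suc k)
  have W: "wreg {-1<..<1} s (Suc (Suc (Suc (2 * k)))) f" using Suc.prems(1) by simp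
  obtain f' where f': "\<forall>x\<in>{-1<..<1}. (f has_real_derivative f' x) (at x)"
      "wreg {-1<..<1} s (Suc (Suc (2 * k))) (\<lambda>x. (1 - x\<^sup>2) * f' x)"
    by (rule wreg_SucE[OF W])
  define g where "g = (\<lambda>x. (1 - x\<^sup>2) * f' x)"
  have g: "wreg {-1<..<1} s (Suc (Suc (2 * k))) g" using f'(2) by (simp add: g_def)
  obtain g' where g': "\<forall>x\<in>{-1<..<1}. (g has_real_derivative g' x) (at x)"
      "wreg {-1<..<1} s (Suc (2 * k)) (\<lambda>x. (1 - x\<^sup>2) * g' x)"
    by (rule wreg_SucE[OF g])
  have sub1: "{-1<..<1} \<subseteq> {-1<..<1::real}" by simp
  have "wreg {-1<..<1} (-1 + s) (Suc (2 * k)) (\<lambda>x. (1 - x\<^sup>2) powr (-1) * ((1 - x\<^sup>2) * g' x))"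
    by (rule wreg_mult[OF wreg_phi_powr[OF sub1] g'(2)])
  moreover have "-1 + s = s - 1" by simp
  ultimately have W2: "wreg {-1<..<1} (s - 1) (Suc (2 * k)) (\<lambda>x. (1 - x\<^sup>2) powr (-1) * ((1 - x\<^sup>2) * g' x))"
    by (simp only:)
  \<comment> \<open>Dividing D g by the weight recovers \<open>g'\<close> at the cost of one order.
    With the two derivations spent, the induction moves from \<open>s\<close> and
    \<open>Suc k\<close> to \<open>s - 1\<close> and \<open>k\<close>.\<close>
  have wg': "wreg {-1<..<1} (s - 1) (Suc (2 * k)) g'"
  proof (rule wreg_cong[OF _ W2])
    fix x :: real assume "x \<in> {-1<..<1}"
    then have "x\<^sup>2 < 1" by (rule square_less_1)
    then show "(1 - x\<^sup>2) powr (-1) * ((1 - x\<^sup>2) * g' x) = g' x" by (simp add: powr_minus)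
  qed simp
  obtain C1 where C1: "\<And>n. n \<ge> 2 \<Longrightarrow>
      \<bar>integral {-1 + legendre_step n..1 - legendre_step n} (\<lambda>x. g' x * poly (legendre_poly n) x)\<bar>
      \<le> C1 * legendre_step n powr s"
    using Suc.IH[OF wg'] Suc.prems(2) by auto
  obtain Cf where Cf: "Cf > 0" "\<And>x. x \<in> {-1<..<1} \<Longrightarrow> \<bar>f x\<bar> \<le> Cf * (1 - x\<^sup>2) powr s"
    using wreg_bounded_pos[OF W] by blast
  obtain Cg where Cg: "Cg > 0" "\<And>x. x \<in> {-1<..<1} \<Longrightarrow> \<bar>g x\<bar> \<le> Cg * (1 - x\<^sup>2) powr s"
    using wreg_bounded_pos[OF g] by blast
  define K where "K = (2::real) powr \<bar>s\<bar> * (2 * Cf + Cg)"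
  have "\<bar>integral {-1 + legendre_step n..1 - legendre_step n} (\<lambda>x. f x * poly (legendre_poly n) x)\<bar>
      \<le> (C1 + 2 * K) * legendre_step n powr (s + 1)" if n: "n \<ge> 2" for n
  proof -
    define h where "h = legendre_step n"
    define \<nu> where "\<nu> = real n * (real n + 1)"
    have h: "0 < h" "h \<le> 1/6" and h\<nu>: "h * \<nu> = 1" using legendre_step_bounds[OF n] by (auto simp: h_def \<nu>_def)
    have ab: "-1 + h \<le> 1 - h" using h by simp
    have sub: "{-1 + h..1 - h} \<subseteq> {-1<..<1}" using h by auto
    let ?P = "poly (legendre_poly n)" and ?P' = "poly (pderiv (legendre_poly n))"
      and ?P'' = "poly (pderiv (pderiv (legendre_poly n)))"
    \<comment> \<open>The boundary expression of two partial integrations against ((1 - x^2) P')' =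
      - \<nu> P; its derivative is - \<nu> f P - g' P.\<close>
    define G where "G = (\<lambda>x. f x * ((1 - x\<^sup>2) * ?P' x) - g x * ?P x)"
    have G': "(G has_real_derivative (- \<nu> * (f x * ?P x) - g' x * ?P x)) (at x)" if "x \<in> {-1 + h..1 - h}" for x
    proof -
      have x: "x \<in> {-1<..<1}" using that sub by auto
      have "((\<lambda>x. (1 - x\<^sup>2) * ?P' x) has_real_derivative (- 2 * x * ?P' x + (1 - x\<^sup>2) * ?P'' x)) (at x)"
        by (auto intro!: derivative_eq_intros poly_DERIV)
      moreover have "- 2 * x * ?P' x + (1 - x\<^sup>2) * ?P'' x = - \<nu> * ?P x"
        using legendre_ode[of x n] by (simp add: \<nu>_def)
      ultimately have d: "((\<lambda>x. (1 - x\<^sup>2) * ?P' x) has_real_derivative - \<nu> * ?P x) (at x)" by simp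
      have df: "(f has_real_derivative f' x) (at x)" and dg: "(g has_real_derivative g' x) (at x)"
        using f'(1) g'(1) x by auto
      have "(G has_real_derivative (f' x * ((1 - x\<^sup>2) * ?P' x) + - \<nu> * ?P x * f x) - (g' x * ?P x + ?P' x * g x)) (at x)"
        unfolding G_def by (intro DERIV_diff DERIV_mult df d dg poly_DERIV)
      moreover have "(f' x * ((1 - x\<^sup>2) * ?P' x) + - \<nu> * ?P x * f x) - (g' x * ?P x + ?P' x * g x)
          = - \<nu> * (f x * ?P x) - g' x * ?P x" by (simp add: g_def algebra_simps)
      ultimately show ?thesis by (simp only:)
    qed
    have "((\<lambda>x. - \<nu> * (f x * ?P x) - g' x * ?P x) has_integral (G (1 - h) - G (-1 + h))) {-1 + h..1 - h}"
      by (rule fundamental_theorem_of_calculus[OF ab])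
         (use G' in \<open>auto simp: has_real_derivative_iff_has_vector_derivative[symmetric] intro: DERIV_subset\<close>)
    then have "G (1 - h) - G (-1 + h) = integral {-1 + h..1 - h} (\<lambda>x. - \<nu> * (f x * ?P x) - g' x * ?P x)"
      by (simp only: integral_unique)
    also have "\<dots> = integral {-1 + h..1 - h} (\<lambda>x. - \<nu> * (f x * ?P x)) - integral {-1 + h..1 - h} (\<lambda>x. g' x * ?P x)"
      by (rule integral_diff)
         (intro integrable_continuous_real continuous_intros continuous_on_subset[OF _ sub]
            wreg_continuous_on[OF W] wreg_continuous_on[OF wg'])+
    also have "integral {-1 + h..1 - h} (\<lambda>x. - \<nu> * (f x * ?P x)) = - \<nu> * integral {-1 + h..1 - h} (\<lambda>x. f x * ?P x)"
      by (rule integral_mult_right)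
    finally have "\<nu> * integral {-1 + h..1 - h} (\<lambda>x. f x * ?P x)
        = - integral {-1 + h..1 - h} (\<lambda>x. g' x * ?P x) - G (1 - h) + G (-1 + h)" by simp
    then have "h * \<nu> * integral {-1 + h..1 - h} (\<lambda>x. f x * ?P x)
        = h * (- integral {-1 + h..1 - h} (\<lambda>x. g' x * ?P x) - G (1 - h) + G (-1 + h))" by simp
    then have I: "\<bar>integral {-1 + h..1 - h} (\<lambda>x. f x * ?P x)\<bar>
        \<le> h * (\<bar>integral {-1 + h..1 - h} (\<lambda>x. g' x * ?P x)\<bar> + \<bar>G (1 - h)\<bar> + \<bar>G (-1 + h)\<bar>)"
      using h(1) unfolding h\<nu> by (simp add: abs_mult)
    \<comment> \<open>At the cut 1 - x^2 lies between h and 2 h, and (1 - x^2) P'^2 \<le> \<nu>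
      together with h \<nu> = 1 gives |(1 - x^2) P'| \<le> 2.\<close>
    have Gb: "\<bar>G x\<bar> \<le> K * h powr s" if x: "x = 1 - h \<or> x = -1 + h" for x
    proof -
      have xi: "x \<in> {-1<..<1}" using x h by auto
      have phi: "1 - x\<^sup>2 = h * (2 - h)" 
      proof (cases "x = 1 - h")
        case True
        show ?thesis unfolding True by (simp add: power2_eq_square algebra_simps)
      next
        case False
        then have "x = -1 + h" using x by simp
        show ?thesis unfolding \<open>x = -1 + h\<close> by (simp add: power2_eq_square algebra_simps)
      qed
      have ph: "h \<le> 1 - x\<^sup>2" "1 - x\<^sup>2 \<le> 2 * h"
        unfolding phi using h mult_left_mono[of 1 "2 - h" h] mult_left_mono[of "2 - h" 2 h] by auto
      have ps: "(1 - x\<^sup>2) powr s \<le> 2 powr \<bar>s\<bar> * h powr s"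
      proof (cases "s \<ge> 0")
        case True
        have "(1 - x\<^sup>2) powr s \<le> (2 * h) powr s" using True ph h by (intro powr_mono2) auto
        then show ?thesis using True h by (simp add: powr_mult)
      next
        case False
        have "(1 - x\<^sup>2) powr s \<le> 1 * h powr s" using False ph h powr_mono2'[of s h "1 - x\<^sup>2"] by simp
        also have "\<dots> \<le> 2 powr \<bar>s\<bar> * h powr s" by (intro mult_right_mono) (auto intro: ge_one_powr_ge_zero)
        finally show ?thesis .
      qed
      have "((1 - x\<^sup>2) * ?P' x)\<^sup>2 = (1 - x\<^sup>2) * ((1 - x\<^sup>2) * (?P' x)\<^sup>2)" by (simp add: power2_eq_square)
      also have "\<dots> \<le> (2 * h) * \<nu>"
        using legendre_deriv_bound[of n x] n xi ph h by (intro mult_mono) (auto simp: \<nu>_def)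
      also have "(2 * h) * \<nu> = 2 * (h * \<nu>)" by simp
      also have "\<dots> \<le> 2\<^sup>2" unfolding h\<nu> by simp
      finally have P': "\<bar>(1 - x\<^sup>2) * ?P' x\<bar> \<le> 2" by (simp only: power2_le_iff_abs_le[of 2])
      have "\<bar>G x\<bar> \<le> \<bar>f x\<bar> * \<bar>(1 - x\<^sup>2) * ?P' x\<bar> + \<bar>g x\<bar> * \<bar>?P x\<bar>"
        unfolding G_def by (metis abs_mult abs_triangle_ineq4)
      also have "\<dots> \<le> (Cf * (1 - x\<^sup>2) powr s) * 2 + (Cg * (1 - x\<^sup>2) powr s) * 1"
        using Cf Cg P' xi abs_legendre_le_1[of x n] by (intro add_mono mult_mono) auto
      also have "\<dots> = (2 * Cf + Cg) * (1 - x\<^sup>2) powr s" by (simp add: algebra_simps)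
      also have "\<dots> \<le> (2 * Cf + Cg) * (2 powr \<bar>s\<bar> * h powr s)"
        using ps Cf Cg by (intro mult_left_mono) auto
      finally show ?thesis by (simp add: K_def mult_ac)
    qed
    have "\<bar>integral {-1 + h..1 - h} (\<lambda>x. f x * ?P x)\<bar> \<le> h * (C1 * h powr s + K * h powr s + K * h powr s)"
      using I C1[OF n] Gb[of "1 - h"] Gb[of "-1 + h"] h
      by (intro order_trans[OF I] mult_left_mono add_mono) (auto simp: h_def)
    also have "\<dots> = (C1 + 2 * K) * h powr (s + 1)" using h by (simp add: powr_add algebra_simps)
    finally show ?thesis by (simp add: h_def)
  qed
  then show ?case by blast
qed

text \<open>The two strips of width h outside the cut contribute h times h^s, the same order as the
  cut integral. Since h is at most 1 / n^2, everything is O(n^(-2 s - 2)).\<close>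

lemma legendre_coefficient_decay:
  assumes W: "wreg {-1<..<1} s (Suc (2 * k)) f" and k: "s + 1 < real k" and s: "s > 0"
    and cont: "continuous_on {-1..1} f" and ends: "f (-1) = 0" "f 1 = 0"
  shows "\<exists>C\<ge>0. \<forall>n\<ge>2. \<bar>integral {-1..1} (\<lambda>x. f x * poly (legendre_poly n) x)\<bar> \<le> C * real n powr (- 2 * s - 2)"
proof -
  obtain C1 where C1: "\<And>n. n \<ge> 2 \<Longrightarrow>
      \<bar>integral {-1 + legendre_step n..1 - legendre_step n} (\<lambda>x. f x * poly (legendre_poly n) x)\<bar>
      \<le> C1 * legendre_step n powr (s + 1)"
    using legendre_coefficient_cut[OF W k] by blast
  obtain Cf where Cf: "Cf > 0" "\<And>x. x \<in> {-1<..<1} \<Longrightarrow> \<bar>f x\<bar> \<le> Cf * (1 - x\<^sup>2) powr s"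
    using wreg_bounded_pos[OF W] by blast
  define C where "C = \<bar>C1\<bar> + 2 * (Cf * 2 powr s)"
  have "\<bar>integral {-1..1} (\<lambda>x. f x * poly (legendre_poly n) x)\<bar> \<le> C * real n powr (- 2 * s - 2)" if n: "n \<ge> 2" for n
  proof -
    define h where "h = legendre_step n"
    have h: "0 < h" "h \<le> 1/6" using legendre_step_bounds[OF n] by (auto simp: h_def)
    let ?u = "\<lambda>x. f x * poly (legendre_poly n) x"
    have cu: "continuous_on {-1..1} ?u" by (intro continuous_intros cont)
    have edge: "\<bar>?u x\<bar> \<le> Cf * (2 powr s * h powr s)" if x: "x \<in> {-1..1}" "x \<le> -1 + h \<or> 1 - h \<le> x" for x
    proof (cases "x = -1 \<or> x = 1")
      case True
      then show ?thesis using ends Cf by auto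
    next
      case False
      then have xi: "x \<in> {-1<..<1}" using x by auto
      have "1 - x\<^sup>2 = (1 - x) * (1 + x)" by (simp add: power2_eq_square algebra_simps)
      also have "\<dots> \<le> 2 * h"
        using x mult_mono[of "1 - x" 2 "1 + x" h] mult_mono[of "1 - x" h "1 + x" 2] h by auto
      finally have "(1 - x\<^sup>2) powr s \<le> (2 * h) powr s"
        using square_less_1[OF xi] s by (intro powr_mono2) auto
      then have "\<bar>f x\<bar> \<le> Cf * (2 powr s * h powr s)"
        using Cf(1) h by (intro order_trans[OF Cf(2)[OF xi]] mult_left_mono) (auto simp: powr_mult)
      then have "\<bar>f x\<bar> * \<bar>poly (legendre_poly n) x\<bar> \<le> Cf * (2 powr s * h powr s) * 1"
        using abs_legendre_le_1[OF x(1), of n] by (intro mult_mono) auto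
      then show ?thesis by (simp add: abs_mult)
    qed
    have "integral {-1..1} ?u = integral {-1..-1+h} ?u + integral {-1+h..1} ?u"
      using h by (intro Henstock_Kurzweil_Integration.integral_combine[symmetric] integrable_continuous_real cu) auto
    also have "integral {-1+h..1} ?u = integral {-1+h..1-h} ?u + integral {1-h..1} ?u"
      using h by (intro Henstock_Kurzweil_Integration.integral_combine[symmetric] integrable_continuous_real
          continuous_on_subset[OF cu]) auto
    finally have split: "integral {-1..1} ?u = integral {-1..-1+h} ?u + (integral {-1+h..1-h} ?u + integral {1-h..1} ?u)" .
    have e: "Cf * (2 powr s * h powr s) * h = Cf * 2 powr s * h powr (s + 1)" using h by (simp add: powr_add)
    have "norm (integral {-1..-1+h} ?u) \<le> Cf * (2 powr s * h powr s) * ((-1 + h) - (-1))"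
      using h edge by (intro integral_bound continuous_on_subset[OF cu]) auto
    then have b1: "\<bar>integral {-1..-1+h} ?u\<bar> \<le> Cf * 2 powr s * h powr (s + 1)" using e by simp
    have "norm (integral {1-h..1} ?u) \<le> Cf * (2 powr s * h powr s) * (1 - (1 - h))"
      using h edge by (intro integral_bound continuous_on_subset[OF cu]) auto
    then have b2: "\<bar>integral {1-h..1} ?u\<bar> \<le> Cf * 2 powr s * h powr (s + 1)" using e by simp
    have b3: "\<bar>integral {-1+h..1-h} ?u\<bar> \<le> \<bar>C1\<bar> * h powr (s + 1)"
      unfolding h_def by (intro order_trans[OF C1[OF n]] mult_right_mono) auto
    have "C * h powr (s + 1) = \<bar>C1\<bar> * h powr (s + 1) + 2 * (Cf * 2 powr s * h powr (s + 1))"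
      by (simp add: C_def algebra_simps)
    with b1 b2 b3 have "\<bar>integral {-1..1} ?u\<bar> \<le> C * h powr (s + 1)"
      unfolding split by linarith
    also have "h powr (s + 1) \<le> (1 / (real n)\<^sup>2) powr (s + 1)"
    proof (intro powr_mono2)
      show "h \<le> 1 / (real n)\<^sup>2" unfolding h_def legendre_step_def using n
        by (intro frac_le) (auto simp: power2_eq_square algebra_simps)
    qed (use s h in auto)
    also have "(1 / (real n)\<^sup>2) powr (s + 1) = real n powr (- 2 * s - 2)"
    proof -
      have "1 / (real n)\<^sup>2 = real n powr (-2)" using n by (simp add: powr_minus powr_numeral divide_inverse)
      moreover have "(-2) * (s + 1) = - 2 * s - 2" by simp
      ultimately show ?thesis by (simp only: powr_powr)
    qed
    finally show ?thesis using Cf(1) by (simp add: C_def mult_left_mono)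
  qed
  moreover have "C \<ge> 0" using Cf(1) by (simp add: C_def)
  ultimately show ?thesis by blast
qed

section \<open>The Galerkin spaces\<close>

lemma boundary_conditions_add:
  "boundary_conditions a b c d p \<Longrightarrow> boundary_conditions a b c d q \<Longrightarrow> boundary_conditions a b c d (p + q)"
  unfolding boundary_conditions_def by (auto simp: pderiv_add algebra_simps)

lemma boundary_conditions_smult:
  assumes "boundary_conditions a b c d p"
  shows "boundary_conditions a b c d (Polynomial.smult t p)"
proof -
  have "a * (t * u) + b * (t * v) = t * (a * u + b * v)" for a b u v :: real by (simp add: algebra_simps)
  then show ?thesis using assms unfolding boundary_conditions_def by (simp add: pderiv_smult)
qed

lemma boundary_conditions_0: "boundary_conditions a b c d 0"
  by (simp add: boundary_conditions_def)

lemma boundary_conditions_sum: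
  "(\<And>i. i \<in> I \<Longrightarrow> boundary_conditions a b c d (p i)) \<Longrightarrow> boundary_conditions a b c d (\<Sum>i\<in>I. p i)"
  by (induction I rule: infinite_finite_induct) (auto intro: boundary_conditions_add boundary_conditions_0)

lemma galerkin_space_mono: "M \<le> N \<Longrightarrow> galerkin_space a b c d M \<subseteq> galerkin_space a b c d N"
  by (auto simp: galerkin_space_def)

lemma galerkin_space_combination:
  assumes "finite I" "\<And>i. i \<in> I \<Longrightarrow> p i \<in> galerkin_space a b c d N"
  shows "(\<Sum>i\<in>I. Polynomial.smult (t i) (p i)) \<in> galerkin_space a b c d N"
  using assms unfolding galerkin_space_def
  by (auto intro!: boundary_conditions_sum boundary_conditions_smult degree_sum_le order_trans[OF degree_smult_le])

text \<open>
  Subtracting from \<open>x\<^sup>i\<close> a combination of two fixed monomials on which the two boundary functionals are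
  independent gives \<open>N\<close> independent elements of the Galerkin space.
\<close>

lemma boundary_functionals_independent:
  fixes a b c d :: real
  assumes "a\<^sup>2 + b\<^sup>2 \<noteq> 0" "c\<^sup>2 + d\<^sup>2 \<noteq> 0"
  defines "L \<equiv> \<lambda>i::nat. (-1) ^ i * (a - real i * b)" and "R \<equiv> \<lambda>i::nat. c + real i * d"
  shows "\<exists>i\<le>2. L i * R (Suc i) \<noteq> L (Suc i) * R i"
proof (rule ccontr)
  assume "\<not> ?thesis"
  then have h: "L 0 * R 1 = L 1 * R 0" "L 1 * R 2 = L 2 * R 1" "L 2 * R 3 = L 3 * R 2"
    by (auto simp: numeral_2_eq_2 numeral_3_eq_3)
  \<comment> \<open>The three determinants are linear in a c, a d - b c and b d with an invertible
    coefficient matrix, so these three quantities vanish.\<close>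
  from h(1) have 1: "2 * (a * c) + a * d - b * c = 0" by (simp add: L_def R_def algebra_simps)
  from h(2) have 2: "2 * (a * c) + 3 * (a * d) - 3 * (b * c) - 4 * (b * d) = 0" by (simp add: L_def R_def algebra_simps)
  from h(3) have 3: "2 * (a * c) + 5 * (a * d) - 5 * (b * c) - 12 * (b * d) = 0" by (simp add: L_def R_def algebra_simps)
  from 1 2 3 have bd: "b * d = 0" and ac: "a * c = 0" and ad: "a * d = b * c" by linarith+
  show False
  proof (cases "b = 0")
    case True
    then have "a \<noteq> 0" using assms(1) by simp
    then have "c = 0" "d = 0" using ac ad True by auto
    then show False using assms(2) by simp
  next
    case False
    then have "d = 0" using bd by simp
    then have "c = 0" using ad False by simp
    then show False using assms(2) \<open>d = 0\<close> by simp
  qed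
qed

lemma poly_span_expand: "r \<in> poly_span R N \<longleftrightarrow> (\<exists>t. r = (\<Sum>n<N. Polynomial.smult (t n) (R n)))"
  by (auto simp: poly_span_def)

lemma sum_smult_swap:
  fixes R :: "nat \<Rightarrow> real poly"
  shows "(\<Sum>i\<in>I. Polynomial.smult (c i) (\<Sum>n<N. Polynomial.smult (t i n) (R n)))
    = (\<Sum>n<N. Polynomial.smult (\<Sum>i\<in>I. t i n * c i) (R n))"
proof (rule poly_eqI)
  fix m
  have "Polynomial.coeff (\<Sum>i\<in>I. Polynomial.smult (c i) (\<Sum>n<N. Polynomial.smult (t i n) (R n))) m
     = (\<Sum>i\<in>I. \<Sum>n<N. t i n * c i * Polynomial.coeff (R n) m)"
    by (simp add: coeff_sum sum_distrib_left mult_ac)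
  also have "\<dots> = (\<Sum>n<N. \<Sum>i\<in>I. t i n * c i * Polynomial.coeff (R n) m)" by (rule sum.swap)
  also have "\<dots> = Polynomial.coeff (\<Sum>n<N. Polynomial.smult (\<Sum>i\<in>I. t i n * c i) (R n)) m"
    by (simp add: coeff_sum sum_distrib_right)
  finally show "Polynomial.coeff (\<Sum>i\<in>I. Polynomial.smult (c i) (\<Sum>n<N. Polynomial.smult (t i n) (R n))) m
     = Polynomial.coeff (\<Sum>n<N. Polynomial.smult (\<Sum>i\<in>I. t i n * c i) (R n)) m" .
qed

text \<open>Dimension count: the Galerkin space contains \<open>N\<close> independent polynomials,
  while a relation among the \<open>R n\<close> would let \<open>N - 1\<close> of them span it. The
  positive definiteness of the mass matrix rests on this.\<close>

lemma galerkin_basis_independent: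
  assumes bc: "a\<^sup>2 + b\<^sup>2 \<noteq> 0" "c\<^sup>2 + d\<^sup>2 \<noteq> 0" and N: "N \<ge> 2"
    and span: "galerkin_space a b c d N = poly_span R N"
    and zero: "(\<Sum>n<N. Polynomial.smult (t n) (R n)) = 0" and k: "k < N"
  shows "t k = 0"
proof (rule ccontr)
  assume tk: "t k \<noteq> 0"
  define L where "L = (\<lambda>i::nat. (-1) ^ i * (a - real i * b))"
  define Q where "Q = (\<lambda>i::nat. c + real i * d)"
  obtain i0 where i0: "i0 \<le> 2" "L i0 * Q (Suc i0) \<noteq> L (Suc i0) * Q i0"
    using boundary_functionals_independent[OF bc] unfolding L_def Q_def by blast
  define D where "D = L i0 * Q (Suc i0) - L (Suc i0) * Q i0"
  have D: "D \<noteq> 0" using i0 by (simp add: D_def)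
  let ?X = "\<lambda>i. Polynomial.monom (1::real) i"
  \<comment> \<open>Cramer's rule: the two subtracted monomials cancel both boundary functionals of
    the monomial of degree \<open>i\<close>.\<close>
  define e where "e = (\<lambda>i. ?X i - Polynomial.smult ((L i * Q (Suc i0) - L (Suc i0) * Q i) / D) (?X i0)
      - Polynomial.smult ((L i0 * Q i - L i * Q i0) / D) (?X (Suc i0)))"
  define J where "J = {..N + 1} - {i0, Suc i0}"
  show False
  proof (cases "N = 2 \<and> i0 = 2 \<and> False")
    case True
    then show ?thesis by simp
  next
    case False
    have pw: "(-1::real) ^ (i - Suc 0) * real i = - ((-1) ^ i * real i)" for i
      by (cases i) auto
    have Lx: "a * poly (?X i) (-1) + b * poly (pderiv (?X i)) (-1) = L i" for i
      using pw[of i] by (simp add: poly_monom pderiv_monom L_def algebra_simps)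
    have Rx: "c * poly (?X i) 1 + d * poly (pderiv (?X i)) 1 = Q i" for i
      by (simp add: poly_monom pderiv_monom Q_def algebra_simps)
    have e_bc: "boundary_conditions a b c d (e i)" for i
    proof -
      have lin: "u * poly (e i) x + v * poly (pderiv (e i)) x =
        (u * poly (?X i) x + v * poly (pderiv (?X i)) x)
        - (L i * Q (Suc i0) - L (Suc i0) * Q i) / D * (u * poly (?X i0) x + v * poly (pderiv (?X i0)) x)
        - (L i0 * Q i - L i * Q i0) / D * (u * poly (?X (Suc i0)) x + v * poly (pderiv (?X (Suc i0))) x)"
        for u v x :: real
        unfolding e_def by (simp only: poly_diff poly_smult pderiv_diff pderiv_smult) (simp only: algebra_simps)
      have "L i - (L i * Q (Suc i0) - L (Suc i0) * Q i) / D * L i0 - (L i0 * Q i - L i * Q i0) / D * L (Suc i0) = 0"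
        using D by (simp add: field_simps) (simp add: D_def algebra_simps)
      moreover have "Q i - (L i * Q (Suc i0) - L (Suc i0) * Q i) / D * Q i0 - (L i0 * Q i - L i * Q i0) / D * Q (Suc i0) = 0"
        using D by (simp add: field_simps) (simp add: D_def algebra_simps)
      ultimately show ?thesis unfolding boundary_conditions_def lin Lx Rx by simp
    qed
    \<comment> \<open>Guaranteed by \<open>N \<ge> 2\<close> even for \<open>i0 = 2\<close>: both
      exceptional degrees are available, and \<open>J\<close> keeps N + 2 - 2 of the admissible
      degrees.\<close>
    have "Suc i0 \<le> N + 1" using i0 N by simp
    then have e_in: "e i \<in> galerkin_space a b c d N" if "i \<in> J" for i
      using that e_bc unfolding galerkin_space_def e_def J_def
      by (auto intro!: degree_diff_le order_trans[OF degree_smult_le] order_trans[OF degree_monom_le])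
    have cJ: "card J = N" unfolding J_def using \<open>Suc i0 \<le> N + 1\<close> by (subst card_Diff_subset) auto
    have fJ: "finite J" by (simp add: J_def)
    have "\<forall>i\<in>J. \<exists>s. e i = (\<Sum>n<N. Polynomial.smult (s n) (R n))"
      using e_in unfolding span poly_span_expand by blast
    then obtain s where s: "\<And>i. i \<in> J \<Longrightarrow> e i = (\<Sum>n<N. Polynomial.smult (s i n) (R n))" by metis
    text \<open>Eliminate \<open>R k\<close> with the relation \<open>t\<close>: then \<open>N - 1\<close> equations suffice.\<close>
    define s' where "s' = (\<lambda>i n. s i n - s i k / t k * t n)"
    have s'k: "s' i k = 0" for i using tk by (simp add: s'_def)
    have es': "e i = (\<Sum>n<N. Polynomial.smult (s' i n) (R n))" if "i \<in> J" for i
    proof -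
      have "(\<Sum>n<N. Polynomial.smult (s' i n) (R n))
          = (\<Sum>n<N. Polynomial.smult (s i n) (R n)) - Polynomial.smult (s i k / t k) (\<Sum>n<N. Polynomial.smult (t n) (R n))"
        by (rule poly_eqI) (simp add: s'_def coeff_sum algebra_simps sum_subtractf sum_distrib_left)
      then show ?thesis using s[OF that] zero by simp
    qed
    define f where "f = (\<lambda>m. if m < k then m else Suc m)"
    obtain y where y: "\<exists>i\<in>J. y i \<noteq> 0" "\<forall>m<N - 1. (\<Sum>i\<in>J. s' i (f m) * y i) = 0"
      using homogeneous_system_nontrivial[OF fJ, of "N - 1" "\<lambda>m i. s' i (f m)"] cJ N by auto
    have "(\<Sum>i\<in>J. s' i n * y i) = 0" if "n < N" for n
    proof (cases "n = k")
      case True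
      then show ?thesis using s'k by simp
    next
      case False
      have "\<exists>m<N - 1. f m = n"
      proof (cases "n < k")
        case True
        then show ?thesis using k by (intro exI[of _ n]) (simp add: f_def)
      next
        case False
        then show ?thesis using that \<open>n \<noteq> k\<close> by (intro exI[of _ "n - 1"]) (auto simp: f_def)
      qed
      then obtain m where "m < N - 1" "f m = n" by blast
      then show ?thesis using y(2) by auto
    qed
    then have "(\<Sum>i\<in>J. Polynomial.smult (y i) (e i)) = 0"
    proof -
      have "(\<Sum>i\<in>J. Polynomial.smult (y i) (e i)) = (\<Sum>i\<in>J. Polynomial.smult (y i) (\<Sum>n<N. Polynomial.smult (s' i n) (R n)))"
        using es' by simp
      also have "\<dots> = (\<Sum>n<N. Polynomial.smult (\<Sum>i\<in>J. s' i n * y i) (R n))" by (rule sum_smult_swap)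
      also have "\<dots> = 0" using \<open>\<And>n. n < N \<Longrightarrow> (\<Sum>i\<in>J. s' i n * y i) = 0\<close> by simp
      finally show ?thesis .
    qed
    note z = this
    obtain i where i: "i \<in> J" "y i \<noteq> 0" using y(1) by blast
    \<comment> \<open>Among the \<open>e j\<close> with \<open>j\<close> in \<open>J\<close> only
      \<open>e i\<close> involves degree \<open>i\<close>, as the subtracted monomials have degrees
      outside \<open>J\<close>.\<close>
    have "0 = Polynomial.coeff (\<Sum>j\<in>J. Polynomial.smult (y j) (e j)) i" unfolding z by simp
    also have "\<dots> = (\<Sum>j\<in>J. if j = i then y j else 0)"
      unfolding coeff_sum using i(1) by (intro sum.cong) (auto simp: e_def J_def)
    also have "\<dots> = y i" using i fJ by simp
    finally show False using i(2) by simp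
  qed
qed

section \<open>The inner product and the integrals in the matrix entries\<close>

definition ip :: "(real \<Rightarrow> real) \<Rightarrow> (real \<Rightarrow> real) \<Rightarrow> real" where
  "ip f g = integral {-1..1} (\<lambda>x. f x * g x)"

lemma ip_commute: "ip f g = ip g f"
  by (simp add: ip_def mult.commute)

lemma ip_sum_left:
  assumes "finite I" "\<And>i. i \<in> I \<Longrightarrow> (\<lambda>x. f i x * g x) integrable_on {-1..1}"
  shows "ip (\<lambda>x. \<Sum>i\<in>I. c i * f i x) g = (\<Sum>i\<in>I. c i * ip (f i) g)"
proof -
  have "ip (\<lambda>x. \<Sum>i\<in>I. c i * f i x) g = integral {-1..1} (\<lambda>x. \<Sum>i\<in>I. c i * (f i x * g x))"
    by (simp add: ip_def sum_distrib_right mult.assoc)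
  also have "\<dots> = (\<Sum>i\<in>I. integral {-1..1} (\<lambda>x. c i * (f i x * g x)))"
    using assms by (intro integral_sum integrable_on_mult_right)
  finally show ?thesis by (simp add: ip_def)
qed

text \<open>Matrix entries are Lebesgue integrals over the open interval, whereas the analysis uses
  the gauge integral over the closed one. Continuity inside supplies Borel measurability, and the
  endpoints are a null set.\<close>

lemma L2_inner_eq:
  assumes ai: "(\<lambda>x. u x * v x) absolutely_integrable_on {-1..1}"
    and cont: "continuous_on {-1<..<1} (\<lambda>x. u x * v x)"
  shows "L2_inner u v = ip u v"
proof -
  have ab: "(\<lambda>x. u x * v x) absolutely_integrable_on {-1<..<1}"
    by (rule set_integrable_subset[OF ai]) auto
  have "(\<lambda>x. indicator {-1<..<1} x *\<^sub>R (u x * v x)) \<in> borel_measurable lborel"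
    using borel_measurable_continuous_on_indicator[OF _ cont] by simp
  from integral_completion[OF this]
  have "L2_inner u v = (LINT x:{-1<..<1}|lebesgue. u x * v x)"
    by (simp add: L2_inner_def set_lebesgue_integral_def)
  also have "\<dots> = integral {-1<..<1} (\<lambda>x. u x * v x)"
    by (rule set_lebesgue_integral_eq_integral(2)[OF ab])
  also have "\<dots> = integral {-1..1} (\<lambda>x. u x * v x)"
    using set_lebesgue_integral_eq_integral(1)[OF ab] has_integral_Icc_iff_Ioo
    by (metis integrable_integral integral_unique)
  finally show ?thesis by (simp add: ip_def)
qed

section \<open>Approximation by Legendre series\<close>

lemma powr_step_bound:
  fixes a :: real
  assumes "a > 0" "n \<ge> 2"
  shows "real n powr (- a - 1) \<le> (real (n - 1) powr (- a) - real n powr (- a)) / a"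
proof -
  have n: "real (n - 1) = real n - 1" "real n - 1 > 0" using assms(2) by auto
  have "\<exists>z>real n - 1. z < real n \<and> real n powr (- a) - (real n - 1) powr (- a) = (real n - (real n - 1)) * (- a * z powr (- a - 1))"
  proof (rule MVT2)
    fix x assume "real n - 1 \<le> x" "x \<le> real n"
    then have "x > 0" using n by simp
    then show "((\<lambda>x. x powr (- a)) has_real_derivative - a * x powr (- a - 1)) (at x)"
      by (auto intro!: derivative_eq_intros)
  qed simp
  then obtain z where z: "real n - 1 < z" "z < real n"
      "real n powr (- a) - (real n - 1) powr (- a) = - a * z powr (- a - 1)" by auto
  have "real n powr (- a - 1) \<le> z powr (- a - 1)" using z n assms(1) by (intro powr_mono2') auto
  also have "\<dots> = (real (n - 1) powr (- a) - real n powr (- a)) / a" using z(3) assms(1) n by (simp add: field_simps)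
  finally show ?thesis .
qed

text \<open>Comparison with a telescoping sum, each step by the mean value theorem. The factor
  \<open>2 powr a\<close> absorbs the shift from N - 1 to N, as N - 1 \<ge> N / 2.\<close>

lemma powr_tail_sum:
  fixes a :: real
  assumes a: "a > 0" and N: "N \<ge> 2"
  shows "(\<Sum>n=N..<M. real n powr (- a - 1)) \<le> 2 powr a / a * real N powr (- a)"
proof -
  have "(\<Sum>n=N..<M. real n powr (- a - 1)) \<le> (\<Sum>n=N..<M. (real (n - 1) powr (- a) - real n powr (- a)) / a)"
    using N by (intro sum_mono powr_step_bound a) auto
  also have "\<dots> \<le> real (N - 1) powr (- a) / a"
  proof -
    have "(\<Sum>n=N..<M. (real (n - 1) powr (- a) - real n powr (- a)) / a)
        = (if N \<le> M then (real (N - 1) powr (- a) - real (M - 1) powr (- a)) / a else 0)"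
    proof (induction M)
      case (Suc M)
      then show ?case using N by (auto simp: le_Suc_eq diff_divide_distrib)
    qed (use N in auto)
    then show ?thesis using a by (auto simp: divide_right_mono)
  qed
  also have "real (N - 1) powr (- a) \<le> (real N / 2) powr (- a)"
    using N a by (intro powr_mono2') auto
  also have "(real N / 2) powr (- a) = 2 powr a * real N powr (- a)"
    by (simp add: powr_divide powr_minus field_simps)
  finally show ?thesis using a by (simp add: divide_right_mono)
qed

lemma integral_uniform_limit:
  fixes f :: "nat \<Rightarrow> real \<Rightarrow> real"
  assumes "uniform_limit {-1..1} f g sequentially" "\<And>n. continuous_on {-1..1} (f n)"
  shows "(\<lambda>n. integral {-1..1} (f n)) \<longlonglongrightarrow> integral {-1..1} g"
proof -
  obtain I J where IJ: "\<And>n. (f n has_integral I n) (cbox (-1) 1)" "(g has_integral J) (cbox (-1) 1)" "I \<longlonglongrightarrow> J"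
    by (rule uniform_limit_integral_cbox[where a = "-1" and b = 1 and f = f and g = g and F = sequentially]) (use assms in auto)
  have "integral {-1..1} (f n) = I n" for n using integral_unique[OF IJ(1)[of n]] by simp
  moreover have "integral {-1..1} g = J" using integral_unique[OF IJ(2)] by simp
  ultimately show ?thesis using IJ(3) by simp
qed

text \<open>The factor n + 1/2 is the reciprocal of the squared norm 2 / (2 n + 1).\<close>

definition legendre_coeff :: "(real \<Rightarrow> real) \<Rightarrow> nat \<Rightarrow> real" where
  "legendre_coeff f n = (real n + 1/2) * integral {-1..1} (\<lambda>x. f x * poly (legendre_poly n) x)"

definition legendre_sum :: "(real \<Rightarrow> real) \<Rightarrow> nat \<Rightarrow> real poly" where
  "legendre_sum f N = (\<Sum>n<N. Polynomial.smult (legendre_coeff f n) (legendre_poly n))"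

lemma poly_legendre_sum: "poly (legendre_sum f N) x = (\<Sum>n<N. legendre_coeff f n * poly (legendre_poly n) x)"
  by (simp add: legendre_sum_def poly_sum)

lemma degree_legendre_sum: "N > 0 \<Longrightarrow> Polynomial.degree (legendre_sum f N) \<le> N - 1"
  unfolding legendre_sum_def
  by (intro degree_sum_le) (auto intro!: order_trans[OF degree_smult_le] simp: degree_legendre)

lemma integral_legendre_product:
  "integral {-1..1} (\<lambda>x. poly (legendre_poly m) x * poly (legendre_poly n) x) = (if m = n then 2 / (2 * real n + 1) else 0)"
  using legendre_norm[of n] legendre_orthogonal[of m n] by (simp add: power2_eq_square)

lemma integral_legendre_combination:
  assumes "finite A"
  shows "integral {-1..1} (\<lambda>x. (\<Sum>n\<in>A. a n * poly (legendre_poly n) x) * poly (legendre_poly m) x)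
    = (if m \<in> A then a m * (2 / (2 * real m + 1)) else 0)"
proof -
  have "integral {-1..1} (\<lambda>x. (\<Sum>n\<in>A. a n * poly (legendre_poly n) x) * poly (legendre_poly m) x)
      = integral {-1..1} (\<lambda>x. \<Sum>n\<in>A. a n * (poly (legendre_poly n) x * poly (legendre_poly m) x))"
    by (simp add: sum_distrib_right mult.assoc)
  also have "\<dots> = (\<Sum>n\<in>A. integral {-1..1} (\<lambda>x. a n * (poly (legendre_poly n) x * poly (legendre_poly m) x)))"
    by (rule integral_sum) (auto intro!: integrable_continuous_real continuous_intros assms)
  also have "\<dots> = (\<Sum>n\<in>A. if n = m then a n * (2 / (2 * real n + 1)) else 0)"
    by (intro sum.cong) (auto simp: integral_legendre_product)
  also have "\<dots> = (if m \<in> A then a m * (2 / (2 * real m + 1)) else 0)"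
    using assms by simp
  finally show ?thesis .
qed

lemma integral_legendre_combination_square:
  assumes "finite A"
  shows "integral {-1..1} (\<lambda>x. (\<Sum>n\<in>A. a n * poly (legendre_poly n) x)\<^sup>2)
    = (\<Sum>n\<in>A. (a n)\<^sup>2 * (2 / (2 * real n + 1)))"
proof -
  define S where "S = (\<lambda>x. \<Sum>n\<in>A. a n * poly (legendre_poly n) x)"
  have "integral {-1..1} (\<lambda>x. (S x)\<^sup>2) = integral {-1..1} (\<lambda>x. \<Sum>n\<in>A. a n * (S x * poly (legendre_poly n) x))"
  proof -
    have "(S x)\<^sup>2 = (\<Sum>n\<in>A. a n * (S x * poly (legendre_poly n) x))" for x
    proof -
      have "(S x)\<^sup>2 = S x * (\<Sum>n\<in>A. a n * poly (legendre_poly n) x)" by (simp add: power2_eq_square S_def)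
      then show ?thesis by (simp add: sum_distrib_left mult_ac)
    qed
    then show ?thesis by simp
  qed
  also have "\<dots> = (\<Sum>n\<in>A. integral {-1..1} (\<lambda>x. a n * (S x * poly (legendre_poly n) x)))"
    by (rule integral_sum) (auto intro!: integrable_continuous_real continuous_intros assms simp: S_def)
  also have "\<dots> = (\<Sum>n\<in>A. (a n)\<^sup>2 * (2 / (2 * real n + 1)))"
    using integral_legendre_combination[OF assms, of a] by (intro sum.cong) (auto simp: S_def power2_eq_square)
  finally show ?thesis by (simp add: S_def)
qed

text \<open>The Weierstrass M-test yields a continuous uniform limit. Its Legendre coefficients are
  those of \<open>f\<close>, so its difference from \<open>f\<close> is orthogonal to all
  polynomials and vanishes.\<close>

lemma legendre_series:
  fixes f :: "real \<Rightarrow> real"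
  assumes cont: "continuous_on {-1..1} f" and s: "s > 0"
    and dec: "\<And>n. n \<ge> 2 \<Longrightarrow> \<bar>legendre_coeff f n\<bar> \<le> C * real n powr (- 2 * s - 1)"
  shows "uniform_limit {-1..1} (\<lambda>N x. poly (legendre_sum f N) x) f sequentially"
proof -
  let ?t = "\<lambda>n x. legendre_coeff f n * poly (legendre_poly n) x"
  have "summable (\<lambda>n. C * real n powr (- 2 * s - 1))"
    using s by (intro summable_mult) (simp add: summable_real_powr_iff)
  then have "summable (\<lambda>n. norm (legendre_coeff f n))"
    by (rule summable_comparison_test_ev[rotated])
       (use dec in \<open>auto intro!: eventually_sequentiallyI[of 2]\<close>)
  then have U: "uniform_limit {-1..1} (\<lambda>N x. \<Sum>n<N. ?t n x) (\<lambda>x. suminf (\<lambda>n. ?t n x)) sequentially"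
  proof (rule Weierstrass_m_test[rotated])
    fix n and x :: real assume "x \<in> {-1..1}"
    then show "norm (?t n x) \<le> norm (legendre_coeff f n)"
      using abs_legendre_le_1[of x n] by (simp add: abs_mult mult_left_le)
  qed
  define g where "g = (\<lambda>x. suminf (\<lambda>n. ?t n x))"
  have U': "uniform_limit {-1..1} (\<lambda>N x. poly (legendre_sum f N) x) g sequentially"
    using U by (simp add: poly_legendre_sum g_def)
  have cg: "continuous_on {-1..1} g"
    by (rule uniform_limit_theorem[OF _ U']) (auto intro!: always_eventually continuous_intros)
  have ortho: "integral {-1..1} (\<lambda>x. (f x - g x) * poly (legendre_poly m) x) = 0" for m
  proof -
    have "uniform_limit {-1..1} (\<lambda>N x. poly (legendre_sum f N) x * poly (legendre_poly m) x)
        (\<lambda>x. g x * poly (legendre_poly m) x) sequentially"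
    proof (intro uniform_lim_mult U' uniform_limit_const)
      show "bounded (g ` {-1..1})" by (intro compact_imp_bounded compact_continuous_image cg) auto
      show "bounded (poly (legendre_poly m) ` {-1..1::real})"
        by (intro compact_imp_bounded compact_continuous_image continuous_intros) auto
    qed
    then have "(\<lambda>N. integral {-1..1} (\<lambda>x. poly (legendre_sum f N) x * poly (legendre_poly m) x))
        \<longlonglongrightarrow> integral {-1..1} (\<lambda>x. g x * poly (legendre_poly m) x)"
      by (rule integral_uniform_limit) (intro continuous_intros)
    moreover have "\<forall>\<^sub>F N in sequentially. integral {-1..1} (\<lambda>x. poly (legendre_sum f N) x * poly (legendre_poly m) x)
        = integral {-1..1} (\<lambda>x. f x * poly (legendre_poly m) x)"
    proof (rule eventually_sequentiallyI[of "Suc m"])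
      fix N assume "Suc m \<le> N"
      then show "integral {-1..1} (\<lambda>x. poly (legendre_sum f N) x * poly (legendre_poly m) x)
        = integral {-1..1} (\<lambda>x. f x * poly (legendre_poly m) x)"
        unfolding poly_legendre_sum integral_legendre_combination[OF finite_lessThan]
        by (simp add: legendre_coeff_def field_simps)
    qed
    ultimately have "(\<lambda>N::nat. integral {-1..1} (\<lambda>x. f x * poly (legendre_poly m) x))
        \<longlonglongrightarrow> integral {-1..1} (\<lambda>x. g x * poly (legendre_poly m) x)"
      by (rule Lim_transform_eventually)
    then have "integral {-1..1} (\<lambda>x. f x * poly (legendre_poly m) x) = integral {-1..1} (\<lambda>x. g x * poly (legendre_poly m) x)"
      by (simp add: LIMSEQ_const_iff)
    moreover have "integral {-1..1} (\<lambda>x. (f x - g x) * poly (legendre_poly m) x)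
        = integral {-1..1} (\<lambda>x. f x * poly (legendre_poly m) x) - integral {-1..1} (\<lambda>x. g x * poly (legendre_poly m) x)"
      unfolding left_diff_distrib by (rule integral_diff) (intro integrable_continuous_real continuous_intros cont cg)+
    ultimately show ?thesis by simp
  qed
  have "f x = g x" if x: "x \<in> {-1..1}" for x
  proof -
    have "f x - g x = 0"
    proof (rule orthogonal_to_polynomials_eq_0[OF _ _ x])
      show "continuous_on {-1..1} (\<lambda>x. f x - g x)" by (intro continuous_intros cont cg)
      fix p
      obtain c where c: "p = (\<Sum>j<Suc (Polynomial.degree p). Polynomial.smult (c j) (legendre_poly j))"
        using legendre_expansion[OF lessI] by blast
      have "integral {-1..1} (\<lambda>x. (f x - g x) * poly p x)
          = integral {-1..1} (\<lambda>x. \<Sum>j<Suc (Polynomial.degree p). c j * ((f x - g x) * poly (legendre_poly j) x))"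
        by (subst c) (simp add: poly_sum sum_distrib_left mult_ac del: sum.lessThan_Suc)
      also have "\<dots> = (\<Sum>j<Suc (Polynomial.degree p). integral {-1..1} (\<lambda>x. c j * ((f x - g x) * poly (legendre_poly j) x)))"
        by (rule integral_sum) (auto intro!: integrable_continuous_real continuous_intros cont cg)
      also have "\<dots> = 0" by (simp add: ortho del: sum.lessThan_Suc)
      finally show "integral {-1..1} (\<lambda>x. (f x - g x) * poly p x) = 0" .
    qed
    then show ?thesis by simp
  qed
  with U' show ?thesis by (metis (no_types, lifting) uniform_limit_cong')
qed

text \<open>The uniform rate sums n^(-2 s - 1). The mean square rate sums the squares of this times
  the norms 2 / (2 n + 1), that is n^(-4 s - 3). Both are bounded for differences of partial sums
  and survive the uniform limit; the uniform rate later controls the endpoint errors.\<close>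

lemma legendre_tail:
  fixes f :: "real \<Rightarrow> real"
  assumes cont: "continuous_on {-1..1} f" and s: "s > 0" and C: "C \<ge> 0"
    and dec: "\<And>n. n \<ge> 2 \<Longrightarrow> \<bar>legendre_coeff f n\<bar> \<le> C * real n powr (- 2 * s - 1)"
  shows "\<exists>K. \<forall>N\<ge>2. (\<forall>x\<in>{-1..1}. \<bar>f x - poly (legendre_sum f N) x\<bar> \<le> K * real N powr (- 2 * s)) \<and>
     integral {-1..1} (\<lambda>x. (f x - poly (legendre_sum f N) x)\<^sup>2) \<le> K * real N powr (- (4 * s + 2))"
proof -
  note U = legendre_series[OF cont s dec]
  define K where "K = max (C * (2 powr (2 * s) / (2 * s))) (C\<^sup>2 * (2 powr (4 * s + 2) / (4 * s + 2)))"
  have diff: "poly (legendre_sum f M) x - poly (legendre_sum f N) x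
      = (\<Sum>n\<in>{N..<M}. legendre_coeff f n * poly (legendre_poly n) x)" if "N \<le> M" for N M x
  proof -
    have "{..<M} = {..<N} \<union> {N..<M}" using that by auto
    moreover have "sum h ({..<N} \<union> {N..<M}) = sum h {..<N} + sum h {N..<M}" for h :: "nat \<Rightarrow> real"
      by (rule sum.union_disjoint) auto
    ultimately show ?thesis unfolding poly_legendre_sum by simp
  qed
  have "\<bar>f x - poly (legendre_sum f N) x\<bar> \<le> K * real N powr (- 2 * s)" if N: "N \<ge> 2" and x: "x \<in> {-1..1}" for N x
  proof -
    have "(\<lambda>M. poly (legendre_sum f M) x) \<longlonglongrightarrow> f x"
      using tendsto_uniform_limitI[OF U x] .
    then have "(\<lambda>M. \<bar>poly (legendre_sum f M) x - poly (legendre_sum f N) x\<bar>) \<longlonglongrightarrow> \<bar>f x - poly (legendre_sum f N) x\<bar>"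
      by (intro tendsto_intros)
    moreover have "\<forall>\<^sub>F M in sequentially. \<bar>poly (legendre_sum f M) x - poly (legendre_sum f N) x\<bar> \<le> K * real N powr (- 2 * s)"
    proof (rule eventually_sequentiallyI[of N])
      fix M assume "N \<le> M"
      have "\<bar>poly (legendre_sum f M) x - poly (legendre_sum f N) x\<bar>
          \<le> (\<Sum>n\<in>{N..<M}. \<bar>legendre_coeff f n * poly (legendre_poly n) x\<bar>)"
        unfolding diff[OF \<open>N \<le> M\<close>] by (rule sum_abs)
      also have "\<dots> \<le> (\<Sum>n\<in>{N..<M}. C * real n powr (- (2 * s) - 1))"
      proof (rule sum_mono)
        fix n assume n: "n \<in> {N..<M}"
        have "\<bar>legendre_coeff f n * poly (legendre_poly n) x\<bar> \<le> (C * real n powr (- 2 * s - 1)) * 1"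
          unfolding abs_mult using dec[of n] N n C abs_legendre_le_1[OF x] by (intro mult_mono) auto
        then show "\<bar>legendre_coeff f n * poly (legendre_poly n) x\<bar> \<le> C * real n powr (- (2 * s) - 1)" by simp
      qed
      also have "\<dots> \<le> C * (2 powr (2 * s) / (2 * s) * real N powr (- (2 * s)))"
        unfolding sum_distrib_left[symmetric] using powr_tail_sum[of "2 * s" N M] s N C by (intro mult_left_mono) auto
      also have "\<dots> = (C * (2 powr (2 * s) / (2 * s))) * real N powr (- 2 * s)" by simp
      also have "\<dots> \<le> K * real N powr (- 2 * s)" unfolding K_def by (intro mult_right_mono) auto
      finally show "\<bar>poly (legendre_sum f M) x - poly (legendre_sum f N) x\<bar> \<le> K * real N powr (- 2 * s)" .
    qed
    ultimately show ?thesis by (rule tendsto_upperbound) simp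
  qed
  moreover have "integral {-1..1} (\<lambda>x. (f x - poly (legendre_sum f N) x)\<^sup>2) \<le> K * real N powr (- (4 * s + 2))"
    if N: "N \<ge> 2" for N
  proof -
    have b: "bounded (h ` {-1..1})" if "continuous_on {-1..1} h" for h :: "real \<Rightarrow> real"
      using that by (intro compact_imp_bounded compact_continuous_image) auto
    have "uniform_limit {-1..1} (\<lambda>M x. poly (legendre_sum f M) x - poly (legendre_sum f N) x)
        (\<lambda>x. f x - poly (legendre_sum f N) x) sequentially"
      by (intro uniform_limit_intros U)
    then have "uniform_limit {-1..1} (\<lambda>M x. (poly (legendre_sum f M) x - poly (legendre_sum f N) x) * (poly (legendre_sum f M) x - poly (legendre_sum f N) x))
        (\<lambda>x. (f x - poly (legendre_sum f N) x) * (f x - poly (legendre_sum f N) x)) sequentially"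
      by (intro uniform_lim_mult) (auto intro!: b continuous_intros cont)
    then have "(\<lambda>M. integral {-1..1} (\<lambda>x. (poly (legendre_sum f M) x - poly (legendre_sum f N) x)\<^sup>2))
        \<longlonglongrightarrow> integral {-1..1} (\<lambda>x. (f x - poly (legendre_sum f N) x)\<^sup>2)"
      unfolding power2_eq_square by (rule integral_uniform_limit) (intro continuous_intros)
    moreover have "\<forall>\<^sub>F M in sequentially. integral {-1..1} (\<lambda>x. (poly (legendre_sum f M) x - poly (legendre_sum f N) x)\<^sup>2)
        \<le> K * real N powr (- (4 * s + 2))"
    proof (rule eventually_sequentiallyI[of N])
      fix M assume "N \<le> M"
      have "integral {-1..1} (\<lambda>x. (poly (legendre_sum f M) x - poly (legendre_sum f N) x)\<^sup>2)
          = (\<Sum>n\<in>{N..<M}. (legendre_coeff f n)\<^sup>2 * (2 / (2 * real n + 1)))"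
        unfolding diff[OF \<open>N \<le> M\<close>] by (rule integral_legendre_combination_square) simp
      also have "\<dots> \<le> (\<Sum>n\<in>{N..<M}. C\<^sup>2 * real n powr (- (4 * s + 2) - 1))"
      proof (rule sum_mono)
        fix n assume n: "n \<in> {N..<M}"
        then have n2: "n \<ge> 2" using N by simp
        have "(legendre_coeff f n)\<^sup>2 \<le> (C * real n powr (- 2 * s - 1))\<^sup>2"
          using dec[OF n2] C by (subst abs_le_square_iff[symmetric]) auto
        also have "\<dots> = C\<^sup>2 * real n powr (- 4 * s - 2)"
          by (simp add: power_mult_distrib power2_eq_square flip: powr_add)
        finally have 1: "(legendre_coeff f n)\<^sup>2 \<le> C\<^sup>2 * real n powr (- 4 * s - 2)" .
        have 2: "2 / (2 * real n + 1) \<le> real n powr (-1)"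
          using n2 by (simp add: powr_minus field_simps)
        have "(legendre_coeff f n)\<^sup>2 * (2 / (2 * real n + 1)) \<le> (C\<^sup>2 * real n powr (- 4 * s - 2)) * real n powr (-1)"
          using 1 2 by (intro mult_mono) auto
        also have "\<dots> = C\<^sup>2 * real n powr (- (4 * s + 2) - 1)"
        proof -
          have "real n powr (- 4 * s - 2) * real n powr (-1) = real n powr ((- 4 * s - 2) + (-1))"
            by (rule powr_add[symmetric])
          moreover have "(- 4 * s - 2) + (-1) = - (4 * s + 2) - 1" by simp
          ultimately show ?thesis by (simp only: mult.assoc)
        qed
        finally show "(legendre_coeff f n)\<^sup>2 * (2 / (2 * real n + 1)) \<le> C\<^sup>2 * real n powr (- (4 * s + 2) - 1)" .
      qed
      also have "\<dots> \<le> C\<^sup>2 * (2 powr (4 * s + 2) / (4 * s + 2) * real N powr (- (4 * s + 2)))"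
        unfolding sum_distrib_left[symmetric] using powr_tail_sum[of "4 * s + 2" N M] s N by (intro mult_left_mono) auto
      also have "\<dots> = (C\<^sup>2 * (2 powr (4 * s + 2) / (4 * s + 2))) * real N powr (- (4 * s + 2))" by simp
      also have "\<dots> \<le> K * real N powr (- (4 * s + 2))" unfolding K_def by (intro mult_right_mono) auto
      finally show "integral {-1..1} (\<lambda>x. (poly (legendre_sum f M) x - poly (legendre_sum f N) x)\<^sup>2) \<le> K * real N powr (- (4 * s + 2))" .
    qed
    ultimately show ?thesis by (rule tendsto_upperbound) simp
  qed
  ultimately show ?thesis by blast
qed

section \<open>Polynomial approximation with prescribed endpoint values and slopes\<close>

lemma poly_antiderivative:
  fixes w :: "real poly"
  shows "\<exists>W. pderiv W = w \<and> Polynomial.degree W \<le> Polynomial.degree w + 1"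
proof -
  define W where "W = (\<Sum>i\<le>Polynomial.degree w. Polynomial.monom (Polynomial.coeff w i / real (Suc i)) (Suc i))"
  have "pderiv W = (\<Sum>i\<le>Polynomial.degree w. Polynomial.monom (Polynomial.coeff w i) i)"
  proof -
    have "pderiv (sum f A) = (\<Sum>x\<in>A. pderiv (f x))" for f :: "nat \<Rightarrow> real poly" and A
      using higher_pderiv_sum[of 1 f A] by simp
    then show ?thesis unfolding W_def
  proof (simp only:, intro sum.cong[OF refl])
    fix i
    show "pderiv (Polynomial.monom (Polynomial.coeff w i / real (Suc i)) (Suc i)) = Polynomial.monom (Polynomial.coeff w i) i"
      by (simp add: pderiv_monom del: of_nat_Suc)
  qed
  qed
  then have "pderiv W = w" by (simp add: poly_as_sum_of_monoms)
  moreover have "Polynomial.degree W \<le> Polynomial.degree w + 1"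
    unfolding W_def by (intro degree_sum_le) (auto intro: order_trans[OF degree_monom_le])
  ultimately show ?thesis by blast
qed

lemma legendre_deriv_1: "poly (pderiv (legendre_poly n)) 1 = real n * (real n + 1) / 2"
  using legendre_ode[of 1 n] by (simp add: poly_legendre_1)

lemma legendre_deriv_minus_1: "poly (pderiv (legendre_poly n)) (-1) = - ((-1) ^ n * (real n * (real n + 1)) / 2)"
  using legendre_ode[of "-1" n] by (simp add: poly_legendre_minus_1 field_simps)

lemma has_integral_pderiv: "(poly (pderiv p) has_integral (poly p 1 - poly p (-1))) {-1..1}" for p :: "real poly"
  by (rule fundamental_theorem_of_calculus)
     (auto simp: has_real_derivative_iff_has_vector_derivative[symmetric] intro: DERIV_subset[OF poly_DERIV])

lemma legendre_deriv_norm: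
  assumes "n \<ge> 1"
  shows "integral {-1..1} (\<lambda>x. (poly (pderiv (legendre_poly n)) x)\<^sup>2) = real n * (real n + 1)"
proof -
  let ?P = "legendre_poly n"
  have d: "Polynomial.degree (pderiv (pderiv ?P)) < n"
    using assms by (simp add: degree_pderiv degree_legendre)
  have "integral {-1..1} (\<lambda>x. (poly (pderiv ?P) x)\<^sup>2 + poly (pderiv (pderiv ?P)) x * poly ?P x)
      = integral {-1..1} (\<lambda>x. (poly (pderiv ?P) x)\<^sup>2) + integral {-1..1} (\<lambda>x. poly (pderiv (pderiv ?P)) x * poly ?P x)"
    by (rule integral_add) (intro integrable_continuous_real continuous_intros)+
  moreover have "integral {-1..1} (\<lambda>x. (poly (pderiv ?P) x)\<^sup>2 + poly (pderiv (pderiv ?P)) x * poly ?P x)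
      = poly (?P * pderiv ?P) 1 - poly (?P * pderiv ?P) (-1)"
  proof -
    have "(\<lambda>x. (poly (pderiv ?P) x)\<^sup>2 + poly (pderiv (pderiv ?P)) x * poly ?P x) = poly (pderiv (?P * pderiv ?P))"
      by (simp add: pderiv_mult fun_eq_iff power2_eq_square algebra_simps)
    then show ?thesis using integral_unique[OF has_integral_pderiv] by metis
  qed
  moreover have "poly (?P * pderiv ?P) 1 - poly (?P * pderiv ?P) (-1) = real n * (real n + 1)"
    by (simp add: legendre_deriv_1 legendre_deriv_minus_1 poly_legendre_1 poly_legendre_minus_1
        flip: power_add power_mult_distrib mult_2)
  ultimately show ?thesis using legendre_orthogonal_lower_degree[OF d] by simp
qed

text \<open>
  Of all polynomials of degree at most \<open>n\<close> with given endpoint values, those built from \<open>P\<^sub>n'\<close> have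
  an \<open>L\<^sup>2\<close> norm that is smaller than these values by a factor of order \<open>n\<close>.
\<close>

lemma endpoint_correction:
  fixes e1 e2 :: real
  assumes j: "j \<ge> 1"
  shows "\<exists>q. Polynomial.degree q \<le> 2 * j \<and> poly q 1 = e1 \<and> poly q (-1) = e2 \<and>
    integral {-1..1} (poly q) = 0 \<and> integral {-1..1} (\<lambda>x. (poly q x)\<^sup>2) \<le> 4 * (e1\<^sup>2 + e2\<^sup>2) / (real j)\<^sup>2"
proof -
  define J where "J = real j"
  have J: "J \<ge> 1" using j by (simp add: J_def)
  \<comment> \<open>\<open>A\<close> and \<open>B\<close> are the values at 1 of the derivatives of
    the Legendre polynomials of degree 2 j and 2 j + 1.\<close>
  define A where "A = J * (2 * J + 1)"
  define B where "B = (2 * J + 1) * (J + 1)"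
  have A: "A \<ge> 2 * J\<^sup>2" "A > 0" using J by (auto simp: A_def power2_eq_square algebra_simps intro: add_pos_pos)
  have B: "B \<ge> 2 * J\<^sup>2" "B \<ge> 6"
  proof -
    show "B \<ge> 2 * J\<^sup>2" using J by (simp add: B_def power2_eq_square algebra_simps)
    have "3 * 2 \<le> B" unfolding B_def using J by (intro mult_mono) auto
    then show "B \<ge> 6" by simp
  qed
  define a where "a = (e1 - e2) / 2 / A"
  define b where "b = (e1 + e2) / 2 / (B - 1)"
  \<comment> \<open>An odd and an even polynomial match the odd and the even part of the endpoint
    data. Subtracting 1 from the even one removes its mean, since the derivative integrates to P(1)
    - P(-1) = 2.\<close>
  let ?E = "pderiv (legendre_poly (2 * j))" and ?O = "pderiv (legendre_poly (2 * j + 1)) - 1"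
  define q where "q = Polynomial.smult a ?E + Polynomial.smult b ?O"
  have E1: "poly ?E 1 = A" "poly ?E (-1) = - A"
    by (simp_all add: legendre_deriv_1 legendre_deriv_minus_1 A_def J_def)
  have O1: "poly ?O 1 = B - 1" "poly ?O (-1) = B - 1"
    by (simp_all add: legendre_deriv_1 legendre_deriv_minus_1 B_def J_def field_simps)
  have deg: "Polynomial.degree q \<le> 2 * j"
    unfolding q_def
    by (intro degree_add_le order_trans[OF degree_smult_le] degree_diff_le)
       (auto simp: degree_pderiv degree_legendre)
  have Ei: "integral {-1..1} (poly ?E) = 0"
    using integral_unique[OF has_integral_pderiv[of "legendre_poly (2 * j)"]]
    by (simp add: poly_legendre_1 poly_legendre_minus_1)
  have Oi1: "integral {-1..1} (poly (pderiv (legendre_poly (2 * j + 1)))) = 2"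
    using integral_unique[OF has_integral_pderiv[of "legendre_poly (2 * j + 1)"]]
    by (simp add: poly_legendre_1 poly_legendre_minus_1)
  have Oi: "integral {-1..1} (poly ?O) = 0"
  proof -
    have "integral {-1..1} (\<lambda>x. poly (pderiv (legendre_poly (2 * j + 1))) x - 1)
        = integral {-1..1} (poly (pderiv (legendre_poly (2 * j + 1)))) - integral {-1..1} (\<lambda>x::real. 1::real)"
      by (rule integral_diff) (auto intro: integrable_poly)
    moreover have "poly ?O = (\<lambda>x. poly (pderiv (legendre_poly (2 * j + 1))) x - 1)" by (simp add: fun_eq_iff)
    ultimately show ?thesis using Oi1 by (simp only:) simp
  qed
  have qi: "integral {-1..1} (poly q) = 0"
  proof -
    have "integral {-1..1} (\<lambda>x. a * poly ?E x + b * poly ?O x)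
        = integral {-1..1} (\<lambda>x. a * poly ?E x) + integral {-1..1} (\<lambda>x. b * poly ?O x)"
      by (rule integral_add) (intro integrable_continuous_real continuous_intros)+
    also have "\<dots> = 0" by (simp only: integral_mult_right Ei Oi)
    finally have i0: "integral {-1..1} (\<lambda>x. a * poly ?E x + b * poly ?O x) = 0" .
    have "poly q = (\<lambda>x. a * poly ?E x + b * poly ?O x)" by (simp add: q_def fun_eq_iff)
    then show ?thesis using i0 by (simp only:)
  qed
  have q1: "poly q 1 = e1" "poly q (-1) = e2"
  proof -
    have "a * A = (e1 - e2) / 2" using A by (simp add: a_def)
    moreover have "B - 1 \<noteq> 0" using B by simp
    from nonzero_eq_divide_eq[OF this, THEN iffD1, OF b_def] have "b * (B - 1) = (e1 + e2) / 2" .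
    ultimately show "poly q 1 = e1" "poly q (-1) = e2"
      unfolding q_def poly_add poly_smult E1 O1 by (auto simp: field_simps)
  qed
  have nE: "integral {-1..1} (\<lambda>x. (poly ?E x)\<^sup>2) = 2 * A"
    using legendre_deriv_norm[of "2 * j"] j by (simp add: A_def J_def)
  have nO: "integral {-1..1} (\<lambda>x. (poly ?O x)\<^sup>2) \<le> 2 * B"
  proof -
    let ?D = "pderiv (legendre_poly (2 * j + 1))"
    have "integral {-1..1} (\<lambda>x. (poly ?O x)\<^sup>2) = integral {-1..1} (\<lambda>x. (poly ?D x)\<^sup>2 + (1 - 2 * poly ?D x))"
      by (simp add: power2_eq_square algebra_simps)
    also have "\<dots> = integral {-1..1} (\<lambda>x. (poly ?D x)\<^sup>2) + integral {-1..1} (\<lambda>x. 1 - 2 * poly ?D x)"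
      by (rule integral_add) (intro integrable_continuous_real continuous_intros)+
    also have "integral {-1..1} (\<lambda>x. 1 - 2 * poly ?D x) = integral {-1..1} (\<lambda>x::real. 1) - integral {-1..1} (\<lambda>x. 2 * poly ?D x)"
      by (rule integral_diff) (intro integrable_continuous_real continuous_intros)+
    also have "integral {-1..1} (\<lambda>x. 2 * poly ?D x) = 4" using Oi1 by simp
    also have "integral {-1..1} (\<lambda>x. (poly ?D x)\<^sup>2) = 2 * B"
      using legendre_deriv_norm[of "2 * j + 1"] by (simp add: B_def J_def algebra_simps)
    finally show ?thesis by simp
  qed
  have "integral {-1..1} (\<lambda>x. (poly q x)\<^sup>2)
      \<le> integral {-1..1} (\<lambda>x. 2 * a\<^sup>2 * (poly ?E x)\<^sup>2 + 2 * b\<^sup>2 * (poly ?O x)\<^sup>2)"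
  proof (rule integral_le)
    fix x
    have "(u + v)\<^sup>2 \<le> 2 * u\<^sup>2 + 2 * v\<^sup>2" for u v :: real
      using sum_squares_bound[of u v] by (simp add: power2_sum)
    from this[of "a * poly ?E x" "b * poly ?O x"]
    show "(poly q x)\<^sup>2 \<le> 2 * a\<^sup>2 * (poly ?E x)\<^sup>2 + 2 * b\<^sup>2 * (poly ?O x)\<^sup>2"
      by (simp add: q_def power_mult_distrib)
  qed (intro integrable_continuous_real continuous_intros)+
  also have "\<dots> = integral {-1..1} (\<lambda>x. 2 * a\<^sup>2 * (poly ?E x)\<^sup>2) + integral {-1..1} (\<lambda>x. 2 * b\<^sup>2 * (poly ?O x)\<^sup>2)"
    by (rule integral_add) (intro integrable_continuous_real continuous_intros)+
  also have "\<dots> = 2 * a\<^sup>2 * (2 * A) + 2 * b\<^sup>2 * integral {-1..1} (\<lambda>x. (poly ?O x)\<^sup>2)"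
    unfolding integral_mult_right nE ..
  also have "\<dots> \<le> 2 * a\<^sup>2 * (2 * A) + 2 * b\<^sup>2 * (2 * B)"
    using nO by (intro add_left_mono mult_left_mono) auto
  also have "2 * a\<^sup>2 * (2 * A) = (e1 - e2)\<^sup>2 / A"
    using A by (simp add: a_def power2_eq_square field_simps)
  also have "\<dots> \<le> (e1 - e2)\<^sup>2 / (2 * J\<^sup>2)"
    using A J by (intro divide_left_mono mult_pos_pos) auto
  also have "2 * b\<^sup>2 * (2 * B) = (e1 + e2)\<^sup>2 * (B / (B - 1)\<^sup>2)"
  proof -
    have "2 * (u / 2 / v)\<^sup>2 * (2 * w) = u\<^sup>2 * (w / v\<^sup>2)" for u v w :: real
      by (cases "v = 0") (simp_all add: power2_eq_square field_simps)
    then show ?thesis unfolding b_def .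
  qed
  \<comment> \<open>For B \<ge> 6, replacing B - 1 by B changes the square by at most a factor
    2.\<close>
  also have "\<dots> \<le> (e1 + e2)\<^sup>2 * (2 / B)"
  proof -
    have "B * B \<le> 2 * (B - 1)\<^sup>2"
    proof -
      have "2 * (B - 1)\<^sup>2 - B * B = B * (B - 4) + 2" by (simp add: power2_eq_square algebra_simps)
      moreover have "B * (B - 4) \<ge> 0" using B by simp
      ultimately show ?thesis by linarith
    qed
    then have "B / (B - 1)\<^sup>2 \<le> 2 / B" using B by (simp add: divide_simps)
    then show ?thesis by (intro mult_left_mono) auto
  qed
  also have "\<dots> \<le> (e1 + e2)\<^sup>2 * (2 / (2 * J\<^sup>2))"
    using B J by (intro mult_left_mono divide_left_mono mult_pos_pos) auto
  also have "(e1 - e2)\<^sup>2 / (2 * J\<^sup>2) + (e1 + e2)\<^sup>2 * (2 / (2 * J\<^sup>2)) \<le> 4 * (e1\<^sup>2 + e2\<^sup>2) / J\<^sup>2"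
  proof -
    have "(e1 - e2)\<^sup>2 / (2 * J\<^sup>2) + (e1 + e2)\<^sup>2 * (2 / (2 * J\<^sup>2)) = ((e1 - e2)\<^sup>2 / 2 + (e1 + e2)\<^sup>2) / J\<^sup>2"
      using J by (simp add: field_simps)
    moreover have "(e1 - e2)\<^sup>2 / 2 + (e1 + e2)\<^sup>2 \<le> 4 * (e1\<^sup>2 + e2\<^sup>2)"
    proof -
      have "4 * (e1\<^sup>2 + e2\<^sup>2) - ((e1 - e2)\<^sup>2 / 2 + (e1 + e2)\<^sup>2) = 2 * e1\<^sup>2 + 2 * e2\<^sup>2 + (e1 - e2)\<^sup>2 / 2"
        by (simp add: power2_eq_square algebra_simps)
      moreover have "0 \<le> 2 * e1\<^sup>2 + 2 * e2\<^sup>2 + (e1 - e2)\<^sup>2 / 2" by simp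
      ultimately show ?thesis by linarith
    qed
    ultimately show ?thesis using J by (simp add: divide_right_mono)
  qed
  finally have "integral {-1..1} (\<lambda>x. (poly q x)\<^sup>2) \<le> 4 * (e1\<^sup>2 + e2\<^sup>2) / (real j)\<^sup>2" by (simp add: J_def)
  with deg q1 qi show ?thesis by blast
qed

text \<open>The weighted bound concerns the open interval only; continuity extends it to the
  endpoints, where the weight vanishes because \<open>s\<close> is positive.\<close>

lemma wreg_closed_bound:
  assumes W: "wreg {-1<..<1} s m f" and s: "s > 0" and cont: "continuous_on {-1..1} f"
  shows "f (-1) = 0" "f 1 = 0"
proof -
  obtain C where C: "C > 0" "\<And>x. x \<in> {-1<..<1} \<Longrightarrow> \<bar>f x\<bar> \<le> C * (1 - x\<^sup>2) powr s"
    using wreg_bounded_pos[OF W] by blast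
  have b: "\<bar>f x\<bar> - C * (1 - x\<^sup>2) powr s \<le> 0" if "x \<in> {-1..1}" for x
  proof (rule continuous_le_on_closure[of "{-1<..<1::real}" "\<lambda>x. \<bar>f x\<bar> - C * (1 - x\<^sup>2) powr s"])
    have "continuous_on {-1..1} (\<lambda>x::real. (1 - x\<^sup>2) powr s)"
      by (rule continuous_on_powr') (auto intro!: continuous_intros simp: s abs_square_le_1 abs_le_iff)
    then have "continuous_on {-1..1} (\<lambda>x. \<bar>f x\<bar> - C * (1 - x\<^sup>2) powr s)"
      by (intro continuous_on_diff continuous_on_mult continuous_on_const continuous_on_rabs cont)
    then show "continuous_on (closure {-1<..<1}) (\<lambda>x. \<bar>f x\<bar> - C * (1 - x\<^sup>2) powr s)" by simp
    show "x \<in> closure {-1<..<1}" using that by simp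
    show "\<bar>f x\<bar> - C * (1 - x\<^sup>2) powr s \<le> 0" if "x \<in> {-1<..<1}" for x using C(2)[OF that] by simp
  qed
  from b[of 1] b[of "-1"] show "f (-1) = 0" "f 1 = 0" by auto
qed

text \<open>The approximation is \<open>H\<close> plus the truncated series of u - H plus an
  endpoint correction. The endpoint errors are O(N^(-2 s)), so the squared norm of the correction is
  O(N^(-4 s - 2)), like that of the truncation error. The mean is exact because the series contains
  its constant term and the correction has mean 0; this later makes the antiderivative fit at both
  ends.\<close>

lemma constrained_approximation:
  assumes W: "wreg {-1<..<1} s (Suc (2 * k)) (\<lambda>x. u x - poly H x)" and k: "s + 1 < real k" and s: "s > 0"
    and cont: "continuous_on {-1..1} u"
  shows "\<exists>K. \<forall>\<^sub>F N in sequentially. \<exists>w. Polynomial.degree w \<le> N \<and> poly w 1 = u 1 \<and> poly w (-1) = u (-1) \<and>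
     integral {-1..1} (poly w) = integral {-1..1} u \<and>
     integral {-1..1} (\<lambda>x. (u x - poly w x)\<^sup>2) \<le> K * real N powr (- (4 * s + 2))"
proof -
  define f where "f = (\<lambda>x. u x - poly H x)"
  have cf: "continuous_on {-1..1} f" unfolding f_def by (intro continuous_intros cont)
  have Wf: "wreg {-1<..<1} s (Suc (2 * k)) f" using W by (simp add: f_def)
  note ends = wreg_closed_bound[OF Wf s cf]
  obtain C0 where C0: "C0 \<ge> 0" "\<And>n. n \<ge> 2 \<Longrightarrow> \<bar>integral {-1..1} (\<lambda>x. f x * poly (legendre_poly n) x)\<bar> \<le> C0 * real n powr (- 2 * s - 2)"
    using legendre_coefficient_decay[OF Wf k s cf ends] by blast
  have dec: "\<bar>legendre_coeff f n\<bar> \<le> (2 * C0) * real n powr (- 2 * s - 1)" if n: "n \<ge> 2" for n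
  proof -
    have "\<bar>legendre_coeff f n\<bar> \<le> (2 * real n) * (C0 * real n powr (- 2 * s - 2))"
      unfolding legendre_coeff_def abs_mult using C0(2)[OF n] n by (intro mult_mono) auto
    also have "\<dots> = (2 * C0) * (real n * real n powr (- 2 * s - 2))" by simp
    also have "real n * real n powr (- 2 * s - 2) = real n powr (1 + (- 2 * s - 2))"
      by (rule powr_mult_base) simp
    also have "1 + (- 2 * s - 2) = - 2 * s - 1" by simp
    finally show ?thesis .
  qed
  have "2 * C0 \<ge> 0" using C0 by simp
  from legendre_tail[OF cf s this dec] obtain K where
    K: "\<And>N x. N \<ge> 2 \<Longrightarrow> x \<in> {-1..1} \<Longrightarrow> \<bar>f x - poly (legendre_sum f N) x\<bar> \<le> K * real N powr (- 2 * s)"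
       "\<And>N. N \<ge> 2 \<Longrightarrow> integral {-1..1} (\<lambda>x. (f x - poly (legendre_sum f N) x)\<^sup>2) \<le> K * real N powr (- (4 * s + 2))"
    by blast
  \<comment> \<open>The factors 2 come from (a - b)^2 \<le> 2 a^2 + 2 b^2, the 4 from
    \<open>endpoint_correction\<close>, and the 16 from 4 j \<ge> N.\<close>
  define K' where "K' = 2 * K + 2 * (4 * (K\<^sup>2 + K\<^sup>2) * 16)"
  have "\<exists>w. Polynomial.degree w \<le> N \<and> poly w 1 = u 1 \<and> poly w (-1) = u (-1) \<and>
     integral {-1..1} (poly w) = integral {-1..1} u \<and>
     integral {-1..1} (\<lambda>x. (u x - poly w x)\<^sup>2) \<le> K' * real N powr (- (4 * s + 2))"
    if N: "N \<ge> max 2 (Polynomial.degree H)" for N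
  proof -
    define S where "S = legendre_sum f N"
    define r where "r = (\<lambda>x. f x - poly S x)"
    have cr: "continuous_on {-1..1} r" unfolding r_def by (intro continuous_intros cf)
    define j where "j = N div 2"
    have N2: "N \<ge> 2" using N by simp
    have j: "j \<ge> 1" "4 * j \<ge> N" "2 * j \<le> N" using N2 unfolding j_def by linarith+
    obtain q where q: "Polynomial.degree q \<le> 2 * j" "poly q 1 = r 1" "poly q (-1) = r (-1)"
        "integral {-1..1} (poly q) = 0" "integral {-1..1} (\<lambda>x. (poly q x)\<^sup>2) \<le> 4 * ((r 1)\<^sup>2 + (r (-1))\<^sup>2) / (real j)\<^sup>2"
      using endpoint_correction[OF j(1), of "r 1" "r (-1)"] by blast
    define w where "w = H + S + q"
    have uw: "u x - poly w x = r x - poly q x" for x by (simp add: w_def r_def f_def)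
    have "Polynomial.degree S \<le> N" using degree_legendre_sum[of N f] N2 by (simp add: S_def)
    then have deg: "Polynomial.degree w \<le> N" unfolding w_def using N q(1) j(3) by (intro degree_add_le) auto
    have w1: "poly w 1 = u 1" "poly w (-1) = u (-1)" using uw[of 1] uw[of "-1"] q(2,3) by auto
    have r0: "integral {-1..1} r = 0"
    proof -
      have "integral {-1..1} (\<lambda>x. poly S x * poly (legendre_poly 0) x) = legendre_coeff f 0 * 2"
        unfolding S_def poly_legendre_sum integral_legendre_combination[OF finite_lessThan] using N2 by simp
      then have "integral {-1..1} (poly S) = integral {-1..1} f"
        by (simp add: legendre_coeff_def legendre_poly_def)
      moreover have "integral {-1..1} r = integral {-1..1} f - integral {-1..1} (poly S)"
        unfolding r_def by (rule integral_diff) (intro integrable_continuous_real continuous_intros cf)+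
      ultimately show ?thesis by simp
    qed
    have wi: "integral {-1..1} (poly w) = integral {-1..1} u"
    proof -
      have "integral {-1..1} (\<lambda>x. u x - poly w x) = integral {-1..1} u - integral {-1..1} (poly w)"
        by (rule integral_diff) (intro integrable_continuous_real continuous_intros cont)+
      moreover have "integral {-1..1} (\<lambda>x. u x - poly w x) = integral {-1..1} r - integral {-1..1} (poly q)"
        unfolding uw by (rule integral_diff) (intro integrable_continuous_real continuous_intros cr)+
      ultimately show ?thesis using r0 q(4) by simp
    qed
    have re: "(r x)\<^sup>2 \<le> K\<^sup>2 * real N powr (- 4 * s)" if "x \<in> {-1..1}" for x
    proof -
      have b: "\<bar>r x\<bar> \<le> K * real N powr (- 2 * s)" using K(1)[OF N2 that] by (simp add: r_def S_def)
      then have "\<bar>r x\<bar> ^ 2 \<le> (K * real N powr (- 2 * s)) ^ 2" by (rule power_mono) simp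
      also have "\<dots> = K\<^sup>2 * real N powr (- 4 * s)" by (simp add: power_mult_distrib power2_eq_square flip: powr_add)
      finally show ?thesis by simp
    qed
    have "4 * ((r 1)\<^sup>2 + (r (-1))\<^sup>2) / (real j)\<^sup>2
        \<le> 4 * (K\<^sup>2 * real N powr (- 4 * s) + K\<^sup>2 * real N powr (- 4 * s)) * (16 * real N powr (-2))"
    proof -
      have "(real N)\<^sup>2 \<le> (4 * real j)\<^sup>2" using j(2) by (intro power_mono) auto
      then have "1 / (real j)\<^sup>2 \<le> 16 / (real N)\<^sup>2" using j(1) N2 by (simp add: field_simps)
      also have "\<dots> = 16 * real N powr (-2)" using N2 by (simp add: powr_minus powr_numeral divide_inverse)
      finally have 1: "1 / (real j)\<^sup>2 \<le> 16 * real N powr (-2)" .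
      have "4 * ((r 1)\<^sup>2 + (r (-1))\<^sup>2) * (1 / (real j)\<^sup>2)
        \<le> 4 * (K\<^sup>2 * real N powr (- 4 * s) + K\<^sup>2 * real N powr (- 4 * s)) * (16 * real N powr (-2))"
        using 1 re[of 1] re[of "-1"] by (intro mult_mono) auto
      then show ?thesis by simp
    qed
    also have "\<dots> = 4 * (K\<^sup>2 + K\<^sup>2) * 16 * (real N powr (- 4 * s) * real N powr (-2))" by (simp add: algebra_simps)
    also have "real N powr (- 4 * s) * real N powr (-2) = real N powr (- (4 * s + 2))"
      by (simp flip: powr_add)
    finally have q2: "integral {-1..1} (\<lambda>x. (poly q x)\<^sup>2) \<le> 4 * (K\<^sup>2 + K\<^sup>2) * 16 * real N powr (- (4 * s + 2))"
      using q(5) by linarith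
    have "integral {-1..1} (\<lambda>x. (u x - poly w x)\<^sup>2) \<le> integral {-1..1} (\<lambda>x. 2 * (r x)\<^sup>2 + 2 * (poly q x)\<^sup>2)"
      unfolding uw
    proof (rule integral_le)
      fix x
      have "(a - b)\<^sup>2 \<le> 2 * a\<^sup>2 + 2 * b\<^sup>2" for a b :: real
      proof -
        have "2 * a\<^sup>2 + 2 * b\<^sup>2 - (a - b)\<^sup>2 = (a + b)\<^sup>2" by (simp add: power2_eq_square algebra_simps)
        moreover have "0 \<le> (a + b)\<^sup>2" by simp
        ultimately show ?thesis by linarith
      qed
      then show "(r x - poly q x)\<^sup>2 \<le> 2 * (r x)\<^sup>2 + 2 * (poly q x)\<^sup>2" .
    qed (intro integrable_continuous_real continuous_intros cr)+
    also have "\<dots> = integral {-1..1} (\<lambda>x. 2 * (r x)\<^sup>2) + integral {-1..1} (\<lambda>x. 2 * (poly q x)\<^sup>2)"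
      by (rule integral_add) (intro integrable_continuous_real continuous_intros cr)+
    also have "\<dots> = 2 * integral {-1..1} (\<lambda>x. (r x)\<^sup>2) + 2 * integral {-1..1} (\<lambda>x. (poly q x)\<^sup>2)"
      by simp
    also have "\<dots> \<le> 2 * (K * real N powr (- (4 * s + 2))) + 2 * (4 * (K\<^sup>2 + K\<^sup>2) * 16 * real N powr (- (4 * s + 2)))"
      using K(2)[OF N2] q2 by (intro add_mono mult_left_mono) (auto simp: r_def S_def)
    also have "\<dots> = K' * real N powr (- (4 * s + 2))" by (simp add: K'_def algebra_simps)
    finally show ?thesis using deg w1 wi by blast
  qed
  then show ?thesis by (intro exI[of _ K'] eventually_sequentiallyI) blast
qed

text \<open>An antiderivative of the approximation of y' is fixed by the value at -1 and attains the
  right value at 1 because the means agree. With values and slopes exact at both ends it satisfies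
  every boundary condition that \<open>y\<close> does.\<close>

lemma c1_approximation:
  assumes W: "wreg {-1<..<1} s (Suc (2 * k)) (\<lambda>x. y' x - poly H x)" and k: "s + 1 < real k" and s: "s > 0"
    and cont: "continuous_on {-1..1} y'"
    and der: "\<And>x. x \<in> {-1..1} \<Longrightarrow> (y has_real_derivative y' x) (at x within {-1..1})"
  shows "\<exists>K. \<forall>\<^sub>F N in sequentially. \<exists>v. Polynomial.degree v \<le> N + 1 \<and> poly v 1 = y 1 \<and> poly v (-1) = y (-1) \<and>
     poly (pderiv v) 1 = y' 1 \<and> poly (pderiv v) (-1) = y' (-1) \<and>
     integral {-1..1} (\<lambda>x. (y' x - poly (pderiv v) x)\<^sup>2) \<le> K * real N powr (- (4 * s + 2))"
proof -
  obtain K where K: "\<forall>\<^sub>F N in sequentially. \<exists>w. Polynomial.degree w \<le> N \<and> poly w 1 = y' 1 \<and> poly w (-1) = y' (-1) \<and>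
     integral {-1..1} (poly w) = integral {-1..1} y' \<and>
     integral {-1..1} (\<lambda>x. (y' x - poly w x)\<^sup>2) \<le> K * real N powr (- (4 * s + 2))"
    using constrained_approximation[OF W k s cont] by blast
  have Iy: "integral {-1..1} y' = y 1 - y (-1)"
    by (intro integral_unique fundamental_theorem_of_calculus)
       (auto simp: has_real_derivative_iff_has_vector_derivative[symmetric] intro: der)
  show ?thesis
  proof (intro exI[of _ K] eventually_mono[OF K])
    fix N assume "\<exists>w. Polynomial.degree w \<le> N \<and> poly w 1 = y' 1 \<and> poly w (-1) = y' (-1) \<and>
     integral {-1..1} (poly w) = integral {-1..1} y' \<and>
     integral {-1..1} (\<lambda>x. (y' x - poly w x)\<^sup>2) \<le> K * real N powr (- (4 * s + 2))"
    then obtain w where w: "Polynomial.degree w \<le> N" "poly w 1 = y' 1" "poly w (-1) = y' (-1)"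
     "integral {-1..1} (poly w) = integral {-1..1} y'"
     "integral {-1..1} (\<lambda>x. (y' x - poly w x)\<^sup>2) \<le> K * real N powr (- (4 * s + 2))" by blast
    obtain V where V: "pderiv V = w" "Polynomial.degree V \<le> Polynomial.degree w + 1"
      using poly_antiderivative by blast
    define v where "v = V - [:poly V (-1) - y (-1):]"
    have dv: "pderiv v = w" by (simp add: v_def pderiv_diff V pderiv_pCons)
    have "Polynomial.degree v \<le> N + 1" unfolding v_def using V(2) w(1) by (intro degree_diff_le) auto
    moreover have vm: "poly v (-1) = y (-1)" by (simp add: v_def)
    moreover have "poly v 1 = y 1"
      using integral_unique[OF has_integral_pderiv[of v]] w(4) Iy vm by (simp add: dv)
    ultimately show "\<exists>v. Polynomial.degree v \<le> N + 1 \<and> poly v 1 = y 1 \<and> poly v (-1) = y (-1) \<and>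
     poly (pderiv v) 1 = y' 1 \<and> poly (pderiv v) (-1) = y' (-1) \<and>
     integral {-1..1} (\<lambda>x. (y' x - poly (pderiv v) x)\<^sup>2) \<le> K * real N powr (- (4 * s + 2))"
      using w dv by (intro exI[of _ v]) simp
  qed
qed

section \<open>The energy form\<close>

definition c1_fun :: "(real \<Rightarrow> real) \<Rightarrow> (real \<Rightarrow> real) \<Rightarrow> bool" where
  "c1_fun f f' \<longleftrightarrow> (\<forall>x\<in>{-1..1}. (f has_real_derivative f' x) (at x within {-1..1})) \<and> continuous_on {-1..1} f'"

lemma c1_fun_continuous:
  assumes "c1_fun f f'"
  shows "continuous_on {-1..1} f" "continuous_on {-1..1} f'"
  using assms DERIV_continuous continuous_on_eq_continuous_within unfolding c1_fun_def by blast+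

lemma c1_fun_poly: "c1_fun (poly p) (poly (pderiv p))"
  unfolding c1_fun_def by (auto intro!: DERIV_subset[OF poly_DERIV] continuous_intros)

lemma c1_fun_add: "c1_fun f f' \<Longrightarrow> c1_fun g g' \<Longrightarrow> c1_fun (\<lambda>x. f x + g x) (\<lambda>x. f' x + g' x)"
  unfolding c1_fun_def by (auto intro!: DERIV_add continuous_intros)

lemma c1_fun_scale: "c1_fun f f' \<Longrightarrow> c1_fun (\<lambda>x. t * f x) (\<lambda>x. t * f' x)"
  unfolding c1_fun_def by (auto intro!: DERIV_cmult continuous_intros)

lemma c1_fun_diff: "c1_fun f f' \<Longrightarrow> c1_fun g g' \<Longrightarrow> c1_fun (\<lambda>x. f x - g x) (\<lambda>x. f' x - g' x)"
  unfolding c1_fun_def by (auto intro!: DERIV_diff continuous_intros)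

lemma c1_fun_sum:
  assumes "finite I" "\<And>i. i \<in> I \<Longrightarrow> c1_fun (f i) (f' i)"
  shows "c1_fun (\<lambda>x. \<Sum>i\<in>I. c i * f i x) (\<lambda>x. \<Sum>i\<in>I. c i * f' i x)"
  using assms
proof (induction I rule: finite_induct)
  case empty
  show ?case by (simp add: c1_fun_def)
next
  case (insert x F)
  then show ?case by (simp add: c1_fun_add c1_fun_scale)
qed

lemma c1_fun_interior:
  assumes "c1_fun f f'" "x \<in> {-1<..<1}"
  shows "(f has_real_derivative f' x) (at x)"
proof -
  have "(f has_real_derivative f' x) (at x within {-1..1})" using assms unfolding c1_fun_def by auto
  then show ?thesis using assms(2) at_within_interior[of x "{-1..1}"] by simp
qed

lemma ip_integrable:
  fixes f g :: "real \<Rightarrow> real"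
  assumes "continuous_on {-1..1} f" "continuous_on {-1..1} g"
  shows "(\<lambda>x. f x * g x) integrable_on {-1..1::real}"
  using assms by (intro integrable_continuous_real continuous_intros)

lemma ip_add_right:
  assumes "continuous_on {-1..1} f" "continuous_on {-1..1} g" "continuous_on {-1..1} h"
  shows "ip f (\<lambda>x. g x + h x) = ip f g + ip f h"
  unfolding ip_def distrib_left by (rule integral_add) (intro ip_integrable assms)+

lemma ip_scale_right: "ip f (\<lambda>x. t * g x) = t * ip f g"
proof -
  have "(\<lambda>x. f x * (t * g x)) = (\<lambda>x. t * (f x * g x))" by (simp add: mult_ac)
  then show ?thesis unfolding ip_def by simp
qed

lemma ip_add_left:
  assumes "continuous_on {-1..1} f" "continuous_on {-1..1} g" "continuous_on {-1..1} h"
  shows "ip (\<lambda>x. g x + h x) f = ip g f + ip h f"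
  unfolding ip_commute[of "\<lambda>x. g x + h x" f] ip_commute[of g f] ip_commute[of h f]
  by (rule ip_add_right[OF assms])

lemma ip_scale_left: "ip (\<lambda>x. t * g x) f = t * ip g f"
  unfolding ip_commute[of "\<lambda>x. t * g x" f] ip_commute[of g f] by (rule ip_scale_right)

lemma ip_sum_right:
  assumes "finite I" "continuous_on {-1..1} f" "\<And>i. i \<in> I \<Longrightarrow> continuous_on {-1..1} (g i)"
  shows "ip f (\<lambda>x. \<Sum>i\<in>I. c i * g i x) = (\<Sum>i\<in>I. c i * ip f (g i))"
proof -
  have "ip f (\<lambda>x. \<Sum>i\<in>I. c i * g i x) = ip (\<lambda>x. \<Sum>i\<in>I. c i * g i x) f" by (rule ip_commute)
  also have "\<dots> = (\<Sum>i\<in>I. c i * ip (g i) f)"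
    by (rule ip_sum_left[OF assms(1) ip_integrable[OF assms(3) assms(2)]])
  also have "\<dots> = (\<Sum>i\<in>I. c i * ip f (g i))"
    by (intro sum.cong refl) (subst ip_commute, rule refl)
  finally show ?thesis .
qed

lemma ip_nonneg:
  assumes "continuous_on {-1..1} f"
  shows "ip f f \<ge> 0"
  unfolding ip_def by (intro integral_nonneg ip_integrable assms) auto

lemma ip_cauchy_schwarz:
  assumes f: "continuous_on {-1..1} f" and g: "continuous_on {-1..1} g"
  shows "(ip f g)\<^sup>2 \<le> ip f f * ip g g"
proof -
  have q: "0 \<le> ip f f - 2 * t * ip f g + t\<^sup>2 * ip g g" for t
  proof -
    let ?h = "\<lambda>x. f x + (- t) * g x"
    have ch: "continuous_on {-1..1} ?h" by (intro continuous_intros f g)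
    have cg: "continuous_on {-1..1} (\<lambda>x. (- t) * g x)" by (intro continuous_intros g)
    have e: "ip k ?h = ip k f + (- t) * ip k g" if "continuous_on {-1..1} k" for k
      by (simp only: ip_add_right[OF that f cg] ip_scale_right)
    have "ip ?h ?h = ip f f + (- t) * ip f g + (- t) * (ip f g + (- t) * ip g g)"
      unfolding e[OF ch] unfolding ip_commute[of ?h] e[OF f] e[OF g] ip_commute[of g f] by simp
    also have "\<dots> = ip f f - 2 * t * ip f g + t\<^sup>2 * ip g g" by (simp add: power2_eq_square algebra_simps)
    finally show ?thesis using ip_nonneg[OF ch] by simp
  qed
  show ?thesis
  proof (cases "ip g g = 0")
    case True
    have "ip f g = 0"
    proof (rule ccontr)
      assume n: "ip f g \<noteq> 0"
      \<comment> \<open>The quadratic is linear in \<open>t\<close> here, and this \<open>t\<close>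
        would give it the value -1.\<close>
      have "0 \<le> ip f f - 2 * ((ip f f + 1) / (2 * ip f g)) * ip f g" using q[of "(ip f f + 1) / (2 * ip f g)"] True by simp
      also have "\<dots> = -1" using n by (simp add: field_simps)
      finally show False by simp
    qed
    then show ?thesis using True by simp
  next
    case False
    then have p: "ip g g > 0" using ip_nonneg[OF g] by simp
    have "0 \<le> ip f f - 2 * (ip f g / ip g g) * ip f g + (ip f g / ip g g)\<^sup>2 * ip g g" by (rule q)
    also have "\<dots> = ip f f - (ip f g)\<^sup>2 / ip g g" using p by (simp add: power2_eq_square field_simps)
    finally show ?thesis using p by (simp add: field_simps)
  qed
qed

text \<open>The squares f(x)^2 and f(t)^2 differ by at most the integral of |2 f f'|. Averaging over
  t and applying Young's inequality leaves a free weight \<open>e\<close>; a small one lets the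
  derivative term absorb point values and the potential.\<close>

lemma sup_bound:
  assumes f: "c1_fun f f'" and e: "e > 0" and x: "x \<in> {-1..1}"
  shows "(f x)\<^sup>2 \<le> e * ip f' f' + (1/2 + 1/e) * ip f f"
proof -
  note cf = c1_fun_continuous[OF f]
  have cont: "continuous_on {-1..1} (\<lambda>x. \<bar>2 * (f x * f' x)\<bar>)" by (intro continuous_intros cf)
  define I where "I = integral {-1..1} (\<lambda>x. \<bar>2 * (f x * f' x)\<bar>)"
  have sub: "\<bar>(f b)\<^sup>2 - (f a)\<^sup>2\<bar> \<le> I" if ab: "-1 \<le> a" "a \<le> b" "b \<le> 1" for a b
  proof -
    have s: "{a..b} \<subseteq> {-1..1}" using ab by auto
    have "((\<lambda>x. 2 * (f x * f' x)) has_integral ((f b)\<^sup>2 - (f a)\<^sup>2)) {a..b}"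
    proof (rule fundamental_theorem_of_calculus[OF ab(2)])
      fix x assume "x \<in> {a..b}"
      then have "(f has_real_derivative f' x) (at x within {a..b})"
        using f s unfolding c1_fun_def by (blast intro: DERIV_subset)
      then have "((\<lambda>x. (f x)\<^sup>2) has_real_derivative 2 * (f x * f' x)) (at x within {a..b})"
        by (auto intro!: derivative_eq_intros)
      then show "((\<lambda>x. (f x)\<^sup>2) has_vector_derivative 2 * (f x * f' x)) (at x within {a..b})"
        by (simp add: has_real_derivative_iff_has_vector_derivative)
    qed
    then have "(f b)\<^sup>2 - (f a)\<^sup>2 = integral {a..b} (\<lambda>x. 2 * (f x * f' x))" by (simp only: integral_unique)
    also have "norm \<dots> \<le> integral {a..b} (\<lambda>x. \<bar>2 * (f x * f' x)\<bar>)"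
      using s by (intro integral_norm_bound_integral integrable_continuous_real continuous_on_subset[OF cont]
          continuous_intros continuous_on_subset[OF cf(1)] continuous_on_subset[OF cf(2)]) auto
    also have "\<dots> \<le> I" unfolding I_def
      using s by (intro integral_subset_le integrable_continuous_real continuous_on_subset[OF cont] cont) auto
    finally show ?thesis by simp
  qed
  have dif: "(f x)\<^sup>2 \<le> (f t)\<^sup>2 + I" if "t \<in> {-1..1}" for t
    using sub[of t x] sub[of x t] x that by (cases "t \<le> x") auto
  have "integral {-1..1} (\<lambda>t::real. (f x)\<^sup>2) \<le> integral {-1..1} (\<lambda>t. f t * f t + I)"
    using dif by (intro integral_le integrable_continuous_real continuous_intros cf) (auto simp: power2_eq_square)
  also have "\<dots> = ip f f + integral {-1..1} (\<lambda>t::real. I)" unfolding ip_def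
    by (rule integral_add) (auto intro!: integrable_continuous_real continuous_intros cf)
  finally have 1: "(f x)\<^sup>2 \<le> ip f f / 2 + I" by simp
  have "I \<le> integral {-1..1} (\<lambda>x. e * (f' x * f' x) + (1/e) * (f x * f x))" unfolding I_def
  proof (rule integral_le)
    fix x
    have "\<bar>2 * (a * b)\<bar> \<le> e * (b * b) + (1/e) * (a * a)" for a b :: real
    proof -
      have "0 \<le> (1/e) * (\<bar>a\<bar> - e * \<bar>b\<bar>)\<^sup>2" using e by simp
      also have "\<dots> = (1/e) * (a * a) + e * (b * b) - 2 * (\<bar>a\<bar> * \<bar>b\<bar>)"
        using e by (simp add: power2_eq_square field_simps)
      finally show ?thesis by (simp add: abs_mult)
    qed
    then show "\<bar>2 * (f x * f' x)\<bar> \<le> e * (f' x * f' x) + (1/e) * (f x * f x)" .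
  qed (intro integrable_continuous_real continuous_intros cf)+
  also have "\<dots> = integral {-1..1} (\<lambda>x. e * (f' x * f' x)) + integral {-1..1} (\<lambda>x. (1/e) * (f x * f x))"
    by (rule integral_add) (intro integrable_continuous_real continuous_intros cf)+
  also have "\<dots> = e * ip f' f' + (1/e) * ip f f" unfolding ip_def by (simp only: integral_mult_right)
  finally show ?thesis using 1 by (simp add: algebra_simps)
qed

lemma green_identity:
  assumes f: "c1_fun f f'" and cg: "continuous_on {-1..1} g'"
    and g: "\<And>x. x \<in> {-1<..<1} \<Longrightarrow> (g' has_real_derivative h x) (at x)"
  shows "((\<lambda>x. f x * h x) has_integral (f 1 * g' 1 - f (-1) * g' (-1) - ip f' g')) {-1..1}"
proof -
  note cf = c1_fun_continuous[OF f]
  have "((\<lambda>x. f' x * g' x + h x * f x) has_integral (f 1 * g' 1 - f (-1) * g' (-1))) {-1..1}"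
    using c1_fun_interior[OF f] g
    by (intro ftc_interior continuous_intros cf cg DERIV_mult) auto
  moreover have "((\<lambda>x. f' x * g' x) has_integral ip f' g') {-1..1}"
    unfolding ip_def by (intro integrable_integral ip_integrable cf cg)
  ultimately have "((\<lambda>x. (f' x * g' x + h x * f x) - f' x * g' x) has_integral
      (f 1 * g' 1 - f (-1) * g' (-1) - ip f' g')) {-1..1}"
    by (rule has_integral_diff)
  then show ?thesis by (simp add: mult.commute)
qed

lemma pderiv_sum_poly: "pderiv (sum f A) = (\<Sum>x\<in>A. pderiv (f x))" for f :: "'a \<Rightarrow> real poly"
  using higher_pderiv_sum[of 1 f A] by simp

text \<open>The spectral theory and the comparison of eigenvalues work for any integrable potential
  that is continuous inside. The orders of the singularities enter through the assumptions of
  \<open>eigenfunction_approximation\<close>.\<close>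

locale sturm_liouville =
  fixes q :: "real \<Rightarrow> real" and aL bL aR bR :: real
  assumes q_ai: "q absolutely_integrable_on {-1..1}" and q_cont: "continuous_on {-1<..<1} q"
    and bcL: "aL\<^sup>2 + bL\<^sup>2 \<noteq> 0" and bcR: "aR\<^sup>2 + bR\<^sup>2 \<noteq> 0"
begin

abbreviation S :: "nat \<Rightarrow> real poly set" where "S N \<equiv> galerkin_space aL bL aR bR N"

text \<open>At a Dirichlet end the denominator vanishes; then the value of the boundary term is irrelevant.\<close>

definition form :: "(real \<Rightarrow> real) \<Rightarrow> (real \<Rightarrow> real) \<Rightarrow> (real \<Rightarrow> real) \<Rightarrow> (real \<Rightarrow> real) \<Rightarrow> real" where
  "form f f' g g' = ip f' g' + aR / bR * (f 1 * g 1) - aL / bL * (f (-1) * g (-1))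
     + integral {-1..1} (\<lambda>x. q x * (f x * g x))"

abbreviation pform :: "real poly \<Rightarrow> real poly \<Rightarrow> real" where
  "pform p r \<equiv> form (poly p) (poly (pderiv p)) (poly r) (poly (pderiv r))"

abbreviation pip :: "real poly \<Rightarrow> real poly \<Rightarrow> real" where
  "pip p r \<equiv> ip (poly p) (poly r)"

text \<open>Only Dirichlet conditions restrict the functions that the form is tested with; all
  others are natural conditions, encoded in the boundary terms of \<open>form\<close>.\<close>

definition ess_bc :: "(real \<Rightarrow> real) \<Rightarrow> bool" where
  "ess_bc f \<longleftrightarrow> (bL = 0 \<longrightarrow> f (-1) = 0) \<and> (bR = 0 \<longrightarrow> f 1 = 0)"

lemma form_commute: "form f f' g g' = form g g' f f'"
  by (simp add: form_def ip_commute mult_ac)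

lemma form_add_right:
  assumes "c1_fun f f'" "c1_fun g g'" "c1_fun h h'"
  shows "form f f' (\<lambda>x. g x + h x) (\<lambda>x. g' x + h' x) = form f f' g g' + form f f' h h'"
proof -
  note c = c1_fun_continuous[OF assms(1)] c1_fun_continuous[OF assms(2)] c1_fun_continuous[OF assms(3)]
  have "integral {-1..1} (\<lambda>x. q x * (f x * (g x + h x)))
      = integral {-1..1} (\<lambda>x. q x * (f x * g x) + q x * (f x * h x))"
    by (simp add: algebra_simps)
  also have "\<dots> = integral {-1..1} (\<lambda>x. q x * (f x * g x)) + integral {-1..1} (\<lambda>x. q x * (f x * h x))"
    by (intro integral_add integrable_mult_continuous q_ai continuous_intros c)
  finally show ?thesis unfolding form_def ip_add_right[OF c(2,4,6)] by (simp add: algebra_simps)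
qed

lemma form_add_left:
  assumes "c1_fun f f'" "c1_fun g g'" "c1_fun h h'"
  shows "form (\<lambda>x. g x + h x) (\<lambda>x. g' x + h' x) f f' = form g g' f f' + form h h' f f'"
  unfolding form_commute[of "\<lambda>x. g x + h x" "\<lambda>x. g' x + h' x" f f'] form_commute[of g g' f f'] form_commute[of h h' f f']
  by (rule form_add_right[OF assms])

lemma form_scale_right: "form f f' (\<lambda>x. t * g x) (\<lambda>x. t * g' x) = t * form f f' g g'"
proof -
  have "(\<lambda>x. q x * (f x * (t * g x))) = (\<lambda>x. t * (q x * (f x * g x)))" by (simp add: mult_ac)
  then show ?thesis unfolding form_def ip_scale_right by (simp add: algebra_simps)
qed

lemma form_sum_right:
  assumes "finite I" "c1_fun f f'" "\<And>i. i \<in> I \<Longrightarrow> c1_fun (g i) (g' i)"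
  shows "form f f' (\<lambda>x. \<Sum>i\<in>I. c i * g i x) (\<lambda>x. \<Sum>i\<in>I. c i * g' i x) = (\<Sum>i\<in>I. c i * form f f' (g i) (g' i))"
  using assms(1,3)
proof (induction I rule: finite_induct)
  case empty
  show ?case by (simp add: form_def ip_def)
next
  case (insert x F)
  have "form f f' (\<lambda>y. c x * g x y + (\<Sum>i\<in>F. c i * g i y)) (\<lambda>y. c x * g' x y + (\<Sum>i\<in>F. c i * g' i y))
      = form f f' (\<lambda>y. c x * g x y) (\<lambda>y. c x * g' x y) + form f f' (\<lambda>y. \<Sum>i\<in>F. c i * g i y) (\<lambda>y. \<Sum>i\<in>F. c i * g' i y)"
    using insert by (intro form_add_right assms(2) c1_fun_scale c1_fun_sum) auto
  then show ?case using insert by (simp add: form_scale_right)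
qed

text \<open>Partial integration produces exactly the boundary terms of \<open>form\<close>: at a
  Dirichlet end \<open>f\<close> vanishes, elsewhere the condition expresses \<open>g'\<close> by
  \<open>g\<close>. So \<open>f\<close> obeys the essential conditions and \<open>g\<close> all of
  them, which covers exact eigenfunctions as well as trial polynomials in the role of
  \<open>g\<close>.\<close>

lemma form_green:
  assumes f: "c1_fun f f'" "ess_bc f" and cg: "continuous_on {-1..1} g'"
    and g: "\<And>x. x \<in> {-1<..<1} \<Longrightarrow> (g' has_real_derivative h x) (at x)"
    and bc: "aL * g (-1) + bL * g' (-1) = 0" "aR * g 1 + bR * g' 1 = 0"
  shows "form f f' g g' = integral {-1..1} (\<lambda>x. q x * (f x * g x)) - integral {-1..1} (\<lambda>x. f x * h x)"
proof -
  have "integral {-1..1} (\<lambda>x. f x * h x) = f 1 * g' 1 - f (-1) * g' (-1) - ip f' g'"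
    by (rule integral_unique[OF green_identity[OF f(1) cg g]])
  moreover have "f 1 * g' 1 = - (aR / bR * (f 1 * g 1))"
  proof (cases "bR = 0")
    case True
    then have "f 1 = 0" using f(2) unfolding ess_bc_def by blast
    then show ?thesis by simp
  next
    case False
    then have "g' 1 = - (aR / bR * g 1)" using bc(2) by (simp add: field_simps)
    then show ?thesis by simp
  qed
  moreover have "f (-1) * g' (-1) = - (aL / bL * (f (-1) * g (-1)))"
  proof (cases "bL = 0")
    case True
    then have "f (-1) = 0" using f(2) unfolding ess_bc_def by blast
    then show ?thesis by simp
  next
    case False
    then have "g' (-1) = - (aL / bL * g (-1))" using bc(1) by (simp add: field_simps)
    then show ?thesis by simp
  qed
  ultimately show ?thesis unfolding form_def by simp
qed

lemma ess_bcI: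
  assumes "aL * g (-1) + bL * g' (-1) = 0" "aR * g 1 + bR * g' 1 = 0"
  shows "ess_bc g"
  using assms bcL bcR unfolding ess_bc_def by auto

lemma S_D:
  assumes "p \<in> S N"
  shows "aL * poly p (-1) + bL * poly (pderiv p) (-1) = 0" "aR * poly p 1 + bR * poly (pderiv p) 1 = 0"
    "ess_bc (poly p)" "Polynomial.degree p \<le> N + 1"
  using assms ess_bcI[of "poly p" "poly (pderiv p)"] unfolding galerkin_space_def boundary_conditions_def by auto

lemma pform_eq:
  assumes "c1_fun f f'" "ess_bc f" "r \<in> S N"
  shows "form f f' (poly r) (poly (pderiv r))
    = integral {-1..1} (\<lambda>x. q x * (f x * poly r x)) - ip f (poly (pderiv (pderiv r)))"
  unfolding ip_def using S_D[OF assms(3)]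
  by (intro form_green[OF assms(1,2)]) (auto intro!: continuous_intros poly_DERIV)

lemma q_term_bound:
  assumes f: "c1_fun f f'" and e: "e > 0"
  shows "\<bar>form f f' f f' - ip f' f'\<bar>
     \<le> (\<bar>aR / bR\<bar> + \<bar>aL / bL\<bar> + integral {-1..1} (\<lambda>x. \<bar>q x\<bar>)) * (e * ip f' f' + (1/2 + 1/e) * ip f f)"
proof -
  define M where "M = e * ip f' f' + (1/2 + 1/e) * ip f f"
  have b: "(f x)\<^sup>2 \<le> M" if "x \<in> {-1..1}" for x unfolding M_def by (rule sup_bound[OF f e that])
  have "\<bar>integral {-1..1} (\<lambda>x. q x * (f x * f x))\<bar> \<le> M * integral {-1..1} (\<lambda>x. \<bar>q x\<bar>)"
    using b by (intro integral_mult_bound[OF q_ai] continuous_intros c1_fun_continuous[OF f]) (auto simp: power2_eq_square)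
  moreover have "\<bar>aR / bR * (f 1 * f 1)\<bar> \<le> \<bar>aR / bR\<bar> * M"
    unfolding abs_mult[of "aR / bR"] using b[of 1] by (intro mult_left_mono) (auto simp: power2_eq_square)
  moreover have "\<bar>aL / bL * (f (-1) * f (-1))\<bar> \<le> \<bar>aL / bL\<bar> * M"
    unfolding abs_mult[of "aL / bL"] using b[of "-1"] by (intro mult_left_mono) (auto simp: power2_eq_square)
  moreover have "(\<bar>aR / bR\<bar> + \<bar>aL / bL\<bar> + integral {-1..1} (\<lambda>x. \<bar>q x\<bar>)) * M
     = \<bar>aR / bR\<bar> * M + \<bar>aL / bL\<bar> * M + M * integral {-1..1} (\<lambda>x. \<bar>q x\<bar>)" by (simp add: algebra_simps)
  ultimately show ?thesis unfolding M_def[symmetric] form_def by linarith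
qed

text \<open>Apart from the derivative term, \<open>form\<close> is at most \<open>T\<close> times
  the squared sup norm, which \<open>sup_bound\<close> controls by a small part of the derivative
  term. This gives Garding's inequality and the boundedness of the form with one constant.\<close>

lemma form_bounds:
  "\<exists>C\<ge>0. \<forall>f f'. c1_fun f f' \<longrightarrow> ip f' f' / 2 \<le> form f f' f f' + C * ip f f \<and>
      form f f' f f' \<le> C * (ip f' f' + ip f f)"
proof -
  define T where "T = \<bar>aR / bR\<bar> + \<bar>aL / bL\<bar> + integral {-1..1} (\<lambda>x. \<bar>q x\<bar>)"
  have "integral {-1..1} (\<lambda>x. \<bar>q x\<bar>) \<ge> 0"
    using q_ai unfolding absolutely_integrable_on_def by (intro integral_nonneg) auto
  then have T: "T \<ge> 0" by (simp add: T_def)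
  define e where "e = 1 / (2 * (T + 1))"
  have e: "e > 0" "T * e \<le> 1/2" using T by (auto simp: e_def field_simps)
  \<comment> \<open>The summand 2 covers the coefficient 3/2 of the derivative term in the upper
    bound.\<close>
  define C where "C = 2 + T * (1/2 + 1/e)"
  have C: "C \<ge> 2" using T e by (simp add: C_def)
  show ?thesis
  proof (intro exI[of _ C] conjI allI impI)
    show "C \<ge> 0" using C by simp
    fix f f' assume f: "c1_fun f f'"
    have nn: "ip f f \<ge> 0" "ip f' f' \<ge> 0" using ip_nonneg c1_fun_continuous[OF f] by auto
    have "\<bar>form f f' f f' - ip f' f'\<bar> \<le> T * (e * ip f' f' + (1/2 + 1/e) * ip f f)"
      unfolding T_def by (rule q_term_bound[OF f e(1)])
    also have "\<dots> = (T * e) * ip f' f' + (C - 2) * ip f f" by (simp add: C_def algebra_simps)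
    also have "\<dots> \<le> (1/2) * ip f' f' + (C - 2) * ip f f" using e nn by (intro add_right_mono mult_right_mono) auto
    finally have b: "\<bar>form f f' f f' - ip f' f'\<bar> \<le> (1/2) * ip f' f' + (C - 2) * ip f f" .
    have "(C - 2) * ip f f \<le> C * ip f f" using nn by (intro mult_right_mono) auto
    then show "ip f' f' / 2 \<le> form f f' f f' + C * ip f f" using b by linarith
    have "2 * ip f' f' \<le> C * ip f' f'" using C nn by (intro mult_right_mono) auto
    then show "form f f' f f' \<le> C * (ip f' f' + ip f f)"
      using b \<open>(C - 2) * ip f f \<le> C * ip f f\<close> nn unfolding distrib_left by linarith
  qed
qed

subsection \<open>Discrete eigenfunctions\<close>

lemma pip_pos:
  assumes "p \<noteq> 0"
  shows "pip p p > 0"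
proof -
  have cont: "continuous_on {-1..1} (poly p)" by (intro continuous_intros)
  have "pip p p \<noteq> 0"
  proof
    assume "pip p p = 0"
    then have "integral {-1..1} (\<lambda>x. (poly p x)\<^sup>2) = 0" by (simp add: ip_def power2_eq_square)
    then have "{-1..1} \<subseteq> {x. poly p x = 0}" using integral_square_eq_0[OF cont] by auto
    moreover have "finite {x. poly p x = 0}" using assms by (simp add: poly_roots_finite)
    ultimately have "finite {-1..1::real}" by (rule finite_subset)
    then show False using infinite_Icc[of "-1::real" 1] by simp
  qed
  then show ?thesis using ip_nonneg[OF cont] by simp
qed

definition comb :: "(nat \<Rightarrow> real poly) \<Rightarrow> nat \<Rightarrow> (nat \<Rightarrow> real) \<Rightarrow> real poly" where
  "comb R N c = (\<Sum>n<N. Polynomial.smult (c n) (R n))"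

lemma poly_comb: "poly (comb R N c) = (\<lambda>x. \<Sum>n<N. c n * poly (R n) x)"
  by (simp add: comb_def poly_sum fun_eq_iff)

lemma poly_pderiv_comb: "poly (pderiv (comb R N c)) = (\<lambda>x. \<Sum>n<N. c n * poly (pderiv (R n)) x)"
proof -
  have "pderiv (comb R N c) = (\<Sum>n<N. Polynomial.smult (c n) (pderiv (R n)))"
    unfolding comb_def by (simp add: pderiv_sum_poly pderiv_smult)
  then show ?thesis by (simp add: poly_sum fun_eq_iff)
qed

lemma pip_comb_right: "pip p (comb R N c) = (\<Sum>n<N. c n * pip p (R n))"
  unfolding poly_comb by (intro ip_sum_right continuous_intros) auto

lemma pform_comb_right: "pform p (comb R N c) = (\<Sum>n<N. c n * pform p (R n))"
  unfolding poly_comb poly_pderiv_comb by (intro form_sum_right c1_fun_poly) auto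

lemma bilin_comb:
  assumes "\<And>p c. F p (comb R N c) = (\<Sum>n<N. c n * F p (R n))" "\<And>p r. F p r = F r p"
  shows "bilin N (\<lambda>i j. F (R i) (R j)) c d = F (comb R N c) (comb R N d)"
proof -
  have "F (comb R N c) (comb R N d) = (\<Sum>j<N. d j * (\<Sum>i<N. c i * F (R j) (R i)))"
    unfolding assms(1)[of "comb R N c"] assms(2)[of "comb R N c"] assms(1) ..
  also have "\<dots> = (\<Sum>j<N. \<Sum>i<N. F (R i) (R j) * c i * d j)"
    by (simp add: sum_distrib_left assms(2) mult_ac)
  also have "\<dots> = bilin N (\<lambda>i j. F (R i) (R j)) c d"
    unfolding bilin_def by (rule sum.swap)
  finally show ?thesis by simp
qed

text \<open>Passage to a basis-free problem: every \<open>R n\<close> satisfies the boundary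
  conditions, so partial integration turns the entries with second derivatives into values of the
  symmetric \<open>form\<close>. The discrete eigenpairs then depend on the space \<open>S N\<close>
  only.\<close>

lemma galerkin_eigenvectors:
  assumes N: "N \<ge> 2" and span: "S N = poly_span R N"
  shows "\<exists>U \<nu>. (\<forall>i<N. U i \<in> S N) \<and>
     (\<forall>i<N. \<forall>j<N. pip (U i) (U j) = (if i = j then 1 else 0)) \<and>
     (\<forall>i<N. \<forall>r\<in>S N. pform (U i) r = \<nu> i * pip (U i) r) \<and>
     (\<forall>i j. i \<le> j \<longrightarrow> j < N \<longrightarrow> \<nu> i \<le> \<nu> j) \<and>
     (\<forall>r\<in>S N. r = (\<Sum>i<N. Polynomial.smult (pip r (U i)) (U i))) \<and>
     (\<forall>k. 1 \<le> k \<longrightarrow> k \<le> N \<longrightarrow> numerical_eigenvalue q R N k = \<nu> (k - 1))"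
proof -
  have R_in: "R n \<in> S N" if "n < N" for n
  proof -
    have "R n = (\<Sum>m<N. Polynomial.smult (if m = n then 1 else 0) (R m))"
    proof -
      have "(\<Sum>m<N. Polynomial.smult (if m = n then 1 else 0) (R m)) = (\<Sum>m<N. if m = n then R m else 0)"
        by (intro sum.cong) auto
      then show ?thesis using that by simp
    qed
    then show ?thesis unfolding span poly_span_expand by (rule exI[of _ "\<lambda>m. if m = n then 1 else 0"])
  qed
  have comb_in: "comb R N c \<in> S N" for c unfolding span poly_span_def comb_def by blast
  have in_comb: "\<exists>c. r = comb R N c" if "r \<in> S N" for r
    using that unfolding span poly_span_def comb_def by blast
  define M where "M = (\<lambda>i j. pform (R i) (R j))"
  define B where "B = (\<lambda>i j. pip (R i) (R j))"
  have bM: "bilin N M c d = pform (comb R N c) (comb R N d)" for c d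
    unfolding M_def by (rule bilin_comb[where F = pform]) (rule pform_comb_right, rule form_commute)
  have bB: "bilin N B c d = pip (comb R N c) (comb R N d)" for c d
    unfolding B_def by (rule bilin_comb[where F = pip]) (rule pip_comb_right, rule ip_commute)
  have symM: "M i j = M j i" for i j unfolding M_def by (rule form_commute)
  have symB: "B i j = B j i" for i j unfolding B_def by (rule ip_commute)
  have pos: "bilin N B c c > 0" if "\<exists>j<N. c j \<noteq> 0" for c
  proof -
    have "comb R N c \<noteq> 0"
      using galerkin_basis_independent[OF bcL bcR N span, of c] that unfolding comb_def by blast
    then show ?thesis unfolding bB by (rule pip_pos)
  qed
  obtain u \<nu> where
    orth: "\<forall>i<N. \<forall>j<N. bilin N B (u i) (u j) = (if i = j then 1 else 0)" and
    eig: "\<forall>i<N. \<forall>z. bilin N M (u i) z = \<nu> i * bilin N B (u i) z" and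
    mono: "\<forall>i j. i \<le> j \<longrightarrow> j < N \<longrightarrow> \<nu> i \<le> \<nu> j"
  proof -
    have "\<exists>u \<nu>. (\<forall>i<N. \<forall>j<N. bilin N B (u i) (u j) = (if i = j then 1 else 0)) \<and>
           (\<forall>i<N. \<forall>z. bilin N M (u i) z = \<nu> i * bilin N B (u i) z) \<and>
           (\<forall>i j. i \<le> j \<longrightarrow> j < N \<longrightarrow> \<nu> i \<le> \<nu> j)"
    proof (rule pencil_eigenvectors)
      show "M i j = M j i" for i j by (rule symM)
      show "B i j = B j i" for i j by (rule symB)
      show "bilin N B c c > 0" if "\<exists>j<N. c j \<noteq> 0" for c using that by (rule pos)
    qed
    then show thesis by (elim exE conjE) (rule that)
  qed
  define U where "U = (\<lambda>i. comb R N (u i))"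
  have matB: "matrix_B R N = mat_of N B"
    unfolding matrix_B_def
  proof (rule cong_mat)
    fix i j assume "i < N" "j < N"
    have "L2_inner (poly (R i)) (poly (R j)) = pip (R i) (R j)"
      by (intro L2_inner_eq absolutely_integrable_continuous_real continuous_intros)
    then show "(case (i, j) of (m, n) \<Rightarrow> L2_inner (poly (R m)) (poly (R n))) = (case (i, j) of (i, j) \<Rightarrow> B i j)"
      by (simp add: B_def)
  qed auto
  have matM: "matrix_A R N + matrix_Q q R N = mat_of N M"
  proof (rule eq_matI)
    fix i j assume "i < dim_row (mat_of N M)" "j < dim_col (mat_of N M)"
    then have ij: "i < N" "j < N" by auto
    have "L2_inner (poly (R i)) (poly (pderiv (pderiv (R j)))) = pip (R i) (pderiv (pderiv (R j)))"
      by (intro L2_inner_eq absolutely_integrable_continuous_real continuous_intros)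
    moreover have "L2_inner (poly (R i)) (\<lambda>x. q x * poly (R j) x) = integral {-1..1} (\<lambda>x. q x * (poly (R i) x * poly (R j) x))"
    proof -
      have e: "(\<lambda>x. poly (R i) x * (q x * poly (R j) x)) = (\<lambda>x. q x * (poly (R i) x * poly (R j) x))"
        by (simp add: mult_ac)
      have "L2_inner (poly (R i)) (\<lambda>x. q x * poly (R j) x) = ip (poly (R i)) (\<lambda>x. q x * poly (R j) x)"
      proof (rule L2_inner_eq)
        show "(\<lambda>x. poly (R i) x * (q x * poly (R j) x)) absolutely_integrable_on {-1..1}"
          unfolding e by (intro abs_integrable_mult_continuous q_ai continuous_intros)
        show "continuous_on {-1<..<1} (\<lambda>x. poly (R i) x * (q x * poly (R j) x))"
          by (intro continuous_intros q_cont)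
      qed
      then show ?thesis by (simp add: ip_def mult_ac)
    qed
    moreover have "M i j = integral {-1..1} (\<lambda>x. q x * (poly (R i) x * poly (R j) x)) - pip (R i) (pderiv (pderiv (R j)))"
      unfolding M_def by (rule pform_eq[OF c1_fun_poly S_D(3)[OF R_in[OF ij(1)]] R_in[OF ij(2)]])
    ultimately show "(matrix_A R N + matrix_Q q R N) $$ (i, j) = mat_of N M $$ (i, j)"
      using ij by (simp add: matrix_A_def matrix_Q_def)
  qed (auto simp: matrix_A_def matrix_Q_def)
  have num: "numerical_eigenvalue q R N k = \<nu> (k - 1)" if "1 \<le> k" "k \<le> N" for k
    unfolding numerical_eigenvalue_def matB matM
    by (rule generalized_eigenvalue_of_index_eq[where u = u]) (use symM symB pos orth eig mono that in blast)+
  have expand: "r = (\<Sum>i<N. Polynomial.smult (pip r (U i)) (U i))" if rS: "r \<in> S N" for r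
  proof -
    obtain c where c: "r = comb R N c" using in_comb[OF rS] by (rule exE)
    have cj: "c j = (\<Sum>i<N. bilin N B c (u i) * u i j)" if j: "j < N" for j
      using orth by (intro pencil_expansion[where B = B] pos j) auto
    have "(\<Sum>i<N. Polynomial.smult (pip r (U i)) (U i)) = (\<Sum>n<N. Polynomial.smult (\<Sum>i<N. u i n * pip r (U i)) (R n))"
      unfolding U_def comb_def by (rule sum_smult_swap)
    also have "\<dots> = (\<Sum>n<N. Polynomial.smult (c n) (R n))"
    proof (rule sum.cong[OF refl])
      fix n assume "n \<in> {..<N}"
      then have n: "n < N" by simp
      have "(\<Sum>i<N. u i n * pip r (U i)) = c n"
        unfolding cj[OF n] bB c U_def by (simp add: mult.commute)
      then show "Polynomial.smult (\<Sum>i<N. u i n * pip r (U i)) (R n) = Polynomial.smult (c n) (R n)" by simp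
    qed
    finally show ?thesis by (simp add: c comb_def)
  qed
  have eigU: "pform (U i) r = \<nu> i * pip (U i) r" if i: "i < N" and rS: "r \<in> S N" for i r
  proof -
    obtain c where c: "r = comb R N c" using in_comb[OF rS] by (rule exE)
    show ?thesis using eig i unfolding c U_def bM[symmetric] bB[symmetric] by blast
  qed
  show ?thesis
  proof (intro exI[of _ U] exI[of _ \<nu>] conjI)
    show "\<forall>i<N. U i \<in> S N" using comb_in by (simp add: U_def)
    show "\<forall>i<N. \<forall>j<N. pip (U i) (U j) = (if i = j then 1 else 0)" using orth by (simp add: U_def bB)
    show "\<forall>i<N. \<forall>r\<in>S N. pform (U i) r = \<nu> i * pip (U i) r" using eigU by blast
    show "\<forall>i j. i \<le> j \<longrightarrow> j < N \<longrightarrow> \<nu> i \<le> \<nu> j" by (rule mono)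
    show "\<forall>r\<in>S N. r = (\<Sum>i<N. Polynomial.smult (pip r (U i)) (U i))" using expand by blast
    show "\<forall>k. 1 \<le> k \<longrightarrow> k \<le> N \<longrightarrow> numerical_eigenvalue q R N k = \<nu> (k - 1)" using num by blast
  qed
qed

end

context sturm_liouville
begin

section \<open>Eigenfunctions\<close>

definition efun :: "real \<Rightarrow> (real \<Rightarrow> real) \<Rightarrow> (real \<Rightarrow> real) \<Rightarrow> bool" where
  "efun lam y y' \<longleftrightarrow> c1_fun y y' \<and> (\<forall>x\<in>{-1<..<1}. (y' has_real_derivative (q x - lam) * y x) (at x)) \<and>
     aL * y (-1) + bL * y' (-1) = 0 \<and> aR * y 1 + bR * y' 1 = 0"

lemma sl_eigenvalue_iff_efun:
  "sl_eigenvalue q aL bL aR bR lam \<longleftrightarrow> (\<exists>y y'. efun lam y y' \<and> (\<exists>x\<in>{-1..1}. y x \<noteq> 0))"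
proof
  assume "sl_eigenvalue q aL bL aR bR lam"
  then obtain y y' y'' where y: "\<exists>x\<in>{-1..1}. y x \<noteq> 0"
        "\<forall>x\<in>{-1..1}. (y has_real_derivative y' x) (at x within {-1..1})"
        "continuous_on {-1..1} y'"
        "\<forall>x\<in>{-1<..<1}. (y' has_real_derivative y'' x) (at x)"
        "\<forall>x\<in>{-1<..<1}. - y'' x + q x * y x = lam * y x"
        "aL * y (-1) + bL * y' (-1) = 0" "aR * y 1 + bR * y' 1 = 0"
    unfolding sl_eigenvalue_def by blast
  have "y'' x = (q x - lam) * y x" if "x \<in> {-1<..<1}" for x
    using y(5) that by (auto simp: algebra_simps)
  then have "\<forall>x\<in>{-1<..<1}. (y' has_real_derivative (q x - lam) * y x) (at x)" using y(4) by simp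
  then have "efun lam y y'" using y unfolding efun_def c1_fun_def by blast
  then show "\<exists>y y'. efun lam y y' \<and> (\<exists>x\<in>{-1..1}. y x \<noteq> 0)" using y(1) by blast
next
  assume "\<exists>y y'. efun lam y y' \<and> (\<exists>x\<in>{-1..1}. y x \<noteq> 0)"
  then obtain y y' where y: "efun lam y y'" "\<exists>x\<in>{-1..1}. y x \<noteq> 0" by blast
  then show "sl_eigenvalue q aL bL aR bR lam"
    unfolding sl_eigenvalue_def efun_def c1_fun_def
    by (intro exI[of _ y] exI[of _ y'] exI[of _ "\<lambda>x. (q x - lam) * y x"]) (auto simp: algebra_simps)
qed

lemma efunD:
  assumes "efun lam y y'"
  shows "c1_fun y y'" "\<And>x. x \<in> {-1<..<1} \<Longrightarrow> (y' has_real_derivative (q x - lam) * y x) (at x)"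
    "aL * y (-1) + bL * y' (-1) = 0" "aR * y 1 + bR * y' 1 = 0" "ess_bc y"
    "continuous_on {-1..1} y" "continuous_on {-1..1} y'"
proof -
  have y: "c1_fun y y'" "\<forall>x\<in>{-1<..<1}. (y' has_real_derivative (q x - lam) * y x) (at x)"
    "aL * y (-1) + bL * y' (-1) = 0" "aR * y 1 + bR * y' 1 = 0"
    using assms unfolding efun_def by auto
  show "c1_fun y y'" "\<And>x. x \<in> {-1<..<1} \<Longrightarrow> (y' has_real_derivative (q x - lam) * y x) (at x)"
    "aL * y (-1) + bL * y' (-1) = 0" "aR * y 1 + bR * y' 1 = 0"
    by (fact y(1), use y(2) in blast, fact y(3), fact y(4))
  show "ess_bc y" by (rule ess_bcI[OF y(3,4)])
  show "continuous_on {-1..1} y" "continuous_on {-1..1} y'" by (fact c1_fun_continuous[OF y(1)])+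
qed

lemma efun_scale: "efun lam y y' \<Longrightarrow> efun lam (\<lambda>x. t * y x) (\<lambda>x. t * y' x)"
proof -
  assume y: "efun lam y y'"
  have "((\<lambda>x. t * y' x) has_real_derivative (q x - lam) * (t * y x)) (at x)" if "x \<in> {-1<..<1}" for x
  proof -
    have "((\<lambda>x. t * y' x) has_real_derivative t * ((q x - lam) * y x)) (at x)"
      by (rule DERIV_cmult[OF efunD(2)[OF y that]])
    then show ?thesis by (simp add: mult_ac)
  qed
  moreover have "a * (t * u) + b * (t * v) = t * (a * u + b * v)" for a b u v :: real
    by (simp add: algebra_simps)
  ultimately show ?thesis using efunD[OF y] c1_fun_scale unfolding efun_def by simp
qed

lemma efun_form:
  assumes y: "efun lam y y'" and f: "c1_fun f f'" "ess_bc f"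
  shows "form f f' y y' = lam * ip f y"
proof -
  note cf = c1_fun_continuous[OF f(1)]
  have "form f f' y y' = integral {-1..1} (\<lambda>x. q x * (f x * y x)) - integral {-1..1} (\<lambda>x. f x * ((q x - lam) * y x))"
    by (rule form_green[OF f efunD(7)[OF y] efunD(2)[OF y] efunD(3,4)[OF y]])
  also have "(\<lambda>x. f x * ((q x - lam) * y x)) = (\<lambda>x. q x * (f x * y x) - lam * (f x * y x))"
    by (simp add: algebra_simps)
  also have "integral {-1..1} (\<lambda>x. q x * (f x * y x) - lam * (f x * y x))
      = integral {-1..1} (\<lambda>x. q x * (f x * y x)) - integral {-1..1} (\<lambda>x. lam * (f x * y x))"
    by (intro integral_diff integrable_mult_continuous q_ai integrable_continuous_real continuous_intros cf efunD(6)[OF y])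
  finally show ?thesis by (simp add: ip_def)
qed

lemma efun_orthogonal:
  assumes "efun lam y y'" "efun mu z z'" "lam \<noteq> mu"
  shows "ip y z = 0"
proof -
  have "mu * ip y z = form y y' z z'" by (rule efun_form[OF assms(2) efunD(1,5)[OF assms(1)], symmetric])
  also have "\<dots> = form z z' y y'" by (rule form_commute)
  also have "\<dots> = lam * ip z y" by (rule efun_form[OF assms(1) efunD(1,5)[OF assms(2)]])
  also have "ip z y = ip y z" by (rule ip_commute)
  finally have "mu * ip y z = lam * ip y z" .
  then show ?thesis using assms(3) by simp
qed

text \<open>The condition at -1 makes the initial data of \<open>y\<close> and \<open>z\<close>
  proportional there, and uniqueness for the initial value problem carries the factor over the whole
  interval.\<close>

lemma efun_simple:
  assumes y: "efun lam y y'" and z: "efun lam z z'" and y0: "x0 \<in> {-1..1}" "y x0 \<noteq> 0"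
  shows "\<exists>t. \<forall>x\<in>{-1..1}. z x = t * y x"
proof -
  have ai: "(\<lambda>x. q x - lam) absolutely_integrable_on {-1..1}"
    by (intro set_integral_diff(1) q_ai absolutely_integrable_continuous_real continuous_intros)
  have unique: "w x = 0" if "efun lam w w'" "w (-1) = 0" "w' (-1) = 0" "x \<in> {-1..1}" for w w' x
  proof (rule ivp_unique[OF ai _ efunD(7)[OF that(1)] efunD(2)[OF that(1)] that(2,3,4)])
    fix x :: real assume "x \<in> {-1..1}"
    then show "(w has_real_derivative w' x) (at x within {-1..1})"
      using efunD(1)[OF that(1)] unfolding c1_fun_def by blast
  qed
  have comb: "z x = t * y x" if t: "z (-1) = t * y (-1)" "z' (-1) = t * y' (-1)" and x: "x \<in> {-1..1}" for t x
  proof -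
    define w where "w = (\<lambda>x. z x - t * y x)"
    define w' where "w' = (\<lambda>x. z' x - t * y' x)"
    note ty = efun_scale[OF y, of t]
    have "efun lam w w'" unfolding efun_def
    proof (intro conjI ballI)
      show "c1_fun w w'" unfolding w_def w'_def by (intro c1_fun_diff efunD(1)[OF z] efunD(1)[OF ty])
      fix x :: real assume x: "x \<in> {-1<..<1}"
      have "(w' has_real_derivative ((q x - lam) * z x - (q x - lam) * (t * y x))) (at x)"
        unfolding w'_def by (intro DERIV_diff efunD(2)[OF z x] efunD(2)[OF ty x])
      then show "(w' has_real_derivative (q x - lam) * w x) (at x)"
        unfolding w_def by (simp only: right_diff_distrib)
    next
      show "aL * w (-1) + bL * w' (-1) = 0" using t by (simp add: w_def w'_def)
      have "aR * w 1 + bR * w' 1 = (aR * z 1 + bR * z' 1) - (aR * (t * y 1) + bR * (t * y' 1))"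
        by (simp add: w_def w'_def algebra_simps)
      then show "aR * w 1 + bR * w' 1 = 0" using efunD(4)[OF z] efunD(4)[OF ty] by simp
    qed
    from unique[OF this _ _ x] have "w x = 0" using t by (simp add: w_def w'_def)
    then show ?thesis by (simp add: w_def)
  qed
  have nz: "y (-1) \<noteq> 0 \<or> y' (-1) \<noteq> 0" using unique[OF y] y0 by blast
  \<comment> \<open>The pair \<open>aL\<close>, \<open>bL\<close> is nonzero and annihilates both
    pairs of initial data, so their determinant is 0.\<close>
  have par: "y (-1) * z' (-1) = z (-1) * y' (-1)"
  proof (cases "aL = 0")
    case True
    then have "y' (-1) = 0" "z' (-1) = 0" using bcL efunD(3)[OF y] efunD(3)[OF z] by auto
    then show ?thesis by simp
  next
    case False
    have "aL * (y (-1) * z' (-1) - z (-1) * y' (-1))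
        = (aL * y (-1) + bL * y' (-1)) * z' (-1) - (aL * z (-1) + bL * z' (-1)) * y' (-1)"
      by (simp add: algebra_simps)
    also have "\<dots> = 0" using efunD(3)[OF y] efunD(3)[OF z] by simp
    finally show ?thesis using False by simp
  qed
  show ?thesis
  proof (cases "y (-1) = 0")
    case True
    then have "y' (-1) \<noteq> 0" "z (-1) = 0" using nz par by auto
    show ?thesis
    proof (intro exI ballI)
      fix x :: real assume "x \<in> {-1..1}"
      then show "z x = (z' (-1) / y' (-1)) * y x"
        using True \<open>y' (-1) \<noteq> 0\<close> \<open>z (-1) = 0\<close> by (rule_tac comb) auto
    qed
  next
    case False
    show ?thesis
    proof (intro exI ballI)
      fix x :: real assume "x \<in> {-1..1}"
      then show "z x = (z (-1) / y (-1)) * y x"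
        using False par by (rule_tac comb) (auto simp: field_simps)
    qed
  qed
qed

lemma ip_pos:
  assumes "continuous_on {-1..1} y" "x \<in> {-1..1}" "y x \<noteq> 0"
  shows "ip y y > 0"
proof -
  have "ip y y \<noteq> 0"
    using integral_square_eq_0[OF assms(1) _ assms(2)] assms(3) by (auto simp: ip_def power2_eq_square)
  then show ?thesis using ip_nonneg[OF assms(1)] by simp
qed

lemma eigenfunction_normalized:
  assumes "sl_eigenvalue q aL bL aR bR lam"
  shows "\<exists>y y'. efun lam y y' \<and> ip y y = 1"
proof -
  obtain y y' x where y: "efun lam y y'" and x: "x \<in> {-1..1}" "y x \<noteq> 0"
    using assms unfolding sl_eigenvalue_iff_efun by blast
  have p: "ip y y > 0" by (rule ip_pos[OF efunD(6)[OF y] x])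
  define t where "t = 1 / sqrt (ip y y)"
  have "ip (\<lambda>x. t * y x) (\<lambda>x. t * y x) = t * (t * ip y y)"
    unfolding ip_scale_right ip_scale_left ..
  also have "\<dots> = 1" using p by (simp add: t_def field_simps)
  finally show ?thesis using efun_scale[OF y, of t] by blast
qed

section \<open>The Ritz upper bound\<close>

text \<open>The outcome of \<open>galerkin_eigenvectors\<close> without reference to matrices.
  Numbering starts at 0, so the eigenvalue of index \<open>k\<close> is
  \<open>\<nu> (k - 1)\<close>; the last clause is completeness.\<close>

definition eigsys :: "nat \<Rightarrow> (nat \<Rightarrow> real poly) \<Rightarrow> (nat \<Rightarrow> real) \<Rightarrow> bool" where
  "eigsys N U \<nu> \<longleftrightarrow> (\<forall>i<N. U i \<in> S N) \<and>
     (\<forall>i<N. \<forall>j<N. pip (U i) (U j) = (if i = j then 1 else 0)) \<and>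
     (\<forall>i<N. \<forall>r\<in>S N. pform (U i) r = \<nu> i * pip (U i) r) \<and>
     (\<forall>i j. i \<le> j \<longrightarrow> j < N \<longrightarrow> \<nu> i \<le> \<nu> j) \<and>
     (\<forall>r\<in>S N. r = (\<Sum>i<N. Polynomial.smult (pip r (U i)) (U i)))"

lemma comb_in_S:
  assumes "\<And>j. j < k \<Longrightarrow> w j \<in> S N"
  shows "comb w k c \<in> S N"
  unfolding comb_def by (rule galerkin_space_combination) (use assms in auto)

text \<open>One half of the Courant-Fischer principle: a span of dimension \<open>k\<close> contains
  a nonzero element orthogonal to the first \<open>k - 1\<close> discrete eigenvectors, and its
  Rayleigh quotient is at least \<open>\<nu> (k - 1)\<close>. Independence of the \<open>w j\<close>
  is expressed by positive norms.\<close>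

lemma ritz_minmax:
  assumes E: "eigsys N U \<nu>" and k: "1 \<le> k" "k \<le> N"
    and w: "\<And>j. j < k \<Longrightarrow> w j \<in> S N"
    and pos: "\<And>c. (\<exists>j<k. c j \<noteq> 0) \<Longrightarrow> pip (comb w k c) (comb w k c) > 0"
    and le: "\<And>c. pform (comb w k c) (comb w k c) \<le> \<Lambda> * pip (comb w k c) (comb w k c)"
  shows "\<nu> (k - 1) \<le> \<Lambda>"
proof -
  obtain c where c: "\<exists>j\<in>{..<k}. c j \<noteq> 0" "\<forall>i<k - 1. (\<Sum>j\<in>{..<k}. pip (U i) (w j) * c j) = 0"
    using homogeneous_system_nontrivial[of "{..<k}" "k - 1" "\<lambda>i j. pip (U i) (w j)"] k by auto
  define x where "x = comb w k c"
  define t where "t = (\<lambda>i. pip x (U i))"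
  have xS: "x \<in> S N" unfolding x_def by (rule comb_in_S[OF w])
  have t0: "t i = 0" if "i < k - 1" for i
  proof -
    have "t i = pip (U i) (comb w k c)" by (simp add: t_def x_def ip_commute)
    also have "\<dots> = (\<Sum>j<k. c j * pip (U i) (w j))" by (rule pip_comb_right)
    also have "\<dots> = 0" using c(2) that by (simp add: mult.commute)
    finally show ?thesis .
  qed
  have xe: "x = comb U N t" using E xS unfolding eigsys_def comb_def t_def by blast
  have f: "pform x x = (\<Sum>i<N. \<nu> i * (t i)\<^sup>2)"
  proof -
    have "pform x x = (\<Sum>i<N. t i * pform x (U i))" using pform_comb_right[of x U N t] unfolding xe[symmetric] .
    also have "\<dots> = (\<Sum>i<N. \<nu> i * (t i)\<^sup>2)"
    proof (rule sum.cong[OF refl])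
      fix i assume "i \<in> {..<N}"
      then have "pform (U i) x = \<nu> i * pip (U i) x" using E xS unfolding eigsys_def by blast
      then show "t i * pform x (U i) = \<nu> i * (t i)\<^sup>2"
        using form_commute[of "poly x"] by (simp add: t_def ip_commute power2_eq_square)
    qed
    finally show ?thesis .
  qed
  have g: "pip x x = (\<Sum>i<N. (t i)\<^sup>2)"
  proof -
    have "pip x x = (\<Sum>i<N. t i * pip x (U i))" using pip_comb_right[of x U N t] unfolding xe[symmetric] .
    then show ?thesis by (simp add: t_def power2_eq_square)
  qed
  have "\<nu> (k - 1) * pip x x = (\<Sum>i<N. \<nu> (k - 1) * (t i)\<^sup>2)" by (simp add: g sum_distrib_left)
  also have "\<dots> \<le> (\<Sum>i<N. \<nu> i * (t i)\<^sup>2)"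
  proof (rule sum_mono)
    fix i assume i: "i \<in> {..<N}"
    show "\<nu> (k - 1) * (t i)\<^sup>2 \<le> \<nu> i * (t i)\<^sup>2"
    proof (cases "i < k - 1")
      case True
      then show ?thesis by (simp add: t0)
    next
      case False
      then have "\<nu> (k - 1) \<le> \<nu> i" using E i unfolding eigsys_def by simp
      then show ?thesis by (intro mult_right_mono) auto
    qed
  qed
  also have "\<dots> \<le> \<Lambda> * pip x x" using le[of c] by (simp add: f[symmetric] x_def)
  finally have "\<nu> (k - 1) * pip x x \<le> \<Lambda> * pip x x" .
  moreover have "pip x x > 0" using pos[of c] c(1) unfolding x_def by blast
  ultimately show ?thesis by (rule mult_right_le_imp_le)
qed

text \<open>Cauchy-Schwarz on an interval of length 2 bounds the square of each value by twice the
  squared norm of \<open>e'\<close>, and integration gives another factor 2. With this Poincare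
  inequality, errors that vanish at -1 are controlled by their derivative alone.\<close>

lemma c1_zero_left_bound:
  assumes e: "c1_fun e e'" and z: "e (-1) = 0"
  shows "ip e e \<le> 4 * ip e' e'"
proof -
  note ce = c1_fun_continuous[OF e]
  have cabs: "continuous_on {-1..1} (\<lambda>x. \<bar>e' x\<bar>)" by (intro continuous_intros ce)
  have b: "(e x)\<^sup>2 \<le> 2 * ip e' e'" if x: "x \<in> {-1..1}" for x
  proof -
    have s: "{-1..x} \<subseteq> {-1..1}" using x by auto
    have "(e' has_integral (e x - e (-1))) {-1..x}"
    proof (rule fundamental_theorem_of_calculus)
      fix t assume "t \<in> {-1..x}"
      then have "(e has_real_derivative e' t) (at t within {-1..x})"
        using e s unfolding c1_fun_def by (blast intro: DERIV_subset)
      then show "(e has_vector_derivative e' t) (at t within {-1..x})"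
        by (simp add: has_real_derivative_iff_has_vector_derivative)
    qed (use x in auto)
    then have "e x = integral {-1..x} e'" using z by (simp add: integral_unique)
    also have "norm \<dots> \<le> integral {-1..x} (\<lambda>x. \<bar>e' x\<bar>)"
      using s by (intro integral_norm_bound_integral integrable_continuous_real continuous_on_subset[OF cabs]
          continuous_on_subset[OF ce(2)]) auto
    also have "\<dots> \<le> integral {-1..1} (\<lambda>x. \<bar>e' x\<bar>)"
      using s by (intro integral_subset_le integrable_continuous_real continuous_on_subset[OF cabs] cabs) auto
    also have "\<dots> = ip (\<lambda>x. \<bar>e' x\<bar>) (\<lambda>x. 1)" by (simp add: ip_def)
    finally have "\<bar>e x\<bar> \<le> ip (\<lambda>x. \<bar>e' x\<bar>) (\<lambda>x. 1)" by simp
    then have "\<bar>e x\<bar>\<^sup>2 \<le> (ip (\<lambda>x. \<bar>e' x\<bar>) (\<lambda>x. 1))\<^sup>2" by (rule power_mono) simp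
    also have "\<dots> \<le> ip (\<lambda>x. \<bar>e' x\<bar>) (\<lambda>x. \<bar>e' x\<bar>) * ip (\<lambda>x. 1) (\<lambda>x. 1)"
      by (rule ip_cauchy_schwarz[OF cabs]) (intro continuous_intros)
    also have "\<dots> = 2 * ip e' e'" by (simp add: ip_def)
    finally show ?thesis by simp
  qed
  have "ip e e \<le> integral {-1..1} (\<lambda>x::real. 2 * ip e' e')" unfolding ip_def[of e]
    using b by (intro integral_le ip_integrable ce) (auto simp: power2_eq_square)
  then show ?thesis by simp
qed

lemma ip_combination_bound:
  fixes e :: "nat \<Rightarrow> real \<Rightarrow> real"
  assumes c: "\<And>j. j < k \<Longrightarrow> continuous_on {-1..1} (e j)" and b: "\<And>j. j < k \<Longrightarrow> ip (e j) (e j) \<le> E"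
  shows "ip (\<lambda>x. \<Sum>j<k. c j * e j x) (\<lambda>x. \<Sum>j<k. c j * e j x) \<le> real k * E * (\<Sum>j<k. (c j)\<^sup>2)"
proof -
  have "ip (\<lambda>x. \<Sum>j<k. c j * e j x) (\<lambda>x. \<Sum>j<k. c j * e j x)
      \<le> integral {-1..1} (\<lambda>x. (\<Sum>j<k. (c j)\<^sup>2) * (\<Sum>j<k. e j x * e j x))" unfolding ip_def
  proof (rule integral_le)
    fix x
    show "(\<Sum>j<k. c j * e j x) * (\<Sum>j<k. c j * e j x) \<le> (\<Sum>j<k. (c j)\<^sup>2) * (\<Sum>j<k. e j x * e j x)"
      using Cauchy_Schwarz_ineq_sum[of c "\<lambda>j. e j x" "{..<k}"] by (simp add: power2_eq_square)
  qed (use c in \<open>auto intro!: integrable_continuous_real continuous_intros\<close>)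
  also have "\<dots> = (\<Sum>j<k. (c j)\<^sup>2) * integral {-1..1} (\<lambda>x. \<Sum>j<k. e j x * e j x)" by (rule integral_mult_right)
  also have "integral {-1..1} (\<lambda>x. \<Sum>j<k. e j x * e j x) = (\<Sum>j<k. ip (e j) (e j))"
    unfolding ip_def by (rule integral_sum) (use c in \<open>auto intro!: ip_integrable\<close>)
  also have "(\<Sum>j<k. (c j)\<^sup>2) * (\<Sum>j<k. ip (e j) (e j)) \<le> (\<Sum>j<k. (c j)\<^sup>2) * (real k * E)"
    using b sum_mono[of "{..<k}" "\<lambda>j. ip (e j) (e j)" "\<lambda>j. E"] by (intro mult_left_mono sum_nonneg) auto
  finally show ?thesis by (simp add: mult_ac)
qed

text \<open>
  On the span of the approximations \<open>v\<^sub>j\<close> the first order terms \<open>c\<^sub>j (\<lambda>\<^sub>j - \<lambda>) \<langle>e, y\<^sub>j\<rangle>\<close> are absorbed by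
  the nonpositive terms \<open>(\<lambda>\<^sub>j - \<lambda>) c\<^sub>j\<^sup>2\<close>, so that the error is quadratic.
\<close>

lemma ritz_upper_bound:
  assumes k: "1 \<le> k"
    and y: "\<And>j. j < k \<Longrightarrow> efun (\<mu> j) (y j) (y' j)" and norm: "\<And>j. j < k \<Longrightarrow> ip (y j) (y j) = 1"
    and inj: "\<And>i j. i < k \<Longrightarrow> j < k \<Longrightarrow> i \<noteq> j \<Longrightarrow> \<mu> i \<noteq> \<mu> j"
    and mu: "\<And>j. j < k \<Longrightarrow> \<mu> j \<le> lam"
  shows "\<exists>K>0. \<exists>\<delta>>0. \<forall>N U \<nu> v E. eigsys N U \<nu> \<longrightarrow> k \<le> N \<longrightarrow> 0 \<le> E \<longrightarrow> E \<le> \<delta> \<longrightarrow>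
     (\<forall>j<k. v j \<in> S N \<and> poly (v j) (-1) = y j (-1) \<and>
        integral {-1..1} (\<lambda>x. (y' j x - poly (pderiv (v j)) x)\<^sup>2) \<le> E) \<longrightarrow> \<nu> (k - 1) \<le> lam + K * E"
proof -
  obtain C where C: "C \<ge> 0" "\<And>f f'. c1_fun f f' \<Longrightarrow> form f f' f f' \<le> C * (ip f' f' + ip f f)"
    using form_bounds by blast
  define D where "D = (\<Sum>j<k. lam - \<mu> j)"
  have D: "D \<ge> 0" unfolding D_def using mu by (intro sum_nonneg) simp
  \<comment> \<open>The outer 4 stems from the norm estimate n \<le> 4 A below; the inner 4 and 5 =
    4 + 1 from the bounds 4 E and E for the errors of function and derivative. The final 1 makes
    \<open>K\<close> positive.\<close>
  define K where "K = 4 * ((4 * (D + \<bar>lam\<bar>) + 5 * C) * real k) + 1"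
  \<comment> \<open>Small enough that the squared error is at most a quarter of the squared norm
    \<open>n\<close> of the exact combination.\<close>
  define \<delta> where "\<delta> = 1 / (16 * real k)"
  have K: "K > 0" using D C by (simp add: K_def add_nonneg_pos)
  have \<delta>: "\<delta> > 0" using k by (simp add: \<delta>_def)
  have claim: "\<nu> (k - 1) \<le> lam + K * E" if E: "eigsys N U \<nu>" and kN: "k \<le> N" and E0: "0 \<le> E" "E \<le> \<delta>" and
    v: "\<And>j. j < k \<Longrightarrow> v j \<in> S N" "\<And>j. j < k \<Longrightarrow> poly (v j) (-1) = y j (-1)"
      "\<And>j. j < k \<Longrightarrow> integral {-1..1} (\<lambda>x. (y' j x - poly (pderiv (v j)) x)\<^sup>2) \<le> E" for N U \<nu> v E
  proof -
    define e where "e = (\<lambda>j x. poly (v j) x - y j x)"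
    define e' where "e' = (\<lambda>j x. poly (pderiv (v j)) x - y' j x)"
    have ce: "c1_fun (e j) (e' j)" if "j < k" for j
      unfolding e_def e'_def by (intro c1_fun_diff c1_fun_poly efunD(1)[OF y[OF that]])
    have e'E: "ip (e' j) (e' j) \<le> E" if "j < k" for j
      using v(3)[OF that] unfolding ip_def e'_def by (simp add: power2_eq_square algebra_simps)
    have eE: "ip (e j) (e j) \<le> 4 * E" if "j < k" for j
      using c1_zero_left_bound[OF ce[OF that]] v(2)[OF that] e'E[OF that] by (simp add: e_def)
    have orth: "ip (y i) (y j) = (if i = j then 1 else 0)" if "i < k" "j < k" for i j
      using norm[OF that(1)] efun_orthogonal[OF y[OF that(1)] y[OF that(2)]] inj[OF that] by auto
    have main: "\<exists>A B. pip (comb v k c) (comb v k c) = A \<and> pform (comb v k c) (comb v k c) \<le> lam * A + B \<and>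
        B \<le> K / 4 * E * (\<Sum>j<k. (c j)\<^sup>2) \<and> (\<Sum>j<k. (c j)\<^sup>2) \<le> 4 * A" for c
    proof -
      define n where "n = (\<Sum>j<k. (c j)\<^sup>2)"
      have n0: "n \<ge> 0" by (simp add: n_def sum_nonneg)
      define Y where "Y = (\<lambda>x. \<Sum>j<k. c j * y j x)"
      define Y' where "Y' = (\<lambda>x. \<Sum>j<k. c j * y' j x)"
      define e0 where "e0 = (\<lambda>x. \<Sum>j<k. c j * e j x)"
      define e0' where "e0' = (\<lambda>x. \<Sum>j<k. c j * e' j x)"
      have cY: "c1_fun Y Y'" unfolding Y_def Y'_def by (rule c1_fun_sum) (use y efunD(1) in auto)
      have ce0: "c1_fun e0 e0'" unfolding e0_def e0'_def by (rule c1_fun_sum) (use ce in auto)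
      note cont = c1_fun_continuous[OF cY] c1_fun_continuous[OF ce0]
      have pv: "poly (comb v k c) = (\<lambda>x. Y x + e0 x)"
        by (simp add: poly_comb Y_def e0_def e_def sum.distrib[symmetric] algebra_simps fun_eq_iff)
      have pv': "poly (pderiv (comb v k c)) = (\<lambda>x. Y' x + e0' x)"
        by (simp add: poly_pderiv_comb Y'_def e0'_def e'_def sum.distrib[symmetric] algebra_simps fun_eq_iff)
      have bound': "ip e0' e0' \<le> real k * E * n" unfolding e0'_def n_def
        by (rule ip_combination_bound) (use c1_fun_continuous(2)[OF ce] e'E in auto)
      have bound: "ip e0 e0 \<le> real k * (4 * E) * n" unfolding e0_def n_def
        by (rule ip_combination_bound) (use c1_fun_continuous(1)[OF ce] eE in auto)
      have essY: "ess_bc Y" unfolding ess_bc_def Y_def using efunD(5)[OF y] by (auto simp: ess_bc_def)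
      have essv: "ess_bc (poly (comb v k c))" by (rule S_D(3)[OF comb_in_S[OF v(1)]])
      \<comment> \<open>The error inherits the essential conditions from both parts, so the exact
        equation may be tested with it.\<close>
      have esse: "ess_bc e0" using essY essv unfolding ess_bc_def pv by auto
      have ipy: "ip f Y = (\<Sum>j<k. c j * ip f (y j))" if "continuous_on {-1..1} f" for f
        unfolding Y_def by (rule ip_sum_right) (use that efunD(6)[OF y] in auto)
      have formy: "form f f' Y Y' = (\<Sum>j<k. c j * (\<mu> j * ip f (y j)))" if "c1_fun f f'" "ess_bc f" for f f'
      proof -
        have "form f f' Y Y' = (\<Sum>j<k. c j * form f f' (y j) (y' j))"
          unfolding Y_def Y'_def by (rule form_sum_right) (use that efunD(1)[OF y] in auto)
        also have "\<dots> = (\<Sum>j<k. c j * (\<mu> j * ip f (y j)))"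
          by (intro sum.cong refl) (use efun_form[OF y that] in auto)
        finally show ?thesis .
      qed
      have Yy: "ip Y (y j) = c j" if "j < k" for j
      proof -
        have "ip Y (y j) = ip (y j) Y" by (rule ip_commute)
        also have "\<dots> = (\<Sum>i<k. c i * ip (y j) (y i))" by (rule ipy[OF efunD(6)[OF y[OF that]]])
        also have "\<dots> = (\<Sum>i<k. if i = j then c i else 0)" by (intro sum.cong) (auto simp: orth that)
        finally show ?thesis using that by simp
      qed
      have YY: "ip Y Y = n" unfolding ipy[OF cont(1)] n_def using Yy by (simp add: power2_eq_square)
      define t where "t = (\<lambda>j. ip e0 (y j))"
      have tb: "(t j)\<^sup>2 \<le> ip e0 e0" if "j < k" for j
        using ip_cauchy_schwarz[OF cont(3) efunD(6)[OF y[OF that]]] norm[OF that] by (simp add: t_def)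
      define A where "A = pip (comb v k c) (comb v k c)"
      have Aeq: "A = n + 2 * ip e0 Y + ip e0 e0"
      proof -
        have cYe: "continuous_on {-1..1} (\<lambda>x. Y x + e0 x)" by (intro continuous_intros cont)
        have "A = ip (\<lambda>x. Y x + e0 x) Y + ip (\<lambda>x. Y x + e0 x) e0"
          unfolding A_def pv by (rule ip_add_right[OF cYe cont(1,3)])
        also have "ip (\<lambda>x. Y x + e0 x) Y = ip Y Y + ip Y e0"
          unfolding ip_commute[of Y e0] by (rule ip_add_left[OF cont(1,1,3)])
        also have "ip (\<lambda>x. Y x + e0 x) e0 = ip e0 Y + ip e0 e0"
          unfolding ip_commute[of e0 Y] by (rule ip_add_left[OF cont(3,1,3)])
        finally show ?thesis using YY ip_commute[of Y e0] by simp
      qed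
      have Feq: "pform (comb v k c) (comb v k c) = form Y Y' Y Y' + 2 * form e0 e0' Y Y' + form e0 e0' e0 e0'"
      proof -
        note cYe = c1_fun_add[OF cY ce0]
        have "pform (comb v k c) (comb v k c) = form (\<lambda>x. Y x + e0 x) (\<lambda>x. Y' x + e0' x) Y Y'
            + form (\<lambda>x. Y x + e0 x) (\<lambda>x. Y' x + e0' x) e0 e0'"
          unfolding pv pv' by (rule form_add_right[OF cYe cY ce0])
        also have "form (\<lambda>x. Y x + e0 x) (\<lambda>x. Y' x + e0' x) Y Y' = form Y Y' Y Y' + form Y Y' e0 e0'"
          unfolding form_commute[of Y Y' e0 e0'] by (rule form_add_left[OF cY cY ce0])
        also have "form (\<lambda>x. Y x + e0 x) (\<lambda>x. Y' x + e0' x) e0 e0' = form e0 e0' Y Y' + form e0 e0' e0 e0'"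
          unfolding form_commute[of e0 e0' Y Y'] by (rule form_add_left[OF ce0 cY ce0])
        finally show ?thesis using form_commute[of Y Y' e0 e0'] by simp
      qed
      have FY: "form Y Y' Y Y' = (\<Sum>j<k. \<mu> j * (c j)\<^sup>2)"
        unfolding formy[OF cY essY] using Yy by (simp add: power2_eq_square mult_ac)
      have Fe: "form e0 e0' Y Y' = (\<Sum>j<k. \<mu> j * (c j * t j))"
        unfolding formy[OF ce0 esse] by (simp add: t_def mult_ac)
      have ieY: "ip e0 Y = (\<Sum>j<k. c j * t j)" unfolding ipy[OF cont(3)] by (simp add: t_def)
      define B where "B = (\<Sum>j<k. (lam - \<mu> j) * (t j)\<^sup>2) + form e0 e0' e0 e0' - lam * ip e0 e0"
      have "pform (comb v k c) (comb v k c) - lam * A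
          = (\<Sum>j<k. (\<mu> j - lam) * ((c j)\<^sup>2 + 2 * (c j * t j))) + form e0 e0' e0 e0' - lam * ip e0 e0"
        unfolding Feq Aeq FY Fe ieY n_def
        by (simp add: algebra_simps sum.distrib sum_subtractf sum_distrib_left)
      also have "(\<Sum>j<k. (\<mu> j - lam) * ((c j)\<^sup>2 + 2 * (c j * t j))) \<le> (\<Sum>j<k. (lam - \<mu> j) * (t j)\<^sup>2)"
      proof (rule sum_mono)
        fix j assume "j \<in> {..<k}"
        then have "(lam - \<mu> j) * (c j + t j)\<^sup>2 \<ge> 0" using mu by simp
        moreover have "(lam - \<mu> j) * (t j)\<^sup>2 - (\<mu> j - lam) * ((c j)\<^sup>2 + 2 * (c j * t j)) = (lam - \<mu> j) * (c j + t j)\<^sup>2"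
          by (simp add: power2_eq_square algebra_simps)
        ultimately show "(\<mu> j - lam) * ((c j)\<^sup>2 + 2 * (c j * t j)) \<le> (lam - \<mu> j) * (t j)\<^sup>2" by linarith
      qed
      finally have 1: "pform (comb v k c) (comb v k c) \<le> lam * A + B" unfolding B_def by linarith
      have "B \<le> D * ip e0 e0 + C * (ip e0' e0' + ip e0 e0) + \<bar>lam\<bar> * ip e0 e0"
      proof -
        have "(\<Sum>j<k. (lam - \<mu> j) * (t j)\<^sup>2) \<le> (\<Sum>j<k. (lam - \<mu> j) * ip e0 e0)"
          using tb mu by (intro sum_mono mult_left_mono) auto
        also have "\<dots> = D * ip e0 e0" by (simp add: D_def sum_distrib_right)
        finally have "(\<Sum>j<k. (lam - \<mu> j) * (t j)\<^sup>2) \<le> D * ip e0 e0" .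
        moreover have "- lam * ip e0 e0 \<le> \<bar>lam\<bar> * ip e0 e0"
          using ip_nonneg[OF cont(3)] by (intro mult_right_mono) auto
        ultimately show ?thesis unfolding B_def using C(2)[OF ce0] by linarith
      qed
      also have "\<dots> = (D + \<bar>lam\<bar> + C) * ip e0 e0 + C * ip e0' e0'" by (simp add: algebra_simps)
      also have "\<dots> \<le> (D + \<bar>lam\<bar> + C) * (real k * (4 * E) * n) + C * (real k * E * n)"
        using bound bound' C D by (intro add_mono mult_left_mono) auto
      also have "\<dots> = (4 * (D + \<bar>lam\<bar>) + 5 * C) * real k * (E * n)" by (simp add: algebra_simps)
      also have "\<dots> \<le> K / 4 * (E * n)"
      proof (rule mult_right_mono)
        have "X \<le> (4 * X + 1) / 4" for X :: real by simp
        then show "(4 * (D + \<bar>lam\<bar>) + 5 * C) * real k \<le> K / 4" unfolding K_def .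
        show "0 \<le> E * n" using E0 n0 by simp
      qed
      finally have 2: "B \<le> K / 4 * E * n" by (simp add: mult.assoc)
      have "n \<le> 4 * A"
      proof -
        \<comment> \<open>This is half the squared norm of Y + 2 e0. It bounds the mixed term in A
          from below by - n / 2 - 2 |e0|^2, whence A \<ge> n / 2 - |e0|^2 \<ge> n / 4.\<close>
        have q: "0 \<le> n / 2 + 2 * ip e0 Y + 2 * ip e0 e0"
        proof -
          let ?g = "\<lambda>x. Y x + 2 * e0 x"
          have c2: "continuous_on {-1..1} (\<lambda>x. 2 * e0 x)" and cg: "continuous_on {-1..1} ?g"
            by (intro continuous_intros cont)+
          have "0 \<le> ip ?g ?g" by (rule ip_nonneg[OF cg])
          also have "ip ?g ?g = ip ?g Y + 2 * ip ?g e0"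
            unfolding ip_add_right[OF cg cont(1) c2] ip_scale_right ..
          also have "ip ?g Y = ip Y Y + 2 * ip Y e0"
            unfolding ip_add_left[OF cont(1) cont(1) c2] ip_scale_left ip_commute[of e0 Y] ..
          also have "ip ?g e0 = ip e0 Y + 2 * ip e0 e0"
            unfolding ip_add_left[OF cont(3) cont(1) c2] ip_scale_left ip_commute[of Y e0] ..
          finally show ?thesis using YY ip_commute[of Y e0] by simp
        qed
        have "ip e0 e0 \<le> n / 4"
        proof -
          have "real k * (4 * E) * n \<le> real k * (4 * \<delta>) * n"
            using E0 n0 by (intro mult_right_mono mult_left_mono) auto
          also have "\<dots> = n / 4" using k by (simp add: \<delta>_def)
          finally show ?thesis using bound by linarith
        qed
        moreover have "n \<le> 4 * (n + 2 * x + z)" if "0 \<le> n / 2 + 2 * x + 2 * z" "z \<le> n / 4" for x z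
          using that by simp
        ultimately show ?thesis using q unfolding Aeq by blast
      qed
      then show ?thesis unfolding n_def[symmetric] A_def[symmetric]
        by (intro exI[of _ A] exI[of _ B] conjI refl 1 2)
    qed
    show ?thesis
    proof (rule ritz_minmax[OF E k kN v(1)])
      fix c :: "nat \<Rightarrow> real" assume "\<exists>j<k. c j \<noteq> 0"
      then obtain j where j: "j < k" "c j \<noteq> 0" by blast
      then have "0 < (c j)\<^sup>2" by simp
      also have "\<dots> \<le> (\<Sum>j<k. (c j)\<^sup>2)" using j(1) by (intro member_le_sum) auto
      finally show "pip (comb v k c) (comb v k c) > 0" using main[of c] by auto
    next
      fix c :: "nat \<Rightarrow> real"
      obtain A B where AB: "pip (comb v k c) (comb v k c) = A" "pform (comb v k c) (comb v k c) \<le> lam * A + B"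
        "B \<le> K / 4 * E * (\<Sum>j<k. (c j)\<^sup>2)" "(\<Sum>j<k. (c j)\<^sup>2) \<le> 4 * A" using main[of c] by blast
      have "K / 4 * E * (\<Sum>j<k. (c j)\<^sup>2) \<le> K / 4 * E * (4 * A)"
        using AB(4) K E0 by (intro mult_left_mono) auto
      then have "pform (comb v k c) (comb v k c) \<le> lam * A + K * E * A" using AB(2,3) by simp
      then show "pform (comb v k c) (comb v k c) \<le> (lam + K * E) * pip (comb v k c) (comb v k c)"
        unfolding AB(1) by (simp add: algebra_simps)
    qed
  qed
  show ?thesis
    by (intro exI[of _ K] exI[of _ \<delta>] conjI allI impI K \<delta>, rule claim) auto
qed

end

section \<open>Compactness\<close>

text \<open>Uniform convergence pairs with a weight that is merely integrable, such as the potential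
  times a test polynomial.\<close>

lemma weighted_integral_limit:
  fixes g u :: "real \<Rightarrow> real" and f :: "nat \<Rightarrow> real \<Rightarrow> real"
  assumes g: "g absolutely_integrable_on {-1..1}" and f: "\<And>n. continuous_on {-1..1} (f n)"
    and u: "continuous_on {-1..1} u" and lim: "uniform_limit {-1..1} f u sequentially"
  shows "(\<lambda>n. integral {-1..1} (\<lambda>x. g x * f n x)) \<longlonglongrightarrow> integral {-1..1} (\<lambda>x. g x * u x)"
proof (rule tendstoI)
  fix r :: real assume r: "r > 0"
  define A where "A = integral {-1..1} (\<lambda>x. \<bar>g x\<bar>)"
  have A: "A \<ge> 0" unfolding A_def
    using g unfolding absolutely_integrable_on_def by (intro integral_nonneg) auto
  define e where "e = r / (A + 1)"
  have e: "e > 0" "e * A < r" using r A by (auto simp: e_def field_simps)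
  from uniform_limitD[OF lim e(1)]
  show "\<forall>\<^sub>F n in sequentially. dist (integral {-1..1} (\<lambda>x. g x * f n x)) (integral {-1..1} (\<lambda>x. g x * u x)) < r"
  proof eventually_elim
    case (elim n)
    have "integral {-1..1} (\<lambda>x. g x * (f n x - u x)) = integral {-1..1} (\<lambda>x. g x * f n x) - integral {-1..1} (\<lambda>x. g x * u x)"
      unfolding right_diff_distrib by (intro integral_diff integrable_mult_continuous g f u)
    moreover have "\<bar>integral {-1..1} (\<lambda>x. g x * (f n x - u x))\<bar> \<le> e * A" unfolding A_def
    proof (rule integral_mult_bound[OF g])
      show "continuous_on {-1..1} (\<lambda>x. f n x - u x)" by (intro continuous_intros f u)
      show "\<bar>f n x - u x\<bar> \<le> e" if "x \<in> {-1..1}" for x using elim that by (auto simp: dist_real_def less_imp_le)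
    qed
    ultimately show ?case using e(2) by (simp add: dist_real_def)
  qed
qed

text \<open>Young's inequality |f'| \<le> 1 / (2 t) + t f'^2 / 2 is integrated between the two
  points. Choosing \<open>t\<close> according to the required accuracy turns a bound on the norm of
  the derivative into equicontinuity.\<close>

lemma c1_modulus:
  assumes f: "c1_fun f f'" and D: "ip f' f' \<le> D" and t: "t > 0" and x: "x \<in> {-1..1}" and y: "y \<in> {-1..1}"
  shows "\<bar>f x - f y\<bar> \<le> \<bar>x - y\<bar> / (2 * t) + t / 2 * D"
proof -
  note cf = c1_fun_continuous[OF f]
  have main: "\<bar>f b - f a\<bar> \<le> (b - a) / (2 * t) + t / 2 * D" if ab: "-1 \<le> a" "a \<le> b" "b \<le> 1" for a b
  proof -
    have s: "{a..b} \<subseteq> {-1..1}" using ab by auto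
    have cs: "continuous_on {a..b} f'" using continuous_on_subset[OF cf(2) s] .
    have "(f' has_integral (f b - f a)) {a..b}"
    proof (rule fundamental_theorem_of_calculus[OF ab(2)])
      fix x assume "x \<in> {a..b}"
      then have "(f has_real_derivative f' x) (at x within {a..b})"
        using f s unfolding c1_fun_def by (blast intro: DERIV_subset)
      then show "(f has_vector_derivative f' x) (at x within {a..b})"
        by (simp add: has_real_derivative_iff_has_vector_derivative)
    qed
    then have "f b - f a = integral {a..b} f'" by (simp only: integral_unique)
    also have "norm \<dots> \<le> integral {a..b} (\<lambda>x. 1 / (2 * t) + t / 2 * (f' x * f' x))"
    proof (rule integral_norm_bound_integral)
      fix x
      have "0 \<le> (1 / (2 * t)) * (1 - t * \<bar>f' x\<bar>)\<^sup>2" using t by simp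
      also have "\<dots> = 1 / (2 * t) + t / 2 * (\<bar>f' x\<bar> * \<bar>f' x\<bar>) - \<bar>f' x\<bar>"
        using t by (simp add: power2_eq_square field_simps)
      finally show "norm (f' x) \<le> 1 / (2 * t) + t / 2 * (f' x * f' x)" by simp
    qed (intro integrable_continuous_real continuous_intros cs)+
    also have "\<dots> = integral {a..b} (\<lambda>x. 1 / (2 * t)) + integral {a..b} (\<lambda>x. t / 2 * (f' x * f' x))"
      by (rule integral_add) (intro integrable_continuous_real continuous_intros cs)+
    also have "integral {a..b} (\<lambda>x. 1 / (2 * t)) = (b - a) / (2 * t)" using ab(2) by simp
    also have "integral {a..b} (\<lambda>x. t / 2 * (f' x * f' x)) = t / 2 * integral {a..b} (\<lambda>x. f' x * f' x)"
      by (rule integral_mult_right)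
    also have "\<dots> \<le> t / 2 * ip f' f'" unfolding ip_def
      using t s by (intro mult_left_mono integral_subset_le integrable_continuous_real continuous_intros cs cf) auto
    also have "\<dots> \<le> t / 2 * D" using D t by (intro mult_left_mono) auto
    finally show ?thesis by simp
  qed
  show ?thesis
  proof (cases "y \<le> x")
    case True
    then show ?thesis using main[of y x] x y by simp
  next
    case False
    then show ?thesis using main[of x y] x y by (simp add: abs_minus_commute)
  qed
qed

text \<open>Finitely many refinements suffice, since \<open>P j\<close> passes to subsequences. The
  index map is an argument of \<open>P\<close>, so that convergence of functions and of eigenvalues
  can be bundled.\<close>

lemma common_subsequence:
  fixes P :: "nat \<Rightarrow> (nat \<Rightarrow> nat) \<Rightarrow> bool"
  assumes ex: "\<And>j r. j < k \<Longrightarrow> strict_mono r \<Longrightarrow> \<exists>s. strict_mono (s :: nat \<Rightarrow> nat) \<and> P j (r \<circ> s)"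
    and sub: "\<And>j r s. j < k \<Longrightarrow> P j r \<Longrightarrow> strict_mono s \<Longrightarrow> P j (r \<circ> s)"
  shows "\<exists>r. strict_mono (r :: nat \<Rightarrow> nat) \<and> (\<forall>j<k. P j r)"
proof -
  have "\<exists>r. strict_mono (r :: nat \<Rightarrow> nat) \<and> (\<forall>j<m. P j r)" if "m \<le> k" for m
    using that
  proof (induction m)
    case 0
    show ?case by (intro exI[of _ id]) (auto simp: strict_mono_def)
  next
    case (Suc m)
    then obtain r :: "nat \<Rightarrow> nat" where r: "strict_mono r" "\<forall>j<m. P j r" by auto
    obtain s :: "nat \<Rightarrow> nat" where s: "strict_mono s" "P m (r \<circ> s)" using ex[OF _ r(1), of m] Suc.prems by auto
    have "\<forall>j<Suc m. P j (r \<circ> s)" using sub[OF _ _ s(1)] r(2) s(2) Suc.prems by (auto simp: less_Suc_eq)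
    then show ?case using strict_mono_o[OF r(1) s(1)] by blast
  qed
  then show ?thesis by blast
qed

lemma uniform_limit_subsequence:
  assumes "uniform_limit A f g sequentially" "strict_mono (s :: nat \<Rightarrow> nat)"
  shows "uniform_limit A (\<lambda>n. f (s n)) g sequentially"
  unfolding uniform_limit_iff
proof (intro allI impI)
  fix e :: real assume "e > 0"
  then have "\<forall>\<^sub>F n in sequentially. \<forall>x\<in>A. dist (f n x) (g x) < e" by (rule uniform_limitD[OF assms(1)])
  then show "\<forall>\<^sub>F n in sequentially. \<forall>x\<in>A. dist (f (s n) x) (g x) < e"
    by (rule eventually_subseq[OF assms(2)])
qed

section \<open>Limits of discrete eigenfunctions and the lower bound\<close>

context sturm_liouville
begin

text \<open>Garding's inequality bounds the norms of the derivatives; \<open>sup_bound\<close> and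
  \<open>c1_modulus\<close> then supply the hypotheses of the Arzela-Ascoli theorem. The derivatives
  themselves are not claimed to converge, so \<open>weak_solution\<close> puts none on the
  limit.\<close>

lemma ritz_precompact:
  assumes nrm: "\<And>n. pip (p n) (p n) = 1" and en: "\<And>n. pform (p n) (p n) \<le> \<Lambda>"
  shows "\<exists>u r. continuous_on {-1..1} u \<and> strict_mono (r :: nat \<Rightarrow> nat) \<and>
     uniform_limit {-1..1} (\<lambda>n. poly (p (r n))) u sequentially"
proof -
  obtain C where C: "C \<ge> 0" "\<And>f f'. c1_fun f f' \<Longrightarrow> ip f' f' / 2 \<le> form f f' f f' + C * ip f f"
    using form_bounds by blast
  define D where "D = 2 * (\<bar>\<Lambda>\<bar> + C)"
  have D0: "D \<ge> 0" using C by (simp add: D_def)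
  have D: "ip (poly (pderiv (p n))) (poly (pderiv (p n))) \<le> D" for n
    using C(2)[OF c1_fun_poly, of "p n"] en[of n] nrm[of n] by (simp add: D_def)
  have sup: "norm (poly (p n) x) \<le> sqrt (D + 3/2)" if "x \<in> {-1..1}" for n x
  proof -
    have "(poly (p n) x)\<^sup>2 \<le> 1 * ip (poly (pderiv (p n))) (poly (pderiv (p n))) + (1/2 + 1/1) * pip (p n) (p n)"
      by (rule sup_bound[OF c1_fun_poly _ that]) simp
    also have "\<dots> \<le> D + 3/2" using D[of n] nrm[of n] by simp
    finally show ?thesis by (metis real_sqrt_abs real_sqrt_le_mono real_norm_def)
  qed
  have eq: "\<exists>d>0. \<forall>n y. y \<in> {-1..1} \<and> norm (x - y) < d \<longrightarrow> norm (poly (p n) x - poly (p n) y) < e"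
    if x: "x \<in> {-1..1}" and e: "e > 0" for x e
  proof -
    define t where "t = e / (D + 1)"
    have t: "t > 0" "t / 2 * D < e / 2" using D0 e by (auto simp: t_def field_simps)
    show ?thesis
    proof (intro exI[of _ "e * t"] conjI allI impI)
      show "e * t > 0" using e t by simp
      fix n y assume y: "y \<in> {-1..1} \<and> norm (x - y) < e * t"
      have "\<bar>poly (p n) x - poly (p n) y\<bar> \<le> \<bar>x - y\<bar> / (2 * t) + t / 2 * D"
        using y by (intro c1_modulus[OF c1_fun_poly D t(1) x]) auto
      also have "\<bar>x - y\<bar> / (2 * t) \<le> e / 2" using y t(1) by (simp add: field_simps)
      finally show "norm (poly (p n) x - poly (p n) y) < e" using t(2) by simp
    qed
  qed
  obtain u r where ur: "continuous_on {-1..1} u" "strict_mono (r :: nat \<Rightarrow> nat)"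
     "\<And>e. 0 < e \<Longrightarrow> \<exists>N. \<forall>n x. n \<ge> N \<and> x \<in> {-1..1} \<longrightarrow> norm (poly (p (r n)) x - u x) < e"
    using Arzela_Ascoli[of "{-1..1::real}" "\<lambda>n. poly (p n)" "sqrt (D + 3/2)", OF compact_Icc sup eq] by blast
  have "uniform_limit {-1..1} (\<lambda>n. poly (p (r n))) u sequentially"
    unfolding uniform_limit_iff eventually_sequentially dist_norm using ur(3) by blast
  with ur show ?thesis by blast
qed

lemma poly_in_S:
  assumes "boundary_conditions aL bL aR bR p"
  shows "p \<in> S (Polynomial.degree p)"
  using assms by (simp add: galerkin_space_def)

text \<open>The lemma of du Bois-Reymond for two derivatives: \<open>u\<close> minus the twice
  integrated right-hand side is orthogonal to v'' whenever \<open>v\<close> and its slope vanish at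
  both ends, hence is affine. So \<open>u\<close> is a classical solution, and further test
  polynomials return the boundary conditions.\<close>

lemma weak_solution:
  assumes cu: "continuous_on {-1..1} u"
    and weak: "\<And>M v. v \<in> S M \<Longrightarrow> integral {-1..1} (\<lambda>x. q x * (u x * poly v x)) - ip u (poly (pderiv (pderiv v))) = \<mu> * ip u (poly v)"
  shows "\<exists>u'. efun \<mu> u u'"
proof -
  define F where "F = (\<lambda>x. (q x - \<mu>) * u x)"
  have qm: "(\<lambda>x. q x - \<mu>) absolutely_integrable_on {-1..1}"
    by (intro set_integral_diff(1) q_ai absolutely_integrable_continuous_real continuous_intros)
  have Fai: "F absolutely_integrable_on {-1..1}" unfolding F_def by (rule abs_integrable_mult_continuous[OF qm cu])
  have Fint: "F integrable_on {-1..1}" using Fai set_lebesgue_integral_eq_integral(1) by blast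
  have cF: "continuous_on {-1<..<1} F" unfolding F_def
    by (intro continuous_intros q_cont continuous_on_subset[OF cu]) auto
  have FI: "integral {-1..1} (\<lambda>x. poly v x * F x) = ip u (poly (pderiv (pderiv v)))" if v: "v \<in> S M" for v M
  proof -
    have "(\<lambda>x. poly v x * F x) = (\<lambda>x. q x * (u x * poly v x) - \<mu> * (u x * poly v x))"
      by (simp add: F_def algebra_simps)
    then have "integral {-1..1} (\<lambda>x. poly v x * F x)
        = integral {-1..1} (\<lambda>x. q x * (u x * poly v x)) - integral {-1..1} (\<lambda>x. \<mu> * (u x * poly v x))"
      by (simp only:) (intro integral_diff integrable_mult_continuous q_ai integrable_continuous_real continuous_intros cu)
    then show ?thesis using weak[OF v] by (simp add: ip_def)
  qed
  define w1 where "w1 = (\<lambda>x. integral {-1..x} F)"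
  define w where "w = (\<lambda>x. integral {-1..x} w1)"
  have cw1: "continuous_on {-1..1} w1" unfolding w1_def by (rule indefinite_integral_continuous_1[OF Fint])
  have dw1: "(w1 has_real_derivative F x) (at x)" if "x \<in> {-1<..<1}" for x
    unfolding w1_def by (rule integral_has_derivative_interior[OF Fint cF that])
  have cw: "c1_fun w w1" unfolding c1_fun_def w_def
    using cw1 integral_has_vector_derivative[OF cw1] by (simp add: has_real_derivative_iff_has_vector_derivative)
  define d where "d = (\<lambda>x. u x - w x)"
  have cd: "continuous_on {-1..1} d" unfolding d_def by (intro continuous_intros cu c1_fun_continuous[OF cw])
  have d_orth: "ip d (poly (pderiv (pderiv v))) = 0"
    if v: "poly v 1 = 0" "poly v (-1) = 0" "poly (pderiv v) 1 = 0" "poly (pderiv v) (-1) = 0" for v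
  proof -
    have vS: "v \<in> S (Polynomial.degree v)" using v by (intro poly_in_S) (simp add: boundary_conditions_def)
    have "integral {-1..1} (\<lambda>x. poly v x * F x) = poly v 1 * w1 1 - poly v (-1) * w1 (-1) - ip (poly (pderiv v)) w1"
      by (rule integral_unique[OF green_identity[OF c1_fun_poly cw1 dw1]])
    moreover have "integral {-1..1} (\<lambda>x. w x * poly (pderiv (pderiv v)) x)
        = w 1 * poly (pderiv v) 1 - w (-1) * poly (pderiv v) (-1) - ip w1 (poly (pderiv v))"
      by (rule integral_unique[OF green_identity[OF cw]]) (auto intro!: continuous_intros poly_DERIV)
    ultimately have "ip u (poly (pderiv (pderiv v))) = ip w (poly (pderiv (pderiv v)))"
      using FI[OF vS] v ip_commute[of w1] by (simp add: ip_def)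
    moreover have "ip d (poly (pderiv (pderiv v))) = ip u (poly (pderiv (pderiv v))) - ip w (poly (pderiv (pderiv v)))"
      unfolding d_def ip_def left_diff_distrib
      by (intro integral_diff ip_integrable cu c1_fun_continuous[OF cw] continuous_intros)
    ultimately show ?thesis by simp
  qed
  \<comment> \<open>Polynomials orthogonal to 1 and x are such second derivatives: the two moments
    make the repeated antiderivative from -1 vanish at 1 together with its slope.\<close>
  have r_orth: "ip d (poly r) = 0" if r: "integral {-1..1} (poly r) = 0" "integral {-1..1} (\<lambda>x. x * poly r x) = 0" for r
  proof -
    obtain V0 where V0: "pderiv V0 = r" using poly_antiderivative by blast
    define V where "V = V0 - [:poly V0 (-1):]"
    have V: "pderiv V = r" "poly V (-1) = 0" by (simp_all add: V_def pderiv_diff V0 pderiv_pCons)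
    obtain v0 where v0: "pderiv v0 = V" using poly_antiderivative by blast
    define v where "v = v0 - [:poly v0 (-1):]"
    have v: "pderiv v = V" "poly v (-1) = 0" by (simp_all add: v_def pderiv_diff v0 pderiv_pCons)
    have V1: "poly V 1 = 0" using integral_unique[OF has_integral_pderiv[of V]] V r(1) by simp
    have "poly ([:0, 1:] * V) 1 - poly ([:0, 1:] * V) (-1) = integral {-1..1} (\<lambda>x. poly V x + x * poly r x)"
    proof -
      have "poly (pderiv ([:0, 1:] * V)) = (\<lambda>x. poly V x + x * poly r x)"
        by (simp add: pderiv_mult V pderiv_pCons fun_eq_iff)
      then show ?thesis using integral_unique[OF has_integral_pderiv[of "[:0, 1:] * V"]] by simp
    qed
    also have "\<dots> = integral {-1..1} (poly V) + integral {-1..1} (\<lambda>x. x * poly r x)"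
      by (rule integral_add) (intro integrable_continuous_real continuous_intros)+
    finally have "integral {-1..1} (poly V) = 0" using V V1 r(2) by simp
    then have "poly v 1 = 0" using integral_unique[OF has_integral_pderiv[of v]] v by simp
    then show ?thesis using d_orth[of v] v V V1 by simp
  qed
  \<comment> \<open>\<open>A\<close> and \<open>B\<close> project \<open>d\<close> onto 1 and x,
    whose squared norms are 2 and 2/3.\<close>
  define A where "A = integral {-1..1} d / 2"
  define B where "B = 3 / 2 * integral {-1..1} (\<lambda>x. x * d x)"
  define d0 where "d0 = (\<lambda>x. d x - (A + B * x))"
  have cd0: "continuous_on {-1..1} d0" unfolding d0_def by (intro continuous_intros cd)
  have id1: "integral {-1..1} (\<lambda>x::real. x) = 0"
  proof -
    have "((\<lambda>x::real. x) has_integral (1\<^sup>2 / 2 - (-1)\<^sup>2 / 2)) {-1..1}"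
      by (rule fundamental_theorem_of_calculus)
         (auto intro!: derivative_eq_intros simp: has_real_derivative_iff_has_vector_derivative[symmetric])
    then show ?thesis by (simp add: integral_unique)
  qed
  have id2: "integral {-1..1} (\<lambda>x::real. x * x) = 2 / 3"
  proof -
    have "((\<lambda>x::real. x * x) has_integral (1 ^ 3 / 3 - (-1) ^ 3 / 3)) {-1..1}"
      by (rule fundamental_theorem_of_calculus)
         (auto intro!: derivative_eq_intros simp: power2_eq_square has_real_derivative_iff_has_vector_derivative[symmetric])
    then show ?thesis by (simp add: integral_unique)
  qed
  have lin1: "integral {-1..1} (\<lambda>x. \<alpha> + \<beta> * x) = 2 * \<alpha>" for \<alpha> \<beta> :: real
  proof -
    have "integral {-1..1} (\<lambda>x. \<alpha> + \<beta> * x) = integral {-1..1} (\<lambda>x::real. \<alpha>) + integral {-1..1} (\<lambda>x. \<beta> * x)"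
      by (rule integral_add) (intro integrable_continuous_real continuous_intros)+
    then show ?thesis by (simp add: id1)
  qed
  have lin2: "integral {-1..1} (\<lambda>x. x * (\<alpha> + \<beta> * x)) = 2 / 3 * \<beta>" for \<alpha> \<beta> :: real
  proof -
    have "integral {-1..1} (\<lambda>x. \<alpha> * x + \<beta> * (x * x)) = integral {-1..1} (\<lambda>x. \<alpha> * x) + integral {-1..1} (\<lambda>x. \<beta> * (x * x))"
      by (rule integral_add) (intro integrable_continuous_real continuous_intros)+
    moreover have "(\<lambda>x. \<alpha> * x + \<beta> * (x * x)) = (\<lambda>x. x * (\<alpha> + \<beta> * x))" by (simp add: algebra_simps)
    ultimately show ?thesis by (simp add: id1 id2)
  qed
  have d0_1: "integral {-1..1} d0 = 0"
  proof -
    have "integral {-1..1} d0 = integral {-1..1} d - integral {-1..1} (\<lambda>x. A + B * x)"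
      unfolding d0_def by (rule integral_diff) (intro integrable_continuous_real continuous_intros cd)+
    then show ?thesis by (simp only: lin1) (simp add: A_def)
  qed
  have d0_x: "integral {-1..1} (\<lambda>x. x * d0 x) = 0"
  proof -
    have "integral {-1..1} (\<lambda>x. x * d0 x) = integral {-1..1} (\<lambda>x. x * d x) - integral {-1..1} (\<lambda>x. x * (A + B * x))"
      unfolding d0_def right_diff_distrib by (rule integral_diff) (intro integrable_continuous_real continuous_intros cd)+
    then show ?thesis by (simp only: lin2) (simp add: B_def)
  qed
  have d0_lin: "integral {-1..1} (\<lambda>x. d0 x * (\<alpha> + \<beta> * x)) = 0" for \<alpha> \<beta>
  proof -
    have "integral {-1..1} (\<lambda>x. \<alpha> * d0 x + \<beta> * (x * d0 x)) = integral {-1..1} (\<lambda>x. \<alpha> * d0 x) + integral {-1..1} (\<lambda>x. \<beta> * (x * d0 x))"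
      by (rule integral_add) (intro integrable_continuous_real continuous_intros cd0)+
    moreover have "(\<lambda>x. \<alpha> * d0 x + \<beta> * (x * d0 x)) = (\<lambda>x. d0 x * (\<alpha> + \<beta> * x))" by (simp add: algebra_simps)
    ultimately show ?thesis by (simp add: d0_1 d0_x)
  qed
  have d0_zero: "d0 x = 0" if "x \<in> {-1..1}" for x
  proof (rule orthogonal_to_polynomials_eq_0[OF cd0 _ that])
    fix p :: "real poly"
    define \<alpha> where "\<alpha> = integral {-1..1} (poly p) / 2"
    define \<beta> where "\<beta> = 3 / 2 * integral {-1..1} (\<lambda>x. x * poly p x)"
    define r where "r = p - [:\<alpha>, \<beta>:]"
    have pr: "poly r x = poly p x - (\<alpha> + \<beta> * x)" for x by (simp add: r_def mult.commute)
    have r1: "integral {-1..1} (poly r) = 0"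
    proof -
      have "integral {-1..1} (\<lambda>x. poly p x - (\<alpha> + \<beta> * x)) = integral {-1..1} (poly p) - integral {-1..1} (\<lambda>x. \<alpha> + \<beta> * x)"
        by (rule integral_diff) (intro integrable_continuous_real continuous_intros)+
      then show ?thesis unfolding pr[abs_def, symmetric] by (simp only: lin1) (simp add: \<alpha>_def)
    qed
    have r2: "integral {-1..1} (\<lambda>x. x * poly r x) = 0"
    proof -
      have "integral {-1..1} (\<lambda>x. x * (poly p x - (\<alpha> + \<beta> * x)))
          = integral {-1..1} (\<lambda>x. x * poly p x) - integral {-1..1} (\<lambda>x. x * (\<alpha> + \<beta> * x))"
        unfolding right_diff_distrib by (rule integral_diff) (intro integrable_continuous_real continuous_intros)+
      then show ?thesis unfolding pr by (simp only: lin2) (simp add: \<beta>_def)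
    qed
    have "integral {-1..1} (\<lambda>x. d0 x * poly r x) = integral {-1..1} (\<lambda>x. d x * poly r x) - integral {-1..1} (\<lambda>x. (A + B * x) * poly r x)"
      unfolding d0_def left_diff_distrib by (rule integral_diff) (intro integrable_continuous_real continuous_intros cd)+
    moreover have "integral {-1..1} (\<lambda>x. (A + B * x) * poly r x) = 0"
    proof -
      have "integral {-1..1} (\<lambda>x. A * poly r x + B * (x * poly r x)) = integral {-1..1} (\<lambda>x. A * poly r x) + integral {-1..1} (\<lambda>x. B * (x * poly r x))"
        by (rule integral_add) (intro integrable_continuous_real continuous_intros)+
      moreover have "(\<lambda>x. A * poly r x + B * (x * poly r x)) = (\<lambda>x. (A + B * x) * poly r x)" by (simp add: algebra_simps)
      ultimately show ?thesis by (simp add: r1 r2)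
    qed
    ultimately have "integral {-1..1} (\<lambda>x. d0 x * poly r x) = 0" using r_orth[OF r1 r2] by (simp add: ip_def)
    moreover have "integral {-1..1} (\<lambda>x. d0 x * poly p x) = integral {-1..1} (\<lambda>x. d0 x * poly r x) + integral {-1..1} (\<lambda>x. d0 x * (\<alpha> + \<beta> * x))"
    proof -
      have "integral {-1..1} (\<lambda>x. d0 x * poly r x + d0 x * (\<alpha> + \<beta> * x)) = integral {-1..1} (\<lambda>x. d0 x * poly r x) + integral {-1..1} (\<lambda>x. d0 x * (\<alpha> + \<beta> * x))"
        by (rule integral_add) (intro integrable_continuous_real continuous_intros cd0)+
      moreover have "(\<lambda>x. d0 x * poly r x + d0 x * (\<alpha> + \<beta> * x)) = (\<lambda>x. d0 x * poly p x)" by (simp add: pr algebra_simps)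
      ultimately show ?thesis by simp
    qed
    ultimately show "integral {-1..1} (\<lambda>x. d0 x * poly p x) = 0" using d0_lin by simp
  qed
  define u' where "u' = (\<lambda>x. w1 x + B)"
  have u_eq: "u x = w x + (A + B * x)" if "x \<in> {-1..1}" for x
    using d0_zero[OF that] by (simp add: d0_def d_def)
  have c1u: "c1_fun u u'"
  proof -
    have *: "((\<lambda>x. w x + (A + B * x)) has_real_derivative u' x) (at x within {-1..1})" if "x \<in> {-1..1}" for x
    proof -
      have "(w has_real_derivative w1 x) (at x within {-1..1})" using cw that unfolding c1_fun_def by blast
      moreover have "((\<lambda>x. A + B * x) has_real_derivative B) (at x within {-1..1})"
        by (auto intro!: derivative_eq_intros)
      ultimately show ?thesis unfolding u'_def by (rule DERIV_add)
    qed
    have **: "(u has_real_derivative u' x) (at x within {-1..1})" if x: "x \<in> {-1..1}" for x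
      by (rule has_field_derivative_transform_within[where d = 1, OF *[OF x]]) (use x u_eq in auto)
    show ?thesis unfolding c1_fun_def using ** by (auto simp: u'_def intro!: continuous_intros cw1)
  qed
  have du': "(u' has_real_derivative F x) (at x)" if "x \<in> {-1<..<1}" for x
    unfolding u'_def using DERIV_add[OF dw1[OF that] DERIV_const[of B]] by simp
  have bdry: "poly v 1 * u' 1 - poly v (-1) * u' (-1) = u 1 * poly (pderiv v) 1 - u (-1) * poly (pderiv v) (-1)"
    if v: "boundary_conditions aL bL aR bR v" for v
  proof -
    have "integral {-1..1} (\<lambda>x. poly v x * F x) = poly v 1 * u' 1 - poly v (-1) * u' (-1) - ip (poly (pderiv v)) u'"
      by (rule integral_unique[OF green_identity[OF c1_fun_poly c1_fun_continuous(2)[OF c1u] du']])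
    moreover have "integral {-1..1} (\<lambda>x. u x * poly (pderiv (pderiv v)) x)
        = u 1 * poly (pderiv v) 1 - u (-1) * poly (pderiv v) (-1) - ip u' (poly (pderiv v))"
      by (rule integral_unique[OF green_identity[OF c1u]]) (auto intro!: continuous_intros poly_DERIV)
    ultimately show ?thesis using FI[OF poly_in_S[OF v]] ip_commute[of u'] by (simp add: ip_def)
  qed
  have "aR * u 1 + bR * u' 1 = 0"
  proof -
    \<comment> \<open>The cubic with value and slope 0 at -1 and with value bR and slope - aR at 1,
      so that \<open>bdry\<close> reduces to the condition at 1.\<close>
    define v where "v = [:1, 1:] * ([:1, 1:] * [:(aR + 2 * bR) / 4, - (aR + bR) / 4:])"
    have v: "poly v 1 = bR" "poly (pderiv v) 1 = - aR" "poly v (-1) = 0" "poly (pderiv v) (-1) = 0"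
      by (simp_all add: v_def pderiv_mult pderiv_pCons field_simps)
    then have "boundary_conditions aL bL aR bR v" by (simp add: boundary_conditions_def)
    from bdry[OF this] v show ?thesis by (simp add: algebra_simps)
  qed
  moreover have "aL * u (-1) + bL * u' (-1) = 0"
  proof -
    define v where "v = [:1, -1:] * ([:1, -1:] * [:(2 * bL - aL) / 4, (bL - aL) / 4:])"
    have v: "poly v (-1) = bL" "poly (pderiv v) (-1) = - aL" "poly v 1 = 0" "poly (pderiv v) 1 = 0"
      by (simp_all add: v_def pderiv_mult pderiv_pCons field_simps)
    then have "boundary_conditions aL bL aR bR v" by (simp add: boundary_conditions_def)
    from bdry[OF this] v show ?thesis by (simp add: algebra_simps)
  qed
  ultimately have "efun \<mu> u u'" unfolding efun_def using c1u du' by (auto simp: F_def)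
  then show ?thesis by blast
qed

text \<open>
  If a discrete eigenvalue of index \<open>k\<close> were below \<open>lam\<close>, the limits of the first \<open>k\<close> discrete
  eigenfunctions would give \<open>k\<close> distinct eigenvalues below \<open>lam\<close>.
\<close>

lemma ritz_lower_bound:
  assumes sys: "\<And>N. N \<ge> N0 \<Longrightarrow> eigsys N (U N) (\<nu> N)"
    and k: "1 \<le> k" "k \<le> N0"
    and fin: "finite {\<mu>. sl_eigenvalue q aL bL aR bR \<mu> \<and> \<mu> < lam}"
    and card: "card {\<mu>. sl_eigenvalue q aL bL aR bR \<mu> \<and> \<mu> < lam} < k"
    and N: "N \<ge> N0"
  shows "lam \<le> \<nu> N (k - 1)"
proof (rule ccontr)
  assume neg: "\<not> ?thesis"
  define \<Lambda> where "\<Lambda> = \<nu> N (k - 1)"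
  have \<Lambda>: "\<Lambda> < lam" using neg by (simp add: \<Lambda>_def)
  \<comment> \<open>The spaces increase, so the first \<open>k\<close> discrete eigenvectors at
    \<open>N\<close> remain competitors in every larger space.\<close>
  have mono: "\<nu> (N + n) (k - 1) \<le> \<Lambda>" for n
  proof (rule ritz_minmax[OF sys k(1)])
    have E: "eigsys N (U N) (\<nu> N)" by (rule sys[OF N])
    show "N0 \<le> N + n" "k \<le> N + n" using N k by auto
    show "U N j \<in> S (N + n)" if "j < k" for j
      using E that k N galerkin_space_mono[of N "N + n"] unfolding eigsys_def by (auto simp: subset_iff)
    have orth: "pip (U N i) (U N j) = (if i = j then 1 else 0)" if "i < k" "j < k" for i j
      using E that k N unfolding eigsys_def by auto
    have cj: "pip (comb (U N) k c) (U N j) = c j" if "j < k" for c j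
    proof -
      have "pip (comb (U N) k c) (U N j) = pip (U N j) (comb (U N) k c)" by (rule ip_commute)
      also have "\<dots> = (\<Sum>i<k. c i * pip (U N j) (U N i))" by (rule pip_comb_right)
      also have "\<dots> = (\<Sum>i<k. if i = j then c i else 0)" by (intro sum.cong) (auto simp: orth that)
      finally show ?thesis using that by simp
    qed
    have nrm: "pip (comb (U N) k c) (comb (U N) k c) = (\<Sum>j<k. (c j)\<^sup>2)" for c
      unfolding pip_comb_right[of "comb (U N) k c"] using cj by (simp add: power2_eq_square)
    show "pip (comb (U N) k c) (comb (U N) k c) > 0" if c: "\<exists>j<k. c j \<noteq> 0" for c
    proof -
      obtain j where j: "j < k" "c j \<noteq> 0" using c by blast
      then have "0 < (c j)\<^sup>2" by simp
      also have "\<dots> \<le> (\<Sum>j<k. (c j)\<^sup>2)" using j(1) by (intro member_le_sum) auto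
      finally show ?thesis by (simp add: nrm)
    qed
    show "pform (comb (U N) k c) (comb (U N) k c) \<le> \<Lambda> * pip (comb (U N) k c) (comb (U N) k c)" for c
    proof -
      have cS: "comb (U N) k c \<in> S N"
        by (rule comb_in_S) (use E k N in \<open>auto simp: eigsys_def\<close>)
      have "pform (comb (U N) k c) (comb (U N) k c) = (\<Sum>j<k. c j * pform (comb (U N) k c) (U N j))"
        by (rule pform_comb_right)
      also have "\<dots> = (\<Sum>j<k. \<nu> N j * (c j)\<^sup>2)"
      proof (rule sum.cong[OF refl])
        fix j assume "j \<in> {..<k}"
        then have j: "j < k" by simp
        then have "pform (U N j) (comb (U N) k c) = \<nu> N j * pip (U N j) (comb (U N) k c)"
          using E cS k N unfolding eigsys_def by auto
        also have "pip (U N j) (comb (U N) k c) = c j" using cj[OF j] ip_commute by metis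
        finally show "c j * pform (comb (U N) k c) (U N j) = \<nu> N j * (c j)\<^sup>2"
          using form_commute[of "poly (U N j)"] by (simp add: power2_eq_square)
      qed
      also have "\<dots> \<le> (\<Sum>j<k. \<Lambda> * (c j)\<^sup>2)"
      proof (rule sum_mono)
        fix j assume "j \<in> {..<k}"
        then have "\<nu> N j \<le> \<Lambda>" using E k N unfolding eigsys_def \<Lambda>_def by auto
        then show "\<nu> N j * (c j)\<^sup>2 \<le> \<Lambda> * (c j)\<^sup>2" by (intro mult_right_mono) auto
      qed
      finally show ?thesis by (simp add: nrm sum_distrib_left)
    qed
  qed
  have E: "eigsys (N + n) (U (N + n)) (\<nu> (N + n))" for n using sys N by simp
  have le: "\<nu> (N + n) j \<le> \<Lambda>" if "j < k" for n j
  proof -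
    have "\<nu> (N + n) j \<le> \<nu> (N + n) (k - 1)" using E[of n] that k N unfolding eigsys_def by auto
    then show ?thesis using mono[of n] by simp
  qed
  have US: "U (N + n) j \<in> S (N + n)" if "j < k" for n j using E[of n] that k N unfolding eigsys_def by auto
  have Uorth: "pip (U (N + n) i) (U (N + n) j) = (if i = j then 1 else 0)" if "i < k" "j < k" for n i j
    using E[of n] that k N unfolding eigsys_def by auto
  have Ueig: "pform (U (N + n) j) r = \<nu> (N + n) j * pip (U (N + n) j) r" if "j < k" "r \<in> S (N + n)" for n j r
    using E[of n] that k N unfolding eigsys_def by auto
  have Uform: "pform (U (N + n) j) (U (N + n) j) = \<nu> (N + n) j" if "j < k" for n j
    using Ueig[OF that US[OF that]] Uorth[OF that that] by simp
  obtain C where C: "C \<ge> 0" "\<And>f f'. c1_fun f f' \<Longrightarrow> ip f' f' / 2 \<le> form f f' f f' + C * ip f f"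
    using form_bounds by blast
  \<comment> \<open>By Garding's inequality the discrete eigenvalues stay in a compact interval, so
    they converge along a subsequence too.\<close>
  have lower: "- C \<le> \<nu> (N + n) j" if "j < k" for n j
    using C(2)[OF c1_fun_poly, of "U (N + n) j"] Uform[OF that] Uorth[OF that that]
      ip_nonneg[of "poly (pderiv (U (N + n) j))"] by (simp add: continuous_intros)
  define P where "P = (\<lambda>j r. \<exists>u \<mu>. continuous_on {-1..1} u \<and>
     uniform_limit {-1..1} (\<lambda>n. poly (U (N + r n) j)) u sequentially \<and> (\<lambda>n. \<nu> (N + r n) j) \<longlonglongrightarrow> \<mu>)"
  have "\<exists>r. strict_mono (r :: nat \<Rightarrow> nat) \<and> (\<forall>j<k. P j r)"
  proof (rule common_subsequence)
    fix j and r :: "nat \<Rightarrow> nat" assume j: "j < k" and r: "strict_mono r"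
    have "\<exists>u s. continuous_on {-1..1} u \<and> strict_mono (s :: nat \<Rightarrow> nat) \<and>
       uniform_limit {-1..1} (\<lambda>n. poly (U (N + r (s n)) j)) u sequentially"
      by (rule ritz_precompact[of "\<lambda>n. U (N + r n) j" \<Lambda>]) (use Uorth[OF j j] Uform[OF j] le[OF j] in auto)
    then obtain u and s :: "nat \<Rightarrow> nat" where us: "continuous_on {-1..1} u" "strict_mono s"
       "uniform_limit {-1..1} (\<lambda>n. poly (U (N + r (s n)) j)) u sequentially" by blast
    have "\<forall>n. \<nu> (N + r (s n)) j \<in> {-C..\<Lambda>}" using lower[OF j] le[OF j] by simp
    moreover have "compact {-C..\<Lambda>}" by simp
    ultimately obtain \<mu> and t :: "nat \<Rightarrow> nat" where t: "strict_mono t" "((\<lambda>n. \<nu> (N + r (s n)) j) \<circ> t) \<longlonglongrightarrow> \<mu>"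
      unfolding compact_def by metis
    have "P j (r \<circ> (s \<circ> t))" unfolding P_def
      using us(1) uniform_limit_subsequence[OF us(3) t(1)] t(2) by (intro exI[of _ u] exI[of _ \<mu>]) (simp add: o_def)
    then show "\<exists>s. strict_mono (s :: nat \<Rightarrow> nat) \<and> P j (r \<circ> s)" using strict_mono_o[OF us(2) t(1)] by blast
  next
    fix j and r s :: "nat \<Rightarrow> nat" assume j: "j < k" and P: "P j r" and s: "strict_mono s"
    obtain u \<mu> where u: "continuous_on {-1..1} u"
       "uniform_limit {-1..1} (\<lambda>n. poly (U (N + r n) j)) u sequentially" "(\<lambda>n. \<nu> (N + r n) j) \<longlonglongrightarrow> \<mu>"
      using P unfolding P_def by blast
    show "P j (r \<circ> s)" unfolding P_def
      using u(1) uniform_limit_subsequence[OF u(2) s] LIMSEQ_subseq_LIMSEQ[OF u(3) s]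
      by (intro exI[of _ u] exI[of _ \<mu>]) (simp add: o_def)
  qed
  then obtain r :: "nat \<Rightarrow> nat" where r: "strict_mono r" "\<forall>j<k. P j r" by blast
  then obtain u \<mu> where u: "\<And>j. j < k \<Longrightarrow> continuous_on {-1..1} (u j)"
     "\<And>j. j < k \<Longrightarrow> uniform_limit {-1..1} (\<lambda>n. poly (U (N + r n) j)) (u j) sequentially"
     "\<And>j. j < k \<Longrightarrow> (\<lambda>n. \<nu> (N + r n) j) \<longlonglongrightarrow> \<mu> j"
    unfolding P_def by metis
  have wl: "(\<lambda>n. integral {-1..1} (\<lambda>x. g x * poly (U (N + r n) j) x)) \<longlonglongrightarrow> integral {-1..1} (\<lambda>x. g x * u j x)"
    if "j < k" "g absolutely_integrable_on {-1..1}" for j g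
    by (rule weighted_integral_limit[OF that(2) _ u(1,2)[OF that(1)]]) (intro continuous_intros)
  have wlc: "(\<lambda>n. ip g (poly (U (N + r n) j))) \<longlonglongrightarrow> ip g (u j)" if "j < k" "continuous_on {-1..1} g" for j g
    unfolding ip_def by (rule wl[OF that(1) absolutely_integrable_continuous_real[OF that(2)]])
  have uorth: "ip (u i) (u j) = (if i = j then 1 else 0)" if ij: "i < k" "j < k" for i j
  proof -
    have bd: "bounded (h ` {-1..1})" if "continuous_on {-1..1} h" for h :: "real \<Rightarrow> real"
      using that by (intro compact_imp_bounded compact_continuous_image) auto
    have "uniform_limit {-1..1} (\<lambda>n x. poly (U (N + r n) i) x * poly (U (N + r n) j) x) (\<lambda>x. u i x * u j x) sequentially"
      by (rule uniform_lim_mult[OF u(2)[OF ij(1)] u(2)[OF ij(2)] bd[OF u(1)[OF ij(1)]] bd[OF u(1)[OF ij(2)]]])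
    then have "(\<lambda>n. pip (U (N + r n) i) (U (N + r n) j)) \<longlonglongrightarrow> ip (u i) (u j)"
      unfolding ip_def by (rule integral_uniform_limit) (intro continuous_intros)
    moreover have "(\<lambda>n. pip (U (N + r n) i) (U (N + r n) j)) = (\<lambda>n. if i = j then 1 else 0)"
      using Uorth[OF ij] by simp
    ultimately show ?thesis using LIMSEQ_unique tendsto_const by metis
  qed
  \<comment> \<open>A fixed test polynomial lies in all sufficiently large spaces; there the
    discrete equation, with both derivatives on \<open>v\<close>, passes to the limit.\<close>
  have weak: "integral {-1..1} (\<lambda>x. q x * (u j x * poly v x)) - ip (u j) (poly (pderiv (pderiv v))) = \<mu> j * ip (u j) (poly v)"
    if j: "j < k" and v: "v \<in> S M" for j v M
  proof -
    have qv: "(\<lambda>x. q x * poly v x) absolutely_integrable_on {-1..1}"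
      by (intro abs_integrable_mult_continuous q_ai continuous_intros)
    have lim: "(\<lambda>n. integral {-1..1} (\<lambda>x. q x * poly v x * poly (U (N + r n) j) x) - ip (poly (pderiv (pderiv v))) (poly (U (N + r n) j)))
        \<longlonglongrightarrow> integral {-1..1} (\<lambda>x. q x * poly v x * u j x) - ip (poly (pderiv (pderiv v))) (u j)"
      by (intro tendsto_diff wl[OF j qv] wlc[OF j] continuous_intros)
    have lim2: "(\<lambda>n. \<nu> (N + r n) j * ip (poly v) (poly (U (N + r n) j))) \<longlonglongrightarrow> \<mu> j * ip (poly v) (u j)"
      by (intro tendsto_mult u(3)[OF j] wlc[OF j] continuous_intros)
    have eq: "\<forall>\<^sub>F n in sequentially. \<nu> (N + r n) j * ip (poly v) (poly (U (N + r n) j))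
       = integral {-1..1} (\<lambda>x. q x * poly v x * poly (U (N + r n) j) x) - ip (poly (pderiv (pderiv v))) (poly (U (N + r n) j))"
    proof (rule eventually_sequentiallyI[of M])
      fix n assume "M \<le> n"
      then have "M \<le> N + r n" using seq_suble[OF r(1), of n] by simp
      then have vS: "v \<in> S (N + r n)" using v galerkin_space_mono by blast
      have "\<nu> (N + r n) j * ip (poly v) (poly (U (N + r n) j)) = pform (U (N + r n) j) v"
        using Ueig[OF j vS] ip_commute by metis
      also have "\<dots> = integral {-1..1} (\<lambda>x. q x * (poly (U (N + r n) j) x * poly v x)) - ip (poly (U (N + r n) j)) (poly (pderiv (pderiv v)))"
        by (rule pform_eq[OF c1_fun_poly S_D(3)[OF US[OF j]] vS])
      also have "\<dots> = integral {-1..1} (\<lambda>x. q x * poly v x * poly (U (N + r n) j) x) - ip (poly (pderiv (pderiv v))) (poly (U (N + r n) j))"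
        by (simp add: mult_ac ip_commute)
      finally show "\<nu> (N + r n) j * ip (poly v) (poly (U (N + r n) j))
       = integral {-1..1} (\<lambda>x. q x * poly v x * poly (U (N + r n) j) x) - ip (poly (pderiv (pderiv v))) (poly (U (N + r n) j))" .
    qed
    have "(\<lambda>n. integral {-1..1} (\<lambda>x. q x * poly v x * poly (U (N + r n) j) x) - ip (poly (pderiv (pderiv v))) (poly (U (N + r n) j)))
        \<longlonglongrightarrow> \<mu> j * ip (poly v) (u j)" by (rule Lim_transform_eventually[OF lim2 eq])
    then have "integral {-1..1} (\<lambda>x. q x * poly v x * u j x) - ip (poly (pderiv (pderiv v))) (u j) = \<mu> j * ip (poly v) (u j)"
      by (rule LIMSEQ_unique[OF lim])
    moreover have "(\<lambda>x. q x * poly v x * u j x) = (\<lambda>x. q x * (u j x * poly v x))" by (simp add: mult_ac)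
    ultimately show ?thesis
      unfolding ip_commute[of "u j" "poly v"] ip_commute[of "u j" "poly (pderiv (pderiv v))"] by (simp only:)
  qed
  have "\<exists>u'. efun (\<mu> j) (u j) u'" if "j < k" for j
    by (rule weak_solution[OF u(1)[OF that] weak[OF that]])
  then obtain u' where u': "\<And>j. j < k \<Longrightarrow> efun (\<mu> j) (u j) (u' j)" by metis
  have nz: "\<exists>x\<in>{-1..1}. u j x \<noteq> 0" if "j < k" for j
  proof (rule ccontr)
    assume "\<not> ?thesis"
    then have "ip (u j) (u j) = integral {-1..1} (\<lambda>x::real. 0)" unfolding ip_def by (intro integral_cong) auto
    then show False using uorth[OF that that] by simp
  qed
  \<comment> \<open>Equal limits of eigenvalues would make the limit functions proportional by
    simplicity, against their orthonormality, which survives uniform convergence.\<close>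
  have inj: "inj_on \<mu> {..<k}"
  proof (rule inj_onI, rule ccontr)
    fix i j assume ij: "i \<in> {..<k}" "j \<in> {..<k}" "\<mu> i = \<mu> j" "i \<noteq> j"
    obtain x0 where x0: "x0 \<in> {-1..1}" "u i x0 \<noteq> 0" using nz[of i] ij by auto
    obtain t where t: "\<forall>x\<in>{-1..1}. u j x = t * u i x"
      using efun_simple[OF u'[of i] _ x0, of "u j" "u' j"] u'[of j] ij by auto
    have "ip (u i) (u j) = ip (u i) (\<lambda>x. t * u i x)" unfolding ip_def using t by (intro integral_cong) simp
    also have "\<dots> = t" using uorth[of i i] ij by (simp add: ip_scale_right)
    finally have "t = 0" using uorth[of i j] ij by simp
    then show False using t nz[of j] ij by auto
  qed
  have "\<mu> ` {..<k} \<subseteq> {\<mu>. sl_eigenvalue q aL bL aR bR \<mu> \<and> \<mu> < lam}"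
  proof
    fix m assume "m \<in> \<mu> ` {..<k}"
    then obtain j where j: "j < k" "m = \<mu> j" by auto
    have "\<mu> j \<le> \<Lambda>" using u(3)[OF j(1)] le[OF j(1)] by (intro LIMSEQ_le_const2) auto
    then show "m \<in> {\<mu>. sl_eigenvalue q aL bL aR bR \<mu> \<and> \<mu> < lam}"
      using j \<Lambda> u'[OF j(1)] nz[OF j(1)] unfolding sl_eigenvalue_iff_efun by auto
  qed
  from card_mono[OF fin this] show False using card_image[OF inj] card by simp
qed

end

section \<open>Regularity at the endpoints\<close>

text \<open>Comparison with \<open>G\<close>, the antiderivative of K (1 + x)^t that vanishes at -1
  because t > -1, gives the pointwise order t + 1. D applied to \<open>R\<close> is (1 - x^2) r,
  again of order t + 1, so one more derivation is available as well.\<close>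

lemma wreg_antiderivative:
  fixes R r :: "real \<Rightarrow> real"
  assumes cont: "continuous_on {-1..1/2} R" and zero: "R (-1) = 0"
    and der: "\<And>x. x \<in> {-1<..<1/2} \<Longrightarrow> (R has_real_derivative r x) (at x)"
    and W: "wreg {-1<..<1/2} t m r" and t: "t > -1"
  shows "wreg {-1<..<1/2} (t + 1) (Suc m) R"
proof -
  obtain C where C: "C > 0" "\<And>x. x \<in> {-1<..<1/2} \<Longrightarrow> \<bar>r x\<bar> \<le> C * (1 - x\<^sup>2) powr t"
    using wreg_bounded_pos[OF W] by blast
  define K where "K = C * 2 powr \<bar>t\<bar>"
  have rK: "\<bar>r x\<bar> \<le> K * (1 + x) powr t" if x: "x \<in> {-1<..<1/2}" for x
  proof -
    have "\<bar>r x\<bar> \<le> C * (1 - x\<^sup>2) powr t" by (rule C(2)[OF x])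
    also have "\<dots> \<le> C * (2 powr \<bar>t\<bar> * (1 + x) powr t)"
      using C(1) one_plus_powr_le(2)[OF x, of t] by (intro mult_left_mono) auto
    finally show ?thesis by (simp add: K_def)
  qed
  define G where "G = (\<lambda>x::real. K / (t + 1) * (1 + x) powr (t + 1))"
  have cG: "continuous_on {-1..x} G" for x
    unfolding G_def by (intro continuous_on_mult continuous_on_const continuous_on_powr' continuous_on_add continuous_on_id) (use t in auto)
  have dG: "(G has_real_derivative K * (1 + x) powr t) (at x)" if x: "x \<in> {-1<..<1/2}" for x
  proof -
    have "((\<lambda>x. (1 + x) powr (t + 1)) has_real_derivative ((t + 1) * (1 + x) powr t)) (at x)"
      using x by (auto intro!: derivative_eq_intros)
    from DERIV_cmult[OF this, of "K / (t + 1)"] show ?thesis using t by (simp add: G_def)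
  qed
  have RG: "\<bar>R x\<bar> \<le> G x" if x: "x \<in> {-1<..<1/2}" for x
  proof -
    have cR: "continuous_on {-1..x} R" by (rule continuous_on_subset[OF cont]) (use x in auto)
    have "G (-1) - R (-1) \<le> G x - R x"
    proof (rule DERIV_nonneg_imp_increasing_open[of "-1" x "\<lambda>x. G x - R x"])
      fix z assume z: "-1 < z" "z < x"
      then have zI: "z \<in> {-1<..<1/2}" using x by auto
      show "\<exists>y. ((\<lambda>x. G x - R x) has_real_derivative y) (at z) \<and> 0 \<le> y"
        using DERIV_diff[OF dG[OF zI] der[OF zI]] rK[OF zI] by (intro exI conjI) auto
    qed (use x cG cR in \<open>auto intro!: continuous_intros\<close>)
    moreover have "G (-1) + R (-1) \<le> G x + R x"
    proof (rule DERIV_nonneg_imp_increasing_open[of "-1" x "\<lambda>x. G x + R x"])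
      fix z assume z: "-1 < z" "z < x"
      then have zI: "z \<in> {-1<..<1/2}" using x by auto
      show "\<exists>y. ((\<lambda>x. G x + R x) has_real_derivative y) (at z) \<and> 0 \<le> y"
        using DERIV_add[OF dG[OF zI] der[OF zI]] rK[OF zI] by (intro exI conjI) auto
    qed (use x cG cR in \<open>auto intro!: continuous_intros\<close>)
    moreover have "G (-1) = 0" by (simp add: G_def)
    ultimately show ?thesis using zero by simp
  qed
  have "\<bar>R x\<bar> \<le> (K / (t + 1) * 2 powr \<bar>t + 1\<bar>) * (1 - x\<^sup>2) powr (t + 1)" if x: "x \<in> {-1<..<1/2}" for x
  proof -
    have "K / (t + 1) * (1 + x) powr (t + 1) \<le> K / (t + 1) * (2 powr \<bar>t + 1\<bar> * (1 - x\<^sup>2) powr (t + 1))"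
      using one_plus_powr_le(1)[OF x, of "t + 1"] C(1) t by (intro mult_left_mono) (auto simp: K_def)
    then show ?thesis using RG[OF x] by (simp add: G_def)
  qed
  then have b: "\<exists>C. \<forall>x\<in>{-1<..<1/2}. \<bar>R x\<bar> \<le> C * (1 - x\<^sup>2) powr (t + 1)" by blast
  have "wreg {-1<..<1/2} (1 + t) m (\<lambda>x. (1 - x\<^sup>2) powr 1 * r x)"
    by (rule wreg_mult[OF wreg_phi_powr W]) auto
  then have "wreg {-1<..<1/2} (t + 1) m (\<lambda>x. (1 - x\<^sup>2) powr 1 * r x)" by (simp only: add.commute)
  moreover have "(1 - x\<^sup>2) powr 1 * r x = (1 - x\<^sup>2) * r x" if "x \<in> {-1<..<1/2}" for x
    using square_less_1[of x] that by simp
  ultimately have "wreg {-1<..<1/2} (t + 1) m (\<lambda>x. (1 - x\<^sup>2) * r x)" by (rule wreg_cong[rotated]) auto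
  with b der show ?thesis by (intro wreg_SucI) auto
qed

text \<open>For q = A + order s0 and y = P + order t, the difference of (q - \<lambda>) y and (A -
  \<lambda>) P is (A - \<lambda>) (y - P) + (q - A) P + (q - A) (y - P). A Dirichlet condition makes
  P divisible by 1 + x, which lifts the middle term to order s0 + 1; the last term is no worse as t
  \<ge> 1. One integration yields y', two yield y.\<close>

lemma regularity_step:
  assumes q: "\<And>m. wreg {-1<..<1/2} s0 m (\<lambda>x. q x - poly A x)"
    and cy: "continuous_on {-1..1/2} y" and cy': "continuous_on {-1..1/2} y'"
    and dy: "\<And>x. x \<in> {-1<..<1/2} \<Longrightarrow> (y has_real_derivative y' x) (at x)"
    and dy': "\<And>x. x \<in> {-1<..<1/2} \<Longrightarrow> (y' has_real_derivative (q x - lam) * y x) (at x)"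
    and \<kappa>: "\<kappa> = 0 \<or> \<kappa> = 1" and dir: "\<kappa> = 1 \<Longrightarrow> y (-1) = 0" and s0: "s0 > -1" and t: "t \<ge> 1"
    and W: "wreg {-1<..<1/2} t m (\<lambda>x. y x - poly P x)" and P: "\<kappa> = 1 \<Longrightarrow> poly P (-1) = 0"
  shows "\<exists>Q. wreg {-1<..<1/2} (min t (s0 + \<kappa>) + 1) (Suc m) (\<lambda>x. y' x - poly Q x)"
    and "\<exists>Q. wreg {-1<..<1/2} (min t (s0 + \<kappa>) + 2) (Suc (Suc m)) (\<lambda>x. y x - poly Q x) \<and> (\<kappa> = 1 \<longrightarrow> poly Q (-1) = 0)"
proof -
  let ?I = "{-1<..<1/2} :: real set"
  have I: "?I \<subseteq> {-1<..<1}" by auto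
  define \<tau> where "\<tau> = min t (s0 + \<kappa>)"
  have \<tau>: "\<tau> > -1" "\<tau> \<le> t" "\<tau> \<le> s0 + \<kappa>" using t s0 \<kappa> by (auto simp: \<tau>_def)
  define F where "F = (A - [:lam:]) * P"
  have Pw: "wreg ?I \<kappa> m (poly P)"
  proof (cases "\<kappa> = 1")
    case False
    then show ?thesis using \<kappa> wreg_poly[OF I] by auto
  next
    case True
    then have "[:1, 1:] dvd P" using P poly_eq_0_iff_dvd[of P "-1"] by simp
    then obtain P1 where P1: "P = [:1, 1:] * P1" by (rule dvdE)
    have "wreg ?I (real 1 + 0) m (\<lambda>x. (1 + x) ^ 1 * poly P1 x)"
      by (rule wreg_mult[OF wreg_one_plus_power wreg_poly[OF I]])
    moreover have "(\<lambda>x. (1 + x) ^ 1 * poly P1 x) = poly P" by (simp add: P1 fun_eq_iff algebra_simps)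
    ultimately show ?thesis using True by simp
  qed
  have "wreg ?I \<tau> m (\<lambda>x. poly (A - [:lam:]) x * (y x - poly P x))"
    by (rule wreg_weaken[OF I _ wreg_mult[OF wreg_poly[OF I] W]]) (use \<tau> in simp)
  moreover have "wreg ?I \<tau> m (\<lambda>x. (q x - poly A x) * poly P x)"
    by (rule wreg_weaken[OF I \<tau>(3) wreg_mult[OF q Pw]])
  moreover have "wreg ?I \<tau> m (\<lambda>x. (q x - poly A x) * (y x - poly P x))"
    by (rule wreg_weaken[OF I _ wreg_mult[OF q W]]) (use \<tau> t \<kappa> in auto)
  ultimately have "wreg ?I \<tau> m (\<lambda>x. poly (A - [:lam:]) x * (y x - poly P x) + (q x - poly A x) * poly P x
      + (q x - poly A x) * (y x - poly P x))" by (intro wreg_add)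
  moreover have "(\<lambda>x. poly (A - [:lam:]) x * (y x - poly P x) + (q x - poly A x) * poly P x
      + (q x - poly A x) * (y x - poly P x)) = (\<lambda>x. (q x - lam) * y x - poly F x)"
    by (simp add: F_def fun_eq_iff algebra_simps)
  ultimately have rw: "wreg ?I \<tau> m (\<lambda>x. (q x - lam) * y x - poly F x)" by (simp only:)
  obtain Q0 where Q0: "pderiv Q0 = F" using poly_antiderivative by blast
  define Q where "Q = Q0 + [:y' (-1) - poly Q0 (-1):]"
  have Q: "pderiv Q = F" "poly Q (-1) = y' (-1)" by (simp_all add: Q_def pderiv_add pderiv_pCons Q0)
  obtain Z0 where Z0: "pderiv Z0 = Q" using poly_antiderivative by blast
  define Z where "Z = Z0 + [:y (-1) - poly Z0 (-1):]"
  have Z: "pderiv Z = Q" "poly Z (-1) = y (-1)" by (simp_all add: Z_def pderiv_add pderiv_pCons Z0)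
  have w1: "wreg ?I (\<tau> + 1) (Suc m) (\<lambda>x. y' x - poly Q x)"
  proof (rule wreg_antiderivative[OF _ _ _ rw \<tau>(1)])
    show "((\<lambda>x. y' x - poly Q x) has_real_derivative (q x - lam) * y x - poly F x) (at x)" if "x \<in> ?I" for x
      using DERIV_diff[OF dy'[OF that] poly_DERIV[of Q x]] by (simp add: Q)
  qed (use cy' Q in \<open>auto intro!: continuous_intros\<close>)
  have w2: "wreg ?I (\<tau> + 1 + 1) (Suc (Suc m)) (\<lambda>x. y x - poly Z x)"
  proof (rule wreg_antiderivative[OF _ _ _ w1])
    show "((\<lambda>x. y x - poly Z x) has_real_derivative y' x - poly Q x) (at x)" if "x \<in> ?I" for x
      using DERIV_diff[OF dy[OF that] poly_DERIV[of Z x]] by (simp add: Z)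
  qed (use cy Z \<tau> in \<open>auto intro!: continuous_intros\<close>)
  show "\<exists>Q. wreg ?I (min t (s0 + \<kappa>) + 1) (Suc m) (\<lambda>x. y' x - poly Q x)"
    by (rule exI[of _ Q]) (use w1 in \<open>simp only: \<tau>_def\<close>)
  have e: "\<tau> + 1 + 1 = min t (s0 + \<kappa>) + 2" by (simp add: \<tau>_def)
  show "\<exists>Q. wreg ?I (min t (s0 + \<kappa>) + 2) (Suc (Suc m)) (\<lambda>x. y x - poly Q x) \<and> (\<kappa> = 1 \<longrightarrow> poly Q (-1) = 0)"
    by (rule exI[of _ Z]) (use w2 Z dir in \<open>simp add: e\<close>)
qed

text \<open>Bootstrap: the order of y minus a polynomial starts at 1, as y' is bounded, and each
  step adds 2 up to the cap s0 + \<kappa> + 2. Stopping the last step after its first integration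
  leaves y' with order s0 + \<kappa> + 1.\<close>

lemma left_regularity:
  assumes q: "\<And>m. wreg {-1<..<1/2} s0 m (\<lambda>x. q x - poly A x)"
    and cy: "continuous_on {-1..1/2} y" and cy': "continuous_on {-1..1/2} y'"
    and dy: "\<And>x. x \<in> {-1<..<1/2} \<Longrightarrow> (y has_real_derivative y' x) (at x)"
    and dy': "\<And>x. x \<in> {-1<..<1/2} \<Longrightarrow> (y' has_real_derivative (q x - lam) * y x) (at x)"
    and \<kappa>: "\<kappa> = 0 \<or> \<kappa> = 1" and dir: "\<kappa> = 1 \<Longrightarrow> y (-1) = 0" and s0: "s0 > -1"
  shows "\<exists>Q. wreg {-1<..<1/2} (s0 + \<kappa> + 1) m (\<lambda>x. y' x - poly Q x)"
proof -
  let ?I = "{-1<..<1/2} :: real set"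
  have I: "?I \<subseteq> {-1<..<1}" by auto
  have step1: "\<exists>Q. wreg ?I (min t (s0 + \<kappa>) + 1) (Suc m) (\<lambda>x. y' x - poly Q x)"
    if "t \<ge> 1" "wreg ?I t m (\<lambda>x. y x - poly P x)" "\<kappa> = 1 \<longrightarrow> poly P (-1) = 0" for t m P
    by (rule regularity_step(1)[OF q cy cy' dy dy' \<kappa> dir s0]) (use that in auto)
  have step2: "\<exists>Q. wreg ?I (min t (s0 + \<kappa>) + 2) (Suc (Suc m)) (\<lambda>x. y x - poly Q x) \<and> (\<kappa> = 1 \<longrightarrow> poly Q (-1) = 0)"
    if "t \<ge> 1" "wreg ?I t m (\<lambda>x. y x - poly P x)" "\<kappa> = 1 \<longrightarrow> poly P (-1) = 0" for t m P
    by (rule regularity_step(2)[OF q cy cy' dy dy' \<kappa> dir s0]) (use that in auto)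
  have inv: "\<exists>P. wreg ?I (min (1 + 2 * real n) (s0 + \<kappa> + 2)) (Suc (2 * n)) (\<lambda>x. y x - poly P x) \<and>
      (\<kappa> = 1 \<longrightarrow> poly P (-1) = 0)" for n
  proof (induction n)
    case 0
    have "compact (y' ` {-1..1/2})" by (intro compact_continuous_image cy' compact_Icc)
    then obtain C where C: "\<And>x. x \<in> {-1..1/2} \<Longrightarrow> \<bar>y' x\<bar> \<le> C"
      by (metis bounded_real compact_imp_bounded imageI)
    have "\<bar>y' x\<bar> \<le> C * (1 - x\<^sup>2) powr 0" if "x \<in> ?I" for x
    proof -
      have "x\<^sup>2 < 1" using that by (intro square_less_1) auto
      then show ?thesis using C[of x] that by auto
    qed
    then have b: "wreg ?I 0 0 y'" unfolding wreg.simps(1) by blast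
    have "wreg ?I (0 + 1) (Suc 0) (\<lambda>x. y x - y (-1))"
    proof (rule wreg_antiderivative[OF _ _ _ b])
      show "((\<lambda>x. y x - y (-1)) has_real_derivative y' x) (at x)" if "x \<in> ?I" for x
        using DERIV_diff[OF dy[OF that] DERIV_const] by simp
    qed (use cy in \<open>auto intro!: continuous_intros\<close>)
    then have w: "wreg ?I 1 1 (\<lambda>x. y x - poly [:y (-1):] x)" by simp
    have "wreg ?I (min (1 + 2 * real 0) (s0 + \<kappa> + 2)) 1 (\<lambda>x. y x - poly [:y (-1):] x)"
      by (rule wreg_weaken[OF I _ w]) simp
    then show ?case using dir by (intro exI[of _ "[:y (-1):]"]) auto
  next
    case (Suc n)
    then obtain P where P: "wreg ?I (min (1 + 2 * real n) (s0 + \<kappa> + 2)) (Suc (2 * n)) (\<lambda>x. y x - poly P x)"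
      "\<kappa> = 1 \<longrightarrow> poly P (-1) = 0" by blast
    have t: "min (1 + 2 * real n) (s0 + \<kappa> + 2) \<ge> 1" using s0 \<kappa> by auto
    obtain Q where Q: "wreg ?I (min (min (1 + 2 * real n) (s0 + \<kappa> + 2)) (s0 + \<kappa>) + 2) (Suc (Suc (Suc (2 * n)))) (\<lambda>x. y x - poly Q x)"
      "\<kappa> = 1 \<longrightarrow> poly Q (-1) = 0"
      using step2[OF t P] by blast
    have "wreg ?I (min (1 + 2 * real (Suc n)) (s0 + \<kappa> + 2)) (Suc (2 * Suc n)) (\<lambda>x. y x - poly Q x)"
      using wreg_weaken[OF I _ Q(1), of "min (1 + 2 * real (Suc n)) (s0 + \<kappa> + 2)"] by simp
    then show ?case using Q(2) by blast
  qed
  obtain n0 :: nat where n0: "s0 + \<kappa> \<le> real n0" using real_arch_simple by blast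
  \<comment> \<open>\<open>n0\<close> steps saturate the order, \<open>m\<close> further ones supply
    the derivations.\<close>
  define n where "n = n0 + m"
  obtain P where P: "wreg ?I (min (1 + 2 * real n) (s0 + \<kappa> + 2)) (Suc (2 * n)) (\<lambda>x. y x - poly P x)"
      "\<kappa> = 1 \<longrightarrow> poly P (-1) = 0" using inv by blast
  have t: "min (1 + 2 * real n) (s0 + \<kappa> + 2) \<ge> 1" using s0 \<kappa> by auto
  obtain Q where Q: "wreg ?I (min (min (1 + 2 * real n) (s0 + \<kappa> + 2)) (s0 + \<kappa>) + 1) (Suc (Suc (2 * n))) (\<lambda>x. y' x - poly Q x)"
    using step1[OF t P] by blast
  have "min (min (1 + 2 * real n) (s0 + \<kappa> + 2)) (s0 + \<kappa>) = s0 + \<kappa>" using n0 by (simp add: n_def)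
  then have "wreg ?I (s0 + \<kappa> + 1) m (\<lambda>x. y' x - poly Q x)"
    using wreg_le[OF Q, of m] by (simp add: n_def)
  then show ?thesis by blast
qed

section \<open>Joining the expansions at the two endpoints\<close>

lemma power_comaximal:
  fixes u v :: "'a :: comm_ring_1"
  assumes "a * u + b * v = 1"
  shows "\<exists>c d. c * u ^ n + d * v ^ n = 1"
proof -
  have step: "\<exists>c d. c * x ^ n + d * w = 1" if "a * x + b * w = 1" for a b x w :: 'a
  proof (induction n)
    case 0
    show ?case by (intro exI[of _ 1] exI[of _ 0]) simp
  next
    case (Suc n)
    then obtain c d where cd: "c * x ^ n + d * w = 1" by blast
    have "1 = (a * x + b * w) * (c * x ^ n + d * w)" using that cd by simp
    also have "\<dots> = (a * c) * x ^ Suc n + (a * x * d + b * c * x ^ n + b * w * d) * w"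
      by (simp add: algebra_simps)
    finally show ?case by metis
  qed
  obtain c d where "c * u ^ n + d * v = 1" using step[OF assms] by blast
  then have "d * v + c * u ^ n = 1" by (simp add: add.commute)
  from step[OF this] show ?thesis by (metis add.commute)
qed

text \<open>The polynomials found at the two ends differ, so \<open>H\<close> has to agree with each
  of them to order M \<ge> s at its own end. This is the Chinese remainder theorem for (1 + x)^M and
  (1 - x)^M; the discrepancies are multiples of these powers, hence of order s.\<close>

lemma wreg_glue:
  assumes L: "wreg {-1<..<1/2} s m (\<lambda>x. f x - poly P x)"
    and R: "wreg {-1<..<1/2} s m (\<lambda>x. f (- x) - poly Q x)"
  shows "\<exists>H. wreg {-1<..<1} s m (\<lambda>x. f x - poly H x)"
proof -
  let ?I = "{-1<..<1/2} :: real set"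
  have I: "?I \<subseteq> {-1<..<1}" by auto
  have uI: "uminus ` ?I = {-1/2<..<1}" by auto
  have un: "?I \<union> {-1/2<..<1} = {-1<..<1::real}" by auto
  obtain M :: nat where M: "s \<le> real M" using real_arch_simple by blast
  have "[:1/2:] * [:1, 1:] + [:1/2:] * [:1, -1::real:] = 1" by (simp add: one_pCons)
  from power_comaximal[OF this, of M] obtain c d where cd: "c * [:1, 1:] ^ M + d * [:1, -1:] ^ M = (1 :: real poly)" by blast
  define Q' where "Q' = pcompose Q [:0, -1:]"
  have Q': "poly Q' x = poly Q (- x)" for x by (simp add: Q'_def poly_pcompose)
  define H where "H = P * (d * [:1, -1:] ^ M) + Q' * (c * [:1, 1:] ^ M)"
  have cdx: "poly c x * (1 + x) ^ M + poly d x * (1 - x) ^ M = 1" for x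
    using arg_cong[OF cd, of "\<lambda>p. poly p x"] by simp
  have H1: "poly P x - poly H x = (1 + x) ^ M * poly (c * (P - Q')) x" for x
  proof -
    have "poly P x - poly H x = poly P x * (1 - poly d x * (1 - x) ^ M) - poly Q' x * poly c x * (1 + x) ^ M"
      by (simp add: H_def algebra_simps)
    also have "1 - poly d x * (1 - x) ^ M = poly c x * (1 + x) ^ M" using cdx[of x] by simp
    finally show ?thesis by (simp add: algebra_simps)
  qed
  have H2: "poly Q x - poly H (- x) = (1 + x) ^ M * poly (pcompose (d * (Q' - P)) [:0, -1:]) x" for x
  proof -
    have "poly Q x - poly H (- x) = poly Q x * (1 - poly c (- x) * (1 + - x) ^ M) - poly P (- x) * poly d (- x) * (1 - - x) ^ M"
      by (simp add: H_def Q' algebra_simps)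
    also have "1 - poly c (- x) * (1 + - x) ^ M = poly d (- x) * (1 - - x) ^ M" using cdx[of "- x"] by (simp add: algebra_simps)
    finally show ?thesis by (simp add: poly_pcompose Q' algebra_simps)
  qed
  have PM: "wreg ?I s m (\<lambda>x. (1 + x) ^ M * poly p x)" for p
    using wreg_mult[OF wreg_one_plus_power wreg_poly[OF I], of M m p] by (intro wreg_weaken[OF I M]) simp
  have "wreg ?I s m (\<lambda>x. (f x - poly P x) + (1 + x) ^ M * poly (c * (P - Q')) x)" by (rule wreg_add[OF L PM])
  then have 1: "wreg ?I s m (\<lambda>x. f x - poly H x)" unfolding H1[symmetric] by simp
  have "wreg ?I s m (\<lambda>x. (f (- x) - poly Q x) + (1 + x) ^ M * poly (pcompose (d * (Q' - P)) [:0, -1:]) x)"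
    by (rule wreg_add[OF R PM])
  then have "wreg ?I s m (\<lambda>x. f (- x) - poly H (- x))" unfolding H2[symmetric] by simp
  from wreg_reflect[OF I this] have 2: "wreg {-1/2<..<1} s m (\<lambda>x. f x - poly H x)" by (simp add: uI)
  have "wreg (?I \<union> {-1/2<..<1}) s m (\<lambda>x. f x - poly H x)" by (rule wreg_union[OF _ _ 1 2]) auto
  then show ?thesis unfolding un by (rule exI)
qed

section \<open>The potential\<close>

text \<open>Iterated difference quotients: the removable singularity theorem keeps the last factor
  holomorphic on all of \<open>U\<close>, not just on a disc around \<open>a\<close>, as is required
  along a whole segment.\<close>

lemma holomorphic_taylor_factor:
  assumes "open U" "G holomorphic_on U"
  shows "\<exists>c H. H holomorphic_on U \<and> (\<forall>z\<in>U. G z = (\<Sum>j<n. c j * (z - a) ^ j) + (z - a) ^ n * H z)"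
proof (induction n)
  case 0
  then show ?case using assms by auto
next
  case (Suc n)
  then obtain c H where H: "H holomorphic_on U" "\<forall>z\<in>U. G z = (\<Sum>j<n. c j * (z - a) ^ j) + (z - a) ^ n * H z" by blast
  define K where "K = (\<lambda>z. if z = a then deriv H a else (H z - H a) / (z - a))"
  have "K holomorphic_on U" unfolding K_def by (rule pole_lemma_open[OF H(1) assms(1)])
  moreover have "G z = (\<Sum>j<Suc n. (c(n := H a)) j * (z - a) ^ j) + (z - a) ^ Suc n * K z" if "z \<in> U" for z
  proof -
    have *: "H z = H a + (z - a) * K z" by (simp add: K_def)
    have "(z - a) ^ n * H z = (z - a) ^ n * (H a + (z - a) * K z)" by (simp only: * [symmetric])
    also have "\<dots> = H a * (z - a) ^ n + (z - a) ^ Suc n * K z" by (simp add: algebra_simps)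
    finally have "(z - a) ^ n * H z = H a * (z - a) ^ n + (z - a) ^ Suc n * K z" .
    then show ?thesis using H(2) that by simp
  qed
  ultimately show ?case by blast
qed

text \<open>The local factorization at the zero is continued by plain division away from it, so that
  the factor is holomorphic on all of \<open>U\<close>.\<close>

lemma holomorphic_zorder_factor:
  assumes U: "open U" "connected U" and g: "g holomorphic_on U" and a: "a \<in> U" and nz: "\<exists>w\<in>U. g w \<noteq> 0"
    and n: "int n = zorder g a"
  shows "\<exists>H. H holomorphic_on U \<and> (\<forall>z\<in>U. g z = (z - a) ^ n * H z)"
proof -
  obtain r where r: "r > 0" "cball a r \<subseteq> U" "zor_poly g a holomorphic_on cball a r"
    "\<forall>w\<in>cball a r. g w = zor_poly g a w * (w - a) ^ nat (zorder g a)"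
    using zorder_exist_zero[OF g U a nz] by blast
  have nn: "nat (zorder g a) = n" using n by simp
  define H where "H = (\<lambda>z. if z \<in> ball a r then zor_poly g a z else g z / (z - a) ^ n)"
  have "H holomorphic_on (ball a r \<union> (U - {a}))" unfolding H_def
  proof (rule holomorphic_on_If_Un)
    show "zor_poly g a holomorphic_on ball a r" by (rule holomorphic_on_subset[OF r(3)]) auto
    show "(\<lambda>z. g z / (z - a) ^ n) holomorphic_on U - {a}"
      by (intro holomorphic_intros holomorphic_on_subset[OF g]) auto
    show "zor_poly g a z = g z / (z - a) ^ n" if "z \<in> ball a r" "z \<in> U - {a}" for z
      using r(4) that by (simp add: nn)
  qed (use U in auto)
  moreover have "ball a r \<union> (U - {a}) = U" using r a by (auto simp: subset_iff)
  moreover have "g z = (z - a) ^ n * H z" if "z \<in> U" for z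
  proof (cases "z \<in> ball a r")
    case True
    then show ?thesis using r(4) by (simp add: H_def nn)
  next
    case False
    then have "z \<noteq> a" using r(1) by auto
    then show ?thesis using False by (simp add: H_def)
  qed
  ultimately show ?thesis by metis
qed

text \<open>If - \<gamma> is not a natural number, the term is the power l - \<gamma> of 1 + x times
  a regular factor, and \<open>P\<close> is 0. Otherwise the whole term is regular at -1, and enough
  of its Taylor expansion goes into \<open>P\<close> to reach any order \<open>s0\<close>.\<close>

lemma singular_term_left:
  fixes g :: "complex \<Rightarrow> complex"
  assumes E: "open E" "complex_of_real ` {-1..1} \<subseteq> E" and g: "g holomorphic_on E"
    and sing: "- \<gamma> \<notin> \<nat> \<Longrightarrow> (\<exists>H. H holomorphic_on E \<and> (\<forall>z\<in>E. g z = (z + 1) ^ l * H z)) \<and> s0 \<le> real l - \<gamma>"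
  shows "\<exists>P. \<forall>m. wreg {-1<..<1/2} s0 m (\<lambda>x. Re (g (of_real x)) / ((1 - x) powr \<beta> * (1 + x) powr \<gamma>) - poly P x)"
proof -
  let ?I = "{-1<..<1/2} :: real set"
  have I: "?I \<subseteq> {-1<..<1}" "?I \<subseteq> {-1..1/2}" by auto
  \<comment> \<open>On this half plane the principal power of 1 - z is holomorphic.\<close>
  define U where "U = E \<inter> {z. Re z < 1}"
  have U: "open U" unfolding U_def by (intro open_Int E open_halfspace_Re_lt)
  have IU: "complex_of_real ` {-1..1/2} \<subseteq> U" using E(2) by (auto simp: U_def subset_iff image_iff)
  have reg: "wreg ?I 0 m (\<lambda>x. Re (G (of_real x)))" if "G holomorphic_on U" for G m
    by (rule wreg_holomorphic[OF U that IU I(2,1)])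
  have w: "(\<lambda>z. (1 - z) powr (- of_real \<beta>)) holomorphic_on U"
    by (intro holomorphic_intros) (auto simp: U_def complex_nonpos_Reals_iff)
  have wr: "(1 - complex_of_real x) powr (- of_real \<beta>) = of_real ((1 - x) powr (- \<beta>))" if "x \<in> ?I" for x
    using powr_of_real[of "1 - x" "- \<beta>"] that by simp
  have Re_scale: "Re (of_real a * z) = a * Re z" for a z by simp
  have UE: "U \<subseteq> E" by (auto simp: U_def)
  show ?thesis
  proof (cases "- \<gamma> \<in> \<nat>")
    case False
    then obtain H where H: "H holomorphic_on E" "\<forall>z\<in>E. g z = (z + 1) ^ l * H z" and s0: "s0 \<le> real l - \<gamma>"
      using sing by blast
    have "wreg ?I s0 m (\<lambda>x. Re (g (of_real x)) / ((1 - x) powr \<beta> * (1 + x) powr \<gamma>) - poly 0 x)" for m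
    proof (rule wreg_cong[OF open_greaterThanLessThan])
      have "(\<lambda>z. H z * (1 - z) powr (- of_real \<beta>)) holomorphic_on U"
        by (intro holomorphic_on_mult w holomorphic_on_subset[OF H(1) UE])
      from wreg_mult[OF wreg_one_plus_powr[of "real l - \<gamma>"] reg[OF this]]
      show "wreg ?I s0 m (\<lambda>x. (1 + x) powr (real l - \<gamma>) * Re (H (of_real x) * (1 - of_real x) powr (- of_real \<beta>)))"
        using s0 by (intro wreg_weaken[OF I(1) s0]) simp
      fix x assume x: "x \<in> ?I"
      then have "complex_of_real x \<in> E" using E(2) by (auto simp: subset_iff image_iff)
      then have "g (of_real x) = of_real ((1 + x) ^ l) * H (of_real x)" using H(2) by (simp add: add.commute)
      then have "Re (g (of_real x)) = (1 + x) ^ l * Re (H (of_real x))" by (simp only: Re_scale)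
      moreover have "Re (H (of_real x) * (1 - of_real x) powr (- of_real \<beta>)) = Re (H (of_real x)) * (1 - x) powr (- \<beta>)"
        unfolding wr[OF x] by simp
      ultimately show "(1 + x) powr (real l - \<gamma>) * Re (H (of_real x) * (1 - of_real x) powr (- of_real \<beta>)) =
         Re (g (of_real x)) / ((1 - x) powr \<beta> * (1 + x) powr \<gamma>) - poly 0 x"
        using x by (simp add: powr_diff powr_realpow powr_minus field_simps)
    qed
    then show ?thesis by blast
  next
    case True
    then obtain n where n: "- \<gamma> = real n" by (rule Nats_cases)
    obtain J :: nat where J: "s0 \<le> real J" using real_arch_simple by blast
    have "(\<lambda>z. g z * (1 - z) powr (- of_real \<beta>)) holomorphic_on U"
      by (intro holomorphic_on_mult w holomorphic_on_subset[OF g UE])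
    from holomorphic_taylor_factor[OF U this, where n = J and a = "-1"]
    obtain c H where H: "H holomorphic_on U"
      "\<And>z. z \<in> U \<Longrightarrow> g z * (1 - z) powr (- of_real \<beta>) = (\<Sum>j<J. c j * (z + 1) ^ j) + (z + 1) ^ J * H z" by auto
    define P where "P = [:1, 1:] ^ n * (\<Sum>j<J. Polynomial.smult (Re (c j)) ([:1, 1:] ^ j))"
    have "wreg ?I s0 m (\<lambda>x. Re (g (of_real x)) / ((1 - x) powr \<beta> * (1 + x) powr \<gamma>) - poly P x)" for m
    proof (rule wreg_cong[OF open_greaterThanLessThan])
      have "wreg ?I (real (J + n) + 0) m (\<lambda>x. (1 + x) ^ (J + n) * Re (H (of_real x)))"
        by (rule wreg_mult[OF wreg_one_plus_power reg[OF H(1)]])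
      then show "wreg ?I s0 m (\<lambda>x. (1 + x) ^ (J + n) * Re (H (of_real x)))"
        by (rule wreg_weaken[OF I(1), rotated]) (use J in simp)
      fix x assume x: "x \<in> ?I"
      then have xU: "complex_of_real x \<in> U" using IU by (auto simp: subset_iff image_iff)
      have p: "(complex_of_real x + 1) ^ j = of_real ((1 + x) ^ j)" for j by (simp add: add.commute)
      have "Re (g (of_real x)) * (1 - x) powr (- \<beta>) = Re (g (of_real x) * (1 - of_real x) powr (- of_real \<beta>))"
        unfolding wr[OF x] by simp
      also have "\<dots> = (\<Sum>j<J. Re (c j) * (1 + x) ^ j) + (1 + x) ^ J * Re (H (of_real x))"
        unfolding H(2)[OF xU] p by (simp add: Re_sum del: of_real_power)
      finally have e: "Re (g (of_real x)) * (1 - x) powr (- \<beta>) = (\<Sum>j<J. Re (c j) * (1 + x) ^ j) + (1 + x) ^ J * Re (H (of_real x))" .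
      have \<gamma>: "\<gamma> = - real n" using n by simp
      have "(1 + x) powr \<gamma> = inverse ((1 + x) powr real n)" unfolding \<gamma> by (rule powr_minus)
      also have "(1 + x) powr real n = (1 + x) ^ n" using x by (intro powr_realpow) auto
      finally have g': "(1 + x) powr \<gamma> = inverse ((1 + x) ^ n)" .
      have "Re (g (of_real x)) / ((1 - x) powr \<beta> * (1 + x) powr \<gamma>) = (1 + x) ^ n * (Re (g (of_real x)) * (1 - x) powr (- \<beta>))"
        unfolding g' powr_minus[of "1 - x"] by (simp add: divide_inverse)
      also have "\<dots> = (1 + x) ^ n * (\<Sum>j<J. Re (c j) * (1 + x) ^ j) + (1 + x) ^ (J + n) * Re (H (of_real x))"
        unfolding e by (simp only: distrib_left power_add mult_ac)
      also have "(1 + x) ^ n * (\<Sum>j<J. Re (c j) * (1 + x) ^ j) = poly P x" by (simp add: P_def poly_sum)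
      finally show "(1 + x) ^ (J + n) * Re (H (of_real x)) = Re (g (of_real x)) / ((1 - x) powr \<beta> * (1 + x) powr \<gamma>) - poly P x"
        by simp
    qed
    then show ?thesis by blast
  qed
qed

lemma potential_left:
  assumes "\<And>i. i \<in> {1..S} \<Longrightarrow> \<exists>E. open E \<and> complex_of_real ` {-1..1} \<subseteq> E \<and> g i holomorphic_on E \<and>
     (- \<gamma> i \<notin> \<nat> \<longrightarrow> (\<exists>H. H holomorphic_on E \<and> (\<forall>z\<in>E. g i z = (z + 1) ^ l i * H z)) \<and> s0 \<le> real (l i) - \<gamma> i)"
  shows "\<exists>P. \<forall>m. wreg {-1<..<1/2} s0 m (\<lambda>x. potential S g \<beta> \<gamma> x - poly P x)"
proof -
  have "\<exists>P. \<forall>m. wreg {-1<..<1/2} s0 m (\<lambda>x. Re (g i (of_real x)) / ((1 - x) powr \<beta> i * (1 + x) powr \<gamma> i) - poly P x)"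
    if i: "i \<in> {1..S}" for i
  proof -
    obtain E where E: "open E" "complex_of_real ` {-1..1} \<subseteq> E" "g i holomorphic_on E"
      "- \<gamma> i \<notin> \<nat> \<Longrightarrow> (\<exists>H. H holomorphic_on E \<and> (\<forall>z\<in>E. g i z = (z + 1) ^ l i * H z)) \<and> s0 \<le> real (l i) - \<gamma> i"
      using assms[OF i] by blast
    show ?thesis by (rule singular_term_left[OF E(1,2,3)]) (rule E(4))
  qed
  then have "\<exists>P. \<forall>i\<in>{1..S}. \<forall>m. wreg {-1<..<1/2} s0 m (\<lambda>x. Re (g i (of_real x)) / ((1 - x) powr \<beta> i * (1 + x) powr \<gamma> i) - poly (P i) x)"
    by (intro bchoice) blast
  then obtain P where P: "\<And>i m. i \<in> {1..S} \<Longrightarrow>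
      wreg {-1<..<1/2} s0 m (\<lambda>x. Re (g i (of_real x)) / ((1 - x) powr \<beta> i * (1 + x) powr \<gamma> i) - poly (P i) x)" by blast
  have "wreg {-1<..<1/2} s0 m (\<lambda>x. \<Sum>i=1..S. (Re (g i (of_real x)) / ((1 - x) powr \<beta> i * (1 + x) powr \<gamma> i) - poly (P i) x))" for m
    by (intro wreg_sum P) auto
  then have "\<forall>m. wreg {-1<..<1/2} s0 m (\<lambda>x. potential S g \<beta> \<gamma> x - poly (\<Sum>i=1..S. P i) x)"
    by (simp add: potential_def poly_sum sum_subtractf)
  then show ?thesis by blast
qed

text \<open>Reflection exchanges the roles of the exponents, so \<open>potential_left\<close> also
  describes the right endpoint.\<close>

lemma potential_reflect: "potential S g \<beta> \<gamma> (- x) = potential S (\<lambda>i z. g i (- z)) \<gamma> \<beta> x"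
  unfolding potential_def
proof (rule sum.cong[OF refl])
  fix i
  show "Re (g i (of_real (- x))) / ((1 - - x) powr \<beta> i * (1 + - x) powr \<gamma> i) =
    Re (g i (- of_real x)) / ((1 - x) powr \<gamma> i * (1 + x) powr \<beta> i)"
    by (subst mult.commute) simp
qed

lemma continuous_and_integrable_if_wreg:
  assumes L: "wreg {-1<..<1/2} s 1 (\<lambda>x. q x - poly P x)" and R: "wreg {-1<..<1/2} s 1 (\<lambda>x. q (- x) - poly Q x)"
    and s: "s > -1"
  shows "continuous_on {-1<..<1} q" "q absolutely_integrable_on {-1..1}"
proof -
  obtain H where H: "wreg {-1<..<1} s 1 (\<lambda>x. q x - poly H x)" using wreg_glue[OF L R] by blast
  have "continuous_on {-1<..<1} (\<lambda>x. (q x - poly H x) + poly H x)"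
    by (intro continuous_on_add wreg_continuous_on[OF H[unfolded One_nat_def]] continuous_intros)
  then show cont: "continuous_on {-1<..<1} q" by simp
  \<comment> \<open>The polynomial part has order 0, so \<open>q\<close> itself is only assigned an
    order up to 0.\<close>
  define t where "t = min s 0"
  have t: "t > -1" "t \<le> 0" "t \<le> s" using s by (auto simp: t_def)
  have "wreg {-1<..<1} t 1 (\<lambda>x. (q x - poly H x) + poly H x)"
    by (intro wreg_add wreg_weaken[OF order_refl t(3) H] wreg_weaken[OF order_refl t(2) wreg_poly[OF order_refl]])
  then have "wreg {-1<..<1} t 1 q" by simp
  then obtain C where C: "C > 0" "\<And>x. x \<in> {-1<..<1} \<Longrightarrow> \<bar>q x\<bar> \<le> C * (1 - x\<^sup>2) powr t"
    using wreg_bounded_pos by blast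
  define F where "F = (\<lambda>x::real. ((1 + x) powr (t + 1) - (1 - x) powr (t + 1)) / (t + 1))"
  have "((\<lambda>x. (1 + x) powr t + (1 - x) powr t) has_integral (F 1 - F (-1))) {-1..1}"
  proof (rule fundamental_theorem_of_calculus_interior)
    show "continuous_on {-1..1} F" unfolding F_def
      by (intro continuous_on_divide continuous_on_diff continuous_on_const continuous_on_powr' continuous_on_add continuous_on_id) (use t in auto)
    show "(F has_vector_derivative ((1 + x) powr t + (1 - x) powr t)) (at x)" if "x \<in> {-1<..<1}" for x
    proof -
      have "((\<lambda>x. ((1 + x) powr (t + 1) - (1 - x) powr (t + 1))) has_real_derivative
          ((t + 1) * ((1 + x) powr t + (1 - x) powr t))) (at x)"
        using that by (auto intro!: derivative_eq_intros simp: algebra_simps)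
      from DERIV_cdivide[OF this, of "t + 1"] show ?thesis
        using t by (simp add: F_def has_real_derivative_iff_has_vector_derivative)
    qed
  qed simp
  then have int: "(\<lambda>x. C * ((1 + x) powr t + (1 - x) powr t)) integrable_on {-1..1}"
    using has_integral_mult_right by blast
  have le: "\<bar>q x\<bar> \<le> C * ((1 + x) powr t + (1 - x) powr t)" if x: "x \<in> {-1<..<1}" for x
  proof -
    have "1 - x\<^sup>2 = (1 - x) * (1 + x)" by (simp add: power2_eq_square algebra_simps)
    then have e: "(1 - x\<^sup>2) powr t = (1 - x) powr t * (1 + x) powr t" using x by (simp add: powr_mult)
    have "(1 - x) powr t * (1 + x) powr t \<le> (1 + x) powr t + (1 - x) powr t"
    proof (cases "x \<ge> 0")
      case True
      then have "(1 + x) powr t \<le> 1 powr t" using t by (intro powr_mono2') auto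
      then have "(1 - x) powr t * (1 + x) powr t \<le> (1 - x) powr t * 1" by (intro mult_left_mono) auto
      then show ?thesis using powr_ge_zero[of "1 + x" t] by linarith
    next
      case False
      then have "(1 - x) powr t \<le> 1 powr t" using t by (intro powr_mono2') auto
      then have "(1 - x) powr t * (1 + x) powr t \<le> 1 * (1 + x) powr t" by (intro mult_right_mono) auto
      then show ?thesis using powr_ge_zero[of "1 - x" t] by linarith
    qed
    then have "C * (1 - x\<^sup>2) powr t \<le> C * ((1 + x) powr t + (1 - x) powr t)"
      using C(1) unfolding e by (intro mult_left_mono) auto
    then show ?thesis using C(2)[OF x] by simp
  qed
  have "q absolutely_integrable_on {-1<..<1}"
  proof (rule measurable_bounded_by_integrable_imp_absolutely_integrable)
    show "q \<in> borel_measurable (lebesgue_on {-1<..<1})"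
      by (rule continuous_imp_measurable_on_sets_lebesgue[OF cont]) auto
    show "(\<lambda>x. C * ((1 + x) powr t + (1 - x) powr t)) integrable_on {-1<..<1}"
      using int integrable_on_Icc_iff_Ioo by blast
  qed (use le in auto)
  then show "q absolutely_integrable_on {-1..1}" by (simp add: absolutely_integrable_on_Icc_iff_Ioo)
qed

section \<open>Neighbourhoods of the interval inside a Bernstein ellipse\<close>

lemma convex_bernstein_interior: "convex {z :: complex. cmod (z - 1) + cmod (z + 1) < b}"
proof (rule convexI)
  fix x y :: complex and u v :: real
  assume x: "x \<in> {z. cmod (z - 1) + cmod (z + 1) < b}" and y: "y \<in> {z. cmod (z - 1) + cmod (z + 1) < b}"
    and uv: "0 \<le> u" "0 \<le> v" "u + v = 1"
  have tri: "cmod (u *\<^sub>R x + v *\<^sub>R y + c) \<le> u * cmod (x + c) + v * cmod (y + c)" for c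
  proof -
    have "u *\<^sub>R x + v *\<^sub>R y + c = u *\<^sub>R (x + c) + v *\<^sub>R (y + c)"
      using uv(3) by (simp add: scaleR_add_right flip: scaleR_add_left)
    then show ?thesis using norm_triangle_ineq[of "u *\<^sub>R (x + c)" "v *\<^sub>R (y + c)"] uv by simp
  qed
  have "cmod (u *\<^sub>R x + v *\<^sub>R y - 1) + cmod (u *\<^sub>R x + v *\<^sub>R y + 1)
      \<le> u * (cmod (x - 1) + cmod (x + 1)) + v * (cmod (y - 1) + cmod (y + 1))"
    using tri[of "-1"] tri[of 1] by (simp add: algebra_simps)
  also have "\<dots> < b" using convex_bound_lt[of "cmod (x - 1) + cmod (x + 1)" b "cmod (y - 1) + cmod (y + 1)" u v] x y uv by simp
  finally show "u *\<^sub>R x + v *\<^sub>R y \<in> {z. cmod (z - 1) + cmod (z + 1) < b}" by simp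
qed

text \<open>The interior of the ellipse is convex, hence connected, so that zeros of finite order
  can be factored out, and symmetric, so that reflection stays inside.\<close>

lemma bernstein_neighbourhood:
  assumes \<rho>: "\<rho> > 1" and g: "g analytic_on bernstein_region \<rho>"
  obtains E where "open E" "connected E" "complex_of_real ` {-1..1} \<subseteq> E" "g holomorphic_on E" "\<And>z. z \<in> E \<Longrightarrow> - z \<in> E"
proof (rule that)
  let ?E = "{z :: complex. cmod (z - 1) + cmod (z + 1) < \<rho> + 1 / \<rho>}"
  show "open ?E" by (intro open_Collect_less continuous_intros)
  show "connected ?E" by (intro convex_connected convex_bernstein_interior)
  \<comment> \<open>The focal sum \<rho> + 1 / \<rho> exceeds 2, which is the sum on the segment
    between the foci.\<close>
  have "0 < (\<rho> - 1)\<^sup>2 / \<rho>" using \<rho> by simp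
  also have "\<dots> = \<rho> + 1 / \<rho> - 2" using \<rho> by (simp add: power2_eq_square field_simps)
  finally have b: "2 < \<rho> + 1 / \<rho>" by simp
  show "complex_of_real ` {-1..1} \<subseteq> ?E"
  proof
    fix z assume "z \<in> complex_of_real ` {-1..1}"
    then obtain x where x: "z = of_real x" "x \<in> {-1..1}" by auto
    have "z - 1 = complex_of_real (x - 1)" "z + 1 = complex_of_real (x + 1)" by (simp_all add: x(1))
    then have "cmod (z - 1) + cmod (z + 1) = \<bar>x - 1\<bar> + \<bar>x + 1\<bar>" by (simp only: norm_of_real)
    also have "\<dots> = 2" using x(2) by (simp add: abs_if)
    finally show "z \<in> ?E" using b by simp
  qed
  show "g holomorphic_on ?E"
    using g by (auto intro: holomorphic_on_subset[OF analytic_imp_holomorphic] simp: bernstein_region_def)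
  show "- z \<in> ?E" if "z \<in> ?E" for z
    using that norm_minus_cancel[of "z - 1"] norm_minus_cancel[of "z + 1"] by (simp add: minus_diff_commute algebra_simps)
qed

text \<open>Used by contraposition: without singular terms the potential would be bounded at both
  endpoints. This is what makes the exponent of the rate finite.\<close>

lemma Bfun_at_right_if_wreg:
  assumes "wreg {-1<..<1/2} 0 m (\<lambda>x. q x - poly P x)"
  shows "Bfun q (at_right (-1))"
proof -
  have "wreg {-1<..<1/2} 0 m (\<lambda>x. (q x - poly P x) + poly P x)"
    by (intro wreg_add assms wreg_poly) auto
  then obtain C where C: "C > 0" "\<And>x. x \<in> {-1<..<1/2} \<Longrightarrow> \<bar>q x\<bar> \<le> C * (1 - x\<^sup>2) powr 0"
    using wreg_bounded_pos by (metis (no_types, lifting) diff_add_cancel ext)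
  have "\<forall>\<^sub>F x in at_right (-1). norm (q x) \<le> C"
    unfolding eventually_at_right_field
  proof (intro exI[of _ "1/2"] conjI allI impI)
    fix x :: real assume "-1 < x" "x < 1/2"
    then have x: "x \<in> {-1<..<1/2}" by simp
    then have "x\<^sup>2 < 1" by (intro square_less_1) auto
    then show "norm (q x) \<le> C" using C(2)[OF x] by simp
  qed simp
  then show ?thesis by (rule BfunI)
qed

text \<open>One exponent below all singular exponents at an endpoint that still permits the order
  \<open>s\<close>. The entry \<open>max 0 (s - c)\<close> serves the case of no singular terms
  there, in which any exponent is admissible.\<close>

lemma uniform_lower_exponent:
  fixes f :: "'i \<Rightarrow> real"
  assumes "finite A" "\<And>i. i \<in> A \<Longrightarrow> f i > -1" "\<And>i. i \<in> A \<Longrightarrow> s \<le> f i + c"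
  shows "\<exists>s0>-1. (\<forall>i\<in>A. s0 \<le> f i) \<and> s \<le> s0 + c"
proof -
  define B where "B = insert (max 0 (s - c)) (f ` A)"
  have B: "finite B" "B \<noteq> {}" using assms(1) by (auto simp: B_def)
  have "Min B \<in> B" using B by (rule Min_in)
  then have "Min B > -1" "s \<le> Min B + c" using assms(2,3) by (auto simp: B_def)
  moreover have "\<forall>i\<in>A. Min B \<le> f i" using B(1) by (auto simp: B_def)
  ultimately show ?thesis by blast
qed

section \<open>Convergence of the eigenvalues\<close>

context sturm_liouville
begin

text \<open>Both endpoint expansions of y' are weakened to the common order \<open>s\<close> and
  glued, which is the input of \<open>c1_approximation\<close>. The result matches value and slope
  at both ends and therefore lies in the Galerkin space.\<close>

lemma eigenfunction_approximation:
  assumes y: "efun mu y y'" and s: "s > 0"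
    and L: "s0 > -1" "s \<le> s0 + dirichlet_indicator bL + 1" "\<And>m. wreg {-1<..<1/2} s0 m (\<lambda>x. q x - poly P x)"
    and R: "s1 > -1" "s \<le> s1 + dirichlet_indicator bR + 1" "\<And>m. wreg {-1<..<1/2} s1 m (\<lambda>x. q (- x) - poly Q x)"
  shows "\<exists>K. \<forall>\<^sub>F N in sequentially. \<exists>v\<in>S N. poly v (-1) = y (-1) \<and>
     integral {-1..1} (\<lambda>x. (y' x - poly (pderiv v) x)\<^sup>2) \<le> K * real N powr (- (4 * s + 2))"
proof -
  let ?I = "{-1<..<1/2} :: real set"
  have I: "?I \<subseteq> {-1<..<1}" by auto
  note c1 = efunD(1)[OF y] and cy = efunD(6)[OF y] and cy' = efunD(7)[OF y]
  have dy: "(y has_real_derivative y' x) (at x)" if "x \<in> {-1<..<1}" for x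
    using c1_fun_interior[OF c1 that] .
  note dy' = efunD(2)[OF y]
  obtain k :: nat where k: "s + 1 < real k" using reals_Archimedean2 by blast
  have dL: "dirichlet_indicator bL = 1 \<Longrightarrow> y (-1) = 0"
    using efunD(3)[OF y] bcL by (auto simp: dirichlet_indicator_def split: if_splits)
  have dR: "dirichlet_indicator bR = 1 \<Longrightarrow> y 1 = 0"
    using efunD(4)[OF y] bcR by (auto simp: dirichlet_indicator_def split: if_splits)
  obtain PL where "wreg ?I (s0 + dirichlet_indicator bL + 1) (Suc (2 * k)) (\<lambda>x. y' x - poly PL x)"
    using left_regularity[OF L(3), of y y' mu "dirichlet_indicator bL" "Suc (2 * k)"]
      continuous_on_subset[OF cy, of "{-1..1/2}"] continuous_on_subset[OF cy', of "{-1..1/2}"] dy dy' dL L(1)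
    by (force simp: dirichlet_indicator_def)
  then have WL: "wreg ?I s (Suc (2 * k)) (\<lambda>x. y' x - poly PL x)" by (rule wreg_weaken[OF I L(2)])
  \<comment> \<open>The reflected function y(- x) has derivative - y'(- x) and solves the equation
    with the reflected potential, so the left endpoint result applies.\<close>
  have "\<exists>Q. wreg ?I (s1 + dirichlet_indicator bR + 1) (Suc (2 * k)) (\<lambda>x. - y' (- x) - poly Q x)"
  proof (rule left_regularity[OF R(3), where y = "\<lambda>x. y (- x)" and lam = mu])
    show "continuous_on {-1..1/2} (\<lambda>x. y (- x))"
      by (rule continuous_on_compose2[OF cy]) (auto intro!: continuous_intros)
    show "continuous_on {-1..1/2} (\<lambda>x. - y' (- x))"
      by (rule continuous_on_minus[OF continuous_on_compose2[OF cy']]) (auto intro!: continuous_intros)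
    show "((\<lambda>x. y (- x)) has_real_derivative - y' (- x)) (at x)" if "x \<in> ?I" for x
    proof -
      have "- x \<in> {-1<..<1}" using that by auto
      from DERIV_chain2[OF dy[OF this] DERIV_minus[OF DERIV_ident]] show ?thesis by simp
    qed
    show "((\<lambda>x. - y' (- x)) has_real_derivative (q (- x) - mu) * y (- x)) (at x)" if "x \<in> ?I" for x
    proof -
      have "- x \<in> {-1<..<1}" using that by auto
      from DERIV_minus[OF DERIV_chain2[OF dy'[OF this] DERIV_minus[OF DERIV_ident]]] show ?thesis by simp
    qed
    show "dirichlet_indicator bR = 0 \<or> dirichlet_indicator bR = 1" by (simp add: dirichlet_indicator_def)
    show "y (- (- 1)) = 0" if "dirichlet_indicator bR = 1" using dR[OF that] by simp
    show "s1 > -1" by (rule R(1))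
  qed
  then obtain PR where "wreg ?I (s1 + dirichlet_indicator bR + 1) (Suc (2 * k)) (\<lambda>x. - y' (- x) - poly PR x)" by blast
  then have "wreg ?I s (Suc (2 * k)) (\<lambda>x. - (- y' (- x) - poly PR x))"
    by (intro wreg_minus[OF I] wreg_weaken[OF I R(2)])
  then have WR: "wreg ?I s (Suc (2 * k)) (\<lambda>x. y' (- x) - poly (- PR) x)" by (simp add: add.commute)
  obtain H where H: "wreg {-1<..<1} s (Suc (2 * k)) (\<lambda>x. y' x - poly H x)" using wreg_glue[OF WL WR] by blast
  obtain K where K: "\<forall>\<^sub>F N in sequentially. \<exists>v. Polynomial.degree v \<le> N + 1 \<and> poly v 1 = y 1 \<and> poly v (-1) = y (-1) \<and>
     poly (pderiv v) 1 = y' 1 \<and> poly (pderiv v) (-1) = y' (-1) \<and>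
     integral {-1..1} (\<lambda>x. (y' x - poly (pderiv v) x)\<^sup>2) \<le> K * real N powr (- (4 * s + 2))"
    using c1_approximation[OF H k s cy', of y] c1 unfolding c1_fun_def by blast
  show ?thesis
  proof (intro exI[of _ K] eventually_mono[OF K])
    fix N assume "\<exists>v. Polynomial.degree v \<le> N + 1 \<and> poly v 1 = y 1 \<and> poly v (-1) = y (-1) \<and>
     poly (pderiv v) 1 = y' 1 \<and> poly (pderiv v) (-1) = y' (-1) \<and>
     integral {-1..1} (\<lambda>x. (y' x - poly (pderiv v) x)\<^sup>2) \<le> K * real N powr (- (4 * s + 2))"
    then obtain v where v: "Polynomial.degree v \<le> N + 1" "poly v 1 = y 1" "poly v (-1) = y (-1)"
     "poly (pderiv v) 1 = y' 1" "poly (pderiv v) (-1) = y' (-1)"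
     "integral {-1..1} (\<lambda>x. (y' x - poly (pderiv v) x)\<^sup>2) \<le> K * real N powr (- (4 * s + 2))" by blast
    have "v \<in> S N" using v efunD(3,4)[OF y] by (simp add: galerkin_space_def boundary_conditions_def)
    then show "\<exists>v\<in>S N. poly v (-1) = y (-1) \<and>
     integral {-1..1} (\<lambda>x. (y' x - poly (pderiv v) x)\<^sup>2) \<le> K * real N powr (- (4 * s + 2))" using v by blast
  qed
qed

text \<open>All \<open>k\<close> eigenfunctions up to the index have to be approximated, because the
  min-max bound requires a trial space of dimension \<open>k\<close>; the worst of their constants
  enters the rate.\<close>

lemma galerkin_convergence_rate:
  assumes index: "sl_eigenvalue_of_index q aL bL aR bR k lam"
    and span: "\<forall>\<^sub>F N in sequentially. S N = poly_span R N"
    and p: "p > 0"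
    and approx: "\<And>mu y y'. efun mu y y' \<Longrightarrow> \<exists>K. \<forall>\<^sub>F N in sequentially. \<exists>v\<in>S N. poly v (-1) = y (-1) \<and>
     integral {-1..1} (\<lambda>x. (y' x - poly (pderiv v) x)\<^sup>2) \<le> K * real N powr (- p)"
  shows "(\<lambda>N. lam - numerical_eigenvalue q R N k) \<in> O(\<lambda>N. (real N + 1) powr (- p))"
proof -
  define A where "A = {\<mu>. sl_eigenvalue q aL bL aR bR \<mu> \<and> \<mu> < lam}"
  have lam: "sl_eigenvalue q aL bL aR bR lam" and A: "finite A" and cardA: "card A + 1 = k"
    using index unfolding sl_eigenvalue_of_index_def A_def by auto
  have k: "1 \<le> k" using cardA by simp
  have "card (insert lam A) = k" using A cardA by (simp add: A_def)
  \<comment> \<open>Any enumeration will do: the upper bound asks for distinct eigenvalues not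
    exceeding \<open>lam\<close>, in no particular order.\<close>
  then obtain \<mu> where \<mu>: "bij_betw \<mu> {..<k} (insert lam A)"
    using ex_bij_betw_nat_finite[of "insert lam A"] A by (auto simp: atLeast0LessThan)
  have \<mu>_in: "\<mu> j \<in> insert lam A" if "j < k" for j using \<mu> that unfolding bij_betw_def by blast
  have \<mu>_ev: "sl_eigenvalue q aL bL aR bR (\<mu> j)" "\<mu> j \<le> lam" if "j < k" for j
    using \<mu>_in[OF that] lam by (auto simp: A_def)
  have "\<forall>j\<in>{..<k}. \<exists>y. \<exists>y'. efun (\<mu> j) y y' \<and> ip y y = 1" using eigenfunction_normalized \<mu>_ev(1) by blast
  from bchoice[OF this] obtain y where "\<forall>j\<in>{..<k}. \<exists>y'. efun (\<mu> j) (y j) y' \<and> ip (y j) (y j) = 1" by blast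
  from bchoice[OF this] obtain y' where y: "\<And>j. j < k \<Longrightarrow> efun (\<mu> j) (y j) (y' j)" "\<And>j. j < k \<Longrightarrow> ip (y j) (y j) = 1"
    by blast
  have "\<forall>j\<in>{..<k}. \<exists>K. \<forall>\<^sub>F N in sequentially. \<exists>v\<in>S N. poly v (-1) = y j (-1) \<and>
     integral {-1..1} (\<lambda>x. (y' j x - poly (pderiv v) x)\<^sup>2) \<le> K * real N powr (- p)"
    using approx[OF y(1)] by blast
  from bchoice[OF this] obtain K where K: "\<And>j. j < k \<Longrightarrow> \<forall>\<^sub>F N in sequentially. \<exists>v\<in>S N. poly v (-1) = y j (-1) \<and>
     integral {-1..1} (\<lambda>x. (y' j x - poly (pderiv v) x)\<^sup>2) \<le> K j * real N powr (- p)" by blast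
  define M where "M = (\<Sum>j<k. \<bar>K j\<bar>)"
  have M: "M \<ge> 0" unfolding M_def by (intro sum_nonneg) auto
  have KM: "K j \<le> M" if "j < k" for j
  proof -
    have "\<bar>K j\<bar> \<le> M" unfolding M_def by (rule member_le_sum) (use that in auto)
    then show ?thesis by simp
  qed
  have inj: "\<mu> i \<noteq> \<mu> j" if "i < k" "j < k" "i \<noteq> j" for i j
    using \<mu> that unfolding bij_betw_def inj_on_def by blast
  have "\<exists>K>0. \<exists>\<delta>>0. \<forall>N U \<nu> v E. eigsys N U \<nu> \<longrightarrow> k \<le> N \<longrightarrow> 0 \<le> E \<longrightarrow> E \<le> \<delta> \<longrightarrow>
     (\<forall>j<k. v j \<in> S N \<and> poly (v j) (-1) = y j (-1) \<and>
        integral {-1..1} (\<lambda>x. (y' j x - poly (pderiv (v j)) x)\<^sup>2) \<le> E) \<longrightarrow> \<nu> (k - 1) \<le> lam + K * E"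
    by (rule ritz_upper_bound[OF k]) (fact y(1), fact y(2), fact inj, fact \<mu>_ev(2))
  then obtain K1 \<delta> where K1: "K1 > 0" "\<delta> > 0" and up: "\<forall>N U \<nu> v E. eigsys N U \<nu> \<longrightarrow> k \<le> N \<longrightarrow> 0 \<le> E \<longrightarrow> E \<le> \<delta> \<longrightarrow>
     (\<forall>j<k. v j \<in> S N \<and> poly (v j) (-1) = y j (-1) \<and>
        integral {-1..1} (\<lambda>x. (y' j x - poly (pderiv (v j)) x)\<^sup>2) \<le> E) \<longrightarrow> \<nu> (k - 1) \<le> lam + K1 * E"
    by (elim exE conjE) (rule that)
  obtain N1 where N1: "\<And>N. N \<ge> N1 \<Longrightarrow> S N = poly_span R N" using span unfolding eventually_sequentially by blast
  \<comment> \<open>2 for the independence of the basis, \<open>k\<close> for the index to exist,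
    \<open>N1\<close> for the basis to span.\<close>
  define N0 where "N0 = max 2 (max k N1)"
  have "\<forall>N. \<exists>U. \<exists>\<nu>. N \<ge> N0 \<longrightarrow> eigsys N U \<nu> \<and> numerical_eigenvalue q R N k = \<nu> (k - 1)"
  proof
    fix N
    show "\<exists>U \<nu>. N \<ge> N0 \<longrightarrow> eigsys N U \<nu> \<and> numerical_eigenvalue q R N k = \<nu> (k - 1)"
    proof (cases "N \<ge> N0")
      case True
      then have N: "N \<ge> 2" "S N = poly_span R N" "k \<le> N" using N1 by (auto simp: N0_def)
      obtain U \<nu> where "(\<forall>i<N. U i \<in> S N) \<and>
     (\<forall>i<N. \<forall>j<N. pip (U i) (U j) = (if i = j then 1 else 0)) \<and>
     (\<forall>i<N. \<forall>r\<in>S N. pform (U i) r = \<nu> i * pip (U i) r) \<and>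
     (\<forall>i j. i \<le> j \<longrightarrow> j < N \<longrightarrow> \<nu> i \<le> \<nu> j) \<and>
     (\<forall>r\<in>S N. r = (\<Sum>i<N. Polynomial.smult (pip r (U i)) (U i))) \<and>
     (\<forall>k. 1 \<le> k \<longrightarrow> k \<le> N \<longrightarrow> numerical_eigenvalue q R N k = \<nu> (k - 1))"
        using galerkin_eigenvectors[OF N(1,2)] by (elim exE) (rule that)
      then have "eigsys N U \<nu> \<and> numerical_eigenvalue q R N k = \<nu> (k - 1)"
        unfolding eigsys_def using k N(3) by (elim conjE) (intro conjI, assumption+, simp)
      then show ?thesis by (intro exI impI)
    qed simp
  qed
  from choice[OF this] obtain U where "\<forall>N. \<exists>\<nu>. N \<ge> N0 \<longrightarrow> eigsys N (U N) \<nu> \<and> numerical_eigenvalue q R N k = \<nu> (k - 1)"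
    by (rule exE)
  from choice[OF this] obtain \<nu> where
    "\<forall>N. N \<ge> N0 \<longrightarrow> eigsys N (U N) (\<nu> N) \<and> numerical_eigenvalue q R N k = \<nu> N (k - 1)" by (rule exE)
  then have sys: "\<And>N. N \<ge> N0 \<Longrightarrow> eigsys N (U N) (\<nu> N)"
    and num: "\<And>N. N \<ge> N0 \<Longrightarrow> numerical_eigenvalue q R N k = \<nu> N (k - 1)" by auto
  have kN0: "k \<le> N0" by (simp add: N0_def)
  have low: "lam \<le> \<nu> N (k - 1)" if "N \<ge> N0" for N
    by (rule ritz_lower_bound[OF sys k kN0 _ _ that]) (use A cardA in \<open>simp_all add: A_def\<close>)
  have "((\<lambda>N. real N powr (- p)) \<longlongrightarrow> 0) sequentially"
    by (rule tendsto_neg_powr) (use p in \<open>auto intro: filterlim_real_sequentially\<close>)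
  from tendsto_mult_right_zero[OF this, of M] have "\<forall>\<^sub>F N in sequentially. M * real N powr (- p) < \<delta>"
    using K1(2) by (rule order_tendstoD(2))
  moreover have "\<forall>\<^sub>F N in sequentially. \<forall>j\<in>{..<k}. \<exists>v\<in>S N. poly v (-1) = y j (-1) \<and>
     integral {-1..1} (\<lambda>x. (y' j x - poly (pderiv v) x)\<^sup>2) \<le> K j * real N powr (- p)"
    by (rule eventually_ball_finite) (use K in auto)
  moreover have "\<forall>\<^sub>F N in sequentially. N \<ge> max N0 1" by (rule eventually_ge_at_top)
  ultimately have "\<forall>\<^sub>F N in sequentially. norm (lam - numerical_eigenvalue q R N k)
      \<le> (K1 * M * 2 powr p) * norm ((real N + 1) powr (- p))"
  proof eventually_elim
    case (elim N)
    then have N: "N \<ge> N0" "N \<ge> 1" by auto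
    have "\<forall>j\<in>{..<k}. \<exists>v. v \<in> S N \<and> poly v (-1) = y j (-1) \<and>
        integral {-1..1} (\<lambda>x. (y' j x - poly (pderiv v) x)\<^sup>2) \<le> M * real N powr (- p)"
    proof
      fix j assume j: "j \<in> {..<k}"
      obtain v where v: "v \<in> S N" "poly v (-1) = y j (-1)"
        "integral {-1..1} (\<lambda>x. (y' j x - poly (pderiv v) x)\<^sup>2) \<le> K j * real N powr (- p)"
        using elim(2) j by blast
      have "K j * real N powr (- p) \<le> M * real N powr (- p)" using KM[of j] j by (intro mult_right_mono) auto
      with v show "\<exists>v. v \<in> S N \<and> poly v (-1) = y j (-1) \<and>
        integral {-1..1} (\<lambda>x. (y' j x - poly (pderiv v) x)\<^sup>2) \<le> M * real N powr (- p)"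
        by (intro exI[of _ v] conjI) (auto intro: order_trans)
    qed
    from bchoice[OF this] obtain v where v: "\<forall>j\<in>{..<k}. v j \<in> S N \<and> poly (v j) (-1) = y j (-1) \<and>
        integral {-1..1} (\<lambda>x. (y' j x - poly (pderiv (v j)) x)\<^sup>2) \<le> M * real N powr (- p)" by (rule exE)
    have "\<nu> N (k - 1) \<le> lam + K1 * (M * real N powr (- p))"
    proof (rule up[rule_format, OF sys[OF N(1)]])
      show "k \<le> N" using N kN0 by simp
      show "0 \<le> M * real N powr (- p)" using M by simp
      show "M * real N powr (- p) \<le> \<delta>" using elim(1) by simp
    qed (use v in auto)
    then have "\<bar>lam - numerical_eigenvalue q R N k\<bar> \<le> K1 * M * real N powr (- p)"
      using low[OF N(1)] num[OF N(1)] by simp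
    \<comment> \<open>The passage from N to N + 1 rests on N \<ge> (N + 1) / 2.\<close>
    also have "real N powr (- p) \<le> 2 powr p * (real N + 1) powr (- p)"
    proof -
      have "((real N + 1) / 2) powr p \<le> real N powr p" using N p by (intro powr_mono2) auto
      then show ?thesis using N by (simp add: powr_minus powr_divide field_simps)
    qed
    finally show ?case using K1 M by (simp add: mult_left_mono mult.assoc)
  qed
  then show ?thesis by (rule bigoI)
qed

end

section \<open>The exponent of the rate from the data of the potential\<close>

theorem theorem3p3:
  fixes S k :: nat
    and \<alpha>L \<beta>L \<alpha>R \<beta>R lam :: real
    and g :: "nat \<Rightarrow> complex \<Rightarrow> complex"
    and \<beta> \<gamma> :: "nat \<Rightarrow> real"
    and r l :: "nat \<Rightarrow> nat"
    and \<xi> \<eta> \<theta> :: "nat \<Rightarrow> real"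
    and q :: "real \<Rightarrow> real"
    and R :: "nat \<Rightarrow> real poly"
    and p_L p_R p :: ereal
  assumes bc_L: "\<alpha>L\<^sup>2 + \<beta>L\<^sup>2 \<noteq> 0"
    and bc_R: "\<alpha>R\<^sup>2 + \<beta>R\<^sup>2 \<noteq> 0"
    and exponents: "\<And>i. i \<in> {1..S} \<Longrightarrow> \<beta> i < 1 \<and> \<gamma> i < 1"
    and g_analytic: "\<And>i. i \<in> {1..S} \<Longrightarrow> \<exists>\<rho>>1. g i analytic_on bernstein_region \<rho>"
    and g_real: "\<And>i x. i \<in> {1..S} \<Longrightarrow> x \<in> {-1..1} \<Longrightarrow> g i (complex_of_real x) \<in> \<real>"
    and g_nonzero: "\<And>i. i \<in> {1..S} \<Longrightarrow> \<exists>x\<in>{-1..1}. g i (complex_of_real x) \<noteq> 0"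
    and q_def: "q = potential S g \<beta> \<gamma>"
    and q_unbounded: "\<not> Bfun q (at_left 1) \<or> \<not> Bfun q (at_right (-1))"
    and r_mult: "\<And>i. i \<in> {1..S} \<Longrightarrow> int (r i) = zorder (g i) 1"
    and l_mult: "\<And>i. i \<in> {1..S} \<Longrightarrow> int (l i) = zorder (g i) (-1)"
    and coeffs: "galerkin_coefficients \<alpha>L \<beta>L \<alpha>R \<beta>R \<xi> \<eta> \<theta>"
    and R_def: "R = galerkin_basis \<xi> \<eta> \<theta>"
    and R_span: "\<forall>\<^sub>F N in sequentially. galerkin_space \<alpha>L \<beta>L \<alpha>R \<beta>R N = poly_span R N"
    and eigenvalue: "sl_eigenvalue_of_index q \<alpha>L \<beta>L \<alpha>R \<beta>R k lam"
    and p_L_def: "p_L = (INF i\<in>{i\<in>{1..S}. - \<gamma> i \<notin> \<nat>}.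
                          ereal (6 - 4 * (\<gamma> i - real (l i) - dirichlet_indicator \<beta>L)))"
    and p_R_def: "p_R = (INF i\<in>{i\<in>{1..S}. - \<beta> i \<notin> \<nat>}.
                          ereal (6 - 4 * (\<beta> i - real (r i) - dirichlet_indicator \<beta>R)))"
    and p_def: "p = inf p_L p_R"
  shows "(\<lambda>N. lam - numerical_eigenvalue q R N k)
           \<in> O(\<lambda>N. (real N + 1) powr (- real_of_ereal p))"
proof -
  define IL where "IL = {i\<in>{1..S}. - \<gamma> i \<notin> \<nat>}"
  define IR where "IR = {i\<in>{1..S}. - \<beta> i \<notin> \<nat>}"
  define a where "a i = 6 - 4 * (\<gamma> i - real (l i) - dirichlet_indicator \<beta>L)" for i
  define b where "b i = 6 - 4 * (\<beta> i - real (r i) - dirichlet_indicator \<beta>R)" for i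
  have \<kappa>: "dirichlet_indicator t \<ge> 0" for t by (simp add: dirichlet_indicator_def)
  have fin: "finite IL" "finite IR" by (simp_all add: IL_def IR_def)
  \<comment> \<open>Exponents below 1 keep every candidate above 6 - 4 = 2, which makes the order
    \<open>s\<close> below positive.\<close>
  have ab: "a i > 2" "b i > 2" if "i \<in> {1..S}" for i
    using exponents[OF that] \<kappa>[of \<beta>L] \<kappa>[of \<beta>R] by (simp_all add: a_def b_def)
  have left: "\<exists>E. open E \<and> complex_of_real ` {-1..1} \<subseteq> E \<and> g i holomorphic_on E \<and>
     (- \<gamma> i \<notin> \<nat> \<longrightarrow> (\<exists>H. H holomorphic_on E \<and> (\<forall>z\<in>E. g i z = (z + 1) ^ l i * H z)) \<and> s0 \<le> real (l i) - \<gamma> i)"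
    if i: "i \<in> {1..S}" and s0: "\<forall>i\<in>IL. s0 \<le> real (l i) - \<gamma> i" for i s0
  proof -
    obtain \<rho> where "\<rho> > 1" "g i analytic_on bernstein_region \<rho>" using g_analytic[OF i] by blast
    then obtain E where E: "open E" "connected E" "complex_of_real ` {-1..1} \<subseteq> E" "g i holomorphic_on E"
      by (rule bernstein_neighbourhood)
    have "complex_of_real (-1) \<in> E" using E(3) by (rule subsetD) (rule imageI, simp)
    then have "-1 \<in> E" by simp
    \<comment> \<open>A nonzero value on the segment shows that \<open>g i\<close> does not vanish
      identically on the connected set \<open>E\<close>, so its zero at -1 has a finite
      order.\<close>
    moreover have "\<exists>w\<in>E. g i w \<noteq> 0" using g_nonzero[OF i] E(3) by blast
    ultimately have "\<exists>H. H holomorphic_on E \<and> (\<forall>z\<in>E. g i z = (z - (-1)) ^ l i * H z)"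
      using holomorphic_zorder_factor[OF E(1,2,4)] l_mult[OF i] by blast
    then show ?thesis using E i s0 by (intro exI[of _ E]) (auto simp: IL_def)
  qed
  have right: "\<exists>E. open E \<and> complex_of_real ` {-1..1} \<subseteq> E \<and> (\<lambda>z. g i (- z)) holomorphic_on E \<and>
     (- \<beta> i \<notin> \<nat> \<longrightarrow> (\<exists>H. H holomorphic_on E \<and> (\<forall>z\<in>E. g i (- z) = (z + 1) ^ r i * H z)) \<and> s0 \<le> real (r i) - \<beta> i)"
    if i: "i \<in> {1..S}" and s0: "\<forall>i\<in>IR. s0 \<le> real (r i) - \<beta> i" for i s0
  proof -
    obtain \<rho> where "\<rho> > 1" "g i analytic_on bernstein_region \<rho>" using g_analytic[OF i] by blast
    then obtain E where E: "open E" "connected E" "complex_of_real ` {-1..1} \<subseteq> E" "g i holomorphic_on E"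
      "\<And>z. z \<in> E \<Longrightarrow> - z \<in> E" using bernstein_neighbourhood by metis
    have refl: "(\<lambda>z. f (- z)) holomorphic_on E" if "f holomorphic_on E" for f
    proof -
      have "(f \<circ> uminus) holomorphic_on E"
        by (rule holomorphic_on_compose_gen[OF _ that]) (use E(5) in \<open>auto intro!: holomorphic_intros\<close>)
      then show ?thesis by (simp add: o_def)
    qed
    have "complex_of_real 1 \<in> E" using E(3) by (rule subsetD) (rule imageI, simp)
    then have "1 \<in> E" by simp
    moreover have "\<exists>w\<in>E. g i w \<noteq> 0" using g_nonzero[OF i] E(3) by blast
    ultimately obtain H where H: "H holomorphic_on E" "\<forall>z\<in>E. g i z = (z - 1) ^ r i * H z"
      using holomorphic_zorder_factor[OF E(1,2,4)] r_mult[OF i] by blast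
    have "g i (- z) = (z + 1) ^ r i * ((-1) ^ r i * H (- z))" if "z \<in> E" for z
    proof -
      have "g i (- z) = (- z - 1) ^ r i * H (- z)" using H(2) E(5)[OF that] by blast
      also have "- z - 1 = - (z + 1)" by simp
      also have "(- (z + 1)) ^ r i = (-1) ^ r i * (z + 1) ^ r i" by (rule power_minus)
      finally show ?thesis by (simp add: mult_ac)
    qed
    moreover have "(\<lambda>z. (-1) ^ r i * H (- z)) holomorphic_on E" by (intro holomorphic_intros refl H(1))
    ultimately have "\<exists>H. H holomorphic_on E \<and> (\<forall>z\<in>E. g i (- z) = (z + 1) ^ r i * H z)" by metis
    then show ?thesis using E(1,3) refl[OF E(4)] i s0 by (intro exI[of _ E]) (auto simp: IR_def)
  qed
  have qL: "\<exists>P. \<forall>m. wreg {-1<..<1/2} s0 m (\<lambda>x. q x - poly P x)" if "\<forall>i\<in>IL. s0 \<le> real (l i) - \<gamma> i" for s0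
    unfolding q_def by (rule potential_left[OF left[OF _ that]])
  have qR: "\<exists>P. \<forall>m. wreg {-1<..<1/2} s0 m (\<lambda>x. q (- x) - poly P x)" if "\<forall>i\<in>IR. s0 \<le> real (r i) - \<beta> i" for s0
    unfolding q_def potential_reflect by (rule potential_left[OF right[OF _ that]])
  \<comment> \<open>Since \<open>q\<close> is unbounded, some term is singular. Hence
    \<open>p\<close> is the minimum of a nonempty finite set of reals, and
    \<open>real_of_ereal\<close> loses nothing.\<close>
  have ne: "IL \<union> IR \<noteq> {}"
  proof
    assume e: "IL \<union> IR = {}"
    have e': "\<forall>i\<in>IL. 0 \<le> real (l i) - \<gamma> i" "\<forall>i\<in>IR. 0 \<le> real (r i) - \<beta> i" using e by auto
    obtain P where P: "\<And>m. wreg {-1<..<1/2} 0 m (\<lambda>x. q x - poly P x)" using qL[OF e'(1)] by blast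
    obtain Q where Q: "\<And>m. wreg {-1<..<1/2} 0 m (\<lambda>x. q (- x) - poly Q x)" using qR[OF e'(2)] by blast
    have "Bfun (\<lambda>x. q (- x)) (at_right (-1))" by (rule Bfun_at_right_if_wreg[OF Q])
    then have "Bfun q (at_left 1)" unfolding Bfun_def at_left_minus[of 1] eventually_filtermap by simp
    then show False using q_unbounded Bfun_at_right_if_wreg[OF P] by blast
  qed
  define V where "V = a ` IL \<union> b ` IR"
  have V: "finite V" "V \<noteq> {}" using fin ne by (auto simp: V_def)
  have p: "p = ereal (Min V)"
  proof -
    have "p = Inf (ereal ` V)"
      unfolding p_def p_L_def p_R_def V_def IL_def IR_def a_def b_def by (simp add: image_Un image_image Inf_union_distrib)
    also have "\<dots> = Min (ereal ` V)" using V by (intro Min_Inf[symmetric]) auto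
    also have "\<dots> = ereal (Min V)" using V by (intro mono_Min_commute[symmetric]) (auto simp: mono_def)
    finally show ?thesis .
  qed
  \<comment> \<open>Solves p = 4 s + 2. For a singular term at the left end, minimality reads s
    \<le> l i - \<gamma> i + \<kappa> + 1, the order available to y' there.\<close>
  define s where "s = (Min V - 2) / 4"
  have "Min V \<in> V" using V by (rule Min_in)
  then have s: "s > 0" using ab by (auto simp: s_def V_def IL_def IR_def)
  have sL: "s \<le> real (l i) - \<gamma> i + (dirichlet_indicator \<beta>L + 1)" if "i \<in> IL" for i
    using Min_le[OF V(1), of "a i"] that by (auto simp: V_def s_def a_def field_simps)
  have sR: "s \<le> real (r i) - \<beta> i + (dirichlet_indicator \<beta>R + 1)" if "i \<in> IR" for i
    using Min_le[OF V(1), of "b i"] that by (auto simp: V_def s_def b_def field_simps)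
  have "real (l i) - \<gamma> i > -1" if "i \<in> IL" for i using exponents[of i] that by (simp add: IL_def)
  with sL have "\<exists>s0>-1. (\<forall>i\<in>IL. s0 \<le> real (l i) - \<gamma> i) \<and> s \<le> s0 + (dirichlet_indicator \<beta>L + 1)"
    by (intro uniform_lower_exponent fin(1))
  then
  obtain s0 where s0: "s0 > -1" "\<forall>i\<in>IL. s0 \<le> real (l i) - \<gamma> i" "s \<le> s0 + (dirichlet_indicator \<beta>L + 1)"
    by blast
  have "real (r i) - \<beta> i > -1" if "i \<in> IR" for i using exponents[of i] that by (simp add: IR_def)
  with sR have "\<exists>s0>-1. (\<forall>i\<in>IR. s0 \<le> real (r i) - \<beta> i) \<and> s \<le> s0 + (dirichlet_indicator \<beta>R + 1)"
    by (intro uniform_lower_exponent fin(2))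
  then
  obtain s1 where s1: "s1 > -1" "\<forall>i\<in>IR. s1 \<le> real (r i) - \<beta> i" "s \<le> s1 + (dirichlet_indicator \<beta>R + 1)"
    by blast
  obtain P where P: "\<And>m. wreg {-1<..<1/2} s0 m (\<lambda>x. q x - poly P x)" using qL[OF s0(2)] by blast
  obtain Q where Q: "\<And>m. wreg {-1<..<1/2} s1 m (\<lambda>x. q (- x) - poly Q x)" using qR[OF s1(2)] by blast
  have I: "{-1<..<1/2} \<subseteq> {-1<..<1::real}" by auto
  have m: "min s0 s1 > -1" using s0 s1 by simp
  interpret sturm_liouville q \<alpha>L \<beta>L \<alpha>R \<beta>R
    by unfold_locales
       (use continuous_and_integrable_if_wreg[OF wreg_weaken[OF I min.cobounded1 P] wreg_weaken[OF I min.cobounded2 Q] m]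
          bc_L bc_R in auto)
  have "(\<lambda>N. lam - numerical_eigenvalue q R N k) \<in> O(\<lambda>N. (real N + 1) powr (- (4 * s + 2)))"
  proof (rule galerkin_convergence_rate[OF eigenvalue R_span])
    fix mu y y' assume y: "efun mu y y'"
    show "\<exists>K. \<forall>\<^sub>F N in sequentially. \<exists>v\<in>galerkin_space \<alpha>L \<beta>L \<alpha>R \<beta>R N. poly v (-1) = y (-1) \<and>
     integral {-1..1} (\<lambda>x. (y' x - poly (pderiv v) x)\<^sup>2) \<le> K * real N powr (- (4 * s + 2))"
      by (rule eigenfunction_approximation[OF y s s0(1) _ P s1(1) _ Q]) (use s0(3) s1(3) in auto)
  qed (use s in simp)
  moreover have "4 * s + 2 = real_of_ereal p" by (simp add: p s_def field_simps)
  ultimately show ?thesis by simp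
qed

end
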